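(* Let $E\to(X,\omega)$ be a holomorphic vector bundle over a compact K\"ahler manifold, $Z$ a polynomial central charge with $Z(E)\neq0$ and fixed representatives $\omega,\tilde U$, and $\tilde h$ a fixed reference metric. The functional $\mathcal{M}_Z(\cdot,\tilde h)$ is convex along geodesics on the locus $\mathrm{Herm}(E)^Z\subset\mathrm{Herm}(E)$ of subsolutions to the $Z$-critical equation.
   Context: Let $n=\dim X$. A stability vector is $\rho\in(\mathbb{C}^* )^{n+1}$ with $\mathrm{Im}(\rho_n)>0$ and $\mathrm{Im}(\rho_d/\rho_{d+1})>0$ for $d<n$. A polynomial central charge is given by such $\rho$, the class $[\omega]$ and a real class $U=1+N$, $N\in H^{>0}(X,\mathbb{R})$; $Z(E)=\int_X\big(\sum_d\rho_d[\omega]^d\big)\cdot\mathrm{Ch}(E)\cdot U$, $\varphi(E)=\arg Z(E)$. Fix $\omega$ and a closed real form $\tilde U$ representing $U$ (degree $2\ell$ part $\tilde U_\ell$). $\mathrm{Herm}(E)$ is the space of Hermitian metrics on $E$. For $h\in\mathrm{Herm}(E)$ with Chern curvature $F(h)$: $\tilde Z(h)=\sum_{d+j+\ell=n}\rho_d\omega^d\wedge\frac1{j!}(\frac{i}{2\pi}F(h))^j\wedge\tilde U_\ell$, $\tilde Z'(h)=\sum_{d+j+\ell=n,\,j\ge1}\rho_d\omega^d\wedge\frac1{(j-1)!}(\frac{i}{2\pi}F(h))^{j-1}\wedge\tilde U_\ell$, $\mathrm{Im}(T)=(T-T^* )/(2i)$ and $D_Z(h)=\mathrm{Im}(e^{-i\varphi(E)}\tilde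 Z(h))$. $\mathcal{M}_Z(h,h')=\int_0^1\int_X\mathrm{tr}\big(h_t^{-1}\partial_th_t\circ D_Z(h_t)\big)dt$ for any smooth path $h_t$ of metrics from $h'$ to $h$ (independent of the path; equivalently, replace each $(\frac{i}{2\pi}F(h))^k$ in $D_Z(h)$ by the Bott--Chern form $R_{k+1}(h,h')$, take trace and integrate). A path $h_t$ is a geodesic if $\partial_t(h_t^{-1}\partial_th_t)=0$. $h$ is a subsolution if for every $x\in X$ and non-zero $u\in T^*_{0,1}X_x\otimes\mathrm{End}(E)_x$, $\mathrm{tr}\,i\big[\mathrm{Im}(e^{-i\varphi(E)}\tilde Z'(h))\wedge u^*\wedge u\big]_{\mathrm{sym}}>0$, with $(\xi\otimes V)^*=\bar\xi\otimes V^*$. Here $[\cdot]_{\mathrm{sym}}$ is the graded symmetrisation $[B_1\wedge\cdots\wedge B_m]_{\mathrm{sym}}=\frac1{m!}\sum_{\sigma\in S_m}(-1)^{\mathrm{grsgn}\,\sigma}B_{\sigma(1)}\wedge\cdots\wedge B_{\sigma(m)}$, an adjacent transposition of $B_i,B_{i+1}$ contributing $\deg B_i\deg B_{i+1}$ mod 2 to $\mathrm{grsgn}$, each curvature factor being treated as a separate endomorphism. *)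

theory Defs
  imports "HOL-Analysis.Analysis"
begin

section \<open>Smooth and holomorphic maps on open subsets of Euclidean spaces\<close>

fun Ck_on :: "nat \<Rightarrow> 'a::real_normed_vector set \<Rightarrow> ('a \<Rightarrow> 'b::real_normed_vector) \<Rightarrow> bool" where
  "Ck_on 0 S f \<longleftrightarrow> continuous_on S f"
| "Ck_on (Suc k) S f \<longleftrightarrow> (\<forall>x\<in>S. f differentiable (at x)) \<and>
      (\<forall>v. Ck_on k S (\<lambda>x. frechet_derivative f (at x) v))"

text \<open>Only used for open \<open>S\<close>.\<close>

definition smooth_on :: "'a::real_normed_vector set \<Rightarrow> ('a \<Rightarrow> 'b::real_normed_vector) \<Rightarrow> bool" where
  "smooth_on S f \<longleftrightarrow> (\<forall>k. Ck_on k S f)"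

definition holo_on :: "(complex^'n) set \<Rightarrow> (complex^'n \<Rightarrow> complex) \<Rightarrow> bool" where
  "holo_on S f \<longleftrightarrow>
     (\<forall>z\<in>S. \<exists>f'. (f has_derivative f') (at z) \<and> (\<forall>c v. f' (c *s v) = c * f' v))"


section \<open>Complex manifolds and holomorphic vector bundles\<close>

text \<open>
  The complex dimension of \<open>X\<close> is \<open>CARD('n)\<close>. Every section, form or metric below is given by its
  family of local expressions: \<open>f i x\<close> is the value at a point \<open>x \<in> cdom X i\<close> in the
  \<open>i\<close>-th chart (and the \<open>i\<close>-th trivialisation of the bundle); values at points outside
  \<open>cdom X i\<close> carry no meaning. The atlas is arbitrary, so charts may be taken small enough for
  a given bundle to be trivial over each of them.
\<close>

record ('i, 'x, 'n) atlas =
  cdom :: "'i \<Rightarrow> 'x set"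
  crd :: "'i \<Rightarrow> 'x \<Rightarrow> complex^'n"

definition cimg :: "('i, 'x, 'n::finite) atlas \<Rightarrow> 'i \<Rightarrow> (complex^'n) set" where
  "cimg X i = crd X i ` cdom X i"

definition cinv :: "('i, 'x, 'n::finite) atlas \<Rightarrow> 'i \<Rightarrow> complex^'n \<Rightarrow> 'x" where
  "cinv X i = inv_into (cdom X i) (crd X i)"

definition compact_complex_manifold :: "('i, 'x::t2_space, 'n::finite) atlas \<Rightarrow> bool" where
  "compact_complex_manifold X \<longleftrightarrow>
     compact (UNIV :: 'x set) \<and>
     (\<Union>i. cdom X i) = UNIV \<and>
     (\<forall>i. open (cdom X i) \<and> open (cimg X i) \<and>
          homeomorphism (cdom X i) (cimg X i) (crd X i) (cinv X i)) \<and>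
     (\<forall>i j k. holo_on (crd X i ` (cdom X i \<inter> cdom X j)) (\<lambda>z. crd X j (cinv X i z) $ k))"

text \<open>A holomorphic vector bundle of rank \<open>CARD('r)\<close>, given by its transition cocycle:
  local components of a section \<open>s\<close> transform as \<open>s\<^sub>i = g\<^sub>i\<^sub>j s\<^sub>j\<close>.\<close>

definition holomorphic_bundle ::
  "('i, 'x, 'n::finite) atlas \<Rightarrow> ('i \<Rightarrow> 'i \<Rightarrow> 'x \<Rightarrow> complex^'r::finite^'r) \<Rightarrow> bool" where
  "holomorphic_bundle X g \<longleftrightarrow>
     (\<forall>i. \<forall>x\<in>cdom X i. g i i x = mat 1) \<and>
     (\<forall>i j k. \<forall>x\<in>cdom X i \<inter> cdom X j \<inter> cdom X k. g i j x ** g j k x = g i k x) \<and>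
     (\<forall>i j a b. holo_on (crd X i ` (cdom X i \<inter> cdom X j)) (\<lambda>z. g i j (cinv X i z) $ a $ b))"

text \<open>Derivative at \<open>x\<close>, in the \<open>i\<close>-th chart, of a function on \<open>X\<close> along the tangent vector with
  coordinates \<open>v\<close>. Real tangent vectors are identified with vectors in \<open>complex^'n\<close>, the complex
  structure being multiplication by \<open>\<i>\<close>.\<close>

definition chart_deriv ::
  "('i, 'x, 'n::finite) atlas \<Rightarrow> 'i \<Rightarrow> ('x \<Rightarrow> 'b::real_normed_vector) \<Rightarrow> 'x \<Rightarrow> complex^'n \<Rightarrow> 'b" where
  "chart_deriv X i f x v = frechet_derivative (\<lambda>z. f (cinv X i z)) (at (crd X i x)) v"


section \<open>Differential forms\<close>

text \<open>
  A form of mixed degree on the real vector space \<open>'v\<close> is a function on lists of vectors; its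
  degree \<open>k\<close> part is the restriction to lists of length \<open>k\<close>.
\<close>

type_synonym ('v, 'b) aform = "'v list \<Rightarrow> 'b"
type_synonym ('i, 'x, 'n, 'b) lform = "'i \<Rightarrow> 'x \<Rightarrow> (complex^'n, 'b) aform"

definition alt_multilinear :: "('v::real_vector, 'b::real_vector) aform \<Rightarrow> bool" where
  "alt_multilinear \<alpha> \<longleftrightarrow>
     (\<forall>vs. \<forall>k<length vs. linear (\<lambda>v. \<alpha> (vs[k := v]))) \<and> (\<forall>vs. \<not> distinct vs \<longrightarrow> \<alpha> vs = 0)"

definition deg_part :: "nat \<Rightarrow> ('v, 'b::zero) aform \<Rightarrow> ('v, 'b) aform" where
  "deg_part k \<alpha> vs = (if length vs = k then \<alpha> vs else 0)"

definition form_unit :: "'b::zero \<Rightarrow> ('v, 'b) aform" where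
  "form_unit e vs = (if vs = [] then e else 0)"

text \<open>Shuffle formula for the wedge product: the summation index is the set of positions fed to
  the first factor, and the sign is that of the shuffle moving these positions to the front. No factor
  \<open>1/(k! l!)\<close> occurs, so \<open>dx \<and> dy\<close> takes the value \<open>1\<close> on the standard frame.\<close>

definition wedge_by ::
  "('a \<Rightarrow> 'b \<Rightarrow> 'c::real_vector) \<Rightarrow> ('v, 'a) aform \<Rightarrow> ('v, 'b) aform \<Rightarrow> ('v, 'c) aform" where
  "wedge_by m \<alpha> \<beta> vs =
     (\<Sum>S\<in>Pow {..<length vs}.
        (-1) ^ card {(p, q). p \<in> S \<and> q \<in> {..<length vs} - S \<and> q < p} *\<^sub>R
        m (\<alpha> (nths vs S)) (\<beta> (nths vs ({..<length vs} - S))))"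

definition swedge :: "('v, complex) aform \<Rightarrow> ('v, complex) aform \<Rightarrow> ('v, complex) aform" where
  "swedge = wedge_by (*)"

definition mwedge ::
  "('v, complex^'r::finite^'r) aform \<Rightarrow> ('v, complex^'r^'r) aform \<Rightarrow> ('v, complex^'r^'r) aform" where
  "mwedge = wedge_by (**)"

definition spow :: "('v, complex) aform \<Rightarrow> nat \<Rightarrow> ('v, complex) aform" where
  "spow \<alpha> k = (swedge \<alpha> ^^ k) (form_unit 1)"

definition mpow :: "('v, complex^'r::finite^'r) aform \<Rightarrow> nat \<Rightarrow> ('v, complex^'r^'r) aform" where
  "mpow \<alpha> k = (mwedge \<alpha> ^^ k) (form_unit (mat 1))"

definition id_form :: "('v, complex) aform \<Rightarrow> ('v, complex^'r::finite^'r) aform" where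
  "id_form \<alpha> vs = mat (\<alpha> vs)"

text \<open>Exterior derivative in the \<open>i\<close>-th chart. The coordinate vector fields are constant, so no
  Lie bracket terms occur.\<close>

definition ext_d ::
  "('i, 'x, 'n::finite) atlas \<Rightarrow> ('i, 'x, 'n, 'b::real_normed_vector) lform \<Rightarrow> ('i, 'x, 'n, 'b) lform" where
  "ext_d X \<alpha> i x vs =
     (\<Sum>k<length vs. (-1) ^ k *\<^sub>R
        chart_deriv X i (\<lambda>y. \<alpha> i y (take k vs @ drop (Suc k) vs)) x (vs ! k))"

definition smooth_form :: "('i, 'x, 'n::finite) atlas \<Rightarrow> ('i, 'x, 'n, complex) lform \<Rightarrow> bool" where
  "smooth_form X \<alpha> \<longleftrightarrow>
     (\<forall>i. \<forall>x\<in>cdom X i. alt_multilinear (\<alpha> i x)) \<and>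
     (\<forall>i vs. smooth_on (cimg X i) (\<lambda>z. \<alpha> i (cinv X i z) vs)) \<and>
     (\<forall>i j. \<forall>x\<in>cdom X i \<inter> cdom X j. \<forall>vs.
        \<alpha> i x vs = \<alpha> j x (map (chart_deriv X i (crd X j) x) vs))"

definition closed_form :: "('i, 'x, 'n::finite) atlas \<Rightarrow> ('i, 'x, 'n, complex) lform \<Rightarrow> bool" where
  "closed_form X \<alpha> \<longleftrightarrow> smooth_form X \<alpha> \<and> (\<forall>i. \<forall>x\<in>cdom X i. \<forall>vs. ext_d X \<alpha> i x vs = 0)"

definition real_form :: "('i, 'x, 'n::finite) atlas \<Rightarrow> ('i, 'x, 'n, complex) lform \<Rightarrow> bool" where
  "real_form X \<alpha> \<longleftrightarrow> (\<forall>i. \<forall>x\<in>cdom X i. \<forall>vs. \<alpha> i x vs \<in> \<real>)"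

definition cohomologous ::
  "('i, 'x, 'n::finite) atlas \<Rightarrow> ('i, 'x, 'n, complex) lform \<Rightarrow> ('i, 'x, 'n, complex) lform \<Rightarrow> bool" where
  "cohomologous X \<alpha> \<beta> \<longleftrightarrow>
     (\<exists>\<eta>. smooth_form X \<eta> \<and> (\<forall>i. \<forall>x\<in>cdom X i. \<forall>vs. \<alpha> i x vs - \<beta> i x vs = ext_d X \<eta> i x vs))"

definition de_rham_class ::
  "('i, 'x, 'n::finite) atlas \<Rightarrow> ('i, 'x, 'n, complex) lform \<Rightarrow> ('i, 'x, 'n, complex) lform set" where
  "de_rham_class X \<alpha> = {\<beta>. closed_form X \<beta> \<and> cohomologous X \<beta> \<alpha>}"


section \<open>Integration\<close>

definition partition_of_unity ::
  "('i, 'x::t2_space, 'n::finite) atlas \<Rightarrow> ('i \<Rightarrow> 'x \<Rightarrow> real) \<Rightarrow> bool" where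
  "partition_of_unity X \<psi> \<longleftrightarrow>
     finite {i. \<exists>x. \<psi> i x \<noteq> 0} \<and>
     (\<forall>i x. 0 \<le> \<psi> i x) \<and>
     (\<forall>i. closure {x. \<psi> i x \<noteq> 0} \<subseteq> cdom X i) \<and>
     (\<forall>i j. smooth_on (cimg X j) (\<lambda>z. \<psi> i (cinv X j z))) \<and>
     (\<forall>x. (\<Sum>i | \<exists>y. \<psi> i y \<noteq> 0. \<psi> i x) = 1)"

text \<open>The complex orientation: the frame \<open>e\<^sub>1, \<i> e\<^sub>1, e\<^sub>2, \<i> e\<^sub>2, \<dots>\<close> is positive, for any
  enumeration of the index type.\<close>

definition oriented_frame :: "(complex^'n::finite) list" where
  "oriented_frame =
     concat (map (\<lambda>k. [axis k 1, axis k \<i>]) (SOME ks. distinct ks \<and> set ks = (UNIV :: 'n set)))"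

text \<open>The integral over \<open>X\<close> of the degree \<open>2n\<close> part; it does not depend on the partition of unity.\<close>

definition form_integral ::
  "('i, 'x::t2_space, 'n::finite) atlas \<Rightarrow> ('i, 'x, 'n, complex) lform \<Rightarrow> complex" where
  "form_integral X \<alpha> =
     (let \<psi> = (SOME \<psi>. partition_of_unity X \<psi>) in
      \<Sum>i | \<exists>x. \<psi> i x \<noteq> 0.
        set_lebesgue_integral lborel (cimg X i)
          (\<lambda>z. \<psi> i (cinv X i z) *\<^sub>R \<alpha> i (cinv X i z) oriented_frame))"


section \<open>Kaehler forms and Hermitian metrics\<close>

definition kaehler_form :: "('i, 'x, 'n::finite) atlas \<Rightarrow> ('i, 'x, 'n, complex) lform \<Rightarrow> bool" where
  "kaehler_form X \<omega> \<longleftrightarrow>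
     closed_form X \<omega> \<and> real_form X \<omega> \<and>
     (\<forall>i. \<forall>x\<in>cdom X i.
        (\<forall>vs. length vs \<noteq> 2 \<longrightarrow> \<omega> i x vs = 0) \<and>
        (\<forall>v w. \<omega> i x [\<i> *s v, \<i> *s w] = \<omega> i x [v, w]) \<and>
        (\<forall>v. v \<noteq> 0 \<longrightarrow> 0 < Re (\<omega> i x [v, \<i> *s v])))"

definition conj_transpose :: "complex^'r::finite^'r \<Rightarrow> complex^'r^'r" where
  "conj_transpose A = (\<chi> a b. cnj (A $ b $ a))"

text \<open>A metric is given by the matrices \<open>H\<^sub>i\<close> with \<open>\<langle>s, t\<rangle> = t\<^sub>i\<^sup>* H\<^sub>i s\<^sub>i\<close>, conjugate-linear in the second
  argument.\<close>

definition hermitian_metrics ::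
  "('i, 'x, 'n::finite) atlas \<Rightarrow> ('i \<Rightarrow> 'i \<Rightarrow> 'x \<Rightarrow> complex^'r::finite^'r) \<Rightarrow>
   ('i \<Rightarrow> 'x \<Rightarrow> complex^'r^'r) set" where
  "hermitian_metrics X g = {h.
     (\<forall>i. smooth_on (cimg X i) (\<lambda>z. h i (cinv X i z))) \<and>
     (\<forall>i. \<forall>x\<in>cdom X i. conj_transpose (h i x) = h i x \<and>
        (\<forall>s. s \<noteq> 0 \<longrightarrow> 0 < Re (\<Sum>a\<in>UNIV. \<Sum>b\<in>UNIV. cnj (s $ a) * h i x $ a $ b * s $ b))) \<and>
     (\<forall>i j. \<forall>x\<in>cdom X i \<inter> cdom X j.
        h j x = conj_transpose (g i j x) ** h i x ** g i j x)}"

definition adjoint_wrt :: "complex^'r::finite^'r \<Rightarrow> complex^'r^'r \<Rightarrow> complex^'r^'r" where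
  "adjoint_wrt H A = matrix_inv H ** conj_transpose A ** H"

text \<open>\<open>(\<xi> \<otimes> V)\<^sup>* = cnj \<xi> \<otimes> V\<^sup>*\<close>: on \<open>End(E)\<close>-valued forms, evaluated at real tangent vectors, the
  adjoint is taken valuewise.\<close>

definition form_adj ::
  "complex^'r::finite^'r \<Rightarrow> ('v, complex^'r^'r) aform \<Rightarrow> ('v, complex^'r^'r) aform" where
  "form_adj H \<alpha> vs = adjoint_wrt H (\<alpha> vs)"

definition one_form :: "('v \<Rightarrow> 'b::zero) \<Rightarrow> ('v, 'b) aform" where
  "one_form u vs = (case vs of [v] \<Rightarrow> u v | _ \<Rightarrow> 0)"

definition chern_connection ::
  "('i, 'x, 'n::finite) atlas \<Rightarrow> ('i \<Rightarrow> 'x \<Rightarrow> complex^'r::finite^'r) \<Rightarrow>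
   ('i, 'x, 'n, complex^'r^'r) lform" where
  "chern_connection X h i x =
     one_form (\<lambda>v. matrix_inv (h i x) **
       (mat (1/2) ** (chart_deriv X i (h i) x v - mat \<i> ** chart_deriv X i (h i) x (\<i> *s v))))"

definition chern_curvature ::
  "('i, 'x, 'n::finite) atlas \<Rightarrow> ('i \<Rightarrow> 'x \<Rightarrow> complex^'r::finite^'r) \<Rightarrow>
   ('i, 'x, 'n, complex^'r^'r) lform" where
  "chern_curvature X h i x vs =
     ext_d X (chern_connection X h) i x vs +
     mwedge (chern_connection X h i x) (chern_connection X h i x) vs"

text \<open>\<open>(\<i> / 2\<pi>) F(h)\<close>\<close>

definition ncurv ::
  "('i, 'x, 'n::finite) atlas \<Rightarrow> ('i \<Rightarrow> 'x \<Rightarrow> complex^'r::finite^'r) \<Rightarrow>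
   ('i, 'x, 'n, complex^'r^'r) lform" where
  "ncurv X h i x vs = mat (\<i> / (2 * of_real pi)) ** chern_curvature X h i x vs"

definition chern_form ::
  "('i, 'x, 'n::finite) atlas \<Rightarrow> ('i \<Rightarrow> 'x \<Rightarrow> complex^'r::finite^'r) \<Rightarrow> ('i, 'x, 'n, complex) lform" where
  "chern_form X h i x vs = (\<Sum>j\<le>CARD('n). trace (mpow (ncurv X h i x) j vs) / fact j)"

definition chern_character ::
  "('i, 'x, 'n::finite) atlas \<Rightarrow> ('i \<Rightarrow> 'i \<Rightarrow> 'x \<Rightarrow> complex^'r::finite^'r) \<Rightarrow>
   ('i, 'x, 'n, complex) lform set" where
  "chern_character X g = (\<Union>h\<in>hermitian_metrics X g. de_rham_class X (chern_form X h))"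


section \<open>Polynomial central charges\<close>

definition stability_vector :: "nat \<Rightarrow> (nat \<Rightarrow> complex) \<Rightarrow> bool" where
  "stability_vector n \<rho> \<longleftrightarrow>
     (\<forall>d\<le>n. \<rho> d \<noteq> 0) \<and> 0 < Im (\<rho> n) \<and> (\<forall>d<n. 0 < Im (\<rho> d / \<rho> (Suc d)))"

text \<open>The value on cohomology classes; it does not depend on the chosen representatives.\<close>

definition central_charge ::
  "('i, 'x::t2_space, 'n::finite) atlas \<Rightarrow> (nat \<Rightarrow> complex) \<Rightarrow>
   ('i, 'x, 'n, complex) lform set \<Rightarrow> ('i, 'x, 'n, complex) lform set \<Rightarrow>
   ('i \<Rightarrow> 'i \<Rightarrow> 'x \<Rightarrow> complex^'r::finite^'r) \<Rightarrow> complex" where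
  "central_charge X \<rho> W U g =
     (SOME z. \<exists>w\<in>W. \<exists>c\<in>chern_character X g. \<exists>u\<in>U.
        z = form_integral X (\<lambda>i x.
              swedge (\<lambda>vs. \<Sum>d\<le>CARD('n). \<rho> d * spow (w i x) d vs) (swedge (c i x) (u i x))))"

text \<open>A polynomial central charge with fixed representatives of \<open>[\<omega>]\<close> and of the unipotent class \<open>U\<close>.\<close>

record ('i, 'x, 'n) charge =
  rho :: "nat \<Rightarrow> complex"
  kform :: "('i, 'x, 'n, complex) lform"
  uform :: "('i, 'x, 'n, complex) lform"

definition polynomial_central_charge ::
  "('i, 'x::t2_space, 'n::finite) atlas \<Rightarrow> ('i, 'x, 'n) charge \<Rightarrow> bool" where
  "polynomial_central_charge X C \<longleftrightarrow>
     stability_vector CARD('n) (rho C) \<and>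
     kaehler_form X (kform C) \<and>
     closed_form X (uform C) \<and> real_form X (uform C) \<and>
     (\<forall>i. \<forall>x\<in>cdom X i. uform C i x [] = 1)"

definition Z_of ::
  "('i, 'x::t2_space, 'n::finite) atlas \<Rightarrow> ('i, 'x, 'n) charge \<Rightarrow>
   ('i \<Rightarrow> 'i \<Rightarrow> 'x \<Rightarrow> complex^'r::finite^'r) \<Rightarrow> complex" where
  "Z_of X C g =
     central_charge X (rho C) (de_rham_class X (kform C)) (de_rham_class X (uform C)) g"

definition Z_phase ::
  "('i, 'x::t2_space, 'n::finite) atlas \<Rightarrow> ('i, 'x, 'n) charge \<Rightarrow>
   ('i \<Rightarrow> 'i \<Rightarrow> 'x \<Rightarrow> complex^'r::finite^'r) \<Rightarrow> real" where
  "Z_phase X C g = Arg (Z_of X C g)"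

text \<open>\<open>\<omega>\<^sup>d \<and> \<Phi> \<and> U\<^sub>l\<close>, where \<open>U\<^sub>l\<close> is the part of degree \<open>2l\<close>\<close>

definition charge_term ::
  "('i, 'x, 'n::finite) charge \<Rightarrow> 'i \<Rightarrow> 'x \<Rightarrow> nat \<Rightarrow> nat \<Rightarrow>
   (complex^'n, complex^'r::finite^'r) aform \<Rightarrow> (complex^'n, complex^'r^'r) aform" where
  "charge_term C i x d l \<Phi> =
     mwedge (id_form (spow (kform C i x) d)) (mwedge \<Phi> (id_form (deg_part (2 * l) (uform C i x))))"

definition Z_tilde ::
  "('i, 'x, 'n::finite) atlas \<Rightarrow> ('i, 'x, 'n) charge \<Rightarrow> ('i \<Rightarrow> 'x \<Rightarrow> complex^'r::finite^'r) \<Rightarrow>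
   ('i, 'x, 'n, complex^'r^'r) lform" where
  "Z_tilde X C h i x vs =
     (\<Sum>(d, j, l) | d + j + l = CARD('n).
        mat (rho C d / fact j) ** charge_term C i x d l (mpow (ncurv X h i x) j) vs)"

definition D_Z ::
  "('i, 'x::t2_space, 'n::finite) atlas \<Rightarrow> ('i \<Rightarrow> 'i \<Rightarrow> 'x \<Rightarrow> complex^'r::finite^'r) \<Rightarrow>
   ('i, 'x, 'n) charge \<Rightarrow> ('i \<Rightarrow> 'x \<Rightarrow> complex^'r^'r) \<Rightarrow> ('i, 'x, 'n, complex^'r^'r) lform" where
  "D_Z X g C h i x vs =
     (let T = (\<lambda>vs. mat (cis (- Z_phase X C g)) ** Z_tilde X C h i x vs) in
      mat (1 / (2 * \<i>)) ** (T vs - form_adj (h i x) T vs))"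


section \<open>Subsolutions\<close>

text \<open>Graded symmetrisation of a word of homogeneous factors, each listed with its degree. The
  exponent counts, with weight \<open>deg \<cdot> deg\<close>, the pairs of factors whose order is reversed, which is
  what a decomposition into adjacent transpositions gives modulo 2.\<close>

definition grsgn :: "nat list \<Rightarrow> (nat \<Rightarrow> nat) \<Rightarrow> nat" where
  "grsgn ds \<sigma> = (\<Sum>(a, b) | a < b \<and> b < length ds \<and> \<sigma> b < \<sigma> a. ds ! \<sigma> a * ds ! \<sigma> b)"

definition sym_wedge ::
  "(nat \<times> ('v, complex^'r::finite^'r) aform) list \<Rightarrow> ('v, complex^'r^'r) aform" where
  "sym_wedge Bs vs =
     (1 / fact (length Bs)) *\<^sub>R
     (\<Sum>\<sigma> | \<sigma> permutes {..<length Bs}. (-1) ^ grsgn (map fst Bs) \<sigma> *\<^sub>R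
        foldr mwedge (map (\<lambda>k. snd (Bs ! \<sigma> k)) [0..<length Bs]) (form_unit (mat 1)) vs)"

text \<open>
  \<open>[e\<^bsup>-i\<theta>\<^esup> Z'(h) \<and> u\<^sup>* \<and> u]\<^sub>s\<^sub>y\<^sub>m\<close> for the formal words in \<open>B\<close> (standing for \<open>(\<i> / 2\<pi>) F(h)\<close>)
  making up \<open>Z'(h)\<close>; \<open>c d\<close> is the coefficient of \<open>\<omega>\<^sup>d\<close>. The scalar forms of even degree are central
  and stay outside the bracket. The adjoint of \<open>c d \<omega>\<^sup>d \<and> B\<^bsup>j-1\<^esup> \<and> U\<^sub>l\<close> is
  \<open>cnj (c d) \<omega>\<^sup>d \<and> (B\<^sup>*)\<^bsup>j-1\<^esup> \<and> U\<^sub>l\<close>, as \<open>\<omega>\<close> and \<open>U\<^sub>l\<close> are real and all degrees are even.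
\<close>

definition sym_bracket ::
  "('i, 'x, 'n::finite) charge \<Rightarrow> 'i \<Rightarrow> 'x \<Rightarrow> (nat \<Rightarrow> complex) \<Rightarrow>
   (complex^'n, complex^'r::finite^'r) aform \<Rightarrow> (complex^'n, complex^'r^'r) aform \<Rightarrow>
   (complex^'n, complex^'r^'r) aform \<Rightarrow> (complex^'n, complex^'r^'r) aform" where
  "sym_bracket C i x c B u' u vs =
     (\<Sum>(d, j, l) | d + j + l = CARD('n) \<and> 1 \<le> j.
        mat (c d / fact (j - 1)) **
        charge_term C i x d l (sym_wedge (replicate (j - 1) (2, B) @ [(1, u'), (1, u)])) vs)"

definition subsolution_form ::
  "('i, 'x::t2_space, 'n::finite) atlas \<Rightarrow> ('i \<Rightarrow> 'i \<Rightarrow> 'x \<Rightarrow> complex^'r::finite^'r) \<Rightarrow>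
   ('i, 'x, 'n) charge \<Rightarrow> ('i \<Rightarrow> 'x \<Rightarrow> complex^'r^'r) \<Rightarrow> 'i \<Rightarrow> 'x \<Rightarrow>
   (complex^'n \<Rightarrow> complex^'r^'r) \<Rightarrow> (complex^'n, complex) aform" where
  "subsolution_form X g C h i x u vs =
     (let c = (\<lambda>d. cis (- Z_phase X C g) * rho C d);
          B = ncurv X h i x;
          v = one_form u;
          v' = form_adj (h i x) v
      in trace (mat \<i> ** (mat (1 / (2 * \<i>)) **
           (sym_bracket C i x c B v' v vs -
            sym_bracket C i x (\<lambda>d. cnj (c d)) (form_adj (h i x) B) v' v vs))))"

text \<open>Elements of \<open>T\<^sup>*\<^sub>0\<^sub>,\<^sub>1 X\<^sub>x \<otimes> End(E)\<^sub>x\<close> are the conjugate-linear maps from the tangent space to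
  \<open>End(E)\<^sub>x\<close>. A top form is positive if it is positive on the oriented frame; the value in question
  is automatically real.\<close>

definition subsolutions ::
  "('i, 'x::t2_space, 'n::finite) atlas \<Rightarrow> ('i \<Rightarrow> 'i \<Rightarrow> 'x \<Rightarrow> complex^'r::finite^'r) \<Rightarrow>
   ('i, 'x, 'n) charge \<Rightarrow> ('i \<Rightarrow> 'x \<Rightarrow> complex^'r^'r) set" where
  "subsolutions X g C = {h \<in> hermitian_metrics X g.
     \<forall>i. \<forall>x\<in>cdom X i. \<forall>u.
       linear u \<and> (\<forall>v. u (\<i> *s v) = mat (- \<i>) ** u v) \<and> (\<exists>v. u v \<noteq> 0) \<longrightarrow>
       0 < Re (subsolution_form X g C h i x u oriented_frame)}"


section \<open>Paths of metrics and the functional\<close>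

text \<open>Smoothness is joint in time and space; on a non-open set of times \<open>J\<close> it means that the path
  extends smoothly to an open set containing \<open>J\<close>.\<close>

definition smooth_metric_path ::
  "('i, 'x, 'n::finite) atlas \<Rightarrow> ('i \<Rightarrow> 'i \<Rightarrow> 'x \<Rightarrow> complex^'r::finite^'r) \<Rightarrow> real set \<Rightarrow>
   (real \<Rightarrow> 'i \<Rightarrow> 'x \<Rightarrow> complex^'r^'r) \<Rightarrow> bool" where
  "smooth_metric_path X g J \<gamma> \<longleftrightarrow>
     (\<exists>T. open T \<and> J \<subseteq> T \<and> (\<forall>t\<in>T. \<gamma> t \<in> hermitian_metrics X g) \<and>
        (\<forall>i. smooth_on (T \<times> cimg X i) (\<lambda>(t, z). \<gamma> t i (cinv X i z))))"

text \<open>\<open>h\<^sub>t\<^sup>-\<^sup>1 \<partial>\<^sub>t h\<^sub>t\<close>\<close>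

definition log_velocity ::
  "(real \<Rightarrow> 'i \<Rightarrow> 'x \<Rightarrow> complex^'r::finite^'r) \<Rightarrow> real \<Rightarrow> 'i \<Rightarrow> 'x \<Rightarrow> complex^'r^'r" where
  "log_velocity \<gamma> t i x = matrix_inv (\<gamma> t i x) ** vector_derivative (\<lambda>s. \<gamma> s i x) (at t)"

definition metric_geodesic ::
  "('i, 'x, 'n::finite) atlas \<Rightarrow> ('i \<Rightarrow> 'i \<Rightarrow> 'x \<Rightarrow> complex^'r::finite^'r) \<Rightarrow> real set \<Rightarrow>
   (real \<Rightarrow> 'i \<Rightarrow> 'x \<Rightarrow> complex^'r^'r) \<Rightarrow> bool" where
  "metric_geodesic X g J \<gamma> \<longleftrightarrow>
     smooth_metric_path X g J \<gamma> \<and>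
     (\<forall>t\<in>J. \<forall>i. \<forall>x\<in>cdom X i. ((\<lambda>s. log_velocity \<gamma> s i x) has_vector_derivative 0) (at t))"

definition path_functional ::
  "('i, 'x::t2_space, 'n::finite) atlas \<Rightarrow> ('i \<Rightarrow> 'i \<Rightarrow> 'x \<Rightarrow> complex^'r::finite^'r) \<Rightarrow>
   ('i, 'x, 'n) charge \<Rightarrow> (real \<Rightarrow> 'i \<Rightarrow> 'x \<Rightarrow> complex^'r^'r) \<Rightarrow> complex" where
  "path_functional X g C \<gamma> =
     set_lebesgue_integral lborel {0..1} (\<lambda>t.
       form_integral X (\<lambda>i x vs. trace (log_velocity \<gamma> t i x ** D_Z X g C (\<gamma> t) i x vs)))"

text \<open>The value is real and independent of the path; \<open>Re\<close> only changes the type.\<close>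

definition M_Z ::
  "('i, 'x::t2_space, 'n::finite) atlas \<Rightarrow> ('i \<Rightarrow> 'i \<Rightarrow> 'x \<Rightarrow> complex^'r::finite^'r) \<Rightarrow>
   ('i, 'x, 'n) charge \<Rightarrow> ('i \<Rightarrow> 'x \<Rightarrow> complex^'r^'r) \<Rightarrow> ('i \<Rightarrow> 'x \<Rightarrow> complex^'r^'r) \<Rightarrow> real" where
  "M_Z X g C h h' =
     Re (SOME m. \<exists>\<gamma>. smooth_metric_path X g {0..1} \<gamma> \<and>
           (\<forall>i. \<forall>x\<in>cdom X i. \<gamma> 0 i x = h' i x \<and> \<gamma> 1 i x = h i x) \<and>
           m = path_functional X g C \<gamma>)"

end

theory Submission
  imports Defs "HOL-Complex_Analysis.Cauchy_Integral_Formula" "HOL-Library.Function_Algebras"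
begin

text \<open>
  Let \<open>\<theta> = h\<^sup>-\<^sup>1 \<partial>\<^sub>t h\<close> and \<open>\<Phi>(t) = \<integral> tr (\<theta> D\<^sub>Z(h\<^sub>t))\<close>. Along a geodesic \<open>\<theta>\<close> is constant in time and the
  curvature varies by the covariant derivative of \<open>\<partial>\<^sub>t A\<close>, which is the \<open>(1,0)\<close>-part of the covariant derivative of \<open>\<theta>\<close>
  and the adjoint of \<open>u = dbar \<theta>\<close>. Integration by parts turns \<open>\<Phi>'(t)\<close> into \<open>1 / 2\<pi>\<close> times the integral of the subsolution
  form evaluated at \<open>u\<close>: under the trace the graded symmetrisation only averages over cyclic
  rearrangements, over which the variation of \<open>F\<^sup>j\<close> sums anyway. So \<open>\<Phi>' \<ge> 0\<close>.

  The form \<open>U\<close> may have components that are not of type \<open>(l, l)\<close>, so the path integral defining \<open>M_Z\<close> need not be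
  independent of the path. The set of its values over all paths from \<open>a\<close> to \<open>b\<close> is a non-empty
  interval, and these sets are compatible with concatenation and reversal. Hence either all of
  them are singletons, and the difference of two values of \<open>M_Z\<close> along the geodesic is an integral of the increasing
  function \<open>\<Phi>\<close>; or one of them has two elements, all of them are the whole real line, and the choice
  operator in \<open>M_Z\<close> returns a constant.
\<close>

text \<open>Metrics, connections and curvatures are handled as local expressions. The parameters of
  a family of metrics are added to the chart coordinates, so that time and space derivatives are
  directional derivatives of one smooth map; the symmetry of its second derivatives yields the
  variation of the curvature. \<open>form_integral\<close> picks some partition of unity. It is kept
  fixed throughout, and the integrands of \<Phi> and \<Phi>' are never compared between charts. Only
  the boundary form of the integration by parts has to be a global form, so only for it are changes
  of frame and of coordinates carried out. Where the sign comes from: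
  \<open>(\<i> / 2 \<pi>) F\<close> is self-adjoint, so the traces pairing \<open>u\<close> with its
  adjoint are imaginary; the factor \<open>\<i> / 2 \<pi>\<close> in the variation of the curvature
  turns the imaginary part in \<open>D_Z\<close> into a real part, and the factor
  \<open>\<i>\<close> of the subsolution condition does the same on the other side. Forms have mixed
  degree, hence no degree to put into a sign; signs are carried by a parity operator
  instead.\<close>

definition dird :: "'a::real_normed_vector \<Rightarrow> ('a \<Rightarrow> 'b::real_normed_vector) \<Rightarrow> 'a \<Rightarrow> 'b" where
  "dird v f x = frechet_derivative f (at x) v"

lemma dird_eqI: "(f has_derivative f') (at x) \<Longrightarrow> dird v f x = f' v"
  unfolding dird_def by (metis frechet_derivative_at)

lemma has_derivative_dird: "f differentiable (at x) \<Longrightarrow> (f has_derivative (\<lambda>v. dird v f x)) (at x)"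
  unfolding dird_def using frechet_derivative_works by blast

lemma linear_dird: "f differentiable (at x) \<Longrightarrow> linear (\<lambda>v. dird v f x)"
  using has_derivative_dird has_derivative_linear by blast

lemma dird_cong_open:
  assumes "open S" "x \<in> S" "\<And>y. y \<in> S \<Longrightarrow> f y = g y"
  shows "dird v f x = dird v g x" "f differentiable (at x) \<longleftrightarrow> g differentiable (at x)"
proof -
  have "(f has_derivative D) (at x) \<longleftrightarrow> (g has_derivative D) (at x)" for D
    using has_derivative_transform_within_open assms by metis
  then show "dird v f x = dird v g x" "f differentiable (at x) \<longleftrightarrow> g differentiable (at x)"
    by (auto simp: dird_def frechet_derivative_def differentiable_def)
qed

section \<open>Calculus of C^k and smooth maps by directional derivatives\<close>

lemma Ck_on_Suc_dird: "Ck_on (Suc k) S f \<longleftrightarrow>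
    (\<forall>x\<in>S. f differentiable (at x)) \<and> (\<forall>v. Ck_on k S (dird v f))"
  by (simp add: dird_def[abs_def])

lemma Ck_on_cong:
  assumes "open S" "\<And>y. y \<in> S \<Longrightarrow> f y = g y"
  shows "Ck_on k S f \<longleftrightarrow> Ck_on k S g"
  using assms(2)
proof (induction k arbitrary: f g)
  case 0
  then show ?case by (simp cong: continuous_on_cong)
next
  case (Suc k)
  have "Ck_on k S (dird v f) \<longleftrightarrow> Ck_on k S (dird v g)" for v
    by (rule Suc.IH) (rule dird_cong_open(1)[OF assms(1) _ Suc.prems])
  moreover have "f differentiable (at x) \<longleftrightarrow> g differentiable (at x)" if "x \<in> S" for x
    by (rule dird_cong_open(2)[OF assms(1) that Suc.prems])
  ultimately show ?case
    unfolding Ck_on_Suc_dird by simp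
qed

lemma Ck_on_SucD: "Ck_on (Suc k) S f \<Longrightarrow> Ck_on k S f"
proof (induction k arbitrary: f)
  case 0
  then show ?case
    by (auto simp: continuous_at_imp_continuous_on differentiable_imp_continuous_within)
next
  case (Suc k)
  then show ?case by (metis Ck_on_Suc_dird)
qed

lemma Ck_on_const: "Ck_on k S (\<lambda>x. c)"
proof (induction k arbitrary: c)
  case (Suc k)
  have "dird v (\<lambda>x. c) = (\<lambda>x. 0)" for v :: 'a
    by (auto simp: dird_def)
  then show ?case using Suc by (simp add: Ck_on_Suc_dird del: Ck_on.simps(2))
qed auto

lemma Ck_on_linear_compose:
  assumes "open S" "bounded_linear L" "Ck_on k S f"
  shows "Ck_on k S (\<lambda>x. L (f x))"
  using assms(3)
proof (induction k arbitrary: f)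
  case 0
  then show ?case using bounded_linear.continuous_on[OF assms(2)] by auto
next
  case (Suc k)
  have d: "((\<lambda>x. L (f x)) has_derivative (\<lambda>v. L (dird v f x))) (at x)" if "x \<in> S" for x
    using Suc.prems that bounded_linear.has_derivative[OF assms(2)] has_derivative_dird
    by (metis Ck_on_Suc_dird)
  have "Ck_on k S (dird v (\<lambda>x. L (f x)))" for v
    by (rule Ck_on_cong[THEN iffD2, OF assms(1), of _ "\<lambda>x. L (dird v f x)"])
      (use d Suc in \<open>auto simp: dird_eqI[OF d] Ck_on_Suc_dird simp del: Ck_on.simps(2)\<close>)
  with d show ?case unfolding Ck_on_Suc_dird differentiable_def by blast
qed

lemma Ck_on_add:
  assumes "open S" "Ck_on k S f" "Ck_on k S g"
  shows "Ck_on k S (\<lambda>x. f x + g x)"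
  using assms(2,3)
proof (induction k arbitrary: f g)
  case 0
  then show ?case by (auto intro: continuous_intros)
next
  case (Suc k)
  have d: "((\<lambda>x. f x + g x) has_derivative (\<lambda>v. dird v f x + dird v g x)) (at x)" if "x \<in> S" for x
    using Suc.prems that by (intro has_derivative_add has_derivative_dird) auto
  have "Ck_on k S (dird v (\<lambda>x. f x + g x))" for v
    by (rule Ck_on_cong[THEN iffD2, OF assms(1), of _ "\<lambda>x. dird v f x + dird v g x"])
      (use d Suc in \<open>auto simp: dird_eqI[OF d] Ck_on_Suc_dird simp del: Ck_on.simps(2)\<close>)
  with d show ?case unfolding Ck_on_Suc_dird differentiable_def by blast
qed

lemma Ck_on_bilinear:
  assumes "open S" "bounded_bilinear B" "Ck_on k S f" "Ck_on k S g"
  shows "Ck_on k S (\<lambda>x. B (f x) (g x))"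
  using assms(3,4)
proof (induction k arbitrary: f g)
  case 0
  then show ?case using bounded_bilinear.continuous_on[OF assms(2)] by auto
next
  case (Suc k)
  have d: "((\<lambda>x. B (f x) (g x)) has_derivative (\<lambda>v. B (f x) (dird v g x) + B (dird v f x) (g x))) (at x)"
    if "x \<in> S" for x
    using Suc.prems that
    by (intro bounded_bilinear.FDERIV[OF assms(2)] has_derivative_dird) auto
  have fg: "Ck_on k S f" "Ck_on k S g" using Suc.prems Ck_on_SucD by blast+
  have "Ck_on k S (dird v (\<lambda>x. B (f x) (g x)))" for v
    by (rule Ck_on_cong[THEN iffD2, OF assms(1), of _ "\<lambda>x. B (f x) (dird v g x) + B (dird v f x) (g x)"])
      (use d Suc fg in \<open>auto simp: dird_eqI[OF d] Ck_on_Suc_dird intro!: Ck_on_add assms simp del: Ck_on.simps(2)\<close>)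
  with d show ?case unfolding Ck_on_Suc_dird differentiable_def by blast
qed

lemma Ck_on_sum:
  assumes "open S" "\<And>a. a \<in> A \<Longrightarrow> Ck_on k S (f a)"
  shows "Ck_on k S (\<lambda>x. \<Sum>a\<in>A. f a x)"
  using assms(2) by (induction A rule: infinite_finite_induct) (auto intro: Ck_on_const Ck_on_add assms(1))

lemma Ck_on_subset: "Ck_on k S f \<Longrightarrow> T \<subseteq> S \<Longrightarrow> Ck_on k T f"
  by (induction k arbitrary: f) (auto intro: continuous_on_subset)

lemma Ck_on_local:
  assumes "open S" "\<And>x. x \<in> S \<Longrightarrow> \<exists>T. open T \<and> x \<in> T \<and> Ck_on k T f"
  shows "Ck_on k S f"
  using assms(2)
proof (induction k arbitrary: f)
  case 0
  show ?case
    unfolding Ck_on.simps continuous_on_eq_continuous_at[OF assms(1)]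
    using 0 by (metis Ck_on.simps(1) continuous_on_eq_continuous_at)
next
  case (Suc k)
  show ?case unfolding Ck_on_Suc_dird
    using Suc.prems Suc.IH by (metis Ck_on_Suc_dird)
qed

text \<open>\<open>Ck_on\<close> differentiates along fixed directions only, whereas the chain rule
  yields the derivative of \<open>f\<close> along \<open>dird v g x\<close>, which moves with
  \<open>x\<close>. Expanding this direction in a basis turns the derivative into a finite sum of
  products to which the induction applies; this is why \<open>g\<close> takes values in a Euclidean
  space.\<close>

lemma Ck_on_compose:
  fixes g :: "'a::real_normed_vector \<Rightarrow> 'b::euclidean_space" and f :: "'b \<Rightarrow> 'c::real_normed_vector"
  assumes "open S" "open T" "\<And>x. x \<in> S \<Longrightarrow> g x \<in> T" "Ck_on k T f" "Ck_on k S g"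
  shows "Ck_on k S (\<lambda>x. f (g x))"
  using assms(4,5)
proof (induction k arbitrary: f)
  case 0
  then show ?case using continuous_on_compose2[of T f S g] assms(3) by (simp add: image_subsetI)
next
  case (Suc k)
  have gk: "Ck_on k S g" using Suc.prems Ck_on_SucD by blast
  have e: "(\<Sum>b\<in>Basis. (dird v g x \<bullet> b) *\<^sub>R dird b f (g x)) = dird (dird v g x) f (g x)" if "x \<in> S" for x v
  proof -
    have l: "linear (\<lambda>v. dird v f (g x))"
      using Suc.prems that assms(3) by (intro linear_dird) auto
    have "dird (\<Sum>b\<in>Basis. (dird v g x \<bullet> b) *\<^sub>R b) f (g x) = (\<Sum>b\<in>Basis. (dird v g x \<bullet> b) *\<^sub>R dird b f (g x))"
      by (simp add: linear_sum[OF l] linear_cmul[OF l])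
    then show ?thesis by (simp add: euclidean_representation)
  qed
  have d: "((\<lambda>x. f (g x)) has_derivative (\<lambda>v. \<Sum>b\<in>Basis. (dird v g x \<bullet> b) *\<^sub>R dird b f (g x))) (at x)"
    if "x \<in> S" for x
  proof -
    have "(f \<circ> g has_derivative (\<lambda>v. dird v f (g x)) \<circ> (\<lambda>v. dird v g x)) (at x)"
      using Suc.prems that assms(3) by (intro diff_chain_at has_derivative_dird) auto
    then show ?thesis using e[OF that] by (simp add: o_def)
  qed
  have "Ck_on k S (dird v (\<lambda>x. f (g x)))" for v
  proof (rule Ck_on_cong[THEN iffD2, OF assms(1), of _ "\<lambda>x. \<Sum>b\<in>Basis. (dird v g x \<bullet> b) *\<^sub>R dird b f (g x)"])
    show "Ck_on k S (\<lambda>x. \<Sum>b\<in>Basis. (dird v g x \<bullet> b) *\<^sub>R dird b f (g x))"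
      using Suc gk
      by (intro Ck_on_sum Ck_on_bilinear[OF _ bounded_bilinear_scaleR]
            Ck_on_linear_compose[OF _ bounded_linear_inner_left] assms(1) Suc.IH)
         (auto simp: Ck_on_Suc_dird simp del: Ck_on.simps(2))
  qed (use d in \<open>auto simp: dird_eqI[OF d]\<close>)
  with d show ?case unfolding Ck_on_Suc_dird differentiable_def by blast
qed

text \<open>The derivative of \<open>1/f\<close> is a product of the derivative of \<open>f\<close>
  with two copies of \<open>1/f\<close>, so order \<open>k\<close> of the inverse itself is what the
  step to order \<open>k + 1\<close> consumes.\<close>

lemma Ck_on_inverse:
  fixes f :: "'a::real_normed_vector \<Rightarrow> 'b::real_normed_field"
  assumes "open S" "\<And>x. x \<in> S \<Longrightarrow> f x \<noteq> 0" "Ck_on k S f"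
  shows "Ck_on k S (\<lambda>x. inverse (f x))"
  using assms(3)
proof (induction k)
  case 0
  then show ?case using assms(2) by (auto intro: continuous_intros)
next
  case (Suc k)
  have d: "((\<lambda>x. inverse (f x)) has_derivative (\<lambda>v. - (inverse (f x) * dird v f x * inverse (f x)))) (at x)"
    if "x \<in> S" for x
    using Suc.prems that assms(2) by (intro Deriv.has_derivative_inverse has_derivative_dird) auto
  have ik: "Ck_on k S (\<lambda>x. inverse (f x))" using Suc Ck_on_SucD by blast
  have "Ck_on k S (dird v (\<lambda>x. inverse (f x)))" for v
    by (rule Ck_on_cong[THEN iffD2, OF assms(1), of _ "\<lambda>x. - (inverse (f x) * dird v f x * inverse (f x))"])
      (use d Suc ik in \<open>auto simp: dird_eqI[OF d] Ck_on_Suc_dird simp del: Ck_on.simps(2)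
        intro!: Ck_on_linear_compose[OF _ bounded_linear_minus[OF bounded_linear_ident]]
         Ck_on_bilinear[OF _ bounded_bilinear_mult] assms\<close>)
  with d show ?case unfolding Ck_on_Suc_dird differentiable_def by blast
qed

lemma smooth_on_dird: "smooth_on S f \<Longrightarrow> smooth_on S (dird v f)"
  unfolding smooth_on_def by (metis Ck_on_Suc_dird)

lemma smooth_on_differentiable: "smooth_on S f \<Longrightarrow> x \<in> S \<Longrightarrow> f differentiable (at x)"
  unfolding smooth_on_def by (metis Ck_on_Suc_dird)

lemma smooth_on_continuous: "smooth_on S f \<Longrightarrow> continuous_on S f"
  unfolding smooth_on_def by (metis Ck_on.simps(1))

lemma smooth_on_cong: "open S \<Longrightarrow> (\<And>y. y \<in> S \<Longrightarrow> f y = g y) \<Longrightarrow> smooth_on S f \<longleftrightarrow> smooth_on S g"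
  unfolding smooth_on_def using Ck_on_cong by blast

lemma smooth_on_const: "smooth_on S (\<lambda>x. c)"
  unfolding smooth_on_def using Ck_on_const by blast

lemma smooth_on_linear_compose:
  "open S \<Longrightarrow> bounded_linear L \<Longrightarrow> smooth_on S f \<Longrightarrow> smooth_on S (\<lambda>x. L (f x))"
  unfolding smooth_on_def using Ck_on_linear_compose by blast

lemma smooth_on_add: "open S \<Longrightarrow> smooth_on S f \<Longrightarrow> smooth_on S g \<Longrightarrow> smooth_on S (\<lambda>x. f x + g x)"
  unfolding smooth_on_def using Ck_on_add by blast

lemma smooth_on_bilinear:
  "open S \<Longrightarrow> bounded_bilinear B \<Longrightarrow> smooth_on S f \<Longrightarrow> smooth_on S g \<Longrightarrow> smooth_on S (\<lambda>x. B (f x) (g x))"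
  unfolding smooth_on_def using Ck_on_bilinear by blast

lemmas smooth_on_mult = smooth_on_bilinear[OF _ bounded_bilinear_mult]
lemmas smooth_on_scaleR = smooth_on_bilinear[OF _ bounded_bilinear_scaleR]

lemma smooth_on_uminus: "open S \<Longrightarrow> smooth_on S f \<Longrightarrow> smooth_on S (\<lambda>x. - f x)"
  by (rule smooth_on_linear_compose[OF _ bounded_linear_minus[OF bounded_linear_ident]])

lemma smooth_on_diff: "open S \<Longrightarrow> smooth_on S f \<Longrightarrow> smooth_on S g \<Longrightarrow> smooth_on S (\<lambda>x. f x - g x)"
  using smooth_on_add[OF _ _ smooth_on_uminus] by fastforce

lemma smooth_on_sum:
  "open S \<Longrightarrow> (\<And>a. a \<in> A \<Longrightarrow> smooth_on S (f a)) \<Longrightarrow> smooth_on S (\<lambda>x. \<Sum>a\<in>A. f a x)"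
  unfolding smooth_on_def by (intro allI Ck_on_sum) auto

lemma smooth_on_prod:
  fixes f :: "'i \<Rightarrow> 'a::real_normed_vector \<Rightarrow> 'b::{real_normed_algebra,comm_ring_1}"
  assumes "open S" "\<And>a. a \<in> A \<Longrightarrow> smooth_on S (f a)"
  shows "smooth_on S (\<lambda>x. \<Prod>a\<in>A. f a x)"
  using assms(2) by (induction A rule: infinite_finite_induct) (auto intro: smooth_on_const smooth_on_mult assms(1))

lemma smooth_on_subset: "smooth_on S f \<Longrightarrow> T \<subseteq> S \<Longrightarrow> smooth_on T f"
  unfolding smooth_on_def using Ck_on_subset by blast

lemma smooth_on_local:
  "open S \<Longrightarrow> (\<And>x. x \<in> S \<Longrightarrow> \<exists>T. open T \<and> x \<in> T \<and> smooth_on T f) \<Longrightarrow> smooth_on S f"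
  unfolding smooth_on_def by (intro allI Ck_on_local) auto

lemma smooth_on_compose:
  fixes g :: "'a::real_normed_vector \<Rightarrow> 'b::euclidean_space"
  shows "open S \<Longrightarrow> open T \<Longrightarrow> (\<And>x. x \<in> S \<Longrightarrow> g x \<in> T) \<Longrightarrow> smooth_on T f \<Longrightarrow> smooth_on S g
     \<Longrightarrow> smooth_on S (\<lambda>x. f (g x))"
  unfolding smooth_on_def by (rule allI, rule Ck_on_compose[where T=T]; blast)

lemma smooth_on_inverse:
  fixes f :: "'a::real_normed_vector \<Rightarrow> 'b::real_normed_field"
  shows "open S \<Longrightarrow> (\<And>x. x \<in> S \<Longrightarrow> f x \<noteq> 0) \<Longrightarrow> smooth_on S f \<Longrightarrow> smooth_on S (\<lambda>x. inverse (f x))"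
  unfolding smooth_on_def by (rule allI, rule Ck_on_inverse; blast)

lemma smooth_on_divide:
  fixes f :: "'a::real_normed_vector \<Rightarrow> 'b::real_normed_field"
  shows "open S \<Longrightarrow> (\<And>x. x \<in> S \<Longrightarrow> g x \<noteq> 0) \<Longrightarrow> smooth_on S f \<Longrightarrow> smooth_on S g \<Longrightarrow> smooth_on S (\<lambda>x. f x / g x)"
  unfolding divide_inverse by (intro smooth_on_mult smooth_on_inverse)

lemma smooth_on_id: "smooth_on S (\<lambda>x. x)"
proof -
  have "dird v (\<lambda>x. x) = (\<lambda>x. v)" for v :: 'a by (auto simp: dird_def)
  then have "Ck_on (Suc k) S (\<lambda>x. x)" for k
    by (simp add: Ck_on_Suc_dird Ck_on_const del: Ck_on.simps(2))
  then show ?thesis unfolding smooth_on_def using Ck_on_SucD by blast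
qed

lemma smooth_on_linear: "open S \<Longrightarrow> bounded_linear L \<Longrightarrow> smooth_on S L"
  by (rule smooth_on_linear_compose[OF _ _ smooth_on_id])

lemma dird_add:
  "f differentiable (at x) \<Longrightarrow> g differentiable (at x) \<Longrightarrow> dird v (\<lambda>x. f x + g x) x = dird v f x + dird v g x"
  by (intro dird_eqI has_derivative_add has_derivative_dird)

lemma dird_diff:
  "f differentiable (at x) \<Longrightarrow> g differentiable (at x) \<Longrightarrow> dird v (\<lambda>x. f x - g x) x = dird v f x - dird v g x"
  by (intro dird_eqI has_derivative_diff has_derivative_dird)

lemma dird_sum:
  "(\<And>a. a \<in> A \<Longrightarrow> f a differentiable (at x)) \<Longrightarrow> dird v (\<lambda>x. \<Sum>a\<in>A. f a x) x = (\<Sum>a\<in>A. dird v (f a) x)"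
  by (intro dird_eqI has_derivative_sum has_derivative_dird)

lemma dird_linear_compose:
  "bounded_linear L \<Longrightarrow> f differentiable (at x) \<Longrightarrow> dird v (\<lambda>x. L (f x)) x = L (dird v f x)"
  using dird_eqI[OF bounded_linear.has_derivative[OF _ has_derivative_dird]] by blast

lemma dird_bilinear:
  "bounded_bilinear B \<Longrightarrow> f differentiable (at x) \<Longrightarrow> g differentiable (at x) \<Longrightarrow>
     dird v (\<lambda>x. B (f x) (g x)) x = B (f x) (dird v g x) + B (dird v f x) (g x)"
  using dird_eqI[OF bounded_bilinear.FDERIV[OF _ has_derivative_dird has_derivative_dird]] by blast

lemma dird_compose:
  "g differentiable (at x) \<Longrightarrow> f differentiable (at (g x)) \<Longrightarrow>
     dird v (\<lambda>x. f (g x)) x = dird (dird v g x) f (g x)"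
  using diff_chain_at[OF has_derivative_dird has_derivative_dird, of g x f]
  by (auto simp: o_def intro: dird_eqI)

lemma dird_const [simp]: "dird v (\<lambda>x. c) x = 0"
  by (simp add: dird_def)

lemma dird_has_vector_derivative:
  assumes "f differentiable (at (x + s *\<^sub>R v))"
  shows "((\<lambda>s. f (x + s *\<^sub>R v)) has_vector_derivative dird v f (x + s *\<^sub>R v)) (at s)"
proof -
  have g: "((\<lambda>s. x + s *\<^sub>R v) has_derivative (\<lambda>d. d *\<^sub>R v)) (at s)"
    by (auto intro!: derivative_eq_intros)
  have "(f \<circ> (\<lambda>s. x + s *\<^sub>R v) has_derivative (\<lambda>u. dird u f (x + s *\<^sub>R v)) \<circ> (\<lambda>d. d *\<^sub>R v)) (at s)"
    by (rule diff_chain_at[OF g has_derivative_dird]) fact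
  then show ?thesis
    using linear_cmul[OF linear_dird[OF assms]] by (simp add: has_vector_derivative_def o_def)
qed

text \<open>Both sides are the \<open>s\<close>-derivative at \<open>0\<close> of the \<open>w\<close>-derivative of
  \<open>f (x + s v) - f x = \<integral>\<^sub>0\<^sup>s (\<partial>\<^sub>v f) (x + \<sigma> v) d\<sigma>\<close>.\<close>

lemma dird_commute:
  fixes f :: "'a::real_normed_vector \<Rightarrow> 'b::banach"
  assumes S: "open S" and x: "x \<in> S" and f: "smooth_on S f"
  shows "dird v (dird w f) x = dird w (dird v f) x"
proof -
  have df: "f differentiable (at y)" "dird a f differentiable (at y)" if "y \<in> S" for y a
    using smooth_on_differentiable smooth_on_dird f that by blast+
  obtain e where e: "0 < e" "cball x e \<subseteq> S" using S x open_contains_cball by blast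
  \<comment> \<open>Small enough for \<open>x + s v + t w\<close> to stay in the ball of radius
    \<open>e\<close> for all \<open>\<bar>s\<bar>, \<bar>t\<bar> \<le> d\<close>.\<close>
  define d where "d = e / (norm v + norm w + 1)"
  have np: "norm v + norm w + 1 > 0" using norm_ge_zero[of v] norm_ge_zero[of w] by linarith
  then have d: "d > 0" using e by (simp add: d_def)
  have inS: "x + s *\<^sub>R v + t *\<^sub>R w \<in> S" if "\<bar>s\<bar> \<le> d" "\<bar>t\<bar> \<le> d" for s t
  proof -
    have "norm (s *\<^sub>R v + t *\<^sub>R w) \<le> d * norm v + d * norm w"
      using that by (intro norm_triangle_mono) (auto intro: mult_right_mono)
    also have "\<dots> \<le> d * (norm v + norm w + 1)" using d by (simp add: algebra_simps)
    also have "\<dots> = e" using np by (simp add: d_def)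
    finally have "norm (s *\<^sub>R v + t *\<^sub>R w) \<le> e" .
    moreover have "x - (x + s *\<^sub>R v + t *\<^sub>R w) = - (s *\<^sub>R v + t *\<^sub>R w)" by simp
    ultimately have "x + s *\<^sub>R v + t *\<^sub>R w \<in> cball x e"
      unfolding mem_cball dist_norm by (metis norm_minus_cancel)
    then show ?thesis using e by blast
  qed
  have int: "((\<lambda>\<sigma>. dird v f (x + \<sigma> *\<^sub>R v + t *\<^sub>R w)) has_integral
         (f (x + s *\<^sub>R v + t *\<^sub>R w) - f (x + t *\<^sub>R w))) {0..s}" if "0 \<le> s" "s \<le> d" "\<bar>t\<bar> \<le> d" for s t
  proof -
    have "((\<lambda>\<sigma>. dird v f (x + \<sigma> *\<^sub>R v + t *\<^sub>R w)) has_integral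
         (f (x + s *\<^sub>R v + t *\<^sub>R w) - f (x + 0 *\<^sub>R v + t *\<^sub>R w))) {0..s}"
    proof (rule fundamental_theorem_of_calculus)
      fix \<sigma> assume "\<sigma> \<in> {0..s}"
      then have "x + t *\<^sub>R w + \<sigma> *\<^sub>R v \<in> S" using inS[of \<sigma> t] that by (simp add: add_ac)
      from dird_has_vector_derivative[OF df(1)[OF this]]
      show "((\<lambda>\<sigma>. f (x + \<sigma> *\<^sub>R v + t *\<^sub>R w)) has_vector_derivative dird v f (x + \<sigma> *\<^sub>R v + t *\<^sub>R w)) (at \<sigma> within {0..s})"
        by (auto simp: add_ac intro: has_vector_derivative_at_within)
    qed (use that in auto)
    then show ?thesis by simp
  qed
  have cw: "continuous_on S (dird w (dird v f))"
    using smooth_on_continuous smooth_on_dird f by blast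
  have A: "dird w f (x + s *\<^sub>R v) - dird w f x = integral {0..s} (\<lambda>\<sigma>. dird w (dird v f) (x + \<sigma> *\<^sub>R v))"
    if s: "0 \<le> s" "s \<le> d" for s
  proof -
    let ?U = "{-d..d}"
    have "((\<lambda>t. integral (cbox 0 s) (\<lambda>\<sigma>. dird v f (x + \<sigma> *\<^sub>R v + t *\<^sub>R w))) has_vector_derivative
       integral (cbox 0 s) (\<lambda>\<sigma>. dird w (dird v f) (x + \<sigma> *\<^sub>R v + 0 *\<^sub>R w))) (at 0 within ?U)"
    proof (rule leibniz_rule_vector_derivative)
      fix t \<sigma> assume t: "t \<in> ?U" "\<sigma> \<in> cbox 0 s"
      show "((\<lambda>t. dird v f (x + \<sigma> *\<^sub>R v + t *\<^sub>R w)) has_vector_derivative dird w (dird v f) (x + \<sigma> *\<^sub>R v + t *\<^sub>R w)) (at t within ?U)"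
        using t s inS[of \<sigma> t] by (intro has_vector_derivative_at_within[OF dird_has_vector_derivative] df) auto
    next
      fix t assume t: "t \<in> ?U"
      show "(\<lambda>\<sigma>. dird v f (x + \<sigma> *\<^sub>R v + t *\<^sub>R w)) integrable_on cbox 0 s"
        using int[of s t] s t by (auto simp: abs_le_iff dest: has_integral_integrable)
    next
      show "continuous_on (?U \<times> cbox 0 s) (\<lambda>(t, \<sigma>). dird w (dird v f) (x + \<sigma> *\<^sub>R v + t *\<^sub>R w))"
        unfolding split_beta
        by (rule continuous_on_compose2[OF cw]) (use s inS in \<open>auto intro!: continuous_intros\<close>)
    qed (use d in auto)
    then have 1: "((\<lambda>t. integral (cbox 0 s) (\<lambda>\<sigma>. dird v f (x + \<sigma> *\<^sub>R v + t *\<^sub>R w))) has_vector_derivative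
       integral {0..s} (\<lambda>\<sigma>. dird w (dird v f) (x + \<sigma> *\<^sub>R v))) (at 0)"
      using d by (simp add: at_within_Icc_at)
    have "((\<lambda>t. f (x + s *\<^sub>R v + t *\<^sub>R w) - f (x + t *\<^sub>R w)) has_vector_derivative
         integral {0..s} (\<lambda>\<sigma>. dird w (dird v f) (x + \<sigma> *\<^sub>R v))) (at 0)"
    proof (rule has_vector_derivative_transform_within_open[OF 1, of "{-d<..<d}"])
      fix t assume "t \<in> {-d<..<d}"
      then show "integral (cbox 0 s) (\<lambda>\<sigma>. dird v f (x + \<sigma> *\<^sub>R v + t *\<^sub>R w)) = f (x + s *\<^sub>R v + t *\<^sub>R w) - f (x + t *\<^sub>R w)"
        using int[of s t] s by (auto simp: abs_le_iff intro: integral_unique)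
    qed (use d in auto)
    moreover have "((\<lambda>t. f (x + s *\<^sub>R v + t *\<^sub>R w) - f (x + t *\<^sub>R w)) has_vector_derivative
         dird w f (x + s *\<^sub>R v + 0 *\<^sub>R w) - dird w f (x + 0 *\<^sub>R w)) (at 0)"
      using inS[of s 0] inS[of 0 0] s d by (intro has_vector_derivative_diff dird_has_vector_derivative df) auto
    ultimately show ?thesis using vector_derivative_unique_at by fastforce
  qed
  \<comment> \<open>The integral from 0 to \<open>s\<close> is meant for \<open>s \<ge> 0\<close>
    only, so both derivatives at 0 are taken within \<open>{0..d}\<close>, where uniqueness still
    holds because \<open>d > 0\<close>.\<close>
  have "((\<lambda>s. integral {0..s} (\<lambda>\<sigma>. dird w (dird v f) (x + \<sigma> *\<^sub>R v))) has_vector_derivative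
       dird w (dird v f) (x + 0 *\<^sub>R v)) (at 0 within {0..d})"
  proof (rule integral_has_vector_derivative)
    show "continuous_on {0..d} (\<lambda>\<sigma>. dird w (dird v f) (x + \<sigma> *\<^sub>R v))"
      by (rule continuous_on_compose2[OF cw]) (use d inS[of _ 0] in \<open>auto intro!: continuous_intros\<close>)
  qed (use d in auto)
  then have I: "((\<lambda>s. integral {0..s} (\<lambda>\<sigma>. dird w (dird v f) (x + \<sigma> *\<^sub>R v))) has_vector_derivative
       dird w (dird v f) x) (at 0 within {0..d})" by simp
  have "((\<lambda>s. dird w f (x + s *\<^sub>R v) - dird w f x) has_vector_derivative
       dird w (dird v f) x) (at 0 within {0..d})"
    by (rule has_vector_derivative_transform[OF _ _ I]) (use d A in auto)
  moreover have "((\<lambda>s. dird w f (x + s *\<^sub>R v) - dird w f x) has_vector_derivative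
       dird v (dird w f) (x + 0 *\<^sub>R v) - 0) (at 0 within {0..d})"
    by (intro has_vector_derivative_diff has_vector_derivative_const
        has_vector_derivative_at_within[OF dird_has_vector_derivative] df) (use x in auto)
  moreover have "at 0 within {0..d} \<noteq> bot"
    using d by (simp add: trivial_limit_within islimpt_Icc)
  ultimately show ?thesis
    using vector_derivative_unique_within[of 0 "{0..d}"] by simp
qed


section \<open>Wedge products, traces and exterior derivatives of local expressions\<close>

lemma bilinear_matrix_mult: "bilinear ((**) :: complex^'r::finite^'r \<Rightarrow> complex^'r^'r \<Rightarrow> complex^'r^'r)"
  unfolding bilinear_def
  by (auto intro!: linearI simp: vec_eq_iff matrix_matrix_mult_def sum.distrib distrib_left distrib_right scaleR_sum_right)

lemma bilinear_times: "bilinear ((*) :: complex \<Rightarrow> _)"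
  unfolding bilinear_def by (auto intro!: linearI simp: distrib_left distrib_right)

lemma bounded_bilinear_matrix_mult: "bounded_bilinear ((**) :: complex^'r::finite^'r \<Rightarrow> complex^'r^'r \<Rightarrow> complex^'r^'r)"
  using bilinear_matrix_mult bilinear_conv_bounded_bilinear by blast

definition ctr :: "'v \<Rightarrow> ('v, 'b) aform \<Rightarrow> ('v, 'b) aform" where
  "ctr v \<alpha> vs = \<alpha> (v # vs)"

text \<open>The parity automorphism, \<open>-1\<close> to the power of the degree. A form of mixed
  degree has no degree of its own; \<open>gsg \<alpha> = \<alpha>\<close> and
  \<open>gsg \<alpha> = - \<alpha>\<close> express that only even, respectively odd, components
  occur.\<close>

definition gsg :: "('v, 'b::real_vector) aform \<Rightarrow> ('v, 'b) aform" where
  "gsg \<alpha> vs = (-1) ^ length vs *\<^sub>R \<alpha> vs"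

lemma gsg_gsg [simp]: "gsg (gsg \<alpha>) = \<alpha>"
  by (rule ext) (simp add: gsg_def power_mult_distrib[symmetric])

lemma gsg_ctr: "gsg (ctr v \<alpha>) = - ctr v (gsg \<alpha>)"
  by (rule ext) (simp add: gsg_def ctr_def)

lemma ctr_gsg: "ctr v (gsg \<alpha>) = - gsg (ctr v \<alpha>)"
  by (simp add: gsg_ctr)

lemma ctr_minus [simp]: "ctr v (- \<alpha>) = - ctr v \<alpha>"
  by (rule ext) (simp add: ctr_def)

lemma gsg_add [simp]: "gsg (\<alpha> + \<beta>) = gsg \<alpha> + gsg \<beta>"
  by (rule ext) (simp add: gsg_def scaleR_right_distrib)

lemma bilinear_linear_left: "bilinear m \<Longrightarrow> linear (\<lambda>x. m x y)"
  and bilinear_linear_right: "bilinear m \<Longrightarrow> linear (m x)"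
  by (simp_all add: bilinear_def)

context
  fixes m :: "'a::real_vector \<Rightarrow> 'b::real_vector \<Rightarrow> 'c::real_vector"
  assumes m: "bilinear m"
begin

lemma wedge_by_add_left: "wedge_by m (\<alpha> + \<alpha>') \<beta> = wedge_by m \<alpha> \<beta> + wedge_by m \<alpha>' \<beta>"
  by (rule ext) (simp add: wedge_by_def bilinear_ladd[OF m] scaleR_right_distrib sum.distrib)

lemma wedge_by_add_right: "wedge_by m \<alpha> (\<beta> + \<beta>') = wedge_by m \<alpha> \<beta> + wedge_by m \<alpha> \<beta>'"
  by (rule ext) (simp add: wedge_by_def bilinear_radd[OF m] scaleR_right_distrib sum.distrib)

lemma wedge_by_minus_left: "wedge_by m (- \<alpha>) \<beta> = - wedge_by m \<alpha> \<beta>"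
  by (rule ext) (simp add: wedge_by_def bilinear_lneg[OF m] sum_negf)

lemma wedge_by_minus_right: "wedge_by m \<alpha> (- \<beta>) = - wedge_by m \<alpha> \<beta>"
  by (rule ext) (simp add: wedge_by_def bilinear_rneg[OF m] sum_negf)

lemma wedge_by_diff_left: "wedge_by m (\<alpha> - \<alpha>') \<beta> = wedge_by m \<alpha> \<beta> - wedge_by m \<alpha>' \<beta>"
  by (rule ext) (simp add: wedge_by_def bilinear_lsub[OF m] scaleR_right_diff_distrib sum_subtractf)

lemma wedge_by_diff_right: "wedge_by m \<alpha> (\<beta> - \<beta>') = wedge_by m \<alpha> \<beta> - wedge_by m \<alpha> \<beta>'"
  by (rule ext) (simp add: wedge_by_def bilinear_rsub[OF m] scaleR_right_diff_distrib sum_subtractf)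

lemma wedge_by_zero_left: "wedge_by m 0 \<beta> = 0"
  by (rule ext) (simp add: wedge_by_def bilinear_lzero[OF m])

lemma wedge_by_zero_right: "wedge_by m \<alpha> 0 = 0"
  by (rule ext) (simp add: wedge_by_def bilinear_rzero[OF m])

lemma wedge_by_Nil: "wedge_by m \<alpha> \<beta> [] = m (\<alpha> []) (\<beta> [])"
  by (simp add: wedge_by_def)

text \<open>Position 0 is that of the vector in front of the list. It is fed either to the first
  factor or to the second, which gives the two terms of the recursion below.\<close>

lemma Pow_lessThan_Suc:
  "Pow {..<Suc n} = (\<lambda>S. insert 0 (Suc ` S)) ` Pow {..<n} \<union> (\<lambda>S. Suc ` S) ` Pow {..<n}"
proof (intro equalityI subsetI)
  fix S assume S: "S \<in> Pow {..<Suc n}"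
  define S' where "S' = {j. Suc j \<in> S}"
  have "S' \<in> Pow {..<n}" using S by (auto simp: S'_def)
  moreover have "S - {0} = Suc ` S'"
    unfolding S'_def by (auto simp: image_iff) (metis not0_implies_Suc)
  then have "S = (if 0 \<in> S then insert 0 (Suc ` S') else Suc ` S')"
    by auto
  ultimately show "S \<in> (\<lambda>S. insert 0 (Suc ` S)) ` Pow {..<n} \<union> (\<lambda>S. Suc ` S) ` Pow {..<n}"
    by (metis UnI1 UnI2 image_eqI)
qed auto

text \<open>Contraction with a vector is an antiderivation; every identity between wedge products
  below is an induction on the list of vectors by means of this recursion.\<close>

lemma wedge_by_Cons:
  "wedge_by m \<alpha> \<beta> (v # vs) = wedge_by m (ctr v \<alpha>) \<beta> vs + wedge_by m (gsg \<alpha>) (ctr v \<beta>) vs"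
proof -
  let ?n = "length vs"
  let ?inv = "\<lambda>n S. {(p, q). p \<in> S \<and> q \<in> {..<n} - S \<and> q < (p::nat)}"
  let ?f = "\<lambda>S. (-1) ^ card (?inv (Suc ?n) S) *\<^sub>R m (\<alpha> (nths (v # vs) S)) (\<beta> (nths (v # vs) ({..<Suc ?n} - S)))"
  have inj1: "inj_on (\<lambda>S. insert 0 (Suc ` S)) (Pow {..<?n})"
    by (rule inj_onI) (metis inj_Suc inj_image_eq_iff insert_ident zero_notin_Suc_image)
  have inj2: "inj_on (\<lambda>S. Suc ` S) (Pow {..<?n})"
    by (rule inj_onI) (metis inj_Suc inj_image_eq_iff)
  have "wedge_by m \<alpha> \<beta> (v # vs) = (\<Sum>S\<in>Pow {..<Suc ?n}. ?f S)"
    by (simp add: wedge_by_def)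
  also have "\<dots> = (\<Sum>S\<in>(\<lambda>S. insert 0 (Suc ` S)) ` Pow {..<?n}. ?f S) + (\<Sum>S\<in>(\<lambda>S. Suc ` S) ` Pow {..<?n}. ?f S)"
    unfolding Pow_lessThan_Suc by (rule sum.union_disjoint) auto
  also have "(\<Sum>S\<in>(\<lambda>S. insert 0 (Suc ` S)) ` Pow {..<?n}. ?f S) = (\<Sum>S\<in>Pow {..<?n}. ?f (insert 0 (Suc ` S)))"
    by (simp add: sum.reindex[OF inj1])
  also have "(\<Sum>S\<in>(\<lambda>S. Suc ` S) ` Pow {..<?n}. ?f S) = (\<Sum>S\<in>Pow {..<?n}. ?f (Suc ` S))"
    by (simp add: sum.reindex[OF inj2])
  also have "(\<Sum>S\<in>Pow {..<?n}. ?f (insert 0 (Suc ` S))) = wedge_by m (ctr v \<alpha>) \<beta> vs"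
    unfolding wedge_by_def
  proof (rule sum.cong[OF refl])
    fix S assume "S \<in> Pow {..<?n}"
    have [simp]: "{j. Suc j \<in> Suc ` S} = S" by (auto simp: inj_image_mem_iff)
    \<comment> \<open>Position 0 goes to the first factor and nothing precedes it, so no inversion
      is added.\<close>
    have "?inv (Suc ?n) (insert 0 (Suc ` S)) = (\<lambda>(p, q). (Suc p, Suc q)) ` ?inv ?n S"
    proof (intro equalityI subsetI)
      fix x assume "x \<in> ?inv (Suc ?n) (insert 0 (Suc ` S))"
      then obtain p q where x: "x = (p, q)" and pq: "p \<in> insert 0 (Suc ` S)" "q < Suc ?n" "q \<notin> insert 0 (Suc ` S)" "q < p" by auto
      from pq obtain p' where p: "p = Suc p'" "p' \<in> S" by auto
      from pq obtain q' where q: "q = Suc q'" by (cases q) auto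
      from p q pq have "(p', q') \<in> ?inv ?n S" by auto
      then show "x \<in> (\<lambda>(p, q). (Suc p, Suc q)) ` ?inv ?n S" using x p q by force
    qed auto
    moreover have "card ((\<lambda>(p, q). (Suc p, Suc q)) ` ?inv ?n S) = card (?inv ?n S)"
      by (rule card_image) (auto simp: inj_on_def)
    ultimately have c: "card (?inv (Suc ?n) (insert 0 (Suc ` S))) = card (?inv ?n S)" by simp
    have n1: "nths (v # vs) (insert 0 (Suc ` S)) = v # nths vs S"
      by (simp add: nths_Cons)
    have "{j. Suc j \<in> {..<Suc ?n} - insert 0 (Suc ` S)} = {..<?n} - S" by auto
    then have n2: "nths (v # vs) ({..<Suc ?n} - insert 0 (Suc ` S)) = nths vs ({..<?n} - S)"
      by (simp only: nths_Cons) simp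
    show "?f (insert 0 (Suc ` S)) =
        (-1) ^ card (?inv ?n S) *\<^sub>R m (ctr v \<alpha> (nths vs S)) (\<beta> (nths vs ({..<?n} - S)))"
      unfolding c n1 n2 ctr_def ..
  qed
  also have "(\<Sum>S\<in>Pow {..<?n}. ?f (Suc ` S)) = wedge_by m (gsg \<alpha>) (ctr v \<beta>) vs"
    unfolding wedge_by_def
  proof (rule sum.cong[OF refl])
    fix S assume S: "S \<in> Pow {..<?n}"
    have [simp]: "{j. Suc j \<in> Suc ` S} = S" by (auto simp: inj_image_mem_iff)
    have fS: "finite S" using S finite_subset by auto
    \<comment> \<open>Position 0 now goes to the second factor and precedes every element of
      \<open>S\<close>: each of these gains one inversion. The resulting sign
      \<open>(-1)^card S\<close> is what \<open>gsg \<alpha>\<close> contributes, as \<alpha>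
      receives \<open>card S\<close> vectors.\<close>
    have "?inv (Suc ?n) (Suc ` S) = (\<lambda>(p, q). (Suc p, Suc q)) ` ?inv ?n S \<union> (\<lambda>p. (Suc p, 0)) ` S"
    proof (intro equalityI subsetI)
      fix x assume "x \<in> ?inv (Suc ?n) (Suc ` S)"
      then obtain p q where x: "x = (p, q)" and pq: "p \<in> Suc ` S" "q < Suc ?n" "q \<notin> Suc ` S" "q < p" by auto
      from pq obtain p' where p: "p = Suc p'" "p' \<in> S" by auto
      show "x \<in> (\<lambda>(p, q). (Suc p, Suc q)) ` ?inv ?n S \<union> (\<lambda>p. (Suc p, 0)) ` S"
      proof (cases q)
        case (Suc q')
        with p pq have "(p', q') \<in> ?inv ?n S" by auto
        then show ?thesis using x p Suc by force
      qed (use x p in auto)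
    qed (use S in auto)
    moreover have "card ((\<lambda>(p, q). (Suc p, Suc q)) ` ?inv ?n S \<union> (\<lambda>p. (Suc p, 0)) ` S)
        = card ((\<lambda>(p, q). (Suc p, Suc q)) ` ?inv ?n S) + card ((\<lambda>p. (Suc p, 0::nat)) ` S)"
    proof (rule card_Un_disjoint)
      show "finite ((\<lambda>(p, q). (Suc p, Suc q)) ` ?inv ?n S)"
        by (rule finite_imageI, rule finite_subset[of _ "S \<times> {..<?n}"]) (use fS in auto)
    qed (use fS in auto)
    moreover have "card ((\<lambda>(p, q). (Suc p, Suc q)) ` ?inv ?n S) = card (?inv ?n S)"
      by (rule card_image) (auto simp: inj_on_def)
    moreover have "card ((\<lambda>p. (Suc p, 0::nat)) ` S) = card S"
      by (rule card_image) (auto simp: inj_on_def)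
    ultimately have c: "card (?inv (Suc ?n) (Suc ` S)) = card (?inv ?n S) + card S" by simp
    have "{i. i < ?n \<and> i \<in> S} = S" using S by auto
    then have l: "length (nths vs S) = card S" by (simp add: length_nths)
    have "nths (v # vs) (Suc ` S) = nths vs S"
      by (simp add: nths_Cons)
    moreover have "{j. Suc j \<in> {..<Suc ?n} - Suc ` S} = {..<?n} - S" by auto
    then have "nths (v # vs) ({..<Suc ?n} - Suc ` S) = v # nths vs ({..<?n} - S)"
      by (simp only: nths_Cons) auto
    ultimately show "?f (Suc ` S) =
        (-1) ^ card (?inv ?n S) *\<^sub>R m (gsg \<alpha> (nths vs S)) (ctr v \<beta> (nths vs ({..<?n} - S)))"
      unfolding c by (simp add: ctr_def gsg_def l power_add bilinear_lmul[OF m])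
  qed
  finally show ?thesis .
qed

lemma ctr_wedge_by: "ctr v (wedge_by m \<alpha> \<beta>) = wedge_by m (ctr v \<alpha>) \<beta> + wedge_by m (gsg \<alpha>) (ctr v \<beta>)"
  by (rule ext) (simp add: ctr_def[of v "wedge_by m \<alpha> \<beta>"] wedge_by_Cons)

lemma gsg_wedge_by: "gsg (wedge_by m \<alpha> \<beta>) = wedge_by m (gsg \<alpha>) (gsg \<beta>)"
proof (rule ext)
  show "gsg (wedge_by m \<alpha> \<beta>) vs = wedge_by m (gsg \<alpha>) (gsg \<beta>) vs" for vs
  proof (induction vs arbitrary: \<alpha> \<beta>)
    case Nil
    then show ?case by (simp add: gsg_def wedge_by_Nil)
  next
    case (Cons v vs)
    have "gsg (wedge_by m \<alpha> \<beta>) (v # vs) = - gsg (wedge_by m (ctr v \<alpha>) \<beta>) vs - gsg (wedge_by m (gsg \<alpha>) (ctr v \<beta>)) vs"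
      by (simp add: gsg_def wedge_by_Cons scaleR_right_distrib)
    then show ?case
      by (simp add: wedge_by_Cons Cons ctr_gsg wedge_by_minus_left wedge_by_minus_right)
  qed
qed

lemma wedge_by_map: "wedge_by m \<alpha> \<beta> (map f vs) = wedge_by m (\<lambda>vs. \<alpha> (map f vs)) (\<lambda>vs. \<beta> (map f vs)) vs"
  by (simp add: wedge_by_def nths_map)

end

lemma wedge_by_assoc:
  assumes "bilinear m1" "bilinear m2" "bilinear m3" "bilinear m4"
    and "\<And>a b c. m1 (m2 a b) c = m3 a (m4 b c)"
  shows "wedge_by m1 (wedge_by m2 \<alpha> \<beta>) \<gamma> = wedge_by m3 \<alpha> (wedge_by m4 \<beta> \<gamma>)"
proof (rule ext)
  show "wedge_by m1 (wedge_by m2 \<alpha> \<beta>) \<gamma> vs = wedge_by m3 \<alpha> (wedge_by m4 \<beta> \<gamma>) vs" for vs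
  proof (induction vs arbitrary: \<alpha> \<beta> \<gamma>)
    case (Cons v vs)
    then show ?case
      by (simp add: wedge_by_Cons ctr_wedge_by gsg_wedge_by wedge_by_add_left wedge_by_add_right assms)
  qed (simp add: wedge_by_Nil assms)
qed

lemmas mwedge_linear =
  wedge_by_add_left[OF bilinear_matrix_mult, folded mwedge_def]
  wedge_by_add_right[OF bilinear_matrix_mult, folded mwedge_def]
  wedge_by_minus_left[OF bilinear_matrix_mult, folded mwedge_def]
  wedge_by_minus_right[OF bilinear_matrix_mult, folded mwedge_def]
  wedge_by_diff_left[OF bilinear_matrix_mult, folded mwedge_def]
  wedge_by_diff_right[OF bilinear_matrix_mult, folded mwedge_def]
  wedge_by_zero_left[OF bilinear_matrix_mult, folded mwedge_def]
  wedge_by_zero_right[OF bilinear_matrix_mult, folded mwedge_def]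

lemmas swedge_linear =
  wedge_by_add_left[OF bilinear_times, folded swedge_def]
  wedge_by_add_right[OF bilinear_times, folded swedge_def]
  wedge_by_zero_left[OF bilinear_times, folded swedge_def]
  wedge_by_zero_right[OF bilinear_times, folded swedge_def]

lemmas gsg_mwedge = gsg_wedge_by[OF bilinear_matrix_mult, folded mwedge_def]
lemmas gsg_swedge = gsg_wedge_by[OF bilinear_times, folded swedge_def]
lemmas mwedge_Nil = wedge_by_Nil[OF bilinear_matrix_mult, folded mwedge_def]
lemmas mwedge_Cons = wedge_by_Cons[OF bilinear_matrix_mult, folded mwedge_def]
lemmas swedge_Nil = wedge_by_Nil[OF bilinear_times, folded swedge_def]
lemmas swedge_Cons = wedge_by_Cons[OF bilinear_times, folded swedge_def]
lemmas mwedge_map = wedge_by_map[OF bilinear_matrix_mult, folded mwedge_def]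
lemmas swedge_map = wedge_by_map[OF bilinear_times, folded swedge_def]

lemma mwedge_assoc: "mwedge (mwedge \<alpha> \<beta>) \<gamma> = mwedge \<alpha> (mwedge \<beta> \<gamma>)"
  unfolding mwedge_def by (intro wedge_by_assoc bilinear_matrix_mult) (simp add: matrix_mul_assoc)

lemma ctr_form_unit [simp]: "ctr v (form_unit e) = 0"
  by (rule ext) (simp add: ctr_def form_unit_def)

lemma gsg_form_unit [simp]: "gsg (form_unit e) = form_unit e"
  by (rule ext) (simp add: gsg_def form_unit_def)

lemma mwedge_unit_left [simp]: "mwedge (form_unit (mat 1)) \<alpha> = \<alpha>"
proof (rule ext)
  show "mwedge (form_unit (mat 1)) \<alpha> vs = \<alpha> vs" for vs
    by (induction vs arbitrary: \<alpha>)
      (simp_all add: mwedge_Nil mwedge_Cons mwedge_linear form_unit_def[of _ "[]"] ctr_def[of _ \<alpha> for \<alpha> :: "('a, complex^'b^'b) aform"])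
qed

lemma mwedge_unit_right [simp]: "mwedge \<alpha> (form_unit (mat 1)) = \<alpha>"
proof (rule ext)
  show "mwedge \<alpha> (form_unit (mat 1)) vs = \<alpha> vs" for vs
    by (induction vs arbitrary: \<alpha>)
      (simp_all add: mwedge_Nil mwedge_Cons mwedge_linear form_unit_def[of _ "[]"] ctr_def[of _ \<alpha> for \<alpha> :: "('a, complex^'b^'b) aform"])
qed

lemma mpow_0 [simp]: "mpow \<alpha> 0 = form_unit (mat 1)"
  and mpow_Suc: "mpow \<alpha> (Suc k) = mwedge \<alpha> (mpow \<alpha> k)"
  by (simp_all add: mpow_def)

lemma mpow_add: "mpow \<alpha> (j + k) = mwedge (mpow \<alpha> j) (mpow \<alpha> k)"
  by (induction j) (simp_all add: mpow_Suc mwedge_assoc)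

lemma mpow_Suc_right: "mpow \<alpha> (Suc k) = mwedge (mpow \<alpha> k) \<alpha>"
  using mpow_add[of \<alpha> k 1] by (simp add: mpow_Suc)

lemma gsg_mpow: "gsg \<alpha> = \<alpha> \<Longrightarrow> gsg (mpow \<alpha> k) = mpow \<alpha> k"
  by (induction k) (simp_all add: mpow_Suc gsg_mwedge)

section \<open>Traces of matrix-valued forms\<close>

definition ftr :: "('v, complex^'r::finite^'r) aform \<Rightarrow> ('v, complex) aform" where
  "ftr \<alpha> vs = trace (\<alpha> vs)"

lemma ftr_add [simp]: "ftr (\<alpha> + \<beta>) = ftr \<alpha> + ftr \<beta>"
  and ftr_diff [simp]: "ftr (\<alpha> - \<beta>) = ftr \<alpha> - ftr \<beta>"
  and ftr_zero [simp]: "ftr 0 = 0"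
  and ftr_minus [simp]: "ftr (- \<alpha>) = - ftr \<alpha>"
  by (rule ext, simp add: ftr_def trace_def sum.distrib sum_subtractf sum_negf)+

text \<open>Contraction exchanges even and odd forms, so the two cases have to be carried through
  one induction. Only the first factor needs a parity: in the odd case \<open>gsg\<close>
  distributes the Koszul sign over the components of \<beta>.\<close>

lemma wedge_by_flip:
  assumes "bilinear m1" "bilinear m2" "\<And>a b. m1 a b = m2 b a"
  shows "(gsg \<alpha> = \<alpha> \<longrightarrow> wedge_by m1 \<alpha> \<beta> vs = wedge_by m2 \<beta> \<alpha> vs) \<and>
   (gsg \<alpha> = - \<alpha> \<longrightarrow> wedge_by m1 \<alpha> \<beta> vs = wedge_by m2 (gsg \<beta>) \<alpha> vs)"
proof (induction vs arbitrary: \<alpha> \<beta>)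
  case Nil
  have "wedge_by m1 \<alpha> \<beta> [] = m2 (\<beta> []) (\<alpha> [])"
    by (metis wedge_by_Nil[OF assms(1)] assms(3))
  moreover have "gsg \<beta> [] = \<beta> []" by (simp add: gsg_def)
  ultimately show ?case
    by (simp only: wedge_by_Nil[OF assms(2)] simp_thms)
next
  case (Cons v vs)
  note c = wedge_by_Cons[OF assms(1)] wedge_by_Cons[OF assms(2)]
  show ?case
  proof (intro conjI impI)
    assume e: "gsg \<alpha> = \<alpha>"
    then have "gsg (ctr v \<alpha>) = - ctr v \<alpha>" by (simp add: gsg_ctr)
    then have 1: "wedge_by m1 (ctr v \<alpha>) \<beta> vs = wedge_by m2 (gsg \<beta>) (ctr v \<alpha>) vs"
      using Cons by blast
    have 2: "wedge_by m1 \<alpha> (ctr v \<beta>) vs = wedge_by m2 (ctr v \<beta>) \<alpha> vs"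
      using Cons e by blast
    show "wedge_by m1 \<alpha> \<beta> (v # vs) = wedge_by m2 \<beta> \<alpha> (v # vs)"
      unfolding c e 1 2 by simp
  next
    assume e: "gsg \<alpha> = - \<alpha>"
    then have "gsg (ctr v \<alpha>) = ctr v \<alpha>" by (simp add: gsg_ctr)
    then have 1: "wedge_by m1 (ctr v \<alpha>) \<beta> vs = wedge_by m2 \<beta> (ctr v \<alpha>) vs"
      using Cons by blast
    have 2: "wedge_by m1 \<alpha> (ctr v \<beta>) vs = wedge_by m2 (gsg (ctr v \<beta>)) \<alpha> vs"
      using Cons e by blast
    have 3: "wedge_by m1 (- \<alpha>) (ctr v \<beta>) vs = - wedge_by m1 \<alpha> (ctr v \<beta>) vs"
      and 4: "wedge_by m2 (- gsg (ctr v \<beta>)) \<alpha> vs = - wedge_by m2 (gsg (ctr v \<beta>)) \<alpha> vs"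
      using assms by (simp_all add: wedge_by_minus_left)
    show "wedge_by m1 \<alpha> \<beta> (v # vs) = wedge_by m2 (gsg \<beta>) \<alpha> (v # vs)"
      unfolding c e ctr_gsg gsg_gsg 1 3 4 2 by simp
  qed
qed

lemma linear_wedge_by: "linear L \<Longrightarrow> L (wedge_by m \<alpha> \<beta> vs) = wedge_by (\<lambda>a b. L (m a b)) \<alpha> \<beta> vs"
  by (simp add: wedge_by_def linear_sum linear_cmul)

lemma linear_trace: "linear (trace :: complex^'r::finite^'r \<Rightarrow> complex)"
  by (rule linearI) (simp_all add: trace_def sum.distrib scaleR_sum_right)

lemma bilinear_compose:
  assumes L: "linear L" and m: "bilinear m"
  shows "bilinear (\<lambda>a b. L (m a b))"
  unfolding bilinear_def
  using linear_compose[OF bilinear_linear_left[OF m] L] linear_compose[OF bilinear_linear_right[OF m] L]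
  by (simp add: o_def)

lemma bilinear_args:
  assumes m: "bilinear m" and f: "linear f" and g: "linear g"
  shows "bilinear (\<lambda>a b. m (f a) (g b))"
  unfolding bilinear_def
  using linear_compose[OF f bilinear_linear_left[OF m]] linear_compose[OF g bilinear_linear_right[OF m]]
  by (simp add: o_def)

text \<open>Graded cyclicity of the trace: \<open>wedge_by_flip\<close> applied to the product
  \<open>trace (a ** b)\<close>, which is symmetric in \<open>a\<close> and
  \<open>b\<close>.\<close>

lemma ftr_even: "gsg \<alpha> = \<alpha> \<Longrightarrow> ftr (mwedge \<alpha> \<beta>) = ftr (mwedge \<beta> \<alpha>)"
  and ftr_odd: "gsg \<alpha> = - \<alpha> \<Longrightarrow> ftr (mwedge \<alpha> \<beta>) = ftr (mwedge (gsg \<beta>) \<alpha>)"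
proof -
  note t = linear_wedge_by[OF linear_trace]
  have f: "bilinear (\<lambda>a b :: complex^'b^'b. trace (a ** b))" "\<And>a b :: complex^'b^'b. trace (a ** b) = trace (b ** a)"
    by (intro bilinear_compose[OF linear_trace] bilinear_matrix_mult) (rule trace_mul_sym)
  show "gsg \<alpha> = \<alpha> \<Longrightarrow> ftr (mwedge \<alpha> \<beta>) = ftr (mwedge \<beta> \<alpha>)"
    "gsg \<alpha> = - \<alpha> \<Longrightarrow> ftr (mwedge \<alpha> \<beta>) = ftr (mwedge (gsg \<beta>) \<alpha>)"
    unfolding ftr_def[abs_def] mwedge_def t
    using wedge_by_flip[OF f(1) f(1) f(2)] by blast+
qed

lemma trace_mat_mult: "trace (mat c ** A) = c * trace (A :: complex^'r::finite^'r)"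
  by (simp add: trace_def mat_def matrix_matrix_mult_def sum_distrib_left if_distrib[of "\<lambda>x. x * _"] cong: if_cong)

lemma mat_mult_commute: "mat c ** A = A ** mat (c::complex)"
  by (simp add: vec_eq_iff mat_def matrix_matrix_mult_def if_distrib[of "\<lambda>x. x * _"] if_distrib[of "\<lambda>x. _ * x"] mult.commute cong: if_cong)

lemma mwedge_form_unit_left:
  fixes \<Phi> :: "('v, complex^'r::finite^'r) aform"
  shows "mwedge (form_unit \<theta>) \<Phi> vs = \<theta> ** \<Phi> vs"
  by (induction vs arbitrary: \<Phi>) (simp_all add: mwedge_Nil mwedge_Cons mwedge_linear form_unit_def[of _ "[]"], simp add: ctr_def)

lemma mwedge_form_unit_right:
  fixes \<Phi> :: "('v, complex^'r::finite^'r) aform"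
  shows "mwedge \<Phi> (form_unit \<theta>) vs = \<Phi> vs ** \<theta>"
  by (induction vs arbitrary: \<Phi>) (simp_all add: mwedge_Nil mwedge_Cons mwedge_linear form_unit_def[of _ "[]"], simp add: ctr_def)

text \<open>The exterior derivative along the directions \<open>e v\<close> only. The point
  \<open>w\<close> may carry parameters besides the chart coordinates, and no differential is taken
  with respect to these; the list entries remain tangent vectors of the chart. As in
  \<open>ext_d\<close>, the vector fields are constant.\<close>

definition dloc :: "('v \<Rightarrow> 'w::real_normed_vector) \<Rightarrow> ('w \<Rightarrow> ('v, 'b::real_normed_vector) aform) \<Rightarrow> 'w \<Rightarrow> ('v, 'b) aform" where
  "dloc e \<alpha> w vs = (\<Sum>k<length vs. (-1) ^ k *\<^sub>R dird (e (vs ! k)) (\<lambda>y. \<alpha> y (take k vs @ drop (Suc k) vs)) w)"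

lemma dloc_Nil [simp]: "dloc e \<alpha> w [] = 0"
  by (simp add: dloc_def)

text \<open>Cartan's formula for constant vector fields: the contraction of
  \<open>d \<alpha>\<close> with \<open>v\<close> is the derivative of \<alpha> along
  \<open>v\<close> minus \<open>d\<close> of the contraction. It turns the Leibniz rule and
  \<open>d d = 0\<close> into inductions over the argument list.\<close>

lemma dloc_Cons: "dloc e \<alpha> w (v # vs) = dird (e v) (\<lambda>y. \<alpha> y vs) w - dloc e (\<lambda>y. ctr v (\<alpha> y)) w vs"
proof -
  have "dloc e \<alpha> w (v # vs) = dird (e v) (\<lambda>y. \<alpha> y vs) w
      + (\<Sum>k<length vs. (-1) ^ Suc k *\<^sub>R dird (e (vs ! k)) (\<lambda>y. \<alpha> y (v # take k vs @ drop (Suc k) vs)) w)"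
    unfolding dloc_def length_Cons sum.lessThan_Suc_shift by simp
  also have "(\<Sum>k<length vs. (-1) ^ Suc k *\<^sub>R dird (e (vs ! k)) (\<lambda>y. \<alpha> y (v # take k vs @ drop (Suc k) vs)) w)
     = - dloc e (\<lambda>y. ctr v (\<alpha> y)) w vs"
    by (simp add: dloc_def ctr_def sum_negf)
  finally show ?thesis by simp
qed

lemma ctr_dloc: "ctr v (dloc e \<alpha> w) = (\<lambda>vs. dird (e v) (\<lambda>y. \<alpha> y vs) w) - dloc e (\<lambda>y. ctr v (\<alpha> y)) w"
  by (rule ext) (simp add: ctr_def[of v "dloc e \<alpha> w"] dloc_Cons)

lemma dloc_add:
  assumes "\<And>vs. (\<lambda>y. \<alpha> y vs) differentiable (at w)" "\<And>vs. (\<lambda>y. \<beta> y vs) differentiable (at w)"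
  shows "dloc e (\<lambda>y. \<alpha> y + \<beta> y) w = dloc e \<alpha> w + dloc e \<beta> w"
  by (rule ext) (simp add: dloc_def dird_add assms scaleR_right_distrib sum.distrib)

lemma dloc_diff:
  assumes "\<And>vs. (\<lambda>y. \<alpha> y vs) differentiable (at w)" "\<And>vs. (\<lambda>y. \<beta> y vs) differentiable (at w)"
  shows "dloc e (\<lambda>y. \<alpha> y - \<beta> y) w = dloc e \<alpha> w - dloc e \<beta> w"
  by (rule ext) (simp add: dloc_def dird_diff assms scaleR_right_diff_distrib sum_subtractf)

lemma dloc_linear:
  assumes "bounded_linear L" "\<And>vs. (\<lambda>y. \<alpha> y vs) differentiable (at w)"
  shows "dloc e (\<lambda>y vs. L (\<alpha> y vs)) w vs = L (dloc e \<alpha> w vs)"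
  using assms(1)[THEN bounded_linear.linear]
  by (simp add: dloc_def dird_linear_compose[OF assms(1)] assms(2) linear_sum linear_cmul)

lemma dloc_gsg:
  fixes \<alpha> :: "'w::real_normed_vector \<Rightarrow> ('v, 'b::real_normed_vector) aform"
  assumes "\<And>vs. (\<lambda>y. \<alpha> y vs) differentiable (at w)"
  shows "dloc e (\<lambda>y. gsg (\<alpha> y)) w = - gsg (dloc e \<alpha> w)"
proof (rule ext)
  fix vs :: "'v list"
  \<comment> \<open>The derivative takes one argument away, hence the exponent
    \<open>length vs - 1\<close>. For the empty list the truncated subtraction is harmless, because
    both sides are then 0.\<close>
  have "dloc e (\<lambda>y. gsg (\<alpha> y)) w vs = (\<Sum>k<length vs. (-1) ^ (length vs - 1) *\<^sub>R
      (-1) ^ k *\<^sub>R dird (e (vs ! k)) (\<lambda>y. \<alpha> y (take k vs @ drop (Suc k) vs)) w)"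
    unfolding dloc_def
  proof (rule sum.cong[OF refl])
    fix k assume "k \<in> {..<length vs}"
    then have "length (take k vs @ drop (Suc k) vs) = length vs - 1" by auto
    then show "(-1) ^ k *\<^sub>R dird (e (vs ! k)) (\<lambda>y. gsg (\<alpha> y) (take k vs @ drop (Suc k) vs)) w =
      (-1) ^ (length vs - 1) *\<^sub>R (-1) ^ k *\<^sub>R dird (e (vs ! k)) (\<lambda>y. \<alpha> y (take k vs @ drop (Suc k) vs)) w"
      unfolding gsg_def by (simp add: dird_linear_compose[OF bounded_linear_scaleR_right] assms mult.commute)
  qed
  also have "\<dots> = (-1) ^ (length vs - 1) *\<^sub>R dloc e \<alpha> w vs"
    by (simp add: dloc_def scaleR_sum_right)
  also have "\<dots> = (- gsg (dloc e \<alpha> w)) vs"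
    by (cases vs) (simp_all add: gsg_def)
  finally show "dloc e (\<lambda>y. gsg (\<alpha> y)) w vs = (- gsg (dloc e \<alpha> w)) vs" .
qed

lemma dloc_cong:
  assumes "open W" "w \<in> W" "\<And>y vs. y \<in> W \<Longrightarrow> \<alpha> y vs = \<beta> y vs"
  shows "dloc e \<alpha> w = dloc e \<beta> w"
  unfolding dloc_def by (intro ext sum.cong refl arg_cong[where f="(*\<^sub>R) _"] dird_cong_open(1)[OF assms])

lemma
  assumes m: "bounded_bilinear m"
    and a: "\<And>vs. (\<lambda>y. \<alpha> y vs) differentiable (at w)" and b: "\<And>vs. (\<lambda>y. \<beta> y vs) differentiable (at w)"
  shows differentiable_wedge_by: "(\<lambda>y. wedge_by m (\<alpha> y) (\<beta> y) vs) differentiable (at w)"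
    and dird_wedge_by: "dird u (\<lambda>y. wedge_by m (\<alpha> y) (\<beta> y) vs) w =
       wedge_by m (\<lambda>vs. dird u (\<lambda>y. \<alpha> y vs) w) (\<beta> w) vs + wedge_by m (\<alpha> w) (\<lambda>vs. dird u (\<lambda>y. \<beta> y vs) w) vs"
proof -
  have d: "((\<lambda>y. m (\<alpha> y vs) (\<beta> y vs')) has_derivative
     (\<lambda>u. m (\<alpha> w vs) (dird u (\<lambda>y. \<beta> y vs') w) + m (dird u (\<lambda>y. \<alpha> y vs) w) (\<beta> w vs'))) (at w)" for vs vs'
    by (intro bounded_bilinear.FDERIV[OF m] has_derivative_dird a b)
  show "(\<lambda>y. wedge_by m (\<alpha> y) (\<beta> y) vs) differentiable (at w)"
    unfolding wedge_by_def
    by (intro differentiable_sum ballI differentiable_scaleR differentiable_const)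
      (auto simp: differentiable_def intro: d)
  show "dird u (\<lambda>y. wedge_by m (\<alpha> y) (\<beta> y) vs) w =
       wedge_by m (\<lambda>vs. dird u (\<lambda>y. \<alpha> y vs) w) (\<beta> w) vs + wedge_by m (\<alpha> w) (\<lambda>vs. dird u (\<lambda>y. \<beta> y vs) w) vs"
    unfolding wedge_by_def
    by (subst dird_eqI[OF has_derivative_sum[OF bounded_linear.has_derivative[OF bounded_linear_scaleR_right d]]])
      (simp add: scaleR_right_distrib sum.distrib add.commute)
qed

lemma dloc_wedge_by:
  assumes m: "bounded_bilinear m"
    and a: "\<And>vs. (\<lambda>y. \<alpha> y vs) differentiable (at w)" and b: "\<And>vs. (\<lambda>y. \<beta> y vs) differentiable (at w)"
  shows "dloc e (\<lambda>y. wedge_by m (\<alpha> y) (\<beta> y)) w =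
     wedge_by m (dloc e \<alpha> w) (\<beta> w) + wedge_by m (gsg (\<alpha> w)) (dloc e \<beta> w)"
proof (rule ext)
  have bl: "bilinear m"
    using m by (simp add: bilinear_def bounded_bilinear.bounded_linear_left bounded_bilinear.bounded_linear_right bounded_linear.linear)
  show "dloc e (\<lambda>y. wedge_by m (\<alpha> y) (\<beta> y)) w vs =
     (wedge_by m (dloc e \<alpha> w) (\<beta> w) + wedge_by m (gsg (\<alpha> w)) (dloc e \<beta> w)) vs" for vs
    using a b
  proof (induction vs arbitrary: \<alpha> \<beta>)
    case Nil
    then show ?case by (simp add: wedge_by_Nil bl bilinear_lzero bilinear_rzero)
  next
    case (Cons v vs)
    note a = Cons.prems(1) and b = Cons.prems(2)
    have ca: "\<And>vs. (\<lambda>y. ctr v (\<alpha> y) vs) differentiable (at w)" and cb: "\<And>vs. (\<lambda>y. ctr v (\<beta> y) vs) differentiable (at w)"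
      using a b by (simp_all add: ctr_def)
    have ga: "\<And>vs. (\<lambda>y. gsg (\<alpha> y) vs) differentiable (at w)"
      using a by (simp add: gsg_def differentiable_scaleR)
    have "dloc e (\<lambda>y. wedge_by m (\<alpha> y) (\<beta> y)) w (v # vs) =
        dird (e v) (\<lambda>y. wedge_by m (\<alpha> y) (\<beta> y) vs) w
        - dloc e (\<lambda>y. wedge_by m (ctr v (\<alpha> y)) (\<beta> y) + wedge_by m (gsg (\<alpha> y)) (ctr v (\<beta> y))) w vs"
      by (simp add: dloc_Cons ctr_wedge_by bl)
    also have "dloc e (\<lambda>y. wedge_by m (ctr v (\<alpha> y)) (\<beta> y) + wedge_by m (gsg (\<alpha> y)) (ctr v (\<beta> y))) w vs
      = dloc e (\<lambda>y. wedge_by m (ctr v (\<alpha> y)) (\<beta> y)) w vs + dloc e (\<lambda>y. wedge_by m (gsg (\<alpha> y)) (ctr v (\<beta> y))) w vs"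
      by (subst dloc_add) (auto intro!: differentiable_wedge_by m a b ca cb ga)
    also have "dloc e (\<lambda>y. wedge_by m (ctr v (\<alpha> y)) (\<beta> y)) w vs =
      (wedge_by m (dloc e (\<lambda>y. ctr v (\<alpha> y)) w) (\<beta> w) + wedge_by m (gsg (ctr v (\<alpha> w))) (dloc e \<beta> w)) vs"
      by (rule Cons.IH[OF ca b])
    also have "dloc e (\<lambda>y. wedge_by m (gsg (\<alpha> y)) (ctr v (\<beta> y))) w vs =
      (wedge_by m (dloc e (\<lambda>y. gsg (\<alpha> y)) w) (ctr v (\<beta> w)) + wedge_by m (gsg (gsg (\<alpha> w))) (dloc e (\<lambda>y. ctr v (\<beta> y)) w)) vs"
      by (rule Cons.IH[OF ga cb])
    finally show ?case
      by (simp add: dird_wedge_by[OF m a b] wedge_by_Cons[OF bl] ctr_dloc dloc_gsg[OF a] ctr_gsg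
         wedge_by_minus_left[OF bl] wedge_by_diff_left[OF bl] wedge_by_diff_right[OF bl])
  qed
qed

lemmas dloc_mwedge = dloc_wedge_by[OF bounded_bilinear_matrix_mult, folded mwedge_def]
lemmas dloc_swedge = dloc_wedge_by[OF bounded_bilinear_mult[where 'a=complex], folded swedge_def]

lemma smooth_on_dloc:
  assumes "open W" "\<And>vs. smooth_on W (\<lambda>y. \<alpha> y vs)"
  shows "smooth_on W (\<lambda>y. dloc e \<alpha> y vs)"
  unfolding dloc_def
  by (intro smooth_on_sum smooth_on_linear_compose[OF _ bounded_linear_scaleR_right] smooth_on_dird assms)

lemma smooth_on_wedge_by:
  assumes "open W" "bounded_bilinear m" "\<And>vs. smooth_on W (\<lambda>y. \<alpha> y vs)" "\<And>vs. smooth_on W (\<lambda>y. \<beta> y vs)"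
  shows "smooth_on W (\<lambda>y. wedge_by m (\<alpha> y) (\<beta> y) vs)"
  unfolding wedge_by_def
  by (intro smooth_on_sum smooth_on_linear_compose[OF _ bounded_linear_scaleR_right] smooth_on_bilinear[OF _ assms(2)] assms)

lemmas smooth_on_mwedge = smooth_on_wedge_by[OF _ bounded_bilinear_matrix_mult, folded mwedge_def]
lemmas smooth_on_swedge = smooth_on_wedge_by[OF _ bounded_bilinear_mult[where 'a=complex], folded swedge_def]

text \<open>The direction \<open>u\<close> need not be one of the \<open>e v\<close>. For the time
  direction this is the interchange of variation and exterior derivative.\<close>

lemma dird_dloc:
  fixes \<alpha> :: "'w::real_normed_vector \<Rightarrow> ('v, 'b::banach) aform"
  assumes "open W" "w \<in> W" "\<And>vs. smooth_on W (\<lambda>y. \<alpha> y vs)"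
  shows "dird u (\<lambda>y. dloc e \<alpha> y vs) w = dloc e (\<lambda>y vs. dird u (\<lambda>y. \<alpha> y vs) y) w vs"
proof -
  have d: "dird a (\<lambda>y. \<alpha> y vs) differentiable (at w)" for a vs
    using smooth_on_differentiable[OF smooth_on_dird] assms by blast
  have "dird u (\<lambda>y. dloc e \<alpha> y vs) w = (\<Sum>k<length vs. (-1) ^ k *\<^sub>R dird u (dird (e (vs ! k)) (\<lambda>y. \<alpha> y (take k vs @ drop (Suc k) vs))) w)"
    unfolding dloc_def
    by (subst dird_sum) (auto intro!: differentiable_scaleR d sum.cong dird_linear_compose bounded_linear_scaleR_right)
  then show ?thesis
    unfolding dloc_def by (simp add: dird_commute[OF assms])
qed

text \<open>The derivative along \<open>v\<close> commutes with \<open>d\<close>, so by Cartan's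
  formula, used twice, contracting \<open>d d \<alpha>\<close> with \<open>v\<close> leaves
  \<open>d d\<close> of the contracted form, which the induction hypothesis removes.\<close>

lemma dloc_dloc:
  fixes \<alpha> :: "'w::real_normed_vector \<Rightarrow> ('v, 'b::banach) aform"
  assumes "open W" "w \<in> W" "\<And>vs. smooth_on W (\<lambda>y. \<alpha> y vs)"
  shows "dloc e (dloc e \<alpha>) w = 0"
proof (rule ext)
  show "dloc e (dloc e \<alpha>) w vs = 0 vs" for vs
    using assms(3)
  proof (induction vs arbitrary: \<alpha>)
    case (Cons v vs)
    have c: "\<And>vs. smooth_on W (\<lambda>y. ctr v (\<alpha> y) vs)" using Cons by (simp add: ctr_def)
    have "dloc e (\<lambda>y. ctr v (dloc e \<alpha> y)) w = dloc e (\<lambda>y vs. dird (e v) (\<lambda>y. \<alpha> y vs) y) w - dloc e (\<lambda>y. dloc e (\<lambda>y. ctr v (\<alpha> y)) y) w"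
      unfolding ctr_dloc
      by (rule dloc_diff)
        (auto intro!: smooth_on_differentiable[OF _ assms(2)] smooth_on_dird smooth_on_dloc Cons c assms(1))
    then show ?case
      using Cons.IH[of "\<lambda>y. ctr v (\<alpha> y)", OF c] by (simp add: dloc_Cons dird_dloc[OF assms(1,2) Cons.prems])
  qed simp
qed

text \<open>Alternating multilinear in the sense of exchanging neighbouring arguments, the form of the
  condition that is stable under contraction.\<close>

definition amf :: "('v::real_vector, 'b::real_vector) aform \<Rightarrow> bool" where
  "amf \<alpha> \<longleftrightarrow> (\<forall>us v w vs. \<alpha> (us @ v # w # vs) = - \<alpha> (us @ w # v # vs)) \<and> (\<forall>us vs. linear (\<lambda>v. \<alpha> (us @ v # vs)))"

lemma amf_swap: "amf \<alpha> \<Longrightarrow> \<alpha> (us @ v # w # vs) = - \<alpha> (us @ w # v # vs)"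
  and amf_linear: "amf \<alpha> \<Longrightarrow> linear (\<lambda>v. \<alpha> (us @ v # vs))"
  unfolding amf_def by blast+

lemma amfI:
  assumes "\<And>us v w vs. \<alpha> (us @ v # w # vs) = - \<alpha> (us @ w # v # vs)" "\<And>us vs. linear (\<lambda>v. \<alpha> (us @ v # vs))"
  shows "amf \<alpha>"
  using assms unfolding amf_def by blast

lemma amf_ctr:
  assumes \<alpha>: "amf \<alpha>" shows "amf (ctr v \<alpha>)"
proof (rule amfI)
  show "ctr v \<alpha> (us @ a # b # vs) = - ctr v \<alpha> (us @ b # a # vs)" for us a b vs
    using amf_swap[OF \<alpha>, of "v # us" a b vs] by (simp only: ctr_def append_Cons)
  show "linear (\<lambda>a. ctr v \<alpha> (us @ a # vs))" for us vs
    using amf_linear[OF \<alpha>, of "v # us" vs] by (simp only: ctr_def append_Cons)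
qed

lemma amf_linear_compose:
  assumes L: "linear L" and \<alpha>: "amf \<alpha>"
  shows "amf (\<lambda>vs. L (\<alpha> vs))"
proof (rule amfI)
  show "L (\<alpha> (us @ v # w # vs)) = - L (\<alpha> (us @ w # v # vs))" for us v w vs
    by (subst amf_swap[OF \<alpha>]) (rule linear_neg[OF L])
  show "linear (\<lambda>v. L (\<alpha> (us @ v # vs)))" for us vs
    using linear_compose[OF amf_linear[OF \<alpha>] L] by (simp add: o_def)
qed

lemma amf_gsg: "amf \<alpha> \<Longrightarrow> amf (gsg \<alpha>)"
proof (rule amfI)
  assume \<alpha>: "amf \<alpha>"
  show "gsg \<alpha> (us @ v # w # vs) = - gsg \<alpha> (us @ w # v # vs)" for us v w vs
    unfolding gsg_def by (subst amf_swap[OF \<alpha>]) simp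
  show "linear (\<lambda>v. gsg \<alpha> (us @ v # vs))" for us vs
    unfolding gsg_def length_append list.size
    by (rule linear_compose_scale_right[OF amf_linear[OF \<alpha>]])
qed

text \<open>Polarisation: vanishing on the repeated argument \<open>v + w\<close> forces
  antisymmetry in \<open>v\<close> and \<open>w\<close>.\<close>

lemma alt_multilinear_imp_amf:
  assumes "alt_multilinear \<alpha>"
  shows "amf \<alpha>"
  unfolding amf_def
proof (intro conjI allI)
  have l: "linear (\<lambda>v. \<alpha> (us @ v # vs))" for us vs
  proof -
    have "linear (\<lambda>v. \<alpha> ((us @ undefined # vs)[length us := v]))"
      using assms unfolding alt_multilinear_def by (metis length_append length_Cons less_add_Suc1 add_Suc_right)
    then show ?thesis by simp
  qed
  then show "linear (\<lambda>v. \<alpha> (us @ v # vs))" for us vs .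
  fix us v w vs
  have z: "\<alpha> (us @ x # x # vs) = 0" for x
    using assms unfolding alt_multilinear_def by (metis distinct.simps(2) distinct_append list.set_intros(1))
  have "\<alpha> (us @ (v + w) # (v + w) # vs) = \<alpha> (us @ v # v # vs) + \<alpha> (us @ v # w # vs) + \<alpha> (us @ w # v # vs) + \<alpha> (us @ w # w # vs)"
    using linear_add[OF l[of us "(v + w) # vs"], of v w] linear_add[OF l[of "us @ [v]" vs], of v w] linear_add[OF l[of "us @ [w]" vs], of v w]
    by simp
  then show "\<alpha> (us @ v # w # vs) = - \<alpha> (us @ w # v # vs)"
    by (simp add: z add_eq_0_iff2)
qed

lemma amf_wedge_by:
  fixes \<alpha> :: "('v::real_vector, 'a::real_vector) aform" and \<beta> :: "('v, 'b::real_vector) aform"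
  assumes m: "bilinear m" and "amf \<alpha>" "amf \<beta>"
  shows "amf (wedge_by m \<alpha> \<beta>)"
  unfolding amf_def
proof (intro conjI allI)
  fix us v w vs
  show "wedge_by m \<alpha> \<beta> (us @ v # w # vs) = - wedge_by m \<alpha> \<beta> (us @ w # v # vs)"
    using assms(2,3)
  proof (induction us arbitrary: \<alpha> \<beta>)
    case Nil
    have "ctr v (ctr w \<alpha>) = - ctr w (ctr v \<alpha>)" if "amf \<alpha>" for \<alpha> :: "('v, 'z::real_vector) aform"
      by (rule ext) (use amf_swap[OF that, of "[]" w v] in \<open>simp only: ctr_def append_Nil uminus_apply\<close>)
    from this[OF Nil(1)] this[OF Nil(2)] show ?case
      by (simp add: wedge_by_Cons[OF m] ctr_gsg wedge_by_minus_left[OF m] wedge_by_minus_right[OF m])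
  next
    case (Cons u us)
    show ?case
      by (simp add: wedge_by_Cons[OF m] Cons.IH amf_ctr amf_gsg Cons.prems)
  qed
next
  fix us vs
  show "linear (\<lambda>v. wedge_by m \<alpha> \<beta> (us @ v # vs))"
    using assms(2,3)
  proof (induction us arbitrary: \<alpha> \<beta>)
    case Nil
    have l: "linear (\<lambda>v. ctr v \<gamma> vs)" if "amf \<gamma>" for \<gamma> :: "('v, 'z::real_vector) aform" and vs
      using amf_linear[OF that, of "[]" vs] by (simp add: ctr_def)
    have 1: "linear (\<lambda>v. wedge_by m (ctr v \<alpha>) \<beta> vs)" for vs
      unfolding wedge_by_def
      by (intro linear_compose_sum ballI linear_compose_scale_right
         linear_compose[OF l[OF Nil(1)] bilinear_linear_left[OF m], unfolded o_def])
    have 2: "linear (\<lambda>v. wedge_by m (gsg \<alpha>) (ctr v \<beta>) vs)" for vs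
      unfolding wedge_by_def
      by (intro linear_compose_sum ballI linear_compose_scale_right
         linear_compose[OF l[OF Nil(2)] bilinear_linear_right[OF m], unfolded o_def])
    show ?case
      by (simp add: wedge_by_Cons[OF m] linear_compose_add 1 2)
  next
    case (Cons u us)
    show ?case
      by (simp add: wedge_by_Cons[OF m] linear_compose_add Cons.IH amf_ctr amf_gsg Cons.prems)
  qed
qed

lemmas amf_mwedge = amf_wedge_by[OF bilinear_matrix_mult, folded mwedge_def]
lemmas amf_swedge = amf_wedge_by[OF bilinear_times, folded swedge_def]

lemma amf_ftr: "amf \<alpha> \<Longrightarrow> amf (ftr \<alpha>)"
  unfolding ftr_def[abs_def] by (rule amf_linear_compose[OF linear_trace])

lemma amf_add:
  assumes "amf \<alpha>" "amf \<beta>" shows "amf (\<alpha> + \<beta>)"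
proof (rule amfI)
  show "(\<alpha> + \<beta>) (us @ v # w # vs) = - (\<alpha> + \<beta>) (us @ w # v # vs)" for us v w vs
    using amf_swap[OF assms(1), of us v w vs] amf_swap[OF assms(2), of us v w vs] by simp
  show "linear (\<lambda>v. (\<alpha> + \<beta>) (us @ v # vs))" for us vs
    by (simp add: linear_compose_add amf_linear assms)
qed

lemma amf_form_unit: "amf (form_unit e)"
  by (rule amfI) (simp_all add: form_unit_def linear_zero)

lemma amf_one_form:
  assumes u: "linear u" shows "amf (one_form u)"
proof (rule amfI)
  show "one_form u (us @ v # w # vs) = - one_form u (us @ w # v # vs)" for us v w vs
    by (cases us) (auto simp: one_form_def split: list.splits)
  show "linear (\<lambda>v. one_form u (us @ v # vs))" for us vs
  proof (cases "us = [] \<and> vs = []")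
    case False
    then have "(\<lambda>v. one_form u (us @ v # vs)) = (\<lambda>v. 0)"
      by (auto simp: one_form_def fun_eq_iff split: list.splits) (auto simp: append_eq_Cons_conv)
    then show ?thesis by (simp add: linear_zero)
  qed (simp add: one_form_def u)
qed

lemma amf_deg_part:
  assumes \<alpha>: "amf \<alpha>" shows "amf (deg_part k \<alpha>)"
proof (rule amfI)
  show "deg_part k \<alpha> (us @ v # w # vs) = - deg_part k \<alpha> (us @ w # v # vs)" for us v w vs
    unfolding deg_part_def by (subst amf_swap[OF \<alpha>]) simp
  show "linear (\<lambda>v. deg_part k \<alpha> (us @ v # vs))" for us vs
    unfolding deg_part_def by (cases "length (us @ undefined # vs) = k") (simp_all add: linear_zero amf_linear[OF \<alpha>])
qed

section \<open>Holomorphic maps are smooth\<close>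

lemma norm_scalar_mult: "norm (c *s v) = cmod c * norm (v :: complex^'n::finite)"
  by (simp add: norm_vec_def vector_scalar_mult_def norm_mult L2_set_right_distrib)

lemma bounded_bilinear_scalar_mult: "bounded_bilinear ((*s) :: complex \<Rightarrow> complex^'n::finite \<Rightarrow> complex^'n)"
  by (rule bounded_bilinear.intro)
    (auto simp: vector_sadd_rdistrib vector_add_ldistrib vec_eq_iff distrib_right distrib_left norm_scalar_mult intro!: exI[of _ 1])

lemmas continuous_on_scalar_mult [continuous_intros] =
  bounded_bilinear.continuous_on[OF bounded_bilinear_scalar_mult]

lemma holo_on_differentiable: "holo_on S f \<Longrightarrow> z \<in> S \<Longrightarrow> f differentiable (at z)"
  unfolding holo_on_def differentiable_def by blast

lemma holo_on_dird_scalar: "holo_on S f \<Longrightarrow> z \<in> S \<Longrightarrow> dird (c *s v) f z = c * dird v f z"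
  unfolding holo_on_def by (metis dird_eqI)

definition circ_pt :: "real \<Rightarrow> real \<Rightarrow> complex" where
  "circ_pt r t = of_real r * exp (2 * of_real pi * \<i> * of_real t)"

lemma norm_circ_pt: "0 < r \<Longrightarrow> norm (circ_pt r t) = r"
  by (simp add: circ_pt_def norm_mult)

lemma circ_pt_nonzero: "0 < r \<Longrightarrow> circ_pt r t \<noteq> 0"
  by (simp add: circ_pt_def)

lemma continuous_on_circ_pt [continuous_intros]: "continuous_on A g \<Longrightarrow> continuous_on A (\<lambda>x. circ_pt r (g x))"
  unfolding circ_pt_def by (intro continuous_intros)

text \<open>Cauchy's formula for the derivative at 0 of the one-variable function
  \<open>\<zeta> \<mapsto> f (z + \<zeta> v)\<close>. The right-hand side contains \<open>f\<close>
  but no derivative of \<open>f\<close>, so whatever can be done to \<open>f\<close> under the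
  integral can be done to its derivative.\<close>

lemma dird_holo_integral:
  fixes f :: "complex^'n::finite \<Rightarrow> complex"
  assumes S: "open S" and f: "holo_on S f" and r: "0 < r"
    and sub: "\<And>\<zeta>. \<zeta> \<in> cball 0 r \<Longrightarrow> z + \<zeta> *s v \<in> S"
  shows "dird v f z = integral {0..1} (\<lambda>t. f (z + circ_pt r t *s v) / circ_pt r t)"
proof -
  let ?F = "\<lambda>\<zeta>. f (z + \<zeta> *s v)"
  have fd: "(?F has_field_derivative dird v f (z + \<zeta> *s v)) (at \<zeta>)" if "\<zeta> \<in> cball 0 r" for \<zeta>
  proof -
    have g: "((\<lambda>\<zeta>. z + \<zeta> *s v) has_derivative (\<lambda>c. c *s v)) (at \<zeta>)"
      using bounded_bilinear.bounded_linear_left[OF bounded_bilinear_scalar_mult, of v]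
      by (auto intro!: derivative_eq_intros bounded_linear_imp_has_derivative)
    have "(f \<circ> (\<lambda>\<zeta>. z + \<zeta> *s v) has_derivative (\<lambda>u. dird u f (z + \<zeta> *s v)) \<circ> (\<lambda>c. c *s v)) (at \<zeta>)"
      by (rule diff_chain_at[OF g has_derivative_dird]) (rule holo_on_differentiable[OF f sub[OF that]])
    then show ?thesis
      by (simp add: has_field_derivative_def o_def holo_on_dird_scalar[OF f sub[OF that]] mult_commute_abs)
  qed
  have c: "continuous_on (cball 0 r) ?F"
    by (intro continuous_at_imp_continuous_on ballI DERIV_isCont[OF fd]) simp
  have h: "?F holomorphic_on ball 0 r"
    unfolding holomorphic_on_def field_differentiable_def
    using has_field_derivative_at_within[OF fd] by (metis ball_subset_cball subsetD)
  have "dird v f z = 1 / (2 * of_real pi * \<i>) * contour_integral (circlepath 0 r) (\<lambda>u. ?F u / (u - 0)^2)"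
    by (rule DERIV_unique[OF fd[of 0, simplified] Cauchy_derivative_integral_circlepath(2)[OF c h, of 0]]) (use r in auto)
  also have "contour_integral (circlepath 0 r) (\<lambda>u. ?F u / (u - 0)^2)
     = integral {0..1} (\<lambda>t. (2 * of_real pi * \<i>) * (f (z + circ_pt r t *s v) / circ_pt r t))"
    unfolding contour_integral_integral vector_derivative_circlepath
    by (intro integral_cong) (use circ_pt_nonzero[OF r] in
      \<open>auto simp: circlepath divide_simps power2_eq_square circ_pt_def\<close>)
  also have "\<dots> = (2 * of_real pi * \<i>) * integral {0..1} (\<lambda>t. f (z + circ_pt r t *s v) / circ_pt r t)"
    by (rule integral_mult_right)
  finally show ?thesis
    by simp
qed

lemma holo_on_dird_local:
  fixes f :: "complex^'n::finite \<Rightarrow> complex"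
  assumes S: "open S" and f: "holo_on S f" and z0: "z0 \<in> S"
  shows "\<exists>\<delta> r. 0 < \<delta> \<and> 0 < r \<and> (\<forall>z\<in>ball z0 \<delta>. \<forall>t. z + circ_pt r t *s v \<in> S) \<and>
    (\<forall>z\<in>ball z0 \<delta>. dird v f z = integral {0..1} (\<lambda>t. f (z + circ_pt r t *s v) / circ_pt r t))"
proof -
  obtain e where e: "0 < e" "ball z0 e \<subseteq> S" using S z0 open_contains_ball by blast
  \<comment> \<open>One half of \<open>e\<close> is for the movement of the centre \<open>z\<close>,
    the other for the circle: \<open>\<zeta> v\<close> has norm at most \<delta> when
    \<open>\<zeta>\<close> has modulus at most \<open>r\<close>. One radius thus serves a whole
    neighbourhood of \<open>z0\<close>, and the integral formula can be differentiated in
    \<open>z\<close>.\<close>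
  define \<delta> where "\<delta> = e / 2"
  define r where "r = e / (2 * (norm v + 1))"
  have "0 < norm v + 1" by (simp add: add_nonneg_pos)
  then have \<delta>: "0 < \<delta>" and r: "0 < r" using e by (auto simp: \<delta>_def r_def intro!: divide_pos_pos)
  have sub: "z + \<zeta> *s v \<in> S" if "z \<in> ball z0 \<delta>" "\<zeta> \<in> cball 0 r" for z \<zeta>
  proof -
    have "norm (\<zeta> *s v) \<le> r * norm v"
      using that by (simp add: norm_scalar_mult mult_right_mono)
    also have "\<dots> \<le> r * (norm v + 1)" using r by simp
    also have "\<dots> = \<delta>" using norm_ge_zero[of v] by (simp add: r_def \<delta>_def divide_simps) (use norm_ge_zero[of v] in linarith)
    finally have "norm (\<zeta> *s v) \<le> \<delta>" .
    moreover have "dist z0 (z + \<zeta> *s v) \<le> dist z0 z + norm (\<zeta> *s v)"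
      by (metis add_diff_cancel_left' dist_norm dist_triangle norm_minus_commute)
    ultimately have "z + \<zeta> *s v \<in> ball z0 e" using that(1) by (simp add: \<delta>_def)
    then show ?thesis using e by blast
  qed
  show ?thesis
  proof (intro exI conjI ballI allI)
    show "z + circ_pt r t *s v \<in> S" if "z \<in> ball z0 \<delta>" for z t
      by (rule sub[OF that]) (simp add: norm_circ_pt[OF r])
    show "dird v f z = integral {0..1} (\<lambda>t. f (z + circ_pt r t *s v) / circ_pt r t)" if "z \<in> ball z0 \<delta>" for z
      by (rule dird_holo_integral[OF S f r sub[OF that]])
  qed (rule \<delta> r)+
qed

lemma holo_on_continuous: "open S \<Longrightarrow> holo_on S f \<Longrightarrow> continuous_on S f"
  by (intro continuous_at_imp_continuous_on) (auto intro: differentiable_imp_continuous_within holo_on_differentiable)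

lemma continuous_on_slice:
  assumes "continuous_on (U \<times> A) (\<lambda>(x, t). h x t)" "x \<in> U"
  shows "continuous_on A (h x)"
proof -
  have "continuous_on A (\<lambda>t. (\<lambda>(x, t). h x t) (x, t))"
    by (rule continuous_on_compose2[OF assms(1) continuous_on_Pair[OF continuous_on_const continuous_on_id]])
      (use assms(2) in auto)
  then show ?thesis by simp
qed

lemma continuous_on_circ_integrand:
  fixes g :: "complex^'n::finite \<Rightarrow> complex"
  assumes "continuous_on S g" "0 < r" "\<And>z t. z \<in> U \<Longrightarrow> z + circ_pt r t *s v \<in> S"
  shows "continuous_on (U \<times> A) (\<lambda>(z, t). g (z + circ_pt r t *s v) / circ_pt r t)"
  unfolding split_beta
proof (intro continuous_on_divide)
  show "continuous_on (U \<times> A) (\<lambda>x. g (fst x + circ_pt r (snd x) *s v))"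
  proof (rule continuous_on_compose2[OF assms(1)])
    show "continuous_on (U \<times> A) (\<lambda>x. fst x + circ_pt r (snd x) *s v)"
      by (intro continuous_on_add continuous_on_scalar_mult continuous_on_circ_pt continuous_on_fst continuous_on_snd continuous_on_id continuous_on_const)
    show "(\<lambda>x. fst x + circ_pt r (snd x) *s v) ` (U \<times> A) \<subseteq> S"
      using assms(3) by (simp add: image_subset_iff)
  qed
  show "continuous_on (U \<times> A) (\<lambda>x. circ_pt r (snd x))"
    by (intro continuous_on_circ_pt continuous_on_snd continuous_on_id)
  show "\<forall>x\<in>U \<times> A. circ_pt r (snd x) \<noteq> 0"
    using circ_pt_nonzero[OF assms(2)] by simp
qed

text \<open>Continuity of the derivative is obtained before its differentiability, since the
  differentiation under the integral in \<open>holo_on_dird\<close> asks for an integrand with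
  continuous derivative.\<close>

lemma continuous_on_dird_holo:
  fixes f :: "complex^'n::finite \<Rightarrow> complex"
  assumes S: "open S" and f: "holo_on S f"
  shows "continuous_on S (dird v f)"
  unfolding continuous_on_eq_continuous_at[OF S]
proof
  fix z0 assume "z0 \<in> S"
  from this obtain \<delta> r where d: "0 < \<delta>" "0 < r"
    and sub: "\<And>z t. z \<in> ball z0 \<delta> \<Longrightarrow> z + circ_pt r t *s v \<in> S"
    and eq: "\<And>z. z \<in> ball z0 \<delta> \<Longrightarrow> dird v f z = integral {0..1} (\<lambda>t. f (z + circ_pt r t *s v) / circ_pt r t)"
    using holo_on_dird_local[OF S f, of z0 v] by blast
  have "continuous_on (ball z0 \<delta>) (\<lambda>z. integral (cbox 0 1) (\<lambda>t. f (z + circ_pt r t *s v) / circ_pt r t))"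
    by (rule integral_continuous_on_param[OF continuous_on_circ_integrand[OF holo_on_continuous[OF S f] d(2) sub]])
  then have "continuous_on (ball z0 \<delta>) (dird v f)"
    by (rule continuous_on_eq) (use eq in auto)
  then show "isCont (dird v f) z0"
    using d by (simp add: continuous_on_eq_continuous_at)
qed

lemma holo_on_dird:
  fixes f :: "complex^'n::finite \<Rightarrow> complex"
  assumes S: "open S" and f: "holo_on S f"
  shows "holo_on S (dird v f)"
  unfolding holo_on_def
proof
  fix z0 assume "z0 \<in> S"
  from this obtain \<delta> r where d: "0 < \<delta>" "0 < r"
    and sub: "\<And>z t. z \<in> ball z0 \<delta> \<Longrightarrow> z + circ_pt r t *s v \<in> S"
    and eq: "\<And>z. z \<in> ball z0 \<delta> \<Longrightarrow> dird v f z = integral {0..1} (\<lambda>t. f (z + circ_pt r t *s v) / circ_pt r t)"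
    using holo_on_dird_local[OF S f, of z0 v] by blast
  \<comment> \<open>The derivative in \<open>z\<close> of the Cauchy integrand, bundled as a bounded
    linear map because the Leibniz rule for a vector variable asks for one; its continuity is then
    checked on basis vectors.\<close>
  define fx where "fx z t = Blinfun (\<lambda>u. dird u f (z + circ_pt r t *s v) / circ_pt r t)" for z t
  have bl: "bounded_linear (\<lambda>u. dird u f (z + circ_pt r t *s v) / circ_pt r t)" if "z \<in> ball z0 \<delta>" for z t
  proof -
    have "linear (\<lambda>u. dird u f (z + circ_pt r t *s v))"
      by (intro linear_dird holo_on_differentiable[OF f] sub that)
    then show ?thesis
      by (simp add: divide_inverse linear_conv_bounded_linear bounded_linear_mult_const)
  qed
  have fx: "blinfun_apply (fx z t) u = dird u f (z + circ_pt r t *s v) / circ_pt r t" if "z \<in> ball z0 \<delta>" for z t u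
    using bounded_linear_Blinfun_apply[OF bl[OF that]] by (simp add: fx_def)
  have cfx: "continuous_on (ball z0 \<delta> \<times> cbox 0 1) (\<lambda>(z, t). fx z t)"
  proof (rule continuous_on_blinfun_componentwise)
    fix b :: "complex^'n"
    have "continuous_on (ball z0 \<delta> \<times> cbox 0 1) (\<lambda>(z, t). dird b f (z + circ_pt r t *s v) / circ_pt r t)"
      by (rule continuous_on_circ_integrand[OF continuous_on_dird_holo[OF S f] d(2) sub])
    then show "continuous_on (ball z0 \<delta> \<times> cbox 0 1) (\<lambda>x. blinfun_apply (case x of (z, t) \<Rightarrow> fx z t) b)"
      by (rule continuous_on_eq) (auto simp: fx)
  qed
  have charge_coeff: "continuous_on (cbox 0 1) (fx z0)"
    by (rule continuous_on_slice[OF cfx]) (use d in simp)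
  have "((\<lambda>z. integral (cbox 0 1) (\<lambda>t. f (z + circ_pt r t *s v) / circ_pt r t)) has_derivative
      blinfun_apply (integral (cbox 0 1) (fx z0))) (at z0 within ball z0 \<delta>)"
  proof (rule leibniz_rule[OF _ _ cfx])
    fix z t assume z: "z \<in> ball z0 \<delta>"
    have g: "((\<lambda>z. z + circ_pt r t *s v) has_derivative (\<lambda>c. c)) (at z)"
      by (auto intro!: derivative_eq_intros)
    have "(f \<circ> (\<lambda>z. z + circ_pt r t *s v) has_derivative (\<lambda>u. dird u f (z + circ_pt r t *s v)) \<circ> (\<lambda>c. c)) (at z)"
      by (rule diff_chain_at[OF g has_derivative_dird]) (rule holo_on_differentiable[OF f sub[OF z]])
    then have "((\<lambda>z. f (z + circ_pt r t *s v)) has_derivative (\<lambda>u. dird u f (z + circ_pt r t *s v))) (at z)"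
      by (simp add: o_def)
    from has_derivative_at_withinI[OF has_derivative_mult_right[OF this, of "inverse (circ_pt r t)"], of "ball z0 \<delta>"]
    have D: "((\<lambda>z. f (z + circ_pt r t *s v) / circ_pt r t) has_derivative
        (\<lambda>u. dird u f (z + circ_pt r t *s v) / circ_pt r t)) (at z within ball z0 \<delta>)"
      by (simp add: divide_inverse mult.commute)
    have "blinfun_apply (fx z t) = (\<lambda>u. dird u f (z + circ_pt r t *s v) / circ_pt r t)"
      by (rule ext) (rule fx[OF z])
    with D show "((\<lambda>z. f (z + circ_pt r t *s v) / circ_pt r t) has_derivative blinfun_apply (fx z t)) (at z within ball z0 \<delta>)"
      by simp
  next
    fix z assume z: "z \<in> ball z0 \<delta>"
    show "(\<lambda>t. f (z + circ_pt r t *s v) / circ_pt r t) integrable_on cbox 0 1"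
      by (rule integrable_continuous, rule continuous_on_slice[OF continuous_on_circ_integrand[OF holo_on_continuous[OF S f] d(2) sub] z])
  qed (use d in auto)
  then have "((\<lambda>z. integral (cbox 0 1) (\<lambda>t. f (z + circ_pt r t *s v) / circ_pt r t)) has_derivative
      blinfun_apply (integral (cbox 0 1) (fx z0))) (at z0)"
    using d at_within_open[of z0 "ball z0 \<delta>"] by simp
  then have D: "(dird v f has_derivative blinfun_apply (integral (cbox 0 1) (fx z0))) (at z0)"
    by (rule has_derivative_transform_within_open[of _ _ _ _ "ball z0 \<delta>"]) (use d eq in auto)
  have z0b: "z0 \<in> ball z0 \<delta>" using d by simp
  have app: "blinfun_apply (integral (cbox 0 1) (fx z0)) u = integral (cbox 0 1) (\<lambda>t. dird u f (z0 + circ_pt r t *s v) / circ_pt r t)" for u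
    using blinfun_apply_integral[OF integrable_continuous[OF charge_coeff], of u] by (simp add: fx[OF z0b])
  have "blinfun_apply (integral (cbox 0 1) (fx z0)) (c *s u) = c * blinfun_apply (integral (cbox 0 1) (fx z0)) u" for c u
    unfolding app using holo_on_dird_scalar[OF f sub[OF z0b]]
    by (simp flip: integral_mult_right)
  with D show "\<exists>f'. (dird v f has_derivative f') (at z0) \<and> (\<forall>c v. f' (c *s v) = c * f' v)"
    by blast
qed

lemma holo_on_imp_smooth_on:
  fixes f :: "complex^'n::finite \<Rightarrow> complex"
  assumes S: "open S" and f: "holo_on S f"
  shows "smooth_on S f"
proof -
  have "Ck_on k S f" for k
    using f
  proof (induction k arbitrary: f)
    case 0
    then show ?case using holo_on_continuous[OF S] by simp
  next
    case (Suc k)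
    then show ?case
      unfolding Ck_on_Suc_dird using holo_on_differentiable holo_on_dird[OF S] by blast
  qed
  then show ?thesis by (simp add: smooth_on_def)
qed

section \<open>Integrals of compactly supported functions\<close>

lemma lborel_integral_compact_support:
  fixes f :: "'a::euclidean_space \<Rightarrow> 'b::euclidean_space"
  assumes f: "continuous_on UNIV f" and z: "\<And>x. x \<notin> cbox a b \<Longrightarrow> f x = 0"
  shows "integrable lborel f" "integral\<^sup>L lborel f = integral (cbox a b) f"
proof -
  have e: "(\<lambda>x. indicator (cbox a b) x *\<^sub>R f x) = f"
    using z by (auto simp: fun_eq_iff indicator_def)
  have i: "integrable lborel (\<lambda>x. indicator (cbox a b) x *\<^sub>R f x)"
    by (rule borel_integrable_compact) (auto intro: continuous_on_subset[OF f])
  with e show "integrable lborel f" by simp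
  have "set_integrable lborel (cbox a b) f"
    using i by (simp add: set_integrable_def)
  from set_borel_integral_eq_integral(2)[OF this] show "integral\<^sup>L lborel f = integral (cbox a b) f"
    by (simp add: set_lebesgue_integral_def e)
qed

lemma compact_subset_cbox:
  fixes K :: "'a::euclidean_space set"
  assumes "compact K"
  obtains a b where "K \<subseteq> cbox a b"
  using bounded_subset_cbox_symmetric[OF compact_imp_bounded[OF assms]] by metis

lemma integrable_compact_support:
  fixes f :: "'a::euclidean_space \<Rightarrow> 'b::euclidean_space"
  assumes "continuous_on UNIV f" "compact K" "\<And>x. x \<notin> K \<Longrightarrow> f x = 0"
  shows "integrable lborel f"
proof -
  obtain a b where "K \<subseteq> cbox a b" using compact_subset_cbox[OF assms(2)] .
  then show ?thesis using assms by (intro lborel_integral_compact_support(1)[of f a b]) auto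
qed

lemma continuous_on_slice_UNIV:
  "continuous_on (U \<times> UNIV) (\<lambda>(x, t). h x t) \<Longrightarrow> x \<in> U \<Longrightarrow> continuous_on UNIV (h x)"
  by (rule continuous_on_slice)

text \<open>One compact set contains the supports for all parameters, so the Lebesgue integrals can
  be replaced by integrals over a fixed box.\<close>

lemma continuous_on_lborel_integral:
  fixes F :: "'p::metric_space \<Rightarrow> 'a::euclidean_space \<Rightarrow> 'b::euclidean_space"
  assumes K: "compact K" and c: "continuous_on (P \<times> UNIV) (\<lambda>(p, z). F p z)"
    and z: "\<And>p z. p \<in> P \<Longrightarrow> z \<notin> K \<Longrightarrow> F p z = 0"
  shows "continuous_on P (\<lambda>p. integral\<^sup>L lborel (F p))"
proof -
  obtain a b where ab: "K \<subseteq> cbox a b" using compact_subset_cbox[OF K] .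
  have "continuous_on P (\<lambda>p. integral (cbox a b) (F p))"
    by (rule integral_continuous_on_param, rule continuous_on_subset[OF c]) auto
  moreover have "integral\<^sup>L lborel (F p) = integral (cbox a b) (F p)" if "p \<in> P" for p
    by (rule lborel_integral_compact_support(2)[OF continuous_on_slice_UNIV[OF c that]]) (use z that ab in auto)
  ultimately show ?thesis by (simp cong: continuous_on_cong)
qed

lemma lborel_integral_has_vector_derivative:
  fixes F :: "real \<Rightarrow> 'a::euclidean_space \<Rightarrow> 'b::euclidean_space"
  assumes K: "compact K" and T: "open T" "t0 \<in> T"
    and c: "continuous_on (T \<times> UNIV) (\<lambda>(p, z). F p z)" and c': "continuous_on (T \<times> UNIV) (\<lambda>(p, z). F' p z)"
    and d: "\<And>t z. t \<in> T \<Longrightarrow> ((\<lambda>t. F t z) has_vector_derivative F' t z) (at t)"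
    and z: "\<And>p z. p \<in> T \<Longrightarrow> z \<notin> K \<Longrightarrow> F p z = 0" and z': "\<And>p z. p \<in> T \<Longrightarrow> z \<notin> K \<Longrightarrow> F' p z = 0"
  shows "((\<lambda>t. integral\<^sup>L lborel (F t)) has_vector_derivative integral\<^sup>L lborel (F' t0)) (at t0)"
proof -
  obtain a b where ab: "K \<subseteq> cbox a b" using compact_subset_cbox[OF K] .
  obtain e where e: "0 < e" "ball t0 e \<subseteq> T" using T open_contains_ball by blast
  have eq: "integral\<^sup>L lborel (F p) = integral (cbox a b) (F p)" "integral\<^sup>L lborel (F' p) = integral (cbox a b) (F' p)"
    if "p \<in> T" for p
  proof -
    show "integral\<^sup>L lborel (F p) = integral (cbox a b) (F p)"
      by (rule lborel_integral_compact_support(2)[OF continuous_on_slice_UNIV[OF c that]]) (use z that ab in auto)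
    show "integral\<^sup>L lborel (F' p) = integral (cbox a b) (F' p)"
      by (rule lborel_integral_compact_support(2)[OF continuous_on_slice_UNIV[OF c' that]]) (use z' that ab in auto)
  qed
  have "((\<lambda>t. integral (cbox a b) (F t)) has_vector_derivative integral (cbox a b) (F' t0)) (at t0 within ball t0 e)"
  proof (rule leibniz_rule_vector_derivative)
    fix t z assume "t \<in> ball t0 e"
    then have "t \<in> T" using e by blast
    from d[OF this] show "((\<lambda>t. F t z) has_vector_derivative F' t z) (at t within ball t0 e)"
      by (rule has_vector_derivative_at_within)
  next
    fix t assume t: "t \<in> ball t0 e"
    then have "t \<in> T" using e by auto
    from continuous_on_slice_UNIV[OF c this] show "F t integrable_on cbox a b"
      by (auto intro: integrable_continuous continuous_on_subset)
  next
    show "continuous_on (ball t0 e \<times> cbox a b) (\<lambda>(x, t). F' x t)"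
      by (rule continuous_on_subset[OF c']) (use e in auto)
  qed (use e in auto)
  then have "((\<lambda>t. integral (cbox a b) (F t)) has_vector_derivative integral (cbox a b) (F' t0)) (at t0)"
    using e at_within_open[of t0 "ball t0 e"] by simp
  then have "((\<lambda>t. integral\<^sup>L lborel (F t)) has_vector_derivative integral (cbox a b) (F' t0)) (at t0)"
    by (rule has_vector_derivative_transform_within_open[of _ _ _ "ball t0 e"]) (use e eq in auto)
  then show ?thesis using eq T by simp
qed

lemma lborel_integral_shift:
  fixes f :: "'a::euclidean_space \<Rightarrow> 'b::euclidean_space"
  assumes "continuous_on UNIV f"
  shows "integral\<^sup>L lborel (\<lambda>x. f (c + x)) = integral\<^sup>L lborel f"
proof -
  have "f \<in> borel_measurable borel" using assms by (rule borel_measurable_continuous_onI)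
  then have "integral\<^sup>L (distr lborel borel ((+) c)) f = integral\<^sup>L lborel (\<lambda>x. f (c + x))"
    by (intro integral_distr) auto
  then show ?thesis by (simp add: lborel_distr_plus)
qed

text \<open>Translation invariance: the integral of \<open>f (x + s v)\<close> does not depend on
  \<open>s\<close>, and its derivative at \<open>s = 0\<close> is the integral of
  \<open>dird v f\<close>.\<close>

lemma lborel_integral_dird_eq_0:
  fixes f :: "'a::euclidean_space \<Rightarrow> 'b::euclidean_space"
  assumes f: "smooth_on UNIV f" and K: "compact K" and z: "\<And>x. x \<notin> K \<Longrightarrow> f x = 0"
  shows "integral\<^sup>L lborel (dird v f) = 0"
proof -
  \<comment> \<open>A common compact support for all translates \<open>f (x + s v)\<close> with
    \<open>s\<close> between -1 and 1.\<close>
  define K' where "K' = (\<lambda>(s, x). x - s *\<^sub>R v) ` ({-1..1} \<times> K)"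
  have K': "compact K'"
    unfolding K'_def split_beta by (intro compact_continuous_image compact_Times continuous_intros K) auto
  have inK: "x + s *\<^sub>R v \<notin> K" if "x \<notin> K'" "s \<in> {-1..1}" for x s
  proof
    assume "x + s *\<^sub>R v \<in> K"
    then have "(\<lambda>(s, x). x - s *\<^sub>R v) (s, x + s *\<^sub>R v) \<in> K'"
      unfolding K'_def using that(2) by (intro imageI) auto
    then show False using that(1) by simp
  qed
  have df: "f differentiable (at x)" for x using smooth_on_differentiable[OF f] by simp
  have z': "dird v f x = 0" if "x \<notin> K" for x
    using dird_cong_open(1)[of "- K" x f "\<lambda>x. 0" v] that z K by (simp add: compact_imp_closed open_Compl)
  have charge_coeff: "continuous_on UNIV f" "continuous_on UNIV (dird v f)"
    using f by (auto intro: smooth_on_continuous smooth_on_dird)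
  have "((\<lambda>s. integral\<^sup>L lborel (\<lambda>x. f (x + s *\<^sub>R v))) has_vector_derivative
      integral\<^sup>L lborel (\<lambda>x. dird v f (x + 0 *\<^sub>R v))) (at 0)"
  proof (rule lborel_integral_has_vector_derivative[OF K', of "{-1<..<1}"])
    show "continuous_on ({-1<..<1} \<times> UNIV) (\<lambda>(p, z). f (z + p *\<^sub>R v))"
      unfolding split_beta by (rule continuous_on_compose2[OF charge_coeff(1)]) (auto intro!: continuous_intros)
    show "continuous_on ({-1<..<1} \<times> UNIV) (\<lambda>(p, z). dird v f (z + p *\<^sub>R v))"
      unfolding split_beta by (rule continuous_on_compose2[OF charge_coeff(2)]) (auto intro!: continuous_intros)
  qed (use inK z z' in \<open>auto intro!: dird_has_vector_derivative df\<close>)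
  moreover have "integral\<^sup>L lborel (\<lambda>x. f (x + s *\<^sub>R v)) = integral\<^sup>L lborel f" for s
    using lborel_integral_shift[OF charge_coeff(1), of "s *\<^sub>R v"] by (simp add: add.commute)
  ultimately have "((\<lambda>s::real. integral\<^sup>L lborel f) has_vector_derivative integral\<^sup>L lborel (dird v f)) (at 0)"
    by simp
  then show ?thesis
    using has_vector_derivative_const vector_derivative_unique_at by blast
qed

section \<open>Change of variables for top forms\<close>

text \<open>With \<open>e\<close> enumerating the standard basis, this is an isometry onto the
  Euclidean space at hand from \<open>real^'m\<close>, the setting of the change of variables
  theorem; \<open>basis_coords\<close> is its inverse.\<close>

definition basis_comb :: "('m::finite \<Rightarrow> 'a::euclidean_space) \<Rightarrow> real^'m \<Rightarrow> 'a" where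
  "basis_comb e x = (\<Sum>j\<in>UNIV. (x $ j) *\<^sub>R e j)"

definition basis_coords :: "('m::finite \<Rightarrow> 'a::euclidean_space) \<Rightarrow> 'a \<Rightarrow> real^'m" where
  "basis_coords e v = (\<chi> j. v \<bullet> e j)"

lemma linear_basis_comb: "linear (basis_comb e)"
  by (rule linearI) (simp_all add: basis_comb_def scaleR_left_distrib sum.distrib scaleR_sum_right)

lemma linear_basis_coords: "linear (basis_coords e)"
  by (rule linearI) (simp_all add: basis_coords_def vec_eq_iff inner_add_left)

context
  fixes e :: "'m::finite \<Rightarrow> 'a::euclidean_space"
  assumes e: "bij_betw e UNIV Basis"
begin

lemma basis_index_inner: "e i \<bullet> e j = (if i = j then 1 else 0)"
proof -
  have "e i \<in> Basis" "e j \<in> Basis" "e i = e j \<longleftrightarrow> i = j"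
    using e by (auto simp: bij_betw_def inj_on_def)
  then show ?thesis by (simp add: inner_Basis)
qed

lemma basis_comb_coords: "basis_comb e (basis_coords e v) = v"
proof -
  have "basis_comb e (basis_coords e v) = (\<Sum>b\<in>Basis. (v \<bullet> b) *\<^sub>R b)"
    unfolding basis_comb_def basis_coords_def using sum.reindex_bij_betw[OF e, of "\<lambda>b. (v \<bullet> b) *\<^sub>R b"] by simp
  then show ?thesis by (simp add: euclidean_representation)
qed

lemma basis_comb_inner: "basis_comb e x \<bullet> e j = x $ j"
  by (simp add: basis_comb_def inner_sum_left basis_index_inner if_distrib[of "\<lambda>y. _ * y"] cong: if_cong)

lemma basis_coords_comb: "basis_coords e (basis_comb e x) = x"
  by (simp add: basis_coords_def basis_comb_inner vec_eq_iff)

lemma lborel_basis_comb: "(lborel :: 'a measure) = distr lborel borel (basis_comb e)"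
proof (rule lborel_eqI)
  fix l u :: 'a
  assume lu: "\<And>b. b \<in> Basis \<Longrightarrow> l \<bullet> b \<le> u \<bullet> b"
  have B: "(Basis :: 'a set) = range e" using e by (simp add: bij_betw_def)
  have m: "basis_comb e \<in> borel_measurable lborel"
    using linear_continuous_on[of "basis_comb e" UNIV] linear_basis_comb linear_conv_bounded_linear
    by (auto intro: borel_measurable_continuous_onI)
  have "basis_comb e -` box l u = box (basis_coords e l) (basis_coords e u)"
  proof -
    have "x \<in> basis_comb e -` box l u \<longleftrightarrow> x \<in> box (basis_coords e l) (basis_coords e u)" for x
    proof -
      have "x \<in> basis_comb e -` box l u \<longleftrightarrow> (\<forall>j. l \<bullet> e j < x $ j \<and> x $ j < u \<bullet> e j)"
        by (simp add: mem_box B basis_comb_inner)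
      then show ?thesis by (simp only: mem_box_cart basis_coords_def vec_lambda_beta)
    qed
    then show ?thesis by blast
  qed
  then have "emeasure (distr lborel borel (basis_comb e)) (box l u) = emeasure lborel (box (basis_coords e l) (basis_coords e u))"
    using m by (subst emeasure_distr) (auto simp: space_borel)
  also have "\<dots> = (\<Prod>b\<in>Basis. (basis_coords e u - basis_coords e l) \<bullet> b)"
    using lu by (intro emeasure_lborel_box) (auto simp: Basis_vec_def inner_axis basis_coords_def B)
  also have "(\<Prod>b\<in>Basis. (basis_coords e u - basis_coords e l) \<bullet> b) = (\<Prod>j\<in>UNIV. (u - l) \<bullet> e j)"
  proof -
    have 1: "Basis = range (\<lambda>j. axis j 1 :: real^'m)" by (auto simp: Basis_vec_def)
    have 2: "inj (\<lambda>j. axis j 1 :: real^'m)" by (auto simp: inj_on_def axis_eq_axis)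
    show ?thesis
      unfolding 1 prod.reindex[OF 2] by (simp add: inner_axis basis_coords_def inner_diff_left)
  qed
  also have "\<dots> = (\<Prod>b\<in>Basis. (u - l) \<bullet> b)"
    using prod.reindex_bij_betw[OF e, of "\<lambda>b. (u - l) \<bullet> b"] by simp
  finally show "emeasure (distr lborel borel (basis_comb e)) (box l u) = (\<Prod>b\<in>Basis. (u - l) \<bullet> b)" .
qed simp

lemma lborel_integral_basis_comb:
  fixes f :: "'a \<Rightarrow> real"
  assumes "integrable lborel f"
  shows "integrable lborel (\<lambda>x. f (basis_comb e x))"
    "integral\<^sup>L lborel (\<lambda>x. f (basis_comb e x)) = integral\<^sup>L lborel f"
proof -
  have m: "basis_comb e \<in> borel_measurable lborel"
    using linear_continuous_on[of "basis_comb e" UNIV] linear_basis_comb linear_conv_bounded_linear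
    by (auto intro: borel_measurable_continuous_onI)
  have fm: "f \<in> borel_measurable borel" using assms by auto
  have "integrable (distr lborel borel (basis_comb e)) f" using assms lborel_basis_comb by simp
  then show "integrable lborel (\<lambda>x. f (basis_comb e x))"
    using integrable_distr_eq[OF m fm] by simp
  have "integral\<^sup>L (distr lborel borel (basis_comb e)) f = integral\<^sup>L lborel (\<lambda>x. f (basis_comb e x))"
    by (rule integral_distr) (use m fm in auto)
  then show "integral\<^sup>L lborel (\<lambda>x. f (basis_comb e x)) = integral\<^sup>L lborel f"
    using lborel_basis_comb by simp
qed

end

definition frame_jacobian :: "('m::finite \<Rightarrow> 'a::euclidean_space) \<Rightarrow> ('a \<Rightarrow> 'a) \<Rightarrow> real" where
  "frame_jacobian e L = det (matrix (\<lambda>x. basis_coords e (L (basis_comb e x))))"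

lemma lborel_change_of_variables_real:
  fixes e :: "'m::{finite,wellorder} \<Rightarrow> 'a::euclidean_space" and f g :: "'a \<Rightarrow> real"
  assumes e: "bij_betw e UNIV Basis"
    and U: "open U" and V: "open V" and inj: "inj_on \<phi> U" and im: "\<phi> ` U = V"
    and d: "\<And>z. z \<in> U \<Longrightarrow> \<phi> differentiable (at z)"
    and f: "integrable lborel f" "\<And>z. z \<notin> U \<Longrightarrow> f z = 0"
    and g: "integrable lborel g" "\<And>z. z \<notin> V \<Longrightarrow> g z = 0"
    and fg: "\<And>z. z \<in> U \<Longrightarrow> f z = \<bar>frame_jacobian e (\<lambda>v. dird v \<phi> z)\<bar> * g (\<phi> z)"
  shows "integral\<^sup>L lborel f = integral\<^sup>L lborel g"
proof -
  define S where "S = basis_comb e -` U"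
  define \<psi> where "\<psi> = (\<lambda>x. basis_coords e (\<phi> (basis_comb e x)))"
  \<comment> \<open>The change of variables theorem is about vector-valued functions; dimension one
    carries the scalar case.\<close>
  define G where "G = (\<lambda>x. vec (g (basis_comb e x)) :: real^1)"
  have lc: "bounded_linear (basis_comb e)" "bounded_linear (basis_coords e)"
    using linear_basis_comb linear_basis_coords linear_conv_bounded_linear by auto
  have S: "open S"
    unfolding S_def using linear_continuous_on[OF lc(1)] U by (simp add: continuous_on_open_vimage open_vimage)
  have "S \<in> sets lebesgue" using S by auto
  have im': "\<psi> ` S = basis_comb e -` V"
  proof (intro equalityI subsetI)
    fix x assume "x \<in> \<psi> ` S"
    then show "x \<in> basis_comb e -` V" using im by (auto simp: \<psi>_def S_def basis_comb_coords[OF e])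
  next
    fix x assume "x \<in> basis_comb e -` V"
    then obtain z where z: "z \<in> U" "\<phi> z = basis_comb e x" using im by auto
    then have "\<psi> (basis_coords e z) = x" by (simp add: \<psi>_def basis_comb_coords[OF e] basis_coords_comb[OF e])
    moreover have "basis_coords e z \<in> S" using z by (simp add: S_def basis_comb_coords[OF e])
    ultimately show "x \<in> \<psi> ` S" by blast
  qed
  have inj': "inj_on \<psi> S"
  proof (rule inj_onI)
    fix x y assume "x \<in> S" "y \<in> S" "\<psi> x = \<psi> y"
    then have "\<phi> (basis_comb e x) = \<phi> (basis_comb e y)"
      unfolding \<psi>_def by (metis basis_comb_coords[OF e])
    then have "basis_comb e x = basis_comb e y" using inj \<open>x \<in> S\<close> \<open>y \<in> S\<close> by (auto simp: S_def inj_on_def)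
    then show "x = y" by (metis basis_coords_comb[OF e])
  qed
  define \<psi>' where "\<psi>' x = (\<lambda>u. basis_coords e (dird (basis_comb e u) \<phi> (basis_comb e x)))" for x
  have der: "(\<psi> has_derivative \<psi>' x) (at x within S)" if "x \<in> S" for x
  proof -
    have "(\<phi> \<circ> basis_comb e has_derivative (\<lambda>v. dird v \<phi> (basis_comb e x)) \<circ> basis_comb e) (at x)"
      by (rule diff_chain_at[OF bounded_linear_imp_has_derivative[OF lc(1)] has_derivative_dird])
        (use d that in \<open>simp add: S_def\<close>)
    from bounded_linear.has_derivative[OF lc(2) this] show ?thesis
      by (auto simp: \<psi>_def \<psi>'_def o_def intro: has_derivative_at_withinI)
  qed
  have J: "det (matrix (\<psi>' x)) = frame_jacobian e (\<lambda>v. dird v \<phi> (basis_comb e x))" for x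
    by (simp add: \<psi>'_def frame_jacobian_def)
  have gi: "integrable lborel (\<lambda>x. g (basis_comb e x))" and gI: "integral\<^sup>L lborel (\<lambda>x. g (basis_comb e x)) = integral\<^sup>L lborel g"
    and fi: "integrable lborel (\<lambda>x. f (basis_comb e x))" and fI: "integral\<^sup>L lborel (\<lambda>x. f (basis_comb e x)) = integral\<^sup>L lborel f"
    using lborel_integral_basis_comb[OF e] f g by auto
  have r: "h integrable_on S' \<and> integral S' h = integral\<^sup>L lborel h \<and> h absolutely_integrable_on S'"
    if "integrable lborel h" "\<And>x. x \<notin> S' \<Longrightarrow> h x = 0" for h :: "real^'m::_ \<Rightarrow> real" and S'
  proof -
    have h: "h = (\<lambda>x. if x \<in> S' then h x else 0)" using that(2) by auto
    have "h absolutely_integrable_on UNIV"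
      using that(1) by (simp add: set_integrable_def integrable_completion)
    then have a: "h absolutely_integrable_on S'" using h absolutely_integrable_restrict_UNIV by metis
    have "integral S' h = integral UNIV h" using integral_restrict_UNIV[of S' h] h by simp
    then show ?thesis using a integral_lborel[OF that(1)] by (simp add: absolutely_integrable_on_def)
  qed
  have r1: "(\<lambda>x. g (basis_comb e x)) absolutely_integrable_on (\<psi> ` S)"
     "integral (\<psi> ` S) (\<lambda>x. g (basis_comb e x)) = integral\<^sup>L lborel g"
    using r[OF gi, of "\<psi> ` S"] g(2) gI unfolding im' by auto
  have r2: "(\<lambda>x. f (basis_comb e x)) absolutely_integrable_on S"
     "integral S (\<lambda>x. f (basis_comb e x)) = integral\<^sup>L lborel f"
    using r[OF fi, of S] f(2) fI unfolding S_def by auto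
  have "G absolutely_integrable_on (\<psi> ` S) \<and> integral (\<psi> ` S) G = vec (integral\<^sup>L lborel g)"
    using r1 unfolding absolutely_integrable_on_1_iff integral_on_1_eq by (simp add: G_def)
  then have "integral S (\<lambda>x. \<bar>det (matrix (\<psi>' x))\<bar> *\<^sub>R G (\<psi> x)) = vec (integral\<^sup>L lborel g)"
    using has_absolute_integral_change_of_variables[OF \<open>S \<in> sets lebesgue\<close> der inj', where f=G and b="vec (integral\<^sup>L lborel g)"]
    by blast
  then have "integral S (\<lambda>x. (\<bar>det (matrix (\<psi>' x))\<bar> *\<^sub>R G (\<psi> x)) $ 1) = integral\<^sup>L lborel g"
    unfolding integral_on_1_eq by (simp add: vec_eq_iff)
  moreover have "integral S (\<lambda>x. (\<bar>det (matrix (\<psi>' x))\<bar> *\<^sub>R G (\<psi> x)) $ 1) = integral S (\<lambda>x. f (basis_comb e x))"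
    by (rule integral_cong) (use fg in \<open>simp add: J G_def \<psi>_def basis_comb_coords[OF e] S_def\<close>)
  ultimately show ?thesis using r2 by simp
qed

section \<open>Alternating forms of top degree\<close>

lemma amf_eq_0_not_distinct:
  assumes \<alpha>: "amf \<alpha>" and "\<not> distinct vs"
  shows "\<alpha> vs = 0"
proof -
  obtain xs ys zs y where vs: "vs = xs @ [y] @ ys @ [y] @ zs"
    using not_distinct_decomp[OF assms(2)] by blast
  have "\<alpha> (xs @ y # ys @ y # zs) = 0" for xs
  proof (induction ys arbitrary: xs)
    case Nil
    have "\<alpha> (xs @ y # y # zs) = - \<alpha> (xs @ y # y # zs)" by (rule amf_swap[OF \<alpha>])
    then have "2 *\<^sub>R \<alpha> (xs @ y # y # zs) = 0" by (metis add.right_inverse scaleR_2)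
    then show ?case by simp
  next
    case (Cons a ys)
    have "\<alpha> (xs @ y # a # ys @ y # zs) = - \<alpha> (xs @ a # y # ys @ y # zs)"
      by (rule amf_swap[OF \<alpha>])
    then show ?case using Cons[of "xs @ [a]"] by simp
  qed
  then show ?thesis by (simp add: vs)
qed

lemma amf_eq_0_mset:
  assumes "amf \<alpha>" "mset vs = mset ws" "\<alpha> ws = 0"
  shows "\<alpha> vs = 0"
  using assms
proof (induction ws arbitrary: vs \<alpha>)
  case (Cons x ws)
  have "x \<in> set vs" using Cons.prems(2) by (metis list.set_intros(1) set_mset_mset)
  then obtain xs ys where vs: "vs = xs @ x # ys" by (meson split_list)
  have move: "\<alpha> (as @ xs @ x # ys) = 0 \<longleftrightarrow> \<alpha> (as @ x # xs @ ys) = 0" for as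
  proof (induction xs arbitrary: as)
    case (Cons a xs)
    have "\<alpha> (as @ x # a # xs @ ys) = - \<alpha> (as @ a # x # xs @ ys)"
      by (rule amf_swap[OF \<open>amf \<alpha>\<close>])
    then show ?case using Cons[of "as @ [a]"] by simp
  qed simp
  have "ctr x \<alpha> (xs @ ys) = 0"
    by (rule Cons.IH[OF amf_ctr[OF Cons.prems(1)]]) (use Cons.prems vs in \<open>auto simp: ctr_def\<close>)
  then show ?case using move[of "[]"] by (simp add: vs ctr_def)
qed simp

text \<open>Multilinear expansion replaces the arguments from the left by basis vectors;
  \<open>us\<close> collects those already replaced. A list of basis vectors of full length either
  repeats one of them or is a permutation of \<open>bs\<close>.\<close>

lemma amf_eq_0_basis:
  fixes \<alpha> :: "('a::euclidean_space, 'b::real_vector) aform"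
  assumes \<alpha>: "amf \<alpha>" and bs: "distinct bs" "set bs = Basis" and z: "\<alpha> bs = 0" and len: "length vs = length bs"
  shows "\<alpha> vs = 0"
proof -
  have "\<alpha> (us @ vs) = 0" if "set us \<subseteq> Basis" "length (us @ vs) = length bs" for us vs
    using that
  proof (induction vs arbitrary: us)
    case Nil
    show ?case
    proof (cases "distinct us")
      case True
      then have "set us = Basis"
        using Nil distinct_card[OF bs(1)] distinct_card[OF True] bs(2) by (intro card_subset_eq) auto
      then have "mset us = mset bs"
        using True bs by (metis set_eq_iff_mset_eq_distinct)
      then show ?thesis using amf_eq_0_mset[OF \<alpha> _ z] by simp
    qed (use amf_eq_0_not_distinct[OF \<alpha>] in simp)
  next
    case (Cons v vs)
    note l = amf_linear[OF \<alpha>, of us vs]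
    have "\<alpha> (us @ v # vs) = \<alpha> (us @ (\<Sum>b\<in>Basis. (v \<bullet> b) *\<^sub>R b) # vs)"
      by (simp add: euclidean_representation)
    also have "\<dots> = (\<Sum>b\<in>Basis. (v \<bullet> b) *\<^sub>R \<alpha> (us @ b # vs))"
      by (simp add: linear_sum[OF l] linear_cmul[OF l])
    also have "\<dots> = 0"
      using Cons.IH[of "us @ [b]" for b] Cons.prems by (intro sum.neutral) auto
    finally show ?case .
  qed
  from this[of "[]" vs] len show ?thesis by simp
qed

text \<open>The model top form to which the others are compared; \<open>idx\<close> assigns to each
  row of the determinant a position in the list.\<close>

definition det_form :: "('m::finite \<Rightarrow> 'a::euclidean_space) \<Rightarrow> ('m \<Rightarrow> nat) \<Rightarrow> ('a, real) aform" where
  "det_form e idx vs = (if length vs = CARD('m) then det (\<chi> j. basis_coords e (vs ! idx j)) else 0)"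

lemma amf_det_form:
  fixes idx :: "'m::finite \<Rightarrow> nat"
  assumes idx: "bij_betw idx UNIV {..<CARD('m)}"
  shows "amf (det_form e idx)"
proof -
  have lin: "linear (\<lambda>v. det_form e idx (us @ v # vs))" for us vs
  proof (cases "length (us @ undefined # vs) = CARD('m)")
    case True
    then obtain j0 where j0: "idx j0 = length us" using idx unfolding bij_betw_def by (metis (no_types, lifting) imageE lessThan_iff length_append length_Cons less_add_Suc1 add_Suc_right)
    have ji: "idx j = length us \<longleftrightarrow> j = j0" for j using idx j0 by (metis bij_betw_def injD)
    define c where "c j = basis_coords e ((us @ undefined # vs) ! idx j)" for j
    have row: "basis_coords e ((us @ v # vs) ! idx j) = (if j = j0 then basis_coords e v else c j)" for v j
      using ji[of j] j0 by (auto simp: c_def nth_append nth_Cons split: nat.splits)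
    have eq: "det_form e idx (us @ v # vs) = det (\<chi> j. if j = j0 then basis_coords e v else c j)" for v
      using True by (simp add: det_form_def row)
    show ?thesis
      unfolding eq
    proof (rule linearI)
      show "det (\<chi> j. if j = j0 then basis_coords e (a + b) else c j) =
          det (\<chi> j. if j = j0 then basis_coords e a else c j) + det (\<chi> j. if j = j0 then basis_coords e b else c j)" for a b
        unfolding linear_add[OF linear_basis_coords] by (rule det_row_add)
      show "det (\<chi> j. if j = j0 then basis_coords e (r *\<^sub>R b) else c j) =
          r *\<^sub>R det (\<chi> j. if j = j0 then basis_coords e b else c j)" for r b
        unfolding linear_cmul[OF linear_basis_coords] scalar_mult_eq_scaleR[symmetric] real_scaleR_def by (rule det_row_mul)
    qed
  qed (simp add: det_form_def linear_zero)
  have zero: "det_form e idx (us @ x # x # vs) = 0" for us x vs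
  proof (cases "length (us @ x # x # vs) = CARD('m)")
    case True
    then have "length us \<in> range idx" "Suc (length us) \<in> range idx" using idx by (auto simp: bij_betw_def)
    then obtain j0 j1 where j: "idx j0 = length us" "idx j1 = Suc (length us)" by (metis imageE)
    then have "j0 \<noteq> j1" by auto
    then have "det (\<chi> j. basis_coords e ((us @ x # x # vs) ! idx j)) = 0"
      by (rule det_identical_rows) (simp add: row_def j nth_append)
    then show ?thesis by (simp add: det_form_def)
  qed (simp add: det_form_def)
  show ?thesis
  proof (rule amfI)
    fix us v w vs
    let ?d = "det_form e idx"
    have "?d (us @ (v + w) # (v + w) # vs) = ?d (us @ v # v # vs) + ?d (us @ v # w # vs) + ?d (us @ w # v # vs) + ?d (us @ w # w # vs)"
      using linear_add[OF lin[of us "(v + w) # vs"], of v w] linear_add[OF lin[of "us @ [v]" vs], of v w] linear_add[OF lin[of "us @ [w]" vs], of v w]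
      by simp
    then show "?d (us @ v # w # vs) = - ?d (us @ w # v # vs)"
      by (simp add: zero)
  qed (rule lin)
qed

text \<open>A top form is determined by its value on a basis, hence a multiple of the determinant.\<close>

lemma amf_map_linear:
  fixes \<alpha> :: "('a::euclidean_space, 'b::real_vector) aform" and e :: "'m::finite \<Rightarrow> 'a"
  assumes \<alpha>: "amf \<alpha>" and bs: "distinct bs" "set bs = Basis"
    and idx: "bij_betw idx UNIV {..<CARD('m)}" and e: "\<And>j. e j = bs ! idx j" and eB: "bij_betw e UNIV Basis"
    and L: "linear L"
  shows "\<alpha> (map L bs) = frame_jacobian e L *\<^sub>R \<alpha> bs"
proof -
  have len: "length bs = CARD('m)"
    using bs eB bij_betw_same_card distinct_card by metis
  have n: "idx j < length bs" for j using idx len by (auto simp: bij_betw_def)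
  have d1: "det_form e idx bs = 1"
  proof -
    have "(\<chi> j. basis_coords e (bs ! idx j)) = mat 1"
      by (simp add: vec_eq_iff basis_coords_def mat_def basis_index_inner[OF eB] flip: e)
    then show ?thesis by (simp add: det_form_def len)
  qed
  have dL: "det_form e idx (map L bs) = frame_jacobian e L"
  proof -
    have "(\<chi> j. basis_coords e (L (bs ! idx j))) = transpose (matrix (\<lambda>x. basis_coords e (L (basis_comb e x))))"
      by (simp add: vec_eq_iff transpose_def matrix_def basis_comb_def axis_def if_distrib[of "\<lambda>y. y *\<^sub>R _"] flip: e cong: if_cong)
    then show ?thesis by (simp add: det_form_def frame_jacobian_def nth_map[OF n] len)
  qed
  \<comment> \<open>Subtracting the right multiple of the determinant form makes the top form vanish
    on the basis, hence on every list of that length.\<close>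
  define \<beta> where "\<beta> = (\<lambda>vs. \<alpha> vs - det_form e idx vs *\<^sub>R \<alpha> bs)"
  note d = amf_det_form[OF idx, of e]
  have "amf \<beta>"
  proof (rule amfI)
    show "\<beta> (us @ v # w # vs) = - \<beta> (us @ w # v # vs)" for us v w vs
      using amf_swap[OF \<alpha>, of us v w vs] amf_swap[OF d, of us v w vs] by (simp add: \<beta>_def)
    show "linear (\<lambda>v. \<beta> (us @ v # vs))" for us vs
      unfolding \<beta>_def
      by (intro linear_compose_sub amf_linear[OF \<alpha>] linear_compose[OF amf_linear[OF d] linear_scaleR_left, unfolded o_def])
  qed
  moreover have "\<beta> bs = 0" by (simp add: \<beta>_def d1)
  ultimately have "\<beta> (map L bs) = 0"
    using amf_eq_0_basis[OF _ bs, of \<beta> "map L bs"] by simp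
  then show ?thesis by (simp add: \<beta>_def dL)
qed

lemma complex_linear_matrix:
  assumes "linear L" "\<And>c v. L (c *s v) = c *s (L v :: complex^'n::finite)"
  shows "L v = matrix L *v v"
proof -
  have "v = (\<Sum>j\<in>UNIV. (v $ j) *s axis j 1)"
    by (simp add: vec_eq_iff axis_def vector_scalar_mult_def if_distrib[of "\<lambda>y. _ * y"] cong: if_cong)
  then have "L v = (\<Sum>j\<in>UNIV. (v $ j) *s L (axis j 1))"
    by (metis (no_types, lifting) assms linear_sum sum.cong)
  then show ?thesis
    by (simp add: vec_eq_iff matrix_vector_mult_def matrix_def vector_scalar_mult_def mult.commute)
qed

text \<open>Complex linear isomorphisms preserve the orientation: joining \<open>L\<close> to the identity
  inside the complement of the finitely many complex numbers where the complex determinant vanishes.\<close>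

lemma jacobian_pos_complex_linear:
  fixes e :: "'m::{finite,wellorder} \<Rightarrow> complex^'n::finite" and L :: "complex^'n \<Rightarrow> complex^'n"
  assumes e: "bij_betw e UNIV Basis"
    and L: "linear L" "\<And>c v. L (c *s v) = c *s L v" and inj: "inj L"
  shows "frame_jacobian e L > 0"
proof -
  define M where "M z v = (1 - z) *s v + z *s L v" for z v
  define p where "p = det (\<chi> i j. [: mat 1 $ i $ j, matrix L $ i $ j - mat 1 $ i $ j :])"
  have lin: "linear (M z)" for z
    unfolding M_def using L(1)
    by (intro linearI) (simp_all add: linear_add linear_cmul vec_eq_iff algebra_simps scaleR_conv_of_real[where 'a=complex])
  have lins: "M z (c *s v) = c *s M z v" for z c v
    by (simp add: M_def L(2) vec_eq_iff algebra_simps)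
  have mz: "matrix (M z) = (\<chi> i j. poly [: mat 1 $ i $ j, matrix L $ i $ j - mat 1 $ i $ j :] z)" for z
    by (simp add: vec_eq_iff matrix_def M_def mat_def axis_def algebra_simps)
  have detp: "det (matrix (M z)) = poly p z" for z
    by (simp add: mz p_def det_def poly_sum poly_prod)
  have M0: "M 0 = (\<lambda>v. v)" and M1: "M 1 = L"
    by (auto simp: M_def vec_eq_iff)
  have "matrix (\<lambda>v::complex^'n. v) = mat 1"
    by (simp add: matrix_def mat_def axis_def vec_eq_iff)
  then have "poly p 0 \<noteq> 0" using detp[of 0] M0 by simp
  then have fin: "finite {z. poly p z = 0}" by (metis poly_roots_finite poly_0)
  have "poly p 1 \<noteq> 0"
  proof -
    have "(*v) (matrix L) = L" by (rule ext) (rule complex_linear_matrix[OF L, symmetric])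
    with inj have "inj ((*v) (matrix L))" by simp
    then have "invertible (matrix L)"
      by (simp add: invertible_left_inverse matrix_left_invertible_injective)
    then show ?thesis using detp[of 1] M1 by (simp add: invertible_det_nz)
  qed
  define Z where "Z = UNIV - {z. poly p z = 0}"
  have conn: "connected Z"
    unfolding Z_def by (rule connected_open_diff_countable) (use fin in \<open>auto simp: countable_finite\<close>)
  let ?f = "\<lambda>z. frame_jacobian e (M z)"
  \<comment> \<open>Off the roots of \<open>p\<close> the map is injective, hence its real
    determinant does not vanish either, and on the connected set \<open>Z\<close> it keeps the sign
    it has at the identity.\<close>
  have nz: "?f z \<noteq> 0" if "z \<in> Z" for z
  proof -
    have "invertible (matrix (M z))" using that detp by (simp add: Z_def invertible_det_nz)
    then have "inj ((*v) (matrix (M z)))"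
      by (simp add: invertible_left_inverse matrix_left_invertible_injective)
    moreover have "(*v) (matrix (M z)) = M z" by (rule ext) (rule complex_linear_matrix[OF lin lins, symmetric])
    ultimately have i: "inj (M z)" by simp
    let ?N = "\<lambda>x. basis_coords e (M z (basis_comb e x))"
    have "linear ?N"
      using linear_compose[OF linear_compose[OF linear_basis_comb lin] linear_basis_coords] by (simp add: o_def)
    moreover have "inj ?N"
      by (rule injI) (metis basis_comb_coords[OF e] basis_coords_comb[OF e] i injD)
    ultimately show ?thesis unfolding frame_jacobian_def using det_nz_iff_inj by blast
  qed
  have cont: "continuous_on Z ?f"
    unfolding frame_jacobian_def det_def matrix_def M_def basis_coords_def
    by (simp add: inner_add_left) (intro continuous_intros bounded_linear.continuous_on[OF bounded_linear_inner_left])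
  have conn': "connected (?f ` Z)" by (rule connected_continuous_image[OF cont conn])
  have "?f 0 = 1"
  proof -
    have "matrix (\<lambda>x::real^'m::_. x) = mat 1"
      by (simp add: matrix_def mat_def axis_def vec_eq_iff)
    then show ?thesis by (simp add: frame_jacobian_def M0 basis_coords_comb[OF e])
  qed
  moreover have "0 \<in> Z" "1 \<in> Z" using \<open>poly p 0 \<noteq> 0\<close> \<open>poly p 1 \<noteq> 0\<close> by (auto simp: Z_def)
  ultimately have "1 \<in> ?f ` Z" "?f 1 \<in> ?f ` Z" by (force, blast)
  have "?f 1 > 0"
  proof (rule ccontr)
    assume "\<not> ?f 1 > 0"
    then have "0 \<in> ?f ` Z"
      using connectedD_interval[OF conn' \<open>?f 1 \<in> ?f ` Z\<close> \<open>1 \<in> ?f ` Z\<close>, of 0] by simp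
    then show False using nz by auto
  qed
  then show ?thesis by (simp add: M1)
qed

lemma oriented_frame: "distinct (oriented_frame :: (complex^'n::finite) list)" "set (oriented_frame :: (complex^'n) list) = Basis"
proof -
  define ks where "ks = (SOME ks. distinct ks \<and> set ks = (UNIV :: 'n set))"
  have ks: "distinct ks \<and> set ks = UNIV"
    unfolding ks_def by (rule someI_ex) (use finite_distinct_list[of "UNIV :: 'n set"] in auto)
  have of: "oriented_frame = concat (map (\<lambda>k. [axis k 1, axis k \<i>]) ks)"
    by (simp add: oriented_frame_def ks_def)
  have "distinct (concat (map (\<lambda>k. [axis k 1, axis k \<i> :: complex^'n]) ks))" if "distinct ks" for ks :: "'n list"
    using that by (induction ks) (auto simp: axis_eq_axis)
  then show "distinct (oriented_frame :: (complex^'n) list)" unfolding of using ks by blast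
  show "set (oriented_frame :: (complex^'n) list) = Basis"
    using ks by (auto simp: of Basis_vec_def Basis_complex_def)
qed

text \<open>The Jacobian is computed in the index type \<open>'n bit0\<close>, as the change of variables theorem of
  the library requires a well-ordered one.\<close>

theorem lborel_integral_top_form:
  fixes \<alpha> \<beta> :: "complex^'n::finite \<Rightarrow> (complex^'n, complex) aform"
  assumes U: "open U" and V: "open V" and inj: "inj_on \<phi> U" and im: "\<phi> ` U = V"
    and d: "\<And>z. z \<in> U \<Longrightarrow> \<phi> differentiable (at z)"
    and cl: "\<And>z c v. z \<in> U \<Longrightarrow> dird (c *s v) \<phi> z = c *s dird v \<phi> z"
    and dinj: "\<And>z. z \<in> U \<Longrightarrow> inj (\<lambda>v. dird v \<phi> z)"
    and f: "integrable lborel f" "\<And>z. z \<notin> U \<Longrightarrow> f z = 0" "\<And>z. z \<in> U \<Longrightarrow> f z = \<alpha> z oriented_frame"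
    and g: "integrable lborel g" "\<And>z. z \<notin> V \<Longrightarrow> g z = 0" "\<And>z. z \<in> V \<Longrightarrow> g z = \<beta> z oriented_frame"
    and \<beta>: "\<And>z. z \<in> V \<Longrightarrow> amf (\<beta> z)"
    and tr: "\<And>z. z \<in> U \<Longrightarrow> \<alpha> z oriented_frame = \<beta> (\<phi> z) (map (\<lambda>v. dird v \<phi> z) oriented_frame)"
  shows "integral\<^sup>L lborel f = integral\<^sup>L lborel g"
proof -
  let ?bs = "oriented_frame :: (complex^'n) list"
  have "DIM(complex^'n) = CARD('n bit0)" by simp
  then have len: "length ?bs = CARD('n bit0)"
    using distinct_card[OF oriented_frame(1)[where 'n='n]] by (simp add: oriented_frame(2))
  obtain idx :: "'n bit0 \<Rightarrow> nat" where idx: "bij_betw idx UNIV {..<CARD('n bit0)}"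
    using ex_bij_betw_finite_nat[of "UNIV :: 'n bit0 set"] by (auto simp: atLeast0LessThan)
  define e where "e j = ?bs ! idx j" for j
  have e: "bij_betw e UNIV Basis"
  proof -
    have "bij_betw ((!) ?bs) {..<length ?bs} (set ?bs)"
      by (rule bij_betw_nth[OF oriented_frame(1)]) auto
    then have "bij_betw ((!) ?bs \<circ> idx) UNIV Basis"
      using bij_betw_trans[OF idx] unfolding len oriented_frame(2) by blast
    then show ?thesis by (simp add: e_def[abs_def] o_def)
  qed
  have J: "\<alpha> z oriented_frame = frame_jacobian e (\<lambda>v. dird v \<phi> z) *\<^sub>R \<beta> (\<phi> z) oriented_frame" if "z \<in> U" for z
    using amf_map_linear[OF \<beta> oriented_frame idx e_def e linear_dird[OF d], of "\<phi> z" z] tr[OF that] that im by auto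
  have P: "\<bar>frame_jacobian e (\<lambda>v. dird v \<phi> z)\<bar> = frame_jacobian e (\<lambda>v. dird v \<phi> z)" if "z \<in> U" for z
    using jacobian_pos_complex_linear[OF e linear_dird[OF d] cl dinj, OF that that that] by simp
  have fg: "f z = \<bar>frame_jacobian e (\<lambda>v. dird v \<phi> z)\<bar> *\<^sub>R g (\<phi> z)" if "z \<in> U" for z
  proof -
    have "\<phi> z \<in> V" using that im by auto
    then show ?thesis using P[OF that] J[OF that] f(3)[OF that] g(3) by simp
  qed
  have "integral\<^sup>L lborel (\<lambda>z. Re (f z)) = integral\<^sup>L lborel (\<lambda>z. Re (g z))"
    "integral\<^sup>L lborel (\<lambda>z. Im (f z)) = integral\<^sup>L lborel (\<lambda>z. Im (g z))"
    by (rule lborel_change_of_variables_real[OF e U V inj im d]; use f(1,2) g(1,2) fg in simp)+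
  then show ?thesis using f(1) g(1) by (simp add: complex_eq_iff)
qed

section \<open>Smooth cutoff functions\<close>

definition flat :: "real poly \<Rightarrow> real \<Rightarrow> real" where
  "flat p x = (if 0 < x then poly p (inverse x) * exp (- inverse x) else 0)"

lemma tendsto_poly_exp: "((\<lambda>y::real. y ^ k * poly p y * exp (- y)) \<longlongrightarrow> 0) at_top"
proof (induction p arbitrary: k)
  case (pCons a p)
  have "((\<lambda>y::real. a * (y ^ k / exp y) + y ^ Suc k * poly p y * exp (- y)) \<longlongrightarrow> a * 0 + 0) at_top"
    by (intro tendsto_intros tendsto_power_div_exp_0 pCons)
  then show ?case by (simp add: algebra_simps exp_minus divide_inverse)
qed simp

lemma tendsto_flat_0: "((\<lambda>x. poly p (inverse x) * exp (- inverse x)) \<longlongrightarrow> 0) (at_right (0::real))"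
  using filterlim_compose[OF tendsto_poly_exp[of 0 p] filterlim_inverse_at_top_right] by (simp add: o_def)

lemma flat_has_derivative: "(flat p has_real_derivative flat ([:0, 0, 1:] * (p - pderiv p)) x) (at x)"
proof -
  consider "x > 0" | "x < 0" | "x = 0" by linarith
  then show ?thesis
  proof cases
    case 1
    have "((\<lambda>x. poly p (inverse x) * exp (- inverse x)) has_real_derivative
        poly p (inverse x) * (exp (- inverse x) * inverse (x^2)) + poly (pderiv p) (inverse x) * (- inverse (x^2)) * exp (- inverse x)) (at x)"
      using 1 by (auto intro!: derivative_eq_intros DERIV_chain2[OF poly_DERIV] simp: power2_eq_square)
    then have "(flat p has_real_derivative
        poly p (inverse x) * (exp (- inverse x) * inverse (x^2)) + poly (pderiv p) (inverse x) * (- inverse (x^2)) * exp (- inverse x)) (at x)"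
      by (rule has_field_derivative_transform_within_open[of _ _ _ "{0<..}"]) (use 1 in \<open>auto simp: flat_def\<close>)
    then show ?thesis using 1 by (simp add: flat_def algebra_simps power2_eq_square)
  next
    case 2
    have "((\<lambda>x. 0) has_real_derivative 0) (at x)" by simp
    then have "(flat p has_real_derivative 0) (at x)"
      by (rule has_field_derivative_transform_within_open[of _ _ _ "{..<0}"]) (use 2 in \<open>auto simp: flat_def\<close>)
    then show ?thesis using 2 by (simp add: flat_def)
  next
    case 3
    \<comment> \<open>The difference quotient from the right is \<open>p (1/y) / y\<close> times
      \<open>exp (-1/y)\<close>. This has the same shape for the polynomial
      \<open>pCons 0 p\<close>, and it tends to 0 because the exponential beats every power.\<close>
    have "((\<lambda>y. (flat p y - flat p 0) / (y - 0)) \<longlongrightarrow> 0) (at 0)"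
    proof (subst filterlim_at_split, intro conjI)
      have "\<forall>\<^sub>F y in at_left 0. (flat p y - flat p 0) / (y - 0) = 0"
        by (rule eventually_at_leftI[of "-1"]) (auto simp: flat_def)
      then show "((\<lambda>y. (flat p y - flat p 0) / (y - 0)) \<longlongrightarrow> 0) (at_left 0)"
        by (simp add: tendsto_eventually)
      have "\<forall>\<^sub>F y in at_right 0. poly (pCons 0 p) (inverse y) * exp (- inverse y) = (flat p y - flat p 0) / (y - 0)"
        by (rule eventually_at_rightI[of _ 1]) (auto simp: flat_def divide_inverse)
      then show "((\<lambda>y. (flat p y - flat p 0) / (y - 0)) \<longlongrightarrow> 0) (at_right 0)"
        using tendsto_flat_0[of "pCons 0 p"] by (rule Lim_transform_eventually[rotated])
    qed
    then show ?thesis using 3 by (simp add: has_field_derivative_iff flat_def)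
  qed
qed

lemma smooth_on_flat: "smooth_on S (flat p)"
proof -
  have d: "dird v (flat p) = (\<lambda>x. v *\<^sub>R flat ([:0, 0, 1:] * (p - pderiv p)) x)" for v p
  proof
    fix x
    show "dird v (flat p) x = v *\<^sub>R flat ([:0, 0, 1:] * (p - pderiv p)) x"
      using dird_eqI[OF flat_has_derivative[unfolded has_field_derivative_def], of v p x] by simp
  qed
  have "Ck_on k UNIV (flat p)" for k
  proof (induction k arbitrary: p)
    case 0
    then show ?case
      using flat_has_derivative DERIV_isCont by (simp add: continuous_on_eq_continuous_at) blast
  next
    case (Suc k)
    show ?case
      unfolding Ck_on_Suc_dird d
    proof (intro conjI ballI allI)
      show "flat p differentiable (at x)" for x
        using flat_has_derivative[of p x] unfolding differentiable_def has_field_derivative_def by blast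
    qed (intro Ck_on_bilinear[OF open_UNIV bounded_bilinear_scaleR] Ck_on_const Suc)
  qed
  then show ?thesis using smooth_on_subset[of UNIV] unfolding smooth_on_def by (metis Ck_on_subset subset_UNIV)
qed

abbreviation bump :: "real \<Rightarrow> real" where "bump \<equiv> flat 1"

lemma bump_pos: "0 < x \<Longrightarrow> 0 < bump x" and bump_nonneg: "0 \<le> bump x" and bump_zero: "x \<le> 0 \<Longrightarrow> bump x = 0"
  by (auto simp: flat_def)

text \<open>Constant on both sides of the middle third of the unit interval. The plateaus allow
  paths to be concatenated smoothly and to be extended to all times.\<close>

definition smooth_step :: "real \<Rightarrow> real" where
  "smooth_step t = bump (3 * t - 1) / (bump (3 * t - 1) + bump (2 - 3 * t))"

lemma smooth_step_denom: "0 < bump (3 * t - 1) + bump (2 - 3 * t)"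
proof (cases "t > 1 / 3")
  case True
  then show ?thesis by (intro add_pos_nonneg bump_pos bump_nonneg) simp
next
  case False
  then show ?thesis by (intro add_nonneg_pos bump_pos bump_nonneg) simp
qed

lemma smooth_on_smooth_step: "smooth_on UNIV smooth_step"
proof -
  have l: "smooth_on UNIV (\<lambda>t::real. a * t + b)" for a b
    by (intro smooth_on_add smooth_on_mult smooth_on_const smooth_on_id open_UNIV)
  have 1: "smooth_on UNIV (\<lambda>t. bump (3 * t - 1))" and 2: "smooth_on UNIV (\<lambda>t. bump (2 - 3 * t))"
    using smooth_on_compose[OF open_UNIV open_UNIV _ smooth_on_flat l[of 3 "-1"]]
      smooth_on_compose[OF open_UNIV open_UNIV _ smooth_on_flat l[of "-3" 2]] by simp_all
  show ?thesis
    unfolding smooth_step_def[abs_def]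
    by (intro smooth_on_divide smooth_on_add open_UNIV 1 2) (use smooth_step_denom less_irrefl in metis)
qed

lemma smooth_step_0: "t \<le> 1 / 3 \<Longrightarrow> smooth_step t = 0"
  by (simp add: smooth_step_def bump_zero)

lemma smooth_step_1: "2 / 3 \<le> t \<Longrightarrow> smooth_step t = 1"
  using smooth_step_denom[of t] bump_zero[of "2 - 3 * t"] by (simp add: smooth_step_def)

lemma smooth_step_bounds: "0 \<le> smooth_step t" "smooth_step t \<le> 1"
  using smooth_step_denom[of t] bump_nonneg[of "3 * t - 1"] bump_nonneg[of "2 - 3 * t"]
  by (simp_all add: smooth_step_def divide_simps)

section \<open>Charts and partitions of unity\<close>

lemma linear_axis: "linear (axis k :: 'a::real_vector \<Rightarrow> 'a^'n::finite)"
  by (rule linearI) (auto simp: axis_def vec_eq_iff)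

lemma smooth_on_vec:
  fixes f :: "'a::real_normed_vector \<Rightarrow> 'b::euclidean_space^'n::finite"
  assumes S: "open S" and f: "\<And>k. smooth_on S (\<lambda>z. f z $ k)"
  shows "smooth_on S f"
proof -
  have "f = (\<lambda>z. \<Sum>k\<in>UNIV. axis k (f z $ k))"
    by (auto simp: fun_eq_iff vec_eq_iff axis_def if_distrib cong: if_cong)
  moreover have "smooth_on S (\<lambda>z. \<Sum>k\<in>UNIV. axis k (f z $ k))"
    by (intro smooth_on_sum S smooth_on_linear_compose[OF S _ f])
      (simp add: linear_axis flip: linear_conv_bounded_linear)
  ultimately show ?thesis by simp
qed

lemma smooth_on_vec_nth: "open S \<Longrightarrow> smooth_on S f \<Longrightarrow> smooth_on S (\<lambda>z. f z $ k)"
  by (rule smooth_on_linear_compose[OF _ bounded_linear_vec_nth])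

locale complex_manifold =
  fixes X :: "('i, 'x::t2_space, 'n::finite) atlas"
  assumes manifold: "compact_complex_manifold X"
begin

lemma compact_X: "compact (UNIV :: 'x set)" and cdom_cover: "(\<Union>i. cdom X i) = UNIV"
  and open_cdom: "open (cdom X i)" and open_cimg: "open (cimg X i)"
  and chart_homeo: "homeomorphism (cdom X i) (cimg X i) (crd X i) (cinv X i)"
  and trans_holo: "holo_on (crd X i ` (cdom X i \<inter> cdom X j)) (\<lambda>z. crd X j (cinv X i z) $ k)"
  using manifold by (auto simp: compact_complex_manifold_def)

lemma cinv_crd [simp]: "x \<in> cdom X i \<Longrightarrow> cinv X i (crd X i x) = x"
  and crd_cinv [simp]: "z \<in> cimg X i \<Longrightarrow> crd X i (cinv X i z) = z"
  and cinv_in: "z \<in> cimg X i \<Longrightarrow> cinv X i z \<in> cdom X i"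
  and crd_in: "x \<in> cdom X i \<Longrightarrow> crd X i x \<in> cimg X i"
  and continuous_on_cinv: "continuous_on (cimg X i) (cinv X i)"
  and continuous_on_crd: "continuous_on (cdom X i) (crd X i)"
  using chart_homeo[of i] by (auto simp: homeomorphism_def)

lemma open_crd_image: "open A \<Longrightarrow> A \<subseteq> cdom X i \<Longrightarrow> open (crd X i ` A)"
proof -
  assume A: "open A" "A \<subseteq> cdom X i"
  have "openin (top_of_set (cdom X i)) A" using A by (simp add: openin_open_eq[OF open_cdom])
  then have "openin (top_of_set (cimg X i)) (crd X i ` A)"
    by (rule homeomorphism_imp_open_map[OF chart_homeo])
  then show ?thesis using open_cimg openin_open_trans by blast
qed

lemma open_cinv_image: "open A \<Longrightarrow> A \<subseteq> cimg X i \<Longrightarrow> open (cinv X i ` A)"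
proof -
  assume A: "open A" "A \<subseteq> cimg X i"
  have "openin (top_of_set (cimg X i)) A" using A by (simp add: openin_open_eq[OF open_cimg])
  then have "openin (top_of_set (cdom X i)) (cinv X i ` A)"
    by (rule homeomorphism_imp_open_map[OF homeomorphism_symD[OF chart_homeo]])
  then show ?thesis using open_cdom openin_open_trans by blast
qed

definition ovl :: "'i \<Rightarrow> 'i \<Rightarrow> (complex^'n) set" where
  "ovl i j = crd X i ` (cdom X i \<inter> cdom X j)"

definition trans :: "'i \<Rightarrow> 'i \<Rightarrow> complex^'n \<Rightarrow> complex^'n" where
  "trans i j z = crd X j (cinv X i z)"

lemma open_ovl: "open (ovl i j)"
  unfolding ovl_def by (intro open_crd_image) (auto intro: open_cdom)

lemma ovlI: "x \<in> cdom X i \<Longrightarrow> x \<in> cdom X j \<Longrightarrow> crd X i x \<in> ovl i j"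
  by (simp add: ovl_def)

lemma ovl_cinv: "z \<in> ovl i j \<Longrightarrow> cinv X i z \<in> cdom X i \<inter> cdom X j"
  by (auto simp: ovl_def)

lemma ovl_subset: "ovl i j \<subseteq> cimg X i"
  by (auto simp: ovl_def crd_in)

lemma trans_in: "z \<in> ovl i j \<Longrightarrow> trans i j z \<in> ovl j i"
  by (auto simp: ovl_def trans_def)

lemma cinv_trans: "z \<in> ovl i j \<Longrightarrow> cinv X j (trans i j z) = cinv X i z"
  by (auto simp: ovl_def trans_def)

lemma trans_trans: "z \<in> ovl i j \<Longrightarrow> trans j i (trans i j z) = z"
  by (auto simp: ovl_def trans_def)

lemma trans_image: "trans i j ` ovl i j = ovl j i"
  by (auto simp: ovl_def trans_def image_iff)

lemma inj_on_trans: "inj_on (trans i j) (ovl i j)"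
  by (rule inj_on_inverseI[of _ "trans j i"]) (rule trans_trans)

lemma smooth_on_trans: "smooth_on (ovl i j) (trans i j)"
  by (rule smooth_on_vec[OF open_ovl]) (simp add: trans_def holo_on_imp_smooth_on[OF open_ovl trans_holo[folded ovl_def]])

lemma trans_differentiable: "z \<in> ovl i j \<Longrightarrow> trans i j differentiable (at z)"
  by (rule smooth_on_differentiable[OF smooth_on_trans])

lemma dird_trans_scalar:
  assumes z: "z \<in> ovl i j"
  shows "dird (c *s v) (trans i j) z = c *s dird v (trans i j) z"
proof -
  have "dird v (\<lambda>z. trans i j z $ k) z = dird v (trans i j) z $ k" for v k
    using dird_linear_compose[OF bounded_linear_vec_nth trans_differentiable[OF z]] .
  moreover have "dird (c *s v) (\<lambda>z. trans i j z $ k) z = c * dird v (\<lambda>z. trans i j z $ k) z" for k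
    unfolding trans_def by (rule holo_on_dird_scalar[OF trans_holo z[unfolded ovl_def]])
  ultimately show ?thesis by (simp add: vec_eq_iff)
qed

lemma dird_trans_trans:
  assumes z: "z \<in> ovl i j"
  shows "dird (dird v (trans i j) z) (trans j i) (trans i j z) = v"
proof -
  have "dird (dird v (trans i j) z) (trans j i) (trans i j z) = dird v (\<lambda>z. trans j i (trans i j z)) z"
    by (rule dird_compose[symmetric, OF trans_differentiable[OF z] trans_differentiable[OF trans_in[OF z]]])
  also have "\<dots> = dird v (\<lambda>z. z) z"
    by (rule dird_cong_open(1)[OF open_ovl z trans_trans])
  finally show ?thesis by (simp add: dird_def)
qed

lemma inj_dird_trans: "z \<in> ovl i j \<Longrightarrow> inj (\<lambda>v. dird v (trans i j) z)"
  by (rule inj_on_inverseI[of _ "\<lambda>w. dird w (trans j i) (trans i j z)"]) (rule dird_trans_trans)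

text \<open>A bump on a coordinate ball, extended by 0. In another chart it is smooth near points of
  the first chart as a composition with the transition map. Near all other points it vanishes,
  because \<open>K\<close> is compact and hence closed in the Hausdorff space
  \<open>X\<close>.\<close>

lemma exists_chart_bump:
  "\<exists>f K. compact K \<and> K \<subseteq> cdom X i \<and> (\<forall>y. 0 \<le> f y) \<and> (\<forall>y. y \<notin> K \<longrightarrow> f y = (0::real)) \<and>
    (\<forall>j. smooth_on (cimg X j) (\<lambda>z. f (cinv X j z))) \<and> open {y. 0 < f y} \<and> (x \<in> cdom X i \<longrightarrow> 0 < f x)"
proof (cases "x \<in> cdom X i")
  case False
  then show ?thesis
    by (intro exI[of _ "\<lambda>_. 0"] exI[of _ "{}"]) (simp add: smooth_on_const)
next
  case True
  define c where "c = crd X i x"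
  obtain r where r: "0 < r" "cball c r \<subseteq> cimg X i"
    using open_cimg[of i] crd_in[OF True] open_contains_cball unfolding c_def by blast
  \<comment> \<open>Scaled so as to be positive exactly on the open ball of radius \<open>r\<close>
    around \<open>c\<close>.\<close>
  define q where "q z = bump (1 - ((z - c) \<bullet> (z - c)) / r^2)" for z
  define f where "f y = (if y \<in> cdom X i then q (crd X i y) else 0)" for y
  define K where "K = cinv X i ` cball c r"
  have K: "compact K" "K \<subseteq> cdom X i"
    unfolding K_def using r continuous_on_subset[OF continuous_on_cinv]
    by (auto intro!: compact_continuous_image cinv_in)
  have qpos: "0 < q z \<longleftrightarrow> z \<in> ball c r" for z
  proof -
    have "0 < q z \<longleftrightarrow> ((z - c) \<bullet> (z - c)) / r^2 < 1"
      unfolding q_def using bump_pos[of "1 - ((z - c) \<bullet> (z - c)) / r^2"] bump_zero[of "1 - ((z - c) \<bullet> (z - c)) / r^2"]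
      by (cases "((z - c) \<bullet> (z - c)) / r^2 < 1") auto
    also have "\<dots> \<longleftrightarrow> (norm (z - c))^2 < r^2" using r by (simp add: divide_simps power2_norm_eq_inner)
    also have "\<dots> \<longleftrightarrow> norm (z - c) < r" using r by (meson norm_ge_zero power2_less_imp_less power_strict_mono pos2 less_imp_le)
    finally show ?thesis by (simp add: dist_norm norm_minus_commute)
  qed
  have q0: "q z = 0" if "z \<notin> ball c r" for z
    using qpos[of z] that bump_nonneg unfolding q_def by (metis linorder_not_less order_antisym)
  have f0: "f y = 0" if "y \<notin> K" for y
  proof (cases "y \<in> cdom X i")
    case True
    then have "crd X i y \<notin> cball c r" using that unfolding K_def by (metis cinv_crd image_eqI)
    then show ?thesis using True q0 by (auto simp: f_def)
  qed (simp add: f_def)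
  have q_smooth: "smooth_on UNIV q"
    unfolding q_def[abs_def]
    by (rule smooth_on_compose[OF open_UNIV open_UNIV _ smooth_on_flat])
      (auto intro!: smooth_on_diff smooth_on_divide smooth_on_bilinear[OF _ bounded_bilinear_inner] smooth_on_const smooth_on_id simp: r(1)[THEN less_imp_neq, symmetric])
  show ?thesis
  proof (intro exI conjI allI impI)
    show "compact K" "K \<subseteq> cdom X i" by (rule K)+
    show "0 \<le> f y" for y by (simp add: f_def q_def bump_nonneg)
    show "f y = 0" if "y \<notin> K" for y by (rule f0[OF that])
    show "0 < f x" using True r qpos[of c] by (simp add: f_def c_def)
    have "{y. 0 < f y} = cinv X i ` ball c r"
    proof (intro equalityI subsetI)
      fix y assume "y \<in> {y. 0 < f y}"
      then have "y \<in> cdom X i" "crd X i y \<in> ball c r" using qpos by (auto simp: f_def split: if_splits)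
      then show "y \<in> cinv X i ` ball c r" by (metis cinv_crd image_eqI)
    next
      fix y assume "y \<in> cinv X i ` ball c r"
      then obtain z where z: "z \<in> ball c r" "y = cinv X i z" by blast
      then have "z \<in> cimg X i" using r by auto
      then show "y \<in> {y. 0 < f y}" using z qpos[of z] cinv_in by (simp add: f_def)
    qed
    then show "open {y. 0 < f y}" using r by (auto intro!: open_cinv_image)
    show "smooth_on (cimg X j) (\<lambda>z. f (cinv X j z))" for j
    proof (rule smooth_on_local[OF open_cimg])
      fix z assume z: "z \<in> cimg X j"
      show "\<exists>T. open T \<and> z \<in> T \<and> smooth_on T (\<lambda>z. f (cinv X j z))"
      proof (cases "cinv X j z \<in> cdom X i")
        case True
        have "smooth_on (ovl j i) (\<lambda>z. q (trans j i z))"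
          by (rule smooth_on_compose[OF open_ovl open_UNIV _ q_smooth smooth_on_trans]) simp
        moreover have "smooth_on (ovl j i) (\<lambda>z. q (trans j i z)) \<longleftrightarrow> smooth_on (ovl j i) (\<lambda>z. f (cinv X j z))"
          by (rule smooth_on_cong[OF open_ovl]) (use ovl_cinv in \<open>auto simp: f_def trans_def\<close>)
        moreover have "z \<in> ovl j i" using ovlI[of "cinv X j z" j i] z True cinv_in by simp
        ultimately show ?thesis using open_ovl by blast
      next
        case False
        let ?T = "crd X j ` (cdom X j - K)"
        have o: "open ?T" using K by (intro open_crd_image open_Diff open_cdom compact_imp_closed) auto
        moreover have "z \<in> ?T" using False K z cinv_in by (force intro!: image_eqI[of _ _ "cinv X j z"])
        moreover have "smooth_on ?T (\<lambda>z. f (cinv X j z)) \<longleftrightarrow> smooth_on ?T (\<lambda>z. 0 :: real)"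
          by (rule smooth_on_cong[OF o]) (auto simp: f0)
        ultimately show ?thesis using smooth_on_const by blast
      qed
    qed
  qed
qed

lemma exists_partition_of_unity: "\<exists>\<psi>. partition_of_unity X \<psi>"
proof -
  have "\<forall>x. \<exists>i. x \<in> cdom X i" using cdom_cover by auto
  then obtain ix where ix: "\<And>x. x \<in> cdom X (ix x)" by metis
  define Q where "Q x f K \<longleftrightarrow> compact K \<and> K \<subseteq> cdom X (ix x) \<and> (\<forall>y. 0 \<le> f y) \<and> (\<forall>y. y \<notin> K \<longrightarrow> f y = (0::real)) \<and>
    (\<forall>j. smooth_on (cimg X j) (\<lambda>z. f (cinv X j z))) \<and> open {y. 0 < f y} \<and> 0 < f x" for x f K
  have "\<exists>f K. Q x f K" for x
    unfolding Q_def using exists_chart_bump[of "ix x" x] ix[of x] by simp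
  then obtain f K where Q: "\<And>x. Q x (f x) (K x)" by metis
  have fK: "\<And>x. compact (K x)" "\<And>x. K x \<subseteq> cdom X (ix x)" "\<And>x y. (0::real) \<le> f x y"
    "\<And>x y. y \<notin> K x \<Longrightarrow> f x y = 0" "\<And>x j. smooth_on (cimg X j) (\<lambda>z. f x (cinv X j z))" "\<And>x. open {y. 0 < f x y}" "\<And>x. 0 < f x x"
    using Q unfolding Q_def by blast+
  have cover: "UNIV \<subseteq> (\<Union>x\<in>UNIV. {y. 0 < f x y})" using fK(7) by auto
  obtain F where "F \<subseteq> UNIV" and F: "finite F" "UNIV \<subseteq> (\<Union>x\<in>F. {y. 0 < f x y})"
    by (rule compactE_image[OF compact_X fK(6) cover])
  define s where "s y = (\<Sum>x\<in>F. f x y)" for y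
  have s: "0 < s y" for y
  proof -
    obtain x where "x \<in> F" "0 < f x y" using F by auto
    then show ?thesis unfolding s_def using F fK(3) by (intro sum_pos2[of F x]) auto
  qed
  \<comment> \<open>The finite subcover may choose several bumps in the same chart; for a partition
    indexed by charts these are added up.\<close>
  define \<psi> where "\<psi> i y = (\<Sum>x\<in>{x\<in>F. ix x = i}. f x y) / s y" for i y
  have nz: "\<exists>x\<in>F. ix x = i \<and> y \<in> K x" if "\<psi> i y \<noteq> 0" for i y
  proof (rule ccontr)
    assume "\<not> ?thesis"
    then have "(\<Sum>x\<in>{x\<in>F. ix x = i}. f x y) = 0" by (intro sum.neutral) (use fK(4) in auto)
    then show False using that by (simp add: \<psi>_def)
  qed
  have sub: "{i. \<exists>x. \<psi> i x \<noteq> 0} \<subseteq> ix ` F" using nz by auto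
  have "partition_of_unity X \<psi>"
    unfolding partition_of_unity_def
  proof (intro conjI allI)
    show fin: "finite {i. \<exists>x. \<psi> i x \<noteq> 0}" using sub F finite_surj by blast
    show "0 \<le> \<psi> i x" for i x using s[of x] fK(3) by (simp add: \<psi>_def sum_nonneg)
    show "closure {x. \<psi> i x \<noteq> 0} \<subseteq> cdom X i" for i
    proof -
      have "closed (\<Union>x\<in>{x\<in>F. ix x = i}. K x)" using F fK(1) by (intro closed_UN) (auto intro: compact_imp_closed)
      moreover have "{x. \<psi> i x \<noteq> 0} \<subseteq> (\<Union>x\<in>{x\<in>F. ix x = i}. K x)" using nz by auto
      ultimately have "closure {x. \<psi> i x \<noteq> 0} \<subseteq> (\<Union>x\<in>{x\<in>F. ix x = i}. K x)" by (rule closure_minimal[rotated])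
      then show ?thesis using fK(2) by blast
    qed
    show "smooth_on (cimg X j) (\<lambda>z. \<psi> i (cinv X j z))" for i j
      unfolding \<psi>_def s_def
      by (intro smooth_on_divide smooth_on_sum open_cimg fK(5)) (use s in \<open>simp add: s_def less_imp_neq[symmetric]\<close>)
    show "(\<Sum>i | \<exists>y. \<psi> i y \<noteq> 0. \<psi> i x) = 1" for x
    proof -
      have "(\<Sum>i | \<exists>y. \<psi> i y \<noteq> 0. \<psi> i x) = (\<Sum>i\<in>ix ` F. \<psi> i x)"
        by (rule sum.mono_neutral_left) (use F sub in auto)
      also have "\<dots> = (\<Sum>i\<in>ix ` F. \<Sum>y\<in>{y\<in>F. ix y = i}. f y x) / s x"
        by (simp add: \<psi>_def sum_divide_distrib)
      also have "(\<Sum>i\<in>ix ` F. \<Sum>y\<in>{y\<in>F. ix y = i}. f y x) = s x"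
        unfolding s_def by (rule sum.group) (use F in auto)
      finally show ?thesis using s[of x] by simp
    qed
  qed
  then show ?thesis by blast
qed

end

section \<open>The trace of the symmetrised bracket\<close>

definition mprod :: "('v, complex^'r::finite^'r) aform list \<Rightarrow> ('v, complex^'r^'r) aform" where
  "mprod xs = foldr mwedge xs (form_unit (mat 1))"

lemma mprod_append: "mprod (xs @ ys) = mwedge (mprod xs) (mprod ys)"
  unfolding mprod_def by (induction xs) (simp_all add: mwedge_assoc)

lemma mprod_Cons: "mprod (x # xs) = mwedge x (mprod xs)"
  by (simp add: mprod_def)

lemma mprod_replicate: "mprod (replicate k B) = mpow B k"
  by (induction k) (simp_all add: mprod_def mpow_Suc)

context
  fixes B u' u :: "('v, complex^'r::finite^'r) aform"
  assumes B: "gsg B = B" and u': "gsg u' = - u'" and u: "gsg u = - u"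
begin

text \<open>Under the trace a word is cyclic. Up to sign, all that matters of it is the number
  \<open>b\<close> of factors \<open>B\<close> met on the way from \<open>u'\<close> to
  \<open>u\<close>.\<close>

definition cyc_tr :: "nat \<Rightarrow> nat \<Rightarrow> ('v, complex) aform" where
  "cyc_tr m b = ftr (mwedge u' (mwedge (mpow B b) (mwedge u (mpow B (m - b)))))"

definition pos_word :: "nat \<Rightarrow> nat \<Rightarrow> nat \<Rightarrow> ('v, complex^'r^'r) aform" where
  "pos_word m p q = mprod (map (\<lambda>k. if k = p then u' else if k = q then u else B) [0..<m + 2])"

lemma map_upt_two_positions:
  assumes "p < q" "q < n"
  shows "map (\<lambda>k. if k = p then x else if k = q then y else z) [0..<n] =
     replicate p z @ x # replicate (q - p - 1) z @ y # replicate (n - 1 - q) z"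
  by (rule nth_equalityI) (use assms in \<open>auto simp: nth_append nth_Cons' less_diff_conv\<close>)

lemma ftr_pos_word_less:
  assumes "p < q" "q < m + 2"
  shows "ftr (pos_word m p q) = cyc_tr m (q - p - 1)"
proof -
  have "ftr (pos_word m p q) = ftr (mwedge (mpow B p) (mwedge u' (mwedge (mpow B (q - p - 1)) (mwedge u (mpow B (m + 2 - 1 - q))))))"
    unfolding pos_word_def map_upt_two_positions[OF assms] by (simp add: mprod_append mprod_Cons mprod_replicate)
  also have "\<dots> = ftr (mwedge u' (mwedge (mpow B (q - p - 1)) (mwedge u (mwedge (mpow B (m + 2 - 1 - q)) (mpow B p)))))"
    by (subst ftr_even) (simp_all add: gsg_mpow[OF B] mwedge_assoc)
  also have "mwedge (mpow B (m + 2 - 1 - q)) (mpow B p) = mpow B (m - (q - p - 1))"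
  proof -
    have "m - (q - p - 1) = (m + 2 - 1 - q) + p" using assms by auto
    then show ?thesis by (simp add: mpow_add)
  qed
  finally show ?thesis by (simp add: cyc_tr_def)
qed

text \<open>Here \<open>u\<close> comes first and has to be moved around the trace to the end. The
  rest of the word is odd because it contains \<open>u'\<close>, which costs the minus sign; the
  even factors \<open>B\<close> move freely.\<close>

lemma ftr_pos_word_greater:
  assumes "q < p" "p < m + 2"
  shows "ftr (pos_word m p q) = - cyc_tr m (m + 1 - p + q)"
proof -
  have sw: "(\<lambda>k. if k = p then u' else if k = q then u else B) = (\<lambda>k. if k = q then u else if k = p then u' else B)"
    using assms by auto
  have "ftr (pos_word m p q) = ftr (mwedge (mpow B q) (mwedge u (mwedge (mpow B (p - q - 1)) (mwedge u' (mpow B (m + 2 - 1 - p))))))"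
    unfolding pos_word_def sw map_upt_two_positions[OF assms] by (simp add: mprod_append mprod_Cons mprod_replicate)
  also have "\<dots> = ftr (mwedge u (mwedge (mpow B (p - q - 1)) (mwedge u' (mwedge (mpow B (m + 2 - 1 - p)) (mpow B q)))))"
    by (subst ftr_even) (simp_all add: gsg_mpow[OF B] mwedge_assoc)
  also have "mwedge (mpow B (m + 2 - 1 - p)) (mpow B q) = mpow B (m + 1 - p + q)"
    by (simp add: mpow_add)
  also have "ftr (mwedge u (mwedge (mpow B (p - q - 1)) (mwedge u' (mpow B (m + 1 - p + q))))) =
     - ftr (mwedge (mpow B (p - q - 1)) (mwedge u' (mwedge (mpow B (m + 1 - p + q)) u)))"
    by (subst ftr_odd[OF u]) (simp add: gsg_mwedge gsg_mpow[OF B] u' mwedge_linear mwedge_assoc)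
  also have "ftr (mwedge (mpow B (p - q - 1)) (mwedge u' (mwedge (mpow B (m + 1 - p + q)) u))) =
     ftr (mwedge u' (mwedge (mpow B (m + 1 - p + q)) (mwedge u (mpow B (p - q - 1)))))"
    by (subst ftr_even) (simp_all add: gsg_mpow[OF B] mwedge_assoc)
  also have "p - q - 1 = m - (m + 1 - p + q)" using assms by auto
  finally show ?thesis by (simp only: cyc_tr_def)
qed

text \<open>A reversed pair with a factor of degree 2 contributes an even number, so only the pair
  \<open>u'\<close>, \<open>u\<close> counts, and it is reversed precisely when \<open>u\<close>
  stands before \<open>u'\<close>. The same sign is produced by graded cyclicity, and the two cancel
  in the next lemma.\<close>

lemma grsgn_parity:
  assumes \<sigma>: "\<sigma> permutes {..<m + 2}" and p: "\<sigma> p = m" and q: "\<sigma> q = m + 1"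
  shows "(-1 :: real) ^ grsgn (replicate m 2 @ [1, 1]) \<sigma> = (if q < p then -1 else 1)"
proof -
  let ?ds = "replicate m (2::nat) @ [1, 1]"
  let ?A = "{(a, b). a < b \<and> b < length ?ds \<and> \<sigma> b < \<sigma> a}"
  have fin: "finite ?A" by (rule finite_subset[of _ "{..<m+2} \<times> {..<m+2}"]) auto
  have inj: "\<sigma> a = \<sigma> b \<longleftrightarrow> a = b" for a b using permutes_inj[OF \<sigma>] by (auto dest: injD)
  have pq: "p < m + 2" "q < m + 2" using permutes_in_image[OF \<sigma>, of p] permutes_in_image[OF \<sigma>, of q] p q by auto
  have ev: "even (case x of (a, b) \<Rightarrow> ?ds ! \<sigma> a * ?ds ! \<sigma> b)" if "x \<in> ?A - {(q, p)}" for x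
  proof -
    obtain a b where x: "x = (a, b)" by (cases x)
    with that have ab: "a < b" "b < m + 2" "\<sigma> b < \<sigma> a" "(a, b) \<noteq> (q, p)" by auto
    have "\<sigma> a < m + 2" using permutes_in_image[OF \<sigma>, of a] ab by auto
    have "\<sigma> b < m"
    proof (rule ccontr)
      assume "\<not> \<sigma> b < m"
      then have "\<sigma> b = m" "\<sigma> a = m + 1" using ab \<open>\<sigma> a < m + 2\<close> by auto
      then have "b = p" "a = q" using p q inj by metis+
      then show False using ab by simp
    qed
    then have "?ds ! \<sigma> b = 2" by (simp add: nth_append)
    then show ?thesis by (simp add: x)
  qed
  show ?thesis
  proof (cases "q < p")
    case True
    then have "(q, p) \<in> ?A" using p q pq by simp
    then have "grsgn ?ds \<sigma> = ?ds ! \<sigma> q * ?ds ! \<sigma> p + (\<Sum>(a, b)\<in>?A - {(q, p)}. ?ds ! \<sigma> a * ?ds ! \<sigma> b)"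
      unfolding grsgn_def by (subst sum.remove[OF fin]) auto
    moreover have "even (\<Sum>(a, b)\<in>?A - {(q, p)}. ?ds ! \<sigma> a * ?ds ! \<sigma> b)"
      by (rule dvd_sum) (rule ev)
    ultimately show ?thesis using True by (simp add: p q nth_append)
  next
    case False
    then have "(q, p) \<notin> ?A" by auto
    then have "even (grsgn ?ds \<sigma>)"
      unfolding grsgn_def by (intro dvd_sum ev) auto
    then show ?thesis using False by simp
  qed
qed

lemma ftr_sym_wedge_summand:
  assumes \<sigma>: "\<sigma> permutes {..<m + 2}"
  shows "(-1) ^ grsgn (replicate m 2 @ [1, 1]) \<sigma> *\<^sub>R
      ftr (mprod (map (\<lambda>k. snd ((replicate m (2::nat, B) @ [(1, u'), (1, u)]) ! \<sigma> k)) [0..<m + 2])) vs =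
    (if inv \<sigma> m < inv \<sigma> (m + 1) then cyc_tr m (inv \<sigma> (m + 1) - inv \<sigma> m - 1) vs
     else cyc_tr m (m + 1 - inv \<sigma> m + inv \<sigma> (m + 1)) vs)"
proof -
  define p where "p = inv \<sigma> m"
  define q where "q = inv \<sigma> (m + 1)"
  have p: "\<sigma> p = m" and q: "\<sigma> q = m + 1" using permutes_inverses[OF \<sigma>] by (simp_all add: p_def q_def)
  have inj: "\<sigma> a = \<sigma> b \<longleftrightarrow> a = b" for a b using permutes_inj[OF \<sigma>] by (auto dest: injD)
  have pq: "p < m + 2" "q < m + 2" using permutes_in_image[OF \<sigma>, of p] permutes_in_image[OF \<sigma>, of q] p q by auto
  have "p \<noteq> q" using p q by auto
  have "map (\<lambda>k. snd ((replicate m (2::nat, B) @ [(1, u'), (1, u)]) ! \<sigma> k)) [0..<m + 2] =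
    map (\<lambda>k. if k = p then u' else if k = q then u else B) [0..<m + 2]"
  proof (rule map_cong[OF refl])
    fix k assume "k \<in> set [0..<m + 2]"
    then have k: "\<sigma> k < m + 2" using permutes_in_image[OF \<sigma>, of k] by auto
    show "snd ((replicate m (2::nat, B) @ [(1, u'), (1, u)]) ! \<sigma> k) = (if k = p then u' else if k = q then u else B)"
    proof (cases "\<sigma> k < m")
      case True
      then have "k \<noteq> p" "k \<noteq> q" using p q by auto
      then show ?thesis using True by (simp add: nth_append)
    next
      case False
      then consider "\<sigma> k = m" | "\<sigma> k = m + 1" using k by linarith
      then show ?thesis
      proof cases
        case 1
        then have "k = p" using p inj by metis
        then show ?thesis using p by (simp add: nth_append)
      next
        case 2
        then have "k = q" using q inj by metis
        then show ?thesis using q \<open>p \<noteq> q\<close> by (simp add: nth_append)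
      qed
    qed
  qed
  then have w: "mprod (map (\<lambda>k. snd ((replicate m (2::nat, B) @ [(1, u'), (1, u)]) ! \<sigma> k)) [0..<m + 2]) = pos_word m p q"
    by (simp only: pos_word_def)
  show ?thesis
  proof (cases "p < q")
    case True
    then show ?thesis
      unfolding w grsgn_parity[OF \<sigma> p q] ftr_pos_word_less[OF True pq(2)] p_def[symmetric] q_def[symmetric] by simp
  next
    case False
    then have "q < p" using \<open>p \<noteq> q\<close> by simp
    then show ?thesis
      unfolding w grsgn_parity[OF \<sigma> p q] ftr_pos_word_greater[OF \<open>q < p\<close> pq(1)] p_def[symmetric] q_def[symmetric] by simp
  qed
qed

text \<open>Each ordered pair of distinct values at \<open>m\<close> and \<open>m + 1\<close> is
  taken by \<open>m!\<close> permutations. The two points are peeled off by transpositions; what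
  remains permutes the numbers below \<open>m\<close> and fixes both points.\<close>

lemma sum_permutes_two_values:
  fixes F :: "nat \<Rightarrow> nat \<Rightarrow> 'c::real_vector"
  shows "(\<Sum>\<sigma> | \<sigma> permutes {..<m + 2}. F (\<sigma> m) (\<sigma> (m + 1))) = fact m *\<^sub>R (\<Sum>q<m + 2. \<Sum>p\<in>{..<m + 2} - {q}. F p q)"
proof -
  have I: "{..<m + 2} = insert (m + 1) (insert m {..<m})" by auto
  have fix_pt: "r k = k" if "r permutes {..<m}" "k \<ge> m" for r :: "nat \<Rightarrow> nat" and k
    using that by (auto simp: permutes_def)
  have "(\<Sum>\<sigma> | \<sigma> permutes {..<m + 2}. F (\<sigma> m) (\<sigma> (m + 1))) =
    (\<Sum>b\<in>insert (m + 1) (insert m {..<m}). \<Sum>c\<in>insert m {..<m}. \<Sum>r | r permutes {..<m}.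
       F ((Transposition.transpose (m + 1) b \<circ> (Transposition.transpose m c \<circ> r)) m) ((Transposition.transpose (m + 1) b \<circ> (Transposition.transpose m c \<circ> r)) (m + 1)))"
    unfolding I by (subst sum_over_permutations_insert, simp, simp, subst sum_over_permutations_insert) auto
  also have "\<dots> = (\<Sum>b\<in>insert (m + 1) (insert m {..<m}). \<Sum>c\<in>insert m {..<m}. \<Sum>r | r permutes {..<m}.
       F (Transposition.transpose (m + 1) b c) b)"
    by (intro sum.cong refl) (auto simp: fix_pt Transposition.transpose_def)
  also have "\<dots> = (\<Sum>b\<in>insert (m + 1) (insert m {..<m}). fact m *\<^sub>R (\<Sum>c\<in>insert m {..<m}. F (Transposition.transpose (m + 1) b c) b))"
    by (simp add: card_permutations[of _ m] sum_constant_scaleR scaleR_sum_right scaleR_right_distrib)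
  also have "\<dots> = (\<Sum>b<m + 2. fact m *\<^sub>R (\<Sum>p\<in>{..<m + 2} - {b}. F p b))"
  proof (rule sum.cong)
    fix b assume b: "b \<in> {..<m + 2}"
    have "(\<Sum>c\<in>insert m {..<m}. F (Transposition.transpose (m + 1) b c) b) = (\<Sum>p\<in>{..<m + 2} - {b}. F p b)"
      by (rule sum.reindex_bij_witness[of _ "Transposition.transpose (m + 1) b" "Transposition.transpose (m + 1) b"])
        (use b in \<open>auto simp: Transposition.transpose_def split: if_splits\<close>)
    then show "fact m *\<^sub>R (\<Sum>c\<in>insert m {..<m}. F (Transposition.transpose (m + 1) b c) b) =
        fact m *\<^sub>R (\<Sum>p\<in>{..<m + 2} - {b}. F p b)" by simp
  qed auto
  finally show ?thesis unfolding scaleR_sum_right .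
qed

text \<open>With the position \<open>q\<close> of \<open>u\<close> fixed, the cyclic distance from
  \<open>u'\<close> to \<open>u\<close> takes every value from 0 to \<open>m\<close> once: the
  values below \<open>q\<close> come from \<open>p < q\<close>, the others from
  \<open>p > q\<close>.\<close>

lemma sum_cyclic_distances:
  fixes t :: "nat \<Rightarrow> 'c::comm_monoid_add"
  assumes q: "q < m + 2"
  shows "(\<Sum>p\<in>{..<m + 2} - {q}. if p < q then t (q - p - 1) else t (m + 1 - p + q)) = (\<Sum>b\<le>m. t b)"
proof -
  let ?g = "\<lambda>p. if p < q then t (q - p - 1) else t (m + 1 - p + q)"
  have "{..<m + 2} - {q} = {..<q} \<union> {q<..<m + 2}" using q by auto
  then have "sum ?g ({..<m + 2} - {q}) = sum ?g ({..<q} \<union> {q<..<m + 2})" by (rule arg_cong)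
  also have "\<dots> = sum ?g {..<q} + sum ?g {q<..<m + 2}"
    by (rule sum.union_disjoint) auto
  also have "sum ?g {..<q} = (\<Sum>p\<in>{..<q}. t (q - p - 1))"
    by (rule sum.cong) auto
  also have "sum ?g {q<..<m + 2} = (\<Sum>p\<in>{q<..<m + 2}. t (m + 1 - p + q))"
    by (rule sum.cong) auto
  also have "(\<Sum>p\<in>{..<q}. t (q - p - 1)) = (\<Sum>b<q. t b)"
    by (rule sum.reindex_bij_witness[of _ "\<lambda>b. q - b - 1" "\<lambda>p. q - p - 1"]) auto
  also have "(\<Sum>p\<in>{q<..<m + 2}. t (m + 1 - p + q)) = (\<Sum>b\<in>{q..m}. t b)"
    by (rule sum.reindex_bij_witness[of _ "\<lambda>b. m + 1 - b + q" "\<lambda>p. m + 1 - p + q"]) (use q in auto)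
  also have "(\<Sum>b<q. t b) + (\<Sum>b\<in>{q..m}. t b) = (\<Sum>b\<in>{..<q} \<union> {q..m}. t b)"
    by (rule sum.union_disjoint[symmetric]) auto
  also have "{..<q} \<union> {q..m} = {..m}" using q by auto
  finally show ?thesis .
qed

text \<open>Among the \<open>(m + 2)!\<close> permutations, with \<open>m = j - 1\<close>, each
  cyclic word occurs \<open>m! (m + 2)\<close> times: \<open>m + 2\<close> positions of
  \<open>u\<close> and \<open>m!\<close> arrangements of the factors \<open>B\<close>. The quotient
  is \<open>1 / j\<close>.\<close>

lemma ftr_sym_wedge:
  assumes j: "1 \<le> j"
  shows "ftr (sym_wedge (replicate (j - 1) (2, B) @ [(1, u'), (1, u)])) vs =
    (\<Sum>b<j. ftr (mwedge u' (mwedge (mpow B b) (mwedge u (mpow B (j - 1 - b))))) vs) / of_nat j"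
proof -
  define m where "m = j - 1"
  have jm: "j = Suc m" using j by (simp add: m_def)
  let ?Bs = "replicate m (2::nat, B) @ [(1, u'), (1, u)]"
  have len: "length ?Bs = m + 2" by simp
  have fst: "map fst ?Bs = replicate m 2 @ [1, 1]" by simp
  let ?F = "\<lambda>p q. if p < q then cyc_tr m (q - p - 1) vs else cyc_tr m (m + 1 - p + q) vs"
  have "ftr (sym_wedge ?Bs) vs = (1 / fact (m + 2)) *\<^sub>R (\<Sum>\<sigma> | \<sigma> permutes {..<m + 2}.
      (-1) ^ grsgn (replicate m 2 @ [1, 1]) \<sigma> *\<^sub>R ftr (mprod (map (\<lambda>k. snd (?Bs ! \<sigma> k)) [0..<m + 2])) vs)"
    unfolding ftr_def sym_wedge_def mprod_def len fst
    by (simp add: linear_cmul[OF linear_trace] linear_sum[OF linear_trace] del: upt_Suc)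
  also have "(\<Sum>\<sigma> | \<sigma> permutes {..<m + 2}.
      (-1) ^ grsgn (replicate m 2 @ [1, 1]) \<sigma> *\<^sub>R ftr (mprod (map (\<lambda>k. snd (?Bs ! \<sigma> k)) [0..<m + 2])) vs)
     = (\<Sum>\<sigma> | \<sigma> permutes {..<m + 2}. ?F (inv \<sigma> m) (inv \<sigma> (m + 1)))"
    by (intro sum.cong refl ftr_sym_wedge_summand) simp
  \<comment> \<open>\<sigma> maps positions to factors, while the summand depends on the positions
    of two given factors; summing over the inverse permutations removes the difference.\<close>
  also have "\<dots> = (\<Sum>\<sigma> | \<sigma> permutes {..<m + 2}. ?F (\<sigma> m) (\<sigma> (m + 1)))"
    by (rule sum_permutations_inverse[symmetric])
  also have "\<dots> = fact m *\<^sub>R (\<Sum>q<m + 2. \<Sum>p\<in>{..<m + 2} - {q}. ?F p q)"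
    by (rule sum_permutes_two_values)
  also have "(\<Sum>q<m + 2. \<Sum>p\<in>{..<m + 2} - {q}. ?F p q) = (\<Sum>q<m + 2. \<Sum>b\<le>m. cyc_tr m b vs)"
    by (intro sum.cong refl sum_cyclic_distances) simp
  also have "\<dots> = of_nat (m + 2) * (\<Sum>b<j. cyc_tr m b vs)"
    by (simp add: jm lessThan_Suc_atMost)
  also have "(1 / fact (m + 2)) *\<^sub>R fact m *\<^sub>R (of_nat (m + 2) * (\<Sum>b<j. cyc_tr m b vs)) = (\<Sum>b<j. cyc_tr m b vs) / of_nat j"
  proof -
    have r: "1 / fact (m + 2) * fact m * real (m + 2) = 1 / real j"
      by (simp add: jm divide_simps)
    have "(1 / fact (m + 2)) *\<^sub>R fact m *\<^sub>R (of_nat (m + 2) * S) = of_real (1 / fact (m + 2) * fact m * real (m + 2)) * S" for S :: complex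
      by (simp only: scaleR_conv_of_real of_real_mult of_real_of_nat_eq mult.assoc)
    then show ?thesis unfolding r by simp
  qed
  finally show ?thesis by (simp add: m_def cyc_tr_def)
qed

end

section \<open>Hermitian metrics in a chart\<close>

text \<open>Complex scaling in the form in which the definitions of curvature and charge express it;
  \<open>scaleR\<close> covers real factors only.\<close>

definition cscale :: "complex \<Rightarrow> complex^'r::finite^'r \<Rightarrow> complex^'r^'r" where
  "cscale c A = mat c ** A"

lemma cscale_nth: "cscale c A $ i $ j = c * A $ i $ j"
  by (simp add: cscale_def mat_def matrix_matrix_mult_def if_distrib[of "\<lambda>x. x * _"] cong: if_cong)

lemma cscale_add: "cscale c (A + B) = cscale c A + cscale c B"
  and cscale_diff: "cscale c (A - B) = cscale c A - cscale c B"
  and cscale_minus: "cscale c (- A) = - cscale c A"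
  and cscale_zero: "cscale c 0 = 0"
  and cscale_cscale: "cscale c (cscale d A) = cscale (c * d) A"
  and cscale_scaleR: "cscale c (r *\<^sub>R A) = r *\<^sub>R cscale c A"
  by (simp_all add: vec_eq_iff cscale_nth algebra_simps)

lemma cscale_left_minus: "cscale (- c) A = - cscale c A"
  by (simp add: vec_eq_iff cscale_nth)

lemma cscale_mult_left: "cscale c A ** B = cscale c (A ** B)"
  by (simp add: cscale_def matrix_mul_assoc)

lemma cscale_mult_right: "A ** cscale c B = cscale c (A ** B)"
  unfolding cscale_def by (metis mat_mult_commute matrix_mul_assoc)

lemma linear_cscale: "linear (cscale c)"
  by (rule linearI) (simp_all add: cscale_add cscale_scaleR)

lemma bounded_linear_cscale: "bounded_linear (cscale c)"
  using linear_cscale linear_conv_bounded_linear by blast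

lemmas cscale_simps = cscale_add cscale_diff cscale_minus cscale_cscale cscale_mult_left cscale_mult_right

lemmas mult_simps = bilinear_ladd[OF bilinear_matrix_mult] bilinear_radd[OF bilinear_matrix_mult]
  bilinear_lsub[OF bilinear_matrix_mult] bilinear_rsub[OF bilinear_matrix_mult]
  bilinear_lneg[OF bilinear_matrix_mult] bilinear_rneg[OF bilinear_matrix_mult] matrix_mul_assoc[symmetric]

lemma conj_transpose_mult: "conj_transpose (A ** B) = conj_transpose B ** conj_transpose A"
  by (simp add: conj_transpose_def matrix_matrix_mult_def vec_eq_iff mult.commute)

lemma conj_transpose_cscale: "conj_transpose (cscale c A) = cscale (cnj c) (conj_transpose A)"
  by (simp add: conj_transpose_def cscale_nth vec_eq_iff)

lemma conj_transpose_add: "conj_transpose (A + B) = conj_transpose A + conj_transpose B"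
  and conj_transpose_diff: "conj_transpose (A - B) = conj_transpose A - conj_transpose B"
  and conj_transpose_zero: "conj_transpose 0 = 0"
  and conj_transpose_mat: "conj_transpose (mat c) = mat (cnj c)"
  and conj_transpose_conj_transpose: "conj_transpose (conj_transpose A) = A"
  by (simp_all add: conj_transpose_def vec_eq_iff mat_def)

lemma linear_conj_transpose: "linear (conj_transpose :: complex^'r::finite^'r \<Rightarrow> _)"
  by (rule linearI) (simp_all add: conj_transpose_def vec_eq_iff)

lemma bounded_linear_conj_transpose: "bounded_linear (conj_transpose :: complex^'r::finite^'r \<Rightarrow> _)"
  using linear_conj_transpose linear_conv_bounded_linear by blast

lemma matrix_inv_cancel:
  assumes "invertible (A :: complex^'r::finite^'r)"
  shows "matrix_inv A ** A = mat 1" "A ** matrix_inv A = mat 1"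
    "matrix_inv A ** (A ** B) = B" "A ** (matrix_inv A ** B) = B"
proof -
  show 1: "matrix_inv A ** A = mat 1" "A ** matrix_inv A = mat 1"
    using assms unfolding invertible_def matrix_inv_def by (metis (mono_tags, lifting) someI_ex)+
  show "matrix_inv A ** (A ** B) = B" "A ** (matrix_inv A ** B) = B"
    by (simp_all add: matrix_mul_assoc 1)
qed

lemma matrix_inv_eqI:
  assumes "invertible A" "A ** B = mat 1"
  shows "matrix_inv A = (B :: complex^'r::finite^'r)"
  using matrix_inv_cancel(3)[OF assms(1), of B] assms(2) by simp

lemma conj_transpose_matrix_inv:
  assumes "invertible A" "conj_transpose A = A"
  shows "conj_transpose (matrix_inv A) = matrix_inv A"
proof -
  have "conj_transpose (matrix_inv A ** A) = mat 1" by (simp add: matrix_inv_cancel[OF assms(1)] conj_transpose_mat)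
  then have "A ** conj_transpose (matrix_inv A) = mat 1" by (simp add: conj_transpose_mult assms(2))
  then show ?thesis using matrix_inv_eqI[OF assms(1)] by metis
qed

lemma smooth_on_det:
  fixes M :: "'w::real_normed_vector \<Rightarrow> complex^'r::finite^'r"
  assumes W: "open W" and "\<And>i j. smooth_on W (\<lambda>w. M w $ i $ j)"
  shows "smooth_on W (\<lambda>w. det (M w))"
  unfolding det_def by (intro smooth_on_sum smooth_on_mult smooth_on_const smooth_on_prod W assms(2))

text \<open>By Cramer's rule the entries of the inverse are quotients of determinants, hence
  smooth.\<close>

lemma smooth_on_matrix_inv:
  fixes H :: "'w::real_normed_vector \<Rightarrow> complex^'r::finite^'r"
  assumes W: "open W" and H: "smooth_on W H" and inv: "\<And>w. w \<in> W \<Longrightarrow> invertible (H w)"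
  shows "smooth_on W (\<lambda>w. matrix_inv (H w))"
proof -
  have Hij: "smooth_on W (\<lambda>w. H w $ i $ j)" for i j
    by (intro smooth_on_vec_nth W H)
  let ?C = "\<lambda>w. (\<chi> k l. det (\<chi> i j. if j = k then mat 1 $ i $ l else H w $ i $ j) / det (H w)) :: complex^'r^'r"
  have "matrix_inv (H w) = ?C w" if "w \<in> W" for w
  proof -
    have d: "det (H w) \<noteq> 0" using inv[OF that] by (simp add: invertible_det_nz)
    have "H w *v (\<chi> k. ?C w $ k $ l) = (\<chi> i. mat 1 $ i $ l)" for l
      using cramer[OF d, of "\<chi> k. ?C w $ k $ l" "\<chi> i. mat 1 $ i $ l"] by (simp cong: if_cong)
    then have "H w ** ?C w = mat 1"
      by (simp add: vec_eq_iff matrix_matrix_mult_def matrix_vector_mult_def)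
    then show ?thesis by (rule matrix_inv_eqI[OF inv[OF that]])
  qed
  moreover have "smooth_on W ?C"
  proof (intro smooth_on_vec W)
    fix k l
    have "smooth_on W (\<lambda>w. det (\<chi> i j. if j = k then mat 1 $ i $ l else H w $ i $ j) / det (H w))"
    proof (intro smooth_on_divide smooth_on_det W)
      show "smooth_on W (\<lambda>w. (\<chi> i j. if j = k then mat 1 $ i $ l else H w $ i $ j) $ i $ j)" for i j
        by (cases "j = k") (simp_all add: smooth_on_const Hij)
    qed (use inv Hij in \<open>auto simp: invertible_det_nz\<close>)
    then show "smooth_on W (\<lambda>w. ?C w $ k $ l)" by simp
  qed
  ultimately show ?thesis using smooth_on_cong[OF W, of "\<lambda>w. matrix_inv (H w)" ?C] by simp
qed

text \<open>One chart with one trivialisation, for a metric that may depend on parameters. A point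
  \<open>w\<close> comprises parameters and chart coordinates, \<open>e\<close> embeds the tangent
  vectors of the chart as directions for \<open>w\<close>, and \<tau> is the direction of
  variation.\<close>

locale metric_family =
  fixes W :: "'w::real_normed_vector set" and e :: "complex^'n::finite \<Rightarrow> 'w" and \<tau> :: 'w
    and H :: "'w \<Rightarrow> complex^'r::finite^'r"
  assumes W: "open W" and e: "linear e" and H: "smooth_on W H"
    and herm: "\<And>w. w \<in> W \<Longrightarrow> conj_transpose (H w) = H w"
    and inv: "\<And>w. w \<in> W \<Longrightarrow> invertible (H w)"
begin

text \<open>The \<open>(1,0)\<close>-part of the derivative along the real tangent vector
  \<open>v\<close>; \<open>pdb\<close> is the \<open>(0,1)\<close>-part. The complex structure acts
  on \<open>v\<close> in the chart, before \<open>e\<close> is applied.\<close>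

definition pd :: "complex^'n \<Rightarrow> ('w \<Rightarrow> complex^'r^'r) \<Rightarrow> 'w \<Rightarrow> complex^'r^'r" where
  "pd v M w = cscale (1/2) (dird (e v) M w - cscale \<i> (dird (e (\<i> *s v)) M w))"

definition pdb :: "complex^'n \<Rightarrow> ('w \<Rightarrow> complex^'r^'r) \<Rightarrow> 'w \<Rightarrow> complex^'r^'r" where
  "pdb v M w = cscale (1/2) (dird (e v) M w + cscale \<i> (dird (e (\<i> *s v)) M w))"

definition Hi :: "'w \<Rightarrow> complex^'r^'r" where "Hi w = matrix_inv (H w)"

definition conn :: "'w \<Rightarrow> (complex^'n, complex^'r^'r) aform" where
  "conn w = one_form (\<lambda>v. Hi w ** pd v H w)"

definition curv :: "'w \<Rightarrow> (complex^'n, complex^'r^'r) aform" where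
  "curv w = dloc e conn w + mwedge (conn w) (conn w)"

definition ncv :: "'w \<Rightarrow> (complex^'n, complex^'r^'r) aform" where
  "ncv w vs = cscale (\<i> / (2 * of_real pi)) (curv w vs)"

definition vel :: "'w \<Rightarrow> complex^'r^'r" where
  "vel w = Hi w ** dird \<tau> H w"

definition dconn :: "'w \<Rightarrow> (complex^'n, complex^'r^'r) aform" where
  "dconn w vs = dird \<tau> (\<lambda>y. conn y vs) w"

definition dbar_vel :: "'w \<Rightarrow> complex^'n \<Rightarrow> complex^'r^'r" where
  "dbar_vel w v = pdb v vel w"

text \<open>The covariant exterior derivative that the Chern connection induces on
  \<open>End(E)\<close>-valued forms: \<open>d \<Phi>\<close> plus the graded commutator of the
  connection form with \<Phi>.\<close>

definition cov :: "('w \<Rightarrow> (complex^'n, complex^'r^'r) aform) \<Rightarrow> 'w \<Rightarrow> (complex^'n, complex^'r^'r) aform" where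
  "cov \<Phi> w = dloc e \<Phi> w + mwedge (conn w) (\<Phi> w) - mwedge (gsg (\<Phi> w)) (conn w)"

section \<open>Chern connection, curvature and their variation in one chart\<close>

lemma smooth_mult:
  fixes M N :: "'w \<Rightarrow> complex^'r^'r"
  shows "smooth_on W M \<Longrightarrow> smooth_on W N \<Longrightarrow> smooth_on W (\<lambda>w. M w ** N w)"
  by (rule smooth_on_bilinear[OF W bounded_bilinear_matrix_mult])

lemma smooth_cscale: "smooth_on W M \<Longrightarrow> smooth_on W (\<lambda>w. cscale c (M w))"
  by (rule smooth_on_linear_compose[OF W bounded_linear_cscale])

lemma smooth_Hi: "smooth_on W Hi"
  unfolding Hi_def[abs_def] by (rule smooth_on_matrix_inv[OF W H inv])

lemma smooth_pd: "smooth_on W M \<Longrightarrow> smooth_on W (pd v M)"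
  unfolding pd_def[abs_def]
  by (intro smooth_cscale smooth_on_diff smooth_on_add smooth_on_dird W; assumption)+

lemma smooth_one_form: "(\<And>v. smooth_on W (\<lambda>w. M w v)) \<Longrightarrow> smooth_on W (\<lambda>w. one_form (M w) vs)"
  unfolding one_form_def by (cases vs rule: remdups_adj.cases) (simp_all add: smooth_on_const)

lemma smooth_conn: "smooth_on W (\<lambda>w. conn w vs)"
  unfolding conn_def by (intro smooth_one_form smooth_mult smooth_Hi smooth_pd H)

lemma smooth_curv: "smooth_on W (\<lambda>w. curv w vs)"
  unfolding curv_def plus_fun_apply by (intro smooth_on_add smooth_on_dloc smooth_on_mwedge W smooth_conn)

lemma smooth_ncv: "smooth_on W (\<lambda>w. ncv w vs)"
  unfolding ncv_def by (intro smooth_cscale smooth_curv)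

lemma smooth_vel: "smooth_on W vel"
  unfolding vel_def[abs_def] by (intro smooth_mult smooth_Hi smooth_on_dird H)

lemma smooth_dconn: "smooth_on W (\<lambda>w. dconn w vs)"
  unfolding dconn_def by (intro smooth_on_dird smooth_conn)

lemma diff: "smooth_on W M \<Longrightarrow> w \<in> W \<Longrightarrow> M differentiable (at w)"
  by (rule smooth_on_differentiable)

lemma dird_mult:
  fixes M N :: "'w \<Rightarrow> complex^'r^'r"
  shows "smooth_on W M \<Longrightarrow> smooth_on W N \<Longrightarrow> w \<in> W \<Longrightarrow> dird u (\<lambda>w. M w ** N w) w = M w ** dird u N w + dird u M w ** N w"
  by (intro dird_bilinear[OF bounded_bilinear_matrix_mult] diff)

lemma dird_cscale: "smooth_on W M \<Longrightarrow> w \<in> W \<Longrightarrow> dird u (\<lambda>w. cscale c (M w)) w = cscale c (dird u M w)"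
  by (intro dird_linear_compose[OF bounded_linear_cscale] diff)

lemma Hi_cancel: "w \<in> W \<Longrightarrow> Hi w ** H w = mat 1" "w \<in> W \<Longrightarrow> H w ** Hi w = mat 1"
  "w \<in> W \<Longrightarrow> Hi w ** (H w ** B) = B" "w \<in> W \<Longrightarrow> H w ** (Hi w ** B) = B"
  unfolding Hi_def by (simp_all add: matrix_inv_cancel inv)

lemma dird_Hi:
  assumes w: "w \<in> W"
  shows "dird u Hi w = - (Hi w ** dird u H w ** Hi w)"
proof -
  have "dird u (\<lambda>w. H w ** Hi w) w = dird u (\<lambda>w. mat 1) w"
    by (rule dird_cong_open(1)[OF W w]) (rule Hi_cancel(2))
  then have "H w ** dird u Hi w + dird u H w ** Hi w = 0"
    by (simp add: dird_mult[OF H smooth_Hi w])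
  then have "Hi w ** (H w ** dird u Hi w + dird u H w ** Hi w) = Hi w ** 0" by simp
  then show ?thesis
    by (simp add: mult_simps Hi_cancel[OF w] bilinear_rzero[OF bilinear_matrix_mult] eq_neg_iff_add_eq_0)
qed

lemma pd_mult:
  "smooth_on W M \<Longrightarrow> smooth_on W N \<Longrightarrow> w \<in> W \<Longrightarrow> pd v (\<lambda>w. M w ** N w) w = M w ** pd v N w + pd v M w ** N w"
  by (simp add: pd_def dird_mult cscale_simps mult_simps algebra_simps)

lemma pd_Hi: "w \<in> W \<Longrightarrow> pd v Hi w = - (Hi w ** pd v H w ** Hi w)"
  by (simp add: pd_def dird_Hi cscale_simps mult_simps algebra_simps)

lemma pd_add_pdb: "pd v M w + pdb v M w = dird (e v) M w"
proof -
  have "pd v M w + pdb v M w = cscale (1/2) (dird (e v) M w) + cscale (1/2) (dird (e v) M w)"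
    by (simp add: pd_def pdb_def cscale_simps)
  then show ?thesis by (simp add: vec_eq_iff cscale_nth)
qed

lemma dird_pd: "smooth_on W M \<Longrightarrow> w \<in> W \<Longrightarrow> dird u (pd v M) w = pd v (dird u M) w"
proof -
  assume M: "smooth_on W M" and w: "w \<in> W"
  have "dird u (pd v M) w = cscale (1/2) (dird u (\<lambda>w. dird (e v) M w - cscale \<i> (dird (e (\<i> *s v)) M w)) w)"
    unfolding pd_def[abs_def] by (intro dird_cscale w smooth_on_diff W smooth_cscale smooth_on_dird M)
  also have "dird u (\<lambda>w. dird (e v) M w - cscale \<i> (dird (e (\<i> *s v)) M w)) w =
     dird u (dird (e v) M) w - cscale \<i> (dird u (dird (e (\<i> *s v)) M) w)"
    by (subst dird_diff) (auto intro!: diff[OF _ w] smooth_cscale smooth_on_dird M simp: dird_cscale[OF smooth_on_dird[OF M] w])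
  finally have eq: "dird u (pd v M) w = cscale (1/2) (dird u (dird (e v) M) w - cscale \<i> (dird u (dird (e (\<i> *s v)) M) w))" .
  show ?thesis unfolding eq by (simp only: pd_def dird_commute[OF W w M, of u])
qed

lemma dird_conj_transpose:
  "smooth_on W M \<Longrightarrow> w \<in> W \<Longrightarrow> dird u (\<lambda>w. conj_transpose (M w)) w = conj_transpose (dird u M w)"
  by (intro dird_linear_compose[OF bounded_linear_conj_transpose] diff)

lemma conj_transpose_pdb:
  "smooth_on W M \<Longrightarrow> w \<in> W \<Longrightarrow> conj_transpose (pdb v M w) = pd v (\<lambda>w. conj_transpose (M w)) w"
  by (simp add: pdb_def pd_def dird_conj_transpose conj_transpose_cscale conj_transpose_add cscale_left_minus cscale_simps)

lemma dird_H_herm: "w \<in> W \<Longrightarrow> conj_transpose (dird u H w) = dird u H w"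
  using dird_conj_transpose[OF H, of w u] dird_cong_open(1)[OF W, of w "\<lambda>w. conj_transpose (H w)" H u] herm by simp

lemma Hi_herm: "w \<in> W \<Longrightarrow> conj_transpose (Hi w) = Hi w"
  unfolding Hi_def by (intro conj_transpose_matrix_inv inv herm)

lemma conj_transpose_pd_H: "w \<in> W \<Longrightarrow> conj_transpose (pd v H w) = pdb v H w"
  by (simp add: pdb_def pd_def dird_H_herm conj_transpose_cscale conj_transpose_diff cscale_left_minus cscale_simps)

lemma dconn_eq: "w \<in> W \<Longrightarrow> dconn w [v] = Hi w ** pd v (dird \<tau> H) w - vel w ** (Hi w ** pd v H w)"
  by (simp add: dconn_def conn_def one_form_def dird_mult smooth_Hi smooth_pd H dird_pd dird_Hi vel_def mult_simps)

lemma conn_other: "length vs \<noteq> 1 \<Longrightarrow> conn w vs = 0"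
  unfolding conn_def one_form_def by (cases vs rule: remdups_adj.cases) auto

lemma dconn_other: "length vs \<noteq> 1 \<Longrightarrow> dconn w vs = 0"
  by (simp add: dconn_def conn_other)

lemma gsg_conn: "gsg (conn w) = - conn w"
proof (rule ext)
  show "gsg (conn w) vs = (- conn w) vs" for vs
    by (cases "length vs = 1") (simp_all add: gsg_def conn_other)
qed

lemma gsg_dconn: "gsg (dconn w) = - dconn w"
proof (rule ext)
  show "gsg (dconn w) vs = (- dconn w) vs" for vs
    by (cases "length vs = 1") (simp_all add: gsg_def dconn_other)
qed

lemma differentiable_conn: "w \<in> W \<Longrightarrow> (\<lambda>y. conn y vs) differentiable (at w)"
  by (rule diff[OF smooth_conn])

lemma gsg_curv: "w \<in> W \<Longrightarrow> gsg (curv w) = curv w"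
proof -
  assume w: "w \<in> W"
  have "dloc e (\<lambda>y. - conn y) w = - dloc e conn w"
    using dloc_linear[OF bounded_linear_minus[OF bounded_linear_ident] differentiable_conn[OF w], of e]
    by (simp add: fun_eq_iff fun_Compl_def)
  moreover have "dloc e (\<lambda>y. gsg (conn y)) w = - gsg (dloc e conn w)"
    by (rule dloc_gsg[OF differentiable_conn[OF w]])
  ultimately have "gsg (dloc e conn w) = dloc e conn w" by (simp add: gsg_conn)
  then show ?thesis by (simp add: curv_def gsg_mwedge gsg_conn mwedge_linear)
qed

lemma gsg_ncv: "w \<in> W \<Longrightarrow> gsg (ncv w) = ncv w"
  using gsg_curv[of w] by (auto simp: fun_eq_iff gsg_def ncv_def cscale_scaleR[symmetric])

lemma curv_other:
  assumes "length vs \<noteq> 2" "w \<in> W" shows "curv w vs = 0"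
proof -
  have "dloc e conn w vs = 0"
    unfolding dloc_def using assms
    by (intro sum.neutral) (auto simp: conn_other dird_def)
  moreover have "mwedge (conn w) (conn w) vs = 0"
    unfolding mwedge_def wedge_by_def
  proof (intro sum.neutral ballI)
    fix S assume S: "S \<in> Pow {..<length vs}"
    have "length (nths vs S) + length (nths vs ({..<length vs} - S)) = length vs"
    proof -
      have "{i. i < length vs \<and> i \<in> S} = S" "{i. i < length vs \<and> i \<in> {..<length vs} - S} = {..<length vs} - S" using S by auto
      moreover have "card S \<le> length vs" using card_mono[of "{..<length vs}" S] S by simp
      ultimately show ?thesis using S by (simp add: length_nths card_Diff_subset finite_subset)
    qed
    then have "length (nths vs S) \<noteq> 1 \<or> length (nths vs ({..<length vs} - S)) \<noteq> 1" using assms by linarith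
    then have "conn w (nths vs S) ** conn w (nths vs ({..<length vs} - S)) = 0"
      using conn_other bilinear_lzero[OF bilinear_matrix_mult] bilinear_rzero[OF bilinear_matrix_mult] by metis
    then show "(- 1) ^ card {(p, q). p \<in> S \<and> q \<in> {..<length vs} - S \<and> q < p} *\<^sub>R
         (conn w (nths vs S) ** conn w (nths vs ({..<length vs} - S))) = 0" by simp
  qed
  ultimately show ?thesis by (simp add: curv_def)
qed

text \<open>The factor after \<open>Hi w\<close> is anti-hermitian, which makes \<open>ncv\<close> self-adjoint.\<close>

lemma curv_two:
  assumes w: "w \<in> W"
  shows "curv w [v, v'] = Hi w ** (cscale (- \<i>/2) (dird (e v) (dird (e (\<i> *s v')) H) w - dird (e v') (dird (e (\<i> *s v)) H) w)
    - pdb v H w ** Hi w ** pd v' H w + pdb v' H w ** Hi w ** pd v H w)"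
proof -
  have dA: "dird (e v) (\<lambda>y. conn y [v']) w = Hi w ** dird (e v) (pd v' H) w
     - Hi w ** (pd v H w + pdb v H w) ** Hi w ** pd v' H w" for v v'
    by (simp add: conn_def one_form_def dird_mult smooth_Hi smooth_pd H w dird_Hi pd_add_pdb mult_simps)
  have ww: "mwedge (conn w) (conn w) [v, v'] = conn w [v] ** conn w [v'] - conn w [v'] ** conn w [v]"
    by (simp add: mwedge_Cons mwedge_Nil ctr_def gsg_def conn_other mult_simps
        bilinear_lzero[OF bilinear_matrix_mult] bilinear_rzero[OF bilinear_matrix_mult])
  \<comment> \<open>Derivatives along \<open>v\<close> and \<open>v'\<close> commute, so the parts
    of \<open>pd\<close> without \<open>\<i>\<close> cancel in the antisymmetrisation.\<close>
  have "dird (e v) (pd v' H) w - dird (e v') (pd v H) w =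
     cscale (- \<i>/2) (dird (e v) (dird (e (\<i> *s v')) H) w - dird (e v') (dird (e (\<i> *s v)) H) w)"
    unfolding dird_pd[OF H w] pd_def dird_commute[OF W w H, of "e (\<i> *s _)"] dird_commute[OF W w H, of "e v'" "e v"]
    by (simp add: vec_eq_iff cscale_nth algebra_simps)
  then have q: "dird (e v) (pd v' H) w = dird (e v') (pd v H) w +
     cscale (- \<i>/2) (dird (e v) (dird (e (\<i> *s v')) H) w - dird (e v') (dird (e (\<i> *s v)) H) w)"
    by (simp add: algebra_simps)
  have "curv w [v, v'] = dird (e v) (\<lambda>y. conn y [v']) w - dird (e v') (\<lambda>y. conn y [v]) w
     + (conn w [v] ** conn w [v'] - conn w [v'] ** conn w [v])"
    by (simp add: curv_def ww dloc_def)
  then show ?thesis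
    unfolding dA q by (simp add: conn_def one_form_def mult_simps algebra_simps)
qed

lemma form_adj_ncv:
  assumes w: "w \<in> W" shows "form_adj (H w) (ncv w) = ncv w"
proof (rule ext)
  fix vs
  show "form_adj (H w) (ncv w) vs = ncv w vs"
  proof (cases "length vs = 2")
    case False
    then show ?thesis
      by (simp add: form_adj_def adjoint_wrt_def ncv_def curv_other w cscale_zero conj_transpose_zero
        bilinear_lzero[OF bilinear_matrix_mult] bilinear_rzero[OF bilinear_matrix_mult])
  next
    case True
    then obtain v v' where vs: "vs = [v, v']"
      by (metis (no_types, lifting) One_nat_def Suc_1 Suc_length_conv length_0_conv)
    define Q where "Q = cscale (- \<i>/2) (dird (e v) (dird (e (\<i> *s v')) H) w - dird (e v') (dird (e (\<i> *s v)) H) w)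
      - pdb v H w ** Hi w ** pd v' H w + pdb v' H w ** Hi w ** pd v H w"
    have hd2: "conj_transpose (dird a (dird b H) w) = dird a (dird b H) w" for a b
      using dird_conj_transpose[OF smooth_on_dird[OF H] w, of a b]
        dird_cong_open(1)[OF W w, of "\<lambda>w. conj_transpose (dird b H w)" "dird b H" a] dird_H_herm by simp
    have pdbH: "conj_transpose (pdb v H w) = pd v H w" for v
      using conj_transpose_pd_H[OF w, of v] conj_transpose_conj_transpose by metis
    have Q: "conj_transpose Q = - Q"
      unfolding Q_def conj_transpose_add conj_transpose_diff conj_transpose_mult conj_transpose_cscale hd2 pdbH
        conj_transpose_pd_H[OF w] Hi_herm[OF w]
      by (simp add: vec_eq_iff cscale_nth mult_simps algebra_simps)
    have c: "curv w vs = Hi w ** Q" unfolding vs curv_two[OF w] Q_def ..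
    have "adjoint_wrt (H w) (Hi w ** Q) = - (Hi w ** Q)"
      by (simp add: adjoint_wrt_def conj_transpose_mult Q Hi_herm[OF w] mult_simps Hi_cancel[OF w] flip: Hi_def)
    moreover have "adjoint_wrt (H w) (cscale a M) = cscale (cnj a) (adjoint_wrt (H w) M)" for a M
      by (simp add: adjoint_wrt_def conj_transpose_cscale cscale_simps)
    ultimately show ?thesis
      by (simp add: form_adj_def ncv_def c cscale_simps cscale_left_minus)
  qed
qed

text \<open>The velocity is self-adjoint, since \<open>H\<close> times it is the hermitian matrix
  \<open>dird \<tau> H\<close>. Conjugate transposition turns \<open>pdb\<close> into
  \<open>pd\<close>, and the derivative of \<open>Hi\<close> supplies the second term of
  \<open>dconn\<close>.\<close>

lemma form_adj_dbar_vel: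
  assumes w: "w \<in> W" shows "form_adj (H w) (one_form (dbar_vel w)) = dconn w"
proof (rule ext)
  fix vs
  show "form_adj (H w) (one_form (dbar_vel w)) vs = dconn w vs"
  proof (cases "length vs = 1")
    case False
    then have "one_form (dbar_vel w) vs = 0" unfolding one_form_def by (cases vs rule: remdups_adj.cases) auto
    then show ?thesis using False
      by (simp add: form_adj_def adjoint_wrt_def dconn_other conj_transpose_zero
        bilinear_lzero[OF bilinear_matrix_mult] bilinear_rzero[OF bilinear_matrix_mult])
  next
    case True
    then obtain v where vs: "vs = [v]" by (metis One_nat_def Suc_length_conv length_0_conv)
    have "conj_transpose (dbar_vel w v) = pd v (\<lambda>w. conj_transpose (vel w)) w"
      unfolding dbar_vel_def by (rule conj_transpose_pdb[OF smooth_vel w])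
    also have "\<dots> = pd v (\<lambda>w. dird \<tau> H w ** Hi w) w"
      unfolding pd_def using dird_cong_open(1)[OF W w, of "\<lambda>w. conj_transpose (vel w)" "\<lambda>w. dird \<tau> H w ** Hi w"]
      by (simp add: vel_def conj_transpose_mult Hi_herm dird_H_herm)
    also have "\<dots> = dird \<tau> H w ** pd v Hi w + pd v (dird \<tau> H) w ** Hi w"
      by (rule pd_mult[OF smooth_on_dird[OF H] smooth_Hi w])
    finally show ?thesis
      by (simp add: vs form_adj_def one_form_def adjoint_wrt_def dconn_eq[OF w] pd_Hi[OF w] vel_def mult_simps Hi_cancel[OF w] flip: Hi_def)
  qed
qed

text \<open>The \<open>(1,0)\<close>-part of the differential of \<open>vel\<close> joins the
  commutator with the connection to form \<open>dconn\<close>. The \<open>(0,1)\<close>-part is left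
  alone, because the Chern connection form has type \<open>(1,0)\<close>.\<close>

lemma cov_vel:
  assumes w: "w \<in> W"
  shows "cov (\<lambda>y. form_unit (vel y)) w = dconn w + one_form (dbar_vel w)"
proof (rule ext)
  fix vs
  have c: "cov (\<lambda>y. form_unit (vel y)) w vs = dloc e (\<lambda>y. form_unit (vel y)) w vs + conn w vs ** vel w - vel w ** conn w vs"
    by (simp add: cov_def mwedge_form_unit_left mwedge_form_unit_right)
  show "cov (\<lambda>y. form_unit (vel y)) w vs = (dconn w + one_form (dbar_vel w)) vs"
  proof (cases "length vs = 1")
    case False
    then have "one_form (dbar_vel w) vs = 0" unfolding one_form_def by (cases vs rule: remdups_adj.cases) auto
    moreover have "dloc e (\<lambda>y. form_unit (vel y)) w vs = 0"
      unfolding dloc_def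
    proof (intro sum.neutral ballI)
      fix k assume "k \<in> {..<length vs}"
      then have "length (take k vs @ drop (Suc k) vs) \<noteq> 0" using False by simp
      then have "take k vs @ drop (Suc k) vs \<noteq> []" by (metis list.size(3))
      then show "(- 1) ^ k *\<^sub>R dird (e (vs ! k)) (\<lambda>y. form_unit (vel y) (take k vs @ drop (Suc k) vs)) w = 0"
        unfolding form_unit_def by (simp del: append_is_Nil_conv)
    qed
    ultimately show ?thesis using False
      by (simp add: c conn_other dconn_other bilinear_lzero[OF bilinear_matrix_mult] bilinear_rzero[OF bilinear_matrix_mult])
  next
    case True
    then obtain v where vs: "vs = [v]" by (metis One_nat_def Suc_length_conv length_0_conv)
    have "dloc e (\<lambda>y. form_unit (vel y)) w vs = dird (e v) vel w"
      by (simp add: vs dloc_def form_unit_def)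
    also have "\<dots> = pd v vel w + pdb v vel w" by (simp add: pd_add_pdb)
    also have "pd v vel w = Hi w ** pd v (dird \<tau> H) w - Hi w ** pd v H w ** vel w"
      unfolding vel_def[abs_def] by (simp add: pd_mult[OF smooth_Hi smooth_on_dird[OF H] w] pd_Hi[OF w] mult_simps)
    finally show ?thesis
      unfolding c by (simp add: vs dconn_eq[OF w] one_form_def dbar_vel_def conn_def mult_simps)
  qed
qed

text \<open>The connection terms that land between the two factors cancel, so the graded Leibniz
  rule of \<open>d\<close> passes to the covariant derivative.\<close>

lemma cov_mwedge:
  assumes w: "w \<in> W" and "\<And>vs. (\<lambda>y. \<Phi> y vs) differentiable (at w)" "\<And>vs. (\<lambda>y. \<Psi> y vs) differentiable (at w)"
  shows "cov (\<lambda>y. mwedge (\<Phi> y) (\<Psi> y)) w = mwedge (cov \<Phi> w) (\<Psi> w) + mwedge (gsg (\<Phi> w)) (cov \<Psi> w)"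
  by (simp add: cov_def dloc_mwedge[OF assms(2,3)] gsg_mwedge mwedge_linear mwedge_assoc algebra_simps)

text \<open>The trace of a graded commutator vanishes, so under the trace \<open>d\<close> may be
  replaced by the covariant derivative.\<close>

lemma dloc_ftr:
  assumes w: "w \<in> W" and d: "\<And>vs. (\<lambda>y. \<Phi> y vs) differentiable (at w)"
  shows "dloc e (\<lambda>y. ftr (\<Phi> y)) w = ftr (cov \<Phi> w)"
proof -
  have "bounded_linear (trace :: complex^'r^'r \<Rightarrow> complex)" using linear_trace linear_conv_bounded_linear by blast
  then have "dloc e (\<lambda>y. ftr (\<Phi> y)) w = ftr (dloc e \<Phi> w)"
    using dloc_linear[of trace \<Phi> w e] d by (auto simp: ftr_def[abs_def] fun_eq_iff)
  then show ?thesis by (simp add: cov_def ftr_odd[OF gsg_conn])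
qed

text \<open>The Bianchi identity. Because of it, the integration by parts differentiates only the
  factors that are not curvatures.\<close>

lemma cov_curv:
  assumes w: "w \<in> W" shows "cov curv w = 0"
proof -
  have "dloc e curv w = dloc e (dloc e conn) w + dloc e (\<lambda>y. mwedge (conn y) (conn y)) w"
    unfolding curv_def[abs_def]
    by (rule dloc_add) (auto intro!: diff[OF _ w] smooth_on_dloc smooth_on_mwedge W smooth_conn)
  also have "\<dots> = mwedge (dloc e conn w) (conn w) - mwedge (conn w) (dloc e conn w)"
    by (simp add: dloc_dloc[OF W w smooth_conn] dloc_mwedge differentiable_conn[OF w] gsg_conn mwedge_linear)
  finally show ?thesis
    by (simp add: cov_def gsg_curv[OF w]) (simp add: curv_def mwedge_linear mwedge_assoc)
qed

lemma mwedge_cscale: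
  "mwedge (\<lambda>vs. cscale c (\<alpha> vs)) \<beta> = (\<lambda>vs. cscale c (mwedge \<alpha> \<beta> vs))"
  "mwedge \<alpha> (\<lambda>vs. cscale c (\<beta> vs)) = (\<lambda>vs. cscale c (mwedge \<alpha> \<beta> vs))"
  by (rule ext, simp add: mwedge_def wedge_by_def linear_sum[OF linear_cscale] cscale_scaleR cscale_mult_left cscale_mult_right)+

lemma cov_ncv:
  assumes w: "w \<in> W" shows "cov ncv w = 0"
proof -
  have 1: "dloc e ncv w = (\<lambda>vs. cscale (\<i> / (2 * of_real pi)) (dloc e curv w vs))"
    unfolding ncv_def[abs_def] by (rule ext, rule dloc_linear[OF bounded_linear_cscale]) (rule diff[OF smooth_curv w])
  have 2: "gsg (ncv w) = (\<lambda>vs. cscale (\<i> / (2 * of_real pi)) (gsg (curv w) vs))"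
    by (rule ext) (simp add: gsg_def ncv_def cscale_scaleR)
  have 3: "ncv w = (\<lambda>vs. cscale (\<i> / (2 * of_real pi)) (curv w vs))"
    by (rule ext) (rule ncv_def)
  have "cov ncv w = (\<lambda>vs. cscale (\<i> / (2 * of_real pi)) (cov curv w vs))"
    unfolding cov_def 1 2 unfolding 3 mwedge_cscale by (rule ext) (simp add: cscale_simps)
  then show ?thesis by (simp add: cov_curv[OF w] cscale_zero fun_eq_iff)
qed

text \<open>Differentiating \<open>d A + A \<and> A\<close> in time gives \<open>d\<close> of
  \<open>dconn\<close> and two wedge terms with the connection; together they are the covariant
  derivative of the odd form \<open>dconn\<close>.\<close>

lemma dird_ncv:
  assumes w: "w \<in> W" shows "dird \<tau> (\<lambda>y. ncv y vs) w = cscale (\<i> / (2 * of_real pi)) (cov dconn w vs)"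
proof -
  have "dird \<tau> (\<lambda>y. curv y vs) w = dird \<tau> (\<lambda>y. dloc e conn y vs) w + dird \<tau> (\<lambda>y. mwedge (conn y) (conn y) vs) w"
    unfolding curv_def plus_fun_apply
    by (rule dird_add) (auto intro!: diff[OF _ w] smooth_on_dloc smooth_on_mwedge W smooth_conn)
  also have "dird \<tau> (\<lambda>y. dloc e conn y vs) w = dloc e dconn w vs"
    unfolding dird_dloc[OF W w smooth_conn] dconn_def[abs_def] ..
  also have "dird \<tau> (\<lambda>y. mwedge (conn y) (conn y) vs) w = mwedge (dconn w) (conn w) vs + mwedge (conn w) (dconn w) vs"
    unfolding mwedge_def dird_wedge_by[OF bounded_bilinear_matrix_mult differentiable_conn[OF w] differentiable_conn[OF w]]
    by (simp add: dconn_def[abs_def])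
  finally have "dird \<tau> (\<lambda>y. curv y vs) w = cov dconn w vs"
    by (simp add: cov_def gsg_dconn mwedge_linear)
  then show ?thesis
    unfolding ncv_def by (simp add: dird_cscale[OF smooth_curv w])
qed

end

section \<open>Variation of the powers of the curvature under the trace\<close>

lemma sum_apply: "(\<Sum>i\<in>A. f i) x = (\<Sum>i\<in>A. f i x)"
  by (induction A rule: infinite_finite_induct) simp_all

lemma mwedge_sum_right: "mwedge \<beta> (\<Sum>i\<in>A. f i) = (\<Sum>i\<in>A. mwedge \<beta> (f i))"
proof (induction A rule: infinite_finite_induct)
  case (insert x F)
  show ?case unfolding sum.insert[OF insert.hyps] mwedge_linear insert.IH ..
qed (simp_all only: sum.empty sum.infinite mwedge_linear not_False_eq_True)

lemma trace_cscale: "trace (cscale c A) = c * trace A"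
  by (simp add: cscale_def trace_mat_mult)

lemma dloc_sum:
  assumes "\<And>i vs. i \<in> A \<Longrightarrow> (\<lambda>y. \<alpha> i y vs) differentiable (at w)"
  shows "dloc e (\<lambda>y. \<Sum>i\<in>A. \<alpha> i y) w = (\<Sum>i\<in>A. dloc e (\<alpha> i) w)"
  by (rule ext) (simp add: sum_apply dloc_def dird_sum assms scaleR_sum_right sum.swap[of _ A])

definition ftriple :: "nat \<Rightarrow> nat \<Rightarrow> ('v, complex^'r::finite^'r) aform \<Rightarrow> ('v, complex^'r^'r) aform \<Rightarrow> ('v, complex^'r^'r) aform \<Rightarrow> ('v, complex) aform" where
  "ftriple k m B x y = ftr (mwedge x (mwedge (mpow B k) (mwedge y (mpow B m))))"

lemma ftriple_odd_swap:
  assumes "gsg B = B" "gsg x = - x" "gsg y = - y"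
  shows "ftriple k m B x y = - ftriple m k B y x"
proof -
  have "ftriple k m B x y = - ftr (mwedge (mpow B k) (mwedge y (mwedge (mpow B m) x)))"
    unfolding ftriple_def by (subst ftr_odd[OF assms(2)]) (simp add: gsg_mwedge gsg_mpow[OF assms(1)] assms(3) mwedge_linear mwedge_assoc)
  also have "ftr (mwedge (mpow B k) (mwedge y (mwedge (mpow B m) x))) = ftriple m k B y x"
    unfolding ftriple_def by (subst ftr_even) (simp_all add: gsg_mpow[OF assms(1)] mwedge_assoc)
  finally show ?thesis .
qed

lemma sum_reflect: "(\<Sum>k<j. f k (j - 1 - k)) = (\<Sum>k<j. f (j - 1 - k) (k::nat))"
  by (rule sum.reindex_bij_witness[of _ "\<lambda>k. j - 1 - k" "\<lambda>k. j - 1 - k"]) auto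

text \<open>Exchanging the two odd factors reverses the sign and maps \<open>k\<close> to
  \<open>j - 1 - k\<close>, so the sum is its own negative.\<close>

lemma sum_ftriple_odd_self:
  assumes "gsg B = B" "gsg x = - x"
  shows "(\<Sum>k<j. ftriple k (j - 1 - k) B x x) = 0"
proof -
  have "(\<Sum>k<j. ftriple k (j - 1 - k) B x x) = - (\<Sum>k<j. ftriple (j - 1 - k) k B x x)"
    unfolding sum_negf[symmetric] by (intro sum.cong refl ftriple_odd_swap assms)
  also have "(\<Sum>k<j. ftriple (j - 1 - k) k B x x) = (\<Sum>k<j. ftriple k (j - 1 - k) B x x)"
    by (rule sum_reflect[symmetric])
  finally have e: "(\<Sum>k<j. ftriple k (j - 1 - k) B x x) = - (\<Sum>k<j. ftriple k (j - 1 - k) B x x)" .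
  show ?thesis
  proof (rule ext)
    fix vs
    have "(\<Sum>k<j. ftriple k (j - 1 - k) B x x) vs = - (\<Sum>k<j. ftriple k (j - 1 - k) B x x) vs"
      using fun_cong[OF e] by simp
    then show "(\<Sum>k<j. ftriple k (j - 1 - k) B x x) vs = 0 vs" by simp
  qed
qed

lemma gsg_one_form: "gsg (one_form u) = - one_form u"
proof (rule ext)
  show "gsg (one_form u) vs = (- one_form u) vs" for vs
    by (cases vs rule: remdups_adj.cases) (simp_all add: gsg_def one_form_def)
qed

context metric_family
begin

lemma smooth_mpow: "smooth_on W (\<lambda>w. mpow (ncv w) k vs)"
proof (induction k arbitrary: vs)
  case 0
  then show ?case by (simp add: smooth_on_const)
next
  case (Suc k)
  then show ?case unfolding mpow_Suc by (intro smooth_on_mwedge W smooth_ncv)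
qed

lemma smooth_form_unit: "smooth_on W M \<Longrightarrow> smooth_on W (\<lambda>w. form_unit (M w) vs)"
  by (cases vs) (simp_all add: form_unit_def smooth_on_const)

lemma cov_mpow:
  assumes w: "w \<in> W" shows "cov (\<lambda>y. mpow (ncv y) k) w = 0"
proof (induction k)
  case 0
  have d: "dloc e (\<lambda>y. form_unit (mat 1)) w = 0"
    by (rule ext) (simp add: dloc_def)
  show ?case by (simp only: cov_def mpow_0 gsg_form_unit mwedge_unit_left mwedge_unit_right d add_0 diff_self)
next
  case (Suc k)
  have e: "cov (\<lambda>y. mwedge (ncv y) (mpow (ncv y) k)) w =
      mwedge (cov ncv w) (mpow (ncv w) k) + mwedge (gsg (ncv w)) (cov (\<lambda>y. mpow (ncv y) k) w)"
    by (rule cov_mwedge[OF w]) (auto intro!: diff[OF _ w] smooth_ncv smooth_mpow)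
  show ?case
    unfolding mpow_Suc e cov_ncv[OF w] Suc by (simp only: mwedge_linear add_0)
qed

text \<open>Endomorphism-valued factors do not commute, so the derivative of a power is a sum over
  the position of the differentiated factor.\<close>

lemma dird_mpow:
  assumes w: "w \<in> W"
  shows "(\<lambda>vs. dird \<tau> (\<lambda>y. mpow (ncv y) j vs) w) =
    (\<lambda>vs. cscale (\<i> / (2 * of_real pi)) ((\<Sum>k<j. mwedge (mpow (ncv w) k) (mwedge (cov dconn w) (mpow (ncv w) (j - 1 - k)))) vs))"
proof (induction j)
  case 0
  then show ?case by (simp add: cscale_zero)
next
  case (Suc j)
  let ?c = "cscale (\<i> / (2 * of_real pi))"
  have dn: "(\<lambda>vs. dird \<tau> (\<lambda>y. ncv y vs) w) = (\<lambda>vs. ?c (cov dconn w vs))"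
    by (rule ext) (rule dird_ncv[OF w])
  have "(\<lambda>vs. dird \<tau> (\<lambda>y. mpow (ncv y) (Suc j) vs) w) =
     mwedge (\<lambda>vs. dird \<tau> (\<lambda>y. ncv y vs) w) (mpow (ncv w) j) + mwedge (ncv w) (\<lambda>vs. dird \<tau> (\<lambda>y. mpow (ncv y) j vs) w)"
    unfolding mpow_Suc mwedge_def
    by (rule ext, subst dird_wedge_by[OF bounded_bilinear_matrix_mult]) (auto intro!: diff[OF _ w] smooth_ncv smooth_mpow)
  also have "\<dots> = (\<lambda>vs. ?c ((mwedge (cov dconn w) (mpow (ncv w) j) +
     mwedge (ncv w) (\<Sum>k<j. mwedge (mpow (ncv w) k) (mwedge (cov dconn w) (mpow (ncv w) (j - 1 - k))))) vs))"
    unfolding dn Suc mwedge_cscale by (rule ext) (simp add: cscale_add)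
  also have "mwedge (ncv w) (\<Sum>k<j. mwedge (mpow (ncv w) k) (mwedge (cov dconn w) (mpow (ncv w) (j - 1 - k)))) =
     (\<Sum>k<j. mwedge (mpow (ncv w) (Suc k)) (mwedge (cov dconn w) (mpow (ncv w) (j - Suc k))))"
    by (simp add: mwedge_sum_right mpow_Suc mwedge_assoc)
  also have "mwedge (cov dconn w) (mpow (ncv w) j) + \<dots> =
     (\<Sum>k<Suc j. mwedge (mpow (ncv w) k) (mwedge (cov dconn w) (mpow (ncv w) (Suc j - 1 - k))))"
    unfolding sum.lessThan_Suc_shift by simp
  finally show ?case .
qed

definition Ef :: "nat \<Rightarrow> 'w \<Rightarrow> (complex^'n, complex) aform" where
  "Ef j w = (\<Sum>k<j. ftriple k (j - 1 - k) (ncv w) (form_unit (vel w)) (dconn w))"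

definition Tf :: "nat \<Rightarrow> 'w \<Rightarrow> (complex^'n, complex) aform" where
  "Tf j w = (\<Sum>k<j. ftriple k (j - 1 - k) (ncv w) (dconn w) (one_form (dbar_vel w)))"

lemma smooth_ftriple:
  assumes "\<And>vs. smooth_on W (\<lambda>w. x w vs)" "\<And>vs. smooth_on W (\<lambda>w. y w vs)"
  shows "smooth_on W (\<lambda>w. ftriple k m (ncv w) (x w) (y w) vs)"
proof -
  have "bounded_linear (trace :: complex^'r^'r \<Rightarrow> complex)" using linear_trace linear_conv_bounded_linear by blast
  then show ?thesis
    unfolding ftriple_def ftr_def
    by (rule smooth_on_linear_compose[OF W]) (intro smooth_on_mwedge W smooth_mpow assms)
qed

lemma smooth_Ef: "smooth_on W (\<lambda>w. Ef j w vs)"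
  unfolding Ef_def sum_apply
  by (intro smooth_on_sum W smooth_ftriple smooth_form_unit smooth_vel smooth_dconn)

text \<open>Integration by parts: \<open>Ef\<close> is the boundary term, and \<open>Tf\<close> is what the subsolution
  condition controls. The terms with two factors \<open>dconn\<close> cancel in pairs.\<close>

lemma ftr_vel_dird_mpow:
  assumes w: "w \<in> W"
  shows "trace (vel w ** dird \<tau> (\<lambda>y. mpow (ncv y) j vs) w) =
    \<i> / (2 * of_real pi) * (dloc e (Ef j) w vs + Tf j w vs)"
proof -
  let ?B = "ncv w" and ?a = "dconn w" and ?u = "one_form (dbar_vel w)"
  note gB = gsg_ncv[OF w]
  \<comment> \<open>The Bianchi identity kills the terms from the curvature factors. Differentiating
    the velocity gives \<open>dconn\<close> and \<open>dbar_vel\<close>, hence the first two terms;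
    differentiating \<open>dconn\<close> gives the third, with a plus sign because the velocity and
    the curvature in front of it are even.\<close>
  have dk: "dloc e (\<lambda>y. ftriple k m (ncv y) (form_unit (vel y)) (dconn y)) w =
     ftriple k m ?B ?a ?a + ftriple k m ?B ?u ?a + ftriple k m ?B (form_unit (vel w)) (cov dconn w)" for k m
  proof -
    note df = diff[OF _ w] smooth_on_mwedge W smooth_mpow smooth_dconn smooth_form_unit smooth_vel
    have c1: "cov (\<lambda>y. mwedge (dconn y) (mpow (ncv y) m)) w = mwedge (cov dconn w) (mpow ?B m)"
      by (subst cov_mwedge[OF w]) (auto intro!: df simp: cov_mpow[OF w] mwedge_linear)
    have c2: "cov (\<lambda>y. mwedge (mpow (ncv y) k) (mwedge (dconn y) (mpow (ncv y) m))) w =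
        mwedge (mpow ?B k) (mwedge (cov dconn w) (mpow ?B m))"
      by (subst cov_mwedge[OF w]) (auto intro!: df simp: cov_mpow[OF w] c1 gsg_mpow[OF gB] mwedge_linear)
    have c3: "cov (\<lambda>y. mwedge (form_unit (vel y)) (mwedge (mpow (ncv y) k) (mwedge (dconn y) (mpow (ncv y) m)))) w =
        mwedge (?a + ?u) (mwedge (mpow ?B k) (mwedge ?a (mpow ?B m))) +
        mwedge (form_unit (vel w)) (mwedge (mpow ?B k) (mwedge (cov dconn w) (mpow ?B m)))"
      by (subst cov_mwedge[OF w]) (auto intro!: df simp: cov_vel[OF w] c2)
    show ?thesis
      unfolding ftriple_def by (subst dloc_ftr[OF w]) (auto intro!: df simp: c3 mwedge_linear)
  qed
  have dE: "dloc e (Ef j) w = (\<Sum>k<j. ftriple k (j - 1 - k) ?B ?u ?a) +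
      (\<Sum>k<j. ftriple k (j - 1 - k) ?B (form_unit (vel w)) (cov dconn w))"
  proof -
    have "dloc e (Ef j) w = (\<Sum>k<j. dloc e (\<lambda>y. ftriple k (j - 1 - k) (ncv y) (form_unit (vel y)) (dconn y)) w)"
      unfolding Ef_def[abs_def]
      by (rule dloc_sum) (intro diff[OF _ w] smooth_ftriple smooth_form_unit smooth_vel smooth_dconn)
    also have "\<dots> = (\<Sum>k<j. ftriple k (j - 1 - k) ?B ?a ?a) + (\<Sum>k<j. ftriple k (j - 1 - k) ?B ?u ?a) +
      (\<Sum>k<j. ftriple k (j - 1 - k) ?B (form_unit (vel w)) (cov dconn w))"
      unfolding dk sum.distrib ..
    finally show ?thesis unfolding sum_ftriple_odd_self[OF gB gsg_dconn] add_0 .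
  qed
  have "(\<Sum>k<j. ftriple k (j - 1 - k) ?B ?u ?a) = - (\<Sum>k<j. ftriple (j - 1 - k) k ?B ?a ?u)"
    unfolding sum_negf[symmetric] by (intro sum.cong refl ftriple_odd_swap gB gsg_dconn gsg_one_form)
  also have "(\<Sum>k<j. ftriple (j - 1 - k) k ?B ?a ?u) = Tf j w"
    unfolding Tf_def by (rule sum_reflect[symmetric])
  finally have eq: "(\<Sum>k<j. ftriple k (j - 1 - k) ?B ?u ?a) = - Tf j w" .
  have "(\<Sum>k<j. ftriple k (j - 1 - k) ?B (form_unit (vel w)) (cov dconn w)) vs = dloc e (Ef j) w vs + Tf j w vs"
    using fun_cong[OF dE, of vs] fun_cong[OF eq, of vs] by simp
  then have "(\<Sum>k<j. ftr (mwedge (form_unit (vel w)) (mwedge (mpow ?B k) (mwedge (cov dconn w) (mpow ?B (j - 1 - k)))))) vs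
     = dloc e (Ef j) w vs + Tf j w vs"
    unfolding ftriple_def .
  moreover have "trace (vel w ** dird \<tau> (\<lambda>y. mpow (ncv y) j vs) w) = \<i> / (2 * of_real pi) *
     (\<Sum>k<j. ftr (mwedge (form_unit (vel w)) (mwedge (mpow ?B k) (mwedge (cov dconn w) (mpow ?B (j - 1 - k)))))) vs"
  proof -
    have "dird \<tau> (\<lambda>y. mpow (ncv y) j vs) w = cscale (\<i> / (2 * of_real pi)) ((\<Sum>k<j. mwedge (mpow ?B k) (mwedge (cov dconn w) (mpow ?B (j - 1 - k)))) vs)"
      using fun_cong[OF dird_mpow[OF w, of j], of vs] .
    moreover have "vel w ** (\<Sum>k<j. f k) = (\<Sum>k<j. vel w ** f k)" for f :: "nat \<Rightarrow> complex^'r^'r"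
      by (rule linear_sum[OF bilinear_linear_right[OF bilinear_matrix_mult]])
    ultimately show ?thesis
      by (simp add: cscale_mult_right trace_cscale sum_apply ftr_def mwedge_form_unit_left linear_sum[OF linear_trace])
  qed
  ultimately show ?thesis by simp
qed

text \<open>Conjugate-linearity is what makes this map admissible in the subsolution
  inequality.\<close>

lemma dbar_vel_scalar: "w \<in> W \<Longrightarrow> dbar_vel w (\<i> *s v) = mat (- \<i>) ** dbar_vel w v"
proof -
  assume w: "w \<in> W"
  have "\<i> *s (\<i> *s v) = - v" by (simp add: vec_eq_iff)
  moreover have "dird (- x) vel w = - dird x vel w" for x
    using linear_neg[OF linear_dird[OF diff[OF smooth_vel w]]] .
  ultimately show ?thesis
    unfolding dbar_vel_def pdb_def by (simp add: linear_neg[OF e] flip: cscale_def) (simp add: vec_eq_iff cscale_nth algebra_simps)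
qed

lemma linear_dird_e: "M differentiable (at w) \<Longrightarrow> linear (\<lambda>v. dird (e v) M w)"
  using linear_compose[OF e linear_dird] by (simp add: o_def)

lemma linear_scalar_mult: "linear (\<lambda>v::complex^'n. c *s v)"
  by (rule linearI) (simp_all add: vec_eq_iff distrib_left)

lemma linear_pd: "smooth_on W M \<Longrightarrow> w \<in> W \<Longrightarrow> linear (\<lambda>v. pd v M w)"
  and linear_pdb: "smooth_on W M \<Longrightarrow> w \<in> W \<Longrightarrow> linear (\<lambda>v. pdb v M w)"
proof -
  assume M: "smooth_on W M" and w: "w \<in> W"
  note l = linear_dird_e[OF diff[OF M w]]
  note l' = linear_compose[OF linear_compose[OF linear_scalar_mult[of \<i>] l] linear_cscale[of \<i>], unfolded o_def]
  show "linear (\<lambda>v. pd v M w)" "linear (\<lambda>v. pdb v M w)"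
    unfolding pd_def pdb_def
    using linear_compose[OF linear_compose_sub[OF l l'] linear_cscale] linear_compose[OF linear_compose_add[OF l l'] linear_cscale]
    by (simp_all add: o_def)
qed

lemma linear_dbar_vel: "w \<in> W \<Longrightarrow> linear (dbar_vel w)"
  using linear_pdb[OF smooth_vel] by (simp add: dbar_vel_def[abs_def])

lemma linear_conn: "w \<in> W \<Longrightarrow> linear (\<lambda>v. conn w [v])"
  using linear_compose[OF linear_pd[OF H] bilinear_linear_right[OF bilinear_matrix_mult], of w "Hi w"]
  by (simp add: conn_def one_form_def o_def)

lemma amf_conn: "w \<in> W \<Longrightarrow> amf (conn w)"
  using amf_one_form[OF linear_conn] by (simp add: conn_def one_form_def)

lemma linear_dird_family:
  fixes f :: "'w \<Rightarrow> complex^'n \<Rightarrow> complex^'r^'r"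
  assumes w: "w \<in> W" and l: "\<And>y. y \<in> W \<Longrightarrow> linear (f y)" and s: "\<And>v. smooth_on W (\<lambda>y. f y v)"
  shows "linear (\<lambda>v. dird u (\<lambda>y. f y v) w)"
proof (rule linearI)
  fix a b
  have "dird u (\<lambda>y. f y (a + b)) w = dird u (\<lambda>y. f y a + f y b) w"
    by (rule dird_cong_open(1)[OF W w]) (rule linear_add[OF l])
  then show "dird u (\<lambda>y. f y (a + b)) w = dird u (\<lambda>y. f y a) w + dird u (\<lambda>y. f y b) w"
    by (simp add: dird_add diff[OF s w])
next
  fix r b
  have "dird u (\<lambda>y. f y (r *\<^sub>R b)) w = dird u (\<lambda>y. r *\<^sub>R f y b) w"
    by (rule dird_cong_open(1)[OF W w]) (rule linear_cmul[OF l])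
  then show "dird u (\<lambda>y. f y (r *\<^sub>R b)) w = r *\<^sub>R dird u (\<lambda>y. f y b) w"
    by (simp add: dird_linear_compose[OF bounded_linear_scaleR_right] diff[OF s w])
qed

lemma linear_dconn: "w \<in> W \<Longrightarrow> linear (\<lambda>v. dconn w [v])"
  unfolding dconn_def by (rule linear_dird_family) (auto intro: linear_conn smooth_conn)

lemma amf_dconn: "w \<in> W \<Longrightarrow> amf (dconn w)"
proof -
  assume w: "w \<in> W"
  have "dconn w = one_form (\<lambda>v. dconn w [v])"
  proof (rule ext)
    show "dconn w vs = one_form (\<lambda>v. dconn w [v]) vs" for vs
      by (cases vs rule: remdups_adj.cases) (simp_all add: one_form_def dconn_other)
  qed
  then show ?thesis using amf_one_form[OF linear_dconn[OF w]] by simp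
qed

lemma amf_curv: "w \<in> W \<Longrightarrow> amf (curv w)"
proof -
  assume w: "w \<in> W"
  let ?d = "dloc e conn w"
  have d0: "?d vs = 0" if "length vs \<noteq> 2" for vs
    unfolding dloc_def using that by (intro sum.neutral) (auto simp: conn_other dird_def)
  have d2: "?d [a, b] = dird (e a) (\<lambda>y. conn y [b]) w - dird (e b) (\<lambda>y. conn y [a]) w" for a b
    by (simp add: dloc_def)
  have l1: "linear (\<lambda>a. ?d [a, b])" and l2: "linear (\<lambda>a. ?d [b, a])" for b
    unfolding d2
    by (intro linear_compose_sub linear_dird_e diff[OF smooth_conn w] linear_dird_family[OF w] linear_conn smooth_conn; assumption)+
  have "amf ?d"
  proof (rule amfI)
    show "?d (us @ v # v' # vs) = - ?d (us @ v' # v # vs)" for us v v' vs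
    proof (cases "us = [] \<and> vs = []")
      case False
      then have "length (us @ v # v' # vs) \<noteq> 2" "length (us @ v' # v # vs) \<noteq> 2" by (cases us; cases vs; simp)+
      then show ?thesis by (simp add: d0)
    qed (simp add: d2)
    show "linear (\<lambda>v. ?d (us @ v # vs))" for us vs
    proof (cases "length us + length vs = 1")
      case False
      then have "(\<lambda>v. ?d (us @ v # vs)) = (\<lambda>v. 0)" by (intro ext d0) simp
      then show ?thesis by (simp add: linear_zero)
    next
      case True
      then consider b where "us = [b]" "vs = []" | b where "us = []" "vs = [b]"
        by (cases us; cases vs) auto
      then show ?thesis using l1 l2 by cases simp_all
    qed
  qed
  then show ?thesis
    unfolding curv_def by (intro amf_add amf_mwedge amf_conn w)
qed

lemma amf_ncv: "w \<in> W \<Longrightarrow> amf (ncv w)"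
  using amf_linear_compose[OF linear_cscale amf_curv, of w "\<i> / (2 * of_real pi)"] by (simp add: ncv_def[abs_def])

lemma amf_mpow: "amf B \<Longrightarrow> amf (mpow B k)"
  by (induction k) (simp_all add: mpow_Suc amf_mwedge amf_form_unit)

lemma amf_sum: "(\<And>i. i \<in> A \<Longrightarrow> amf (f i)) \<Longrightarrow> amf (\<Sum>i\<in>A. f i)"
proof (induction A rule: infinite_finite_induct)
  case (insert x F)
  have "amf (f x + sum f F)" by (rule amf_add) (use insert in auto)
  then show ?case by (simp only: sum.insert[OF insert.hyps])
qed (auto intro!: amfI simp: linear_zero)

lemma amf_Ef: "w \<in> W \<Longrightarrow> amf (Ef j w)"
  unfolding Ef_def ftriple_def
  by (intro amf_sum amf_ftr amf_mwedge amf_form_unit amf_mpow amf_ncv amf_dconn)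

end

section \<open>Adjoints, gauge changes and coordinate changes\<close>

lemma linear_adjoint_wrt: "linear (adjoint_wrt (H :: complex^'r::finite^'r))"
  by (rule linearI)
    (simp_all add: adjoint_wrt_def conj_transpose_add mult_simps linear_cmul[OF linear_conj_transpose]
      bilinear_lmul[OF bilinear_matrix_mult] bilinear_rmul[OF bilinear_matrix_mult])

lemma form_adj_minus: "form_adj H (- \<alpha>) = - form_adj H \<alpha>"
  by (rule ext) (simp add: form_adj_def linear_neg[OF linear_adjoint_wrt])

context
  fixes H :: "complex^'r::finite^'r"
  assumes inv: "invertible H" and herm: "conj_transpose H = H"
begin

lemma adjoint_wrt_mult: "adjoint_wrt H (A ** B) = adjoint_wrt H B ** adjoint_wrt H A"
  by (simp add: adjoint_wrt_def conj_transpose_mult mult_simps matrix_inv_cancel[OF inv])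

lemma adjoint_wrt_adjoint_wrt: "adjoint_wrt H (adjoint_wrt H A) = A"
  by (simp add: adjoint_wrt_def conj_transpose_mult mult_simps matrix_inv_cancel[OF inv] herm
      conj_transpose_matrix_inv[OF inv herm] conj_transpose_conj_transpose)

lemma trace_adjoint_wrt: "trace (adjoint_wrt H A) = cnj (trace A)"
proof -
  have "trace (adjoint_wrt H A) = trace (H ** matrix_inv H ** conj_transpose A)"
    unfolding adjoint_wrt_def by (metis matrix_mul_assoc trace_mul_sym)
  then show ?thesis by (simp add: matrix_inv_cancel[OF inv] trace_def conj_transpose_def)
qed

text \<open>Taking adjoints reverses a product of matrices but leaves the list of vectors in place,
  so the wedge product is reversed with the Koszul sign.\<close>

lemma form_adj_mwedge_even: "gsg \<alpha> = \<alpha> \<Longrightarrow> form_adj H (mwedge \<alpha> \<beta>) = mwedge (form_adj H \<beta>) (form_adj H \<alpha>)"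
  and form_adj_mwedge_odd: "gsg \<alpha> = - \<alpha> \<Longrightarrow> form_adj H (mwedge \<alpha> \<beta>) = mwedge (form_adj H (gsg \<beta>)) (form_adj H \<alpha>)"
proof -
  let ?m1 = "\<lambda>(a :: complex^'r^'r) (b :: complex^'r^'r). adjoint_wrt H (a ** b)" and ?m2 = "\<lambda>b a. adjoint_wrt H b ** adjoint_wrt H a"
  have 1: "bilinear ?m1" "bilinear ?m2"
  proof -
    show "bilinear ?m1" by (rule bilinear_compose[OF linear_adjoint_wrt bilinear_matrix_mult])
    show "bilinear ?m2" by (rule bilinear_args[OF bilinear_matrix_mult linear_adjoint_wrt linear_adjoint_wrt])
  qed
  have l: "form_adj H (mwedge \<alpha> \<beta>) = wedge_by ?m1 \<alpha> \<beta>"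
    by (rule ext) (simp add: form_adj_def mwedge_def linear_wedge_by[OF linear_adjoint_wrt])
  have r: "wedge_by ?m2 \<beta> \<alpha> = mwedge (form_adj H \<beta>) (form_adj H \<alpha>)" for \<alpha> \<beta> :: "('v, complex^'r^'r) aform"
    by (simp add: mwedge_def form_adj_def[abs_def] wedge_by_def fun_eq_iff)
  have f: "(gsg \<alpha> = \<alpha> \<longrightarrow> wedge_by ?m1 \<alpha> \<beta> vs = wedge_by ?m2 \<beta> \<alpha> vs) \<and>
      (gsg \<alpha> = - \<alpha> \<longrightarrow> wedge_by ?m1 \<alpha> \<beta> vs = wedge_by ?m2 (gsg \<beta>) \<alpha> vs)" for vs
    by (rule wedge_by_flip[OF 1 adjoint_wrt_mult])
  show "form_adj H (mwedge \<alpha> \<beta>) = mwedge (form_adj H \<beta>) (form_adj H \<alpha>)" if "gsg \<alpha> = \<alpha>"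
    unfolding l r[symmetric] using f that by blast
  show "form_adj H (mwedge \<alpha> \<beta>) = mwedge (form_adj H (gsg \<beta>)) (form_adj H \<alpha>)" if "gsg \<alpha> = - \<alpha>"
    unfolding l r[symmetric] using f that by blast
qed

lemma form_adj_mpow:
  assumes "gsg B = B" "form_adj H B = B"
  shows "form_adj H (mpow B k) = mpow B k"
proof (induction k)
  case 0
  have "adjoint_wrt H (mat 1) = mat 1" by (simp add: adjoint_wrt_def conj_transpose_mat matrix_inv_cancel[OF inv])
  then show ?case by (auto simp: form_adj_def form_unit_def fun_eq_iff linear_0[OF linear_adjoint_wrt])
next
  case (Suc k)
  show ?case
    unfolding mpow_Suc form_adj_mwedge_even[OF assms(1)] Suc assms(2) by (simp only: mpow_Suc[symmetric] mpow_Suc_right)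
qed

text \<open>With \<open>x\<close> the adjoint of \<open>y\<close>, taking the adjoint of the word
  reproduces it up to a cyclic rotation, while reversing the order of the two odd factors costs a
  sign. The trace is therefore imaginary.\<close>

lemma cnj_ftriple:
  assumes B: "gsg B = B" "form_adj H B = B" and x: "gsg x = - x" "form_adj H y = x" and y: "gsg y = - y"
  shows "cnj (ftriple k m B x y vs) = - ftriple k m B x y vs"
proof -
  note Bk = gsg_mpow[OF B(1)] form_adj_mpow[OF B]
  have xy: "form_adj H x = y"
    unfolding x(2)[symmetric] by (rule ext) (simp add: form_adj_def adjoint_wrt_adjoint_wrt)
  have "form_adj H (mwedge x (mwedge (mpow B k) (mwedge y (mpow B m)))) =
     - mwedge (mwedge (mwedge (mpow B m) x) (mpow B k)) y"
    by (simp add: form_adj_mwedge_odd[OF x(1)] form_adj_mwedge_even[OF Bk(1)] form_adj_mwedge_odd[OF y] gsg_mwedge Bk y x xy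
        mwedge_linear form_adj_minus)
  then have "cnj (ftriple k m B x y vs) = ftr (- mwedge (mwedge (mwedge (mpow B m) x) (mpow B k)) y) vs"
    unfolding ftriple_def ftr_def trace_adjoint_wrt[symmetric] by (simp add: form_adj_def fun_eq_iff)
  also have "\<dots> = - ftr (mwedge (mpow B m) (mwedge x (mwedge (mpow B k) y))) vs"
    by (simp add: mwedge_assoc)
  also have "ftr (mwedge (mpow B m) (mwedge x (mwedge (mpow B k) y))) = ftriple k m B x y"
    unfolding ftriple_def by (subst ftr_even) (simp_all add: Bk mwedge_assoc)
  finally show ?thesis .
qed

end

lemma (in metric_family) cnj_Tf: "w \<in> W \<Longrightarrow> cnj (Tf j w vs) = - Tf j w vs"
  unfolding Tf_def sum_apply
  by (simp add: cnj_ftriple[OF inv herm gsg_ncv form_adj_ncv gsg_dconn form_adj_dbar_vel gsg_one_form] sum_negf)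

section \<open>Changes of frame and of coordinates\<close>

definition conj_form :: "complex^'r::finite^'r \<Rightarrow> ('v, complex^'r^'r) aform \<Rightarrow> ('v, complex^'r^'r) aform" where
  "conj_form G \<Phi> vs = matrix_inv G ** (\<Phi> vs ** G)"

lemma conj_form_mwedge_units: "conj_form G \<Phi> = mwedge (form_unit (matrix_inv G)) (mwedge \<Phi> (form_unit G))"
  by (rule ext) (simp add: conj_form_def mwedge_form_unit_left mwedge_form_unit_right)

context
  fixes G :: "complex^'r::finite^'r"
  assumes G: "invertible G"
begin

lemma conj_form_cancel: "mwedge (form_unit G) (mwedge (form_unit (matrix_inv G)) \<Phi>) = \<Phi>"
  "mwedge (form_unit (matrix_inv G)) (mwedge (form_unit G) \<Phi>) = \<Phi>"
  by (rule ext, simp add: mwedge_form_unit_left matrix_inv_cancel[OF G])+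

lemma conj_form_mwedge: "mwedge (conj_form G \<Phi>) (conj_form G \<Psi>) = conj_form G (mwedge \<Phi> \<Psi>)"
  by (simp add: conj_form_mwedge_units mwedge_assoc conj_form_cancel)

lemma conj_form_mpow: "mpow (conj_form G B) k = conj_form G (mpow B k)"
proof (induction k)
  case 0
  show ?case by (rule ext) (simp add: conj_form_def form_unit_def matrix_inv_cancel[OF G]
    bilinear_lzero[OF bilinear_matrix_mult] bilinear_rzero[OF bilinear_matrix_mult])
qed (simp add: mpow_Suc conj_form_mwedge)

lemma ftr_conj_form: "ftr (conj_form G \<Phi>) = ftr \<Phi>"
proof (rule ext)
  fix vs
  have "trace (matrix_inv G ** (\<Phi> vs ** G)) = trace (\<Phi> vs ** (G ** matrix_inv G))"
    by (metis matrix_mul_assoc trace_mul_sym)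
  then show "ftr (conj_form G \<Phi>) vs = ftr \<Phi> vs"
    by (simp add: ftr_def conj_form_def matrix_inv_cancel[OF G])
qed

lemma ftriple_conj_form: "ftriple k m (conj_form G B) (conj_form G x) (conj_form G y) = ftriple k m B x y"
  by (simp add: ftriple_def conj_form_mpow conj_form_mwedge ftr_conj_form)

end

lemma conj_form_form_unit: "conj_form G (form_unit A) = form_unit (matrix_inv G ** (A ** G))"
  by (rule ext) (simp add: conj_form_def form_unit_def bilinear_lzero[OF bilinear_matrix_mult] bilinear_rzero[OF bilinear_matrix_mult])

lemma ftriple_map:
  "ftriple k m B x y (map f vs) = ftriple k m (\<lambda>vs. B (map f vs)) (\<lambda>vs. x (map f vs)) (\<lambda>vs. y (map f vs)) vs"
proof -
  have "mpow B k (map f vs) = mpow (\<lambda>vs. B (map f vs)) k vs" for k vs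
  proof (induction k arbitrary: vs)
    case 0
    then show ?case by (simp add: form_unit_def)
  qed (simp add: mpow_Suc mwedge_map)
  then show ?thesis by (simp add: ftriple_def ftr_def mwedge_map)
qed

lemma dloc_form_unit: "dloc e (\<lambda>y. form_unit (G y)) w = one_form (\<lambda>v. dird (e v) G w)"
proof (rule ext)
  fix vs
  show "dloc e (\<lambda>y. form_unit (G y)) w vs = one_form (\<lambda>v. dird (e v) G w) vs"
  proof (cases vs rule: remdups_adj.cases)
    case (3 a b cs)
    have "dloc e (\<lambda>y. form_unit (G y)) w vs = 0"
      unfolding dloc_def
    proof (intro sum.neutral ballI)
      fix k assume k: "k \<in> {..<length vs}"
      have "length (take k vs @ drop (Suc k) vs) \<noteq> 0" using k 3 by (auto simp: min_def)
      then have "take k vs @ drop (Suc k) vs \<noteq> []" by (metis list.size(3))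
      then show "(- 1) ^ k *\<^sub>R dird (e (vs ! k)) (\<lambda>y. form_unit (G y) (take k vs @ drop (Suc k) vs)) w = 0"
        unfolding form_unit_def by (simp del: append_is_Nil_conv)
    qed
    then show ?thesis using 3 by (simp add: one_form_def)
  qed (simp_all add: dloc_def form_unit_def one_form_def)
qed

text \<open>\<open>G\<close> plays the part of the transition matrix between two trivialisations
  over the same coordinates: holomorphic in space and constant along \<tau>.\<close>

locale gauge_change = A: metric_family W e \<tau> H + B: metric_family W e \<tau> H'
  for W :: "'w::real_normed_vector set" and e :: "complex^'n::finite \<Rightarrow> 'w" and \<tau> :: 'w
    and H H' :: "'w \<Rightarrow> complex^'r::finite^'r" +
  fixes G :: "'w \<Rightarrow> complex^'r^'r"
  assumes G: "smooth_on W G" and G_inv: "\<And>w. w \<in> W \<Longrightarrow> invertible (G w)"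
    and H': "\<And>w. w \<in> W \<Longrightarrow> H' w = conj_transpose (G w) ** H w ** G w"
    and G_const: "\<And>w. w \<in> W \<Longrightarrow> dird \<tau> G w = 0"
    and G_holo: "\<And>w v. w \<in> W \<Longrightarrow> dird (e (\<i> *s v)) G w = cscale \<i> (dird (e v) G w)"
begin

definition Gi :: "'w \<Rightarrow> complex^'r^'r" where "Gi w = matrix_inv (G w)"

lemma Gi_cancel: "w \<in> W \<Longrightarrow> Gi w ** G w = mat 1" "w \<in> W \<Longrightarrow> G w ** Gi w = mat 1"
  "w \<in> W \<Longrightarrow> Gi w ** (G w ** M) = M" "w \<in> W \<Longrightarrow> G w ** (Gi w ** M) = M"
  unfolding Gi_def using matrix_inv_cancel[OF G_inv] by auto

lemma Gt_cancel:
  assumes "w \<in> W"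
  shows "conj_transpose (Gi w) ** (conj_transpose (G w) ** M) = M" "conj_transpose (G w) ** conj_transpose (Gi w) = mat 1"
    "conj_transpose (G w) ** (conj_transpose (Gi w) ** M) = M"
proof -
  have "conj_transpose (Gi w) ** conj_transpose (G w) = mat 1"
    using Gi_cancel(2)[OF assms] by (metis conj_transpose_mult conj_transpose_mat complex_cnj_one)
  then show "conj_transpose (Gi w) ** (conj_transpose (G w) ** M) = M" by (simp add: matrix_mul_assoc)
  show "conj_transpose (G w) ** conj_transpose (Gi w) = mat 1"
    using Gi_cancel(1)[OF assms] by (metis conj_transpose_mult conj_transpose_mat complex_cnj_one)
  then show "conj_transpose (G w) ** (conj_transpose (Gi w) ** M) = M" by (simp add: matrix_mul_assoc)
qed

lemma smooth_Gi: "smooth_on W Gi"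
  unfolding Gi_def[abs_def] by (rule smooth_on_matrix_inv[OF A.W G G_inv])

lemma smooth_Gt: "smooth_on W (\<lambda>w. conj_transpose (G w))"
  by (rule smooth_on_linear_compose[OF A.W bounded_linear_conj_transpose G])

lemma dird_Gi:
  assumes w: "w \<in> W" shows "dird u Gi w = - (Gi w ** dird u G w ** Gi w)"
proof -
  have "dird u (\<lambda>w. G w ** Gi w) w = dird u (\<lambda>w. mat 1) w"
    by (rule dird_cong_open(1)[OF A.W w]) (rule Gi_cancel(2))
  then have "G w ** dird u Gi w + dird u G w ** Gi w = 0"
    by (simp add: A.dird_mult[OF G smooth_Gi w])
  then have "Gi w ** (G w ** dird u Gi w + dird u G w ** Gi w) = Gi w ** 0" by simp
  then show ?thesis
    by (simp add: mult_simps Gi_cancel[OF w] bilinear_rzero[OF bilinear_matrix_mult] eq_neg_iff_add_eq_0)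
qed

lemma Hi'_eq:
  assumes w: "w \<in> W" shows "B.Hi w = Gi w ** (A.Hi w ** conj_transpose (Gi w))"
proof -
  have "H' w ** (Gi w ** (A.Hi w ** conj_transpose (Gi w))) = mat 1"
    by (simp add: H'[OF w] mult_simps Gi_cancel[OF w] A.Hi_cancel[OF w] Gt_cancel[OF w])
  then show ?thesis unfolding B.Hi_def by (rule matrix_inv_eqI[OF B.inv[OF w]])
qed

lemma dird_tau_H': "w \<in> W \<Longrightarrow> dird \<tau> H' w = conj_transpose (G w) ** (dird \<tau> H w ** G w)"
proof -
  assume w: "w \<in> W"
  have "dird \<tau> H' w = dird \<tau> (\<lambda>w. conj_transpose (G w) ** (H w ** G w)) w"
    by (rule dird_cong_open(1)[OF A.W w]) (simp add: H' mult_simps)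
  then show ?thesis
    by (simp add: A.dird_mult[OF smooth_Gt A.smooth_mult[OF A.H G] w] A.dird_mult[OF A.H G w] A.dird_conj_transpose[OF G w]
        G_const[OF w] conj_transpose_zero bilinear_lzero[OF bilinear_matrix_mult] bilinear_rzero[OF bilinear_matrix_mult])
qed

lemma vel_gauge: "w \<in> W \<Longrightarrow> B.vel w = Gi w ** (A.vel w ** G w)"
  by (simp add: B.vel_def A.vel_def Hi'_eq dird_tau_H' mult_simps Gt_cancel)

lemma pd_H': "w \<in> W \<Longrightarrow> B.pd v H' w = conj_transpose (G w) ** (A.pd v H w ** G w + H w ** dird (e v) G w)"
proof -
  assume w: "w \<in> W"
  have "B.pd v H' w = A.pd v (\<lambda>w. conj_transpose (G w) ** (H w ** G w)) w"
    unfolding A.pd_def using dird_cong_open(1)[OF A.W w, of H' "\<lambda>w. conj_transpose (G w) ** (H w ** G w)"]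
    by (simp add: H' mult_simps)
  moreover have "A.pdb v G w = 0" "A.pd v G w = dird (e v) G w"
    unfolding A.pd_def A.pdb_def G_holo[OF w] by (simp_all add: vec_eq_iff cscale_nth)
  moreover have "A.pd v (\<lambda>w. conj_transpose (G w)) w = conj_transpose (A.pdb v G w)"
    by (rule A.conj_transpose_pdb[OF G w, symmetric])
  ultimately show ?thesis
    by (simp add: A.pd_mult[OF smooth_Gt A.smooth_mult[OF A.H G] w] A.pd_mult[OF A.H G w] conj_transpose_zero
        bilinear_lzero[OF bilinear_matrix_mult] mult_simps add.commute)
qed

lemma conn_gauge_one: "w \<in> W \<Longrightarrow> B.conn w [v] = Gi w ** (A.conn w [v] ** G w) + Gi w ** dird (e v) G w"
  by (simp add: B.conn_def A.conn_def one_form_def Hi'_eq pd_H' mult_simps Gt_cancel A.Hi_cancel)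

lemma conn_gauge: "w \<in> W \<Longrightarrow> B.conn w = mwedge (form_unit (Gi w)) (mwedge (A.conn w) (form_unit (G w)))
     + mwedge (form_unit (Gi w)) (dloc e (\<lambda>y. form_unit (G y)) w)"
proof (rule ext)
  fix vs assume w: "w \<in> W"
  show "B.conn w vs = (mwedge (form_unit (Gi w)) (mwedge (A.conn w) (form_unit (G w)))
     + mwedge (form_unit (Gi w)) (dloc e (\<lambda>y. form_unit (G y)) w)) vs"
  proof (cases "length vs = 1")
    case True
    then obtain v where "vs = [v]" by (metis One_nat_def Suc_length_conv length_0_conv)
    then show ?thesis
      by (simp add: conn_gauge_one[OF w] mwedge_form_unit_left mwedge_form_unit_right dloc_form_unit one_form_def)
  next
    case False
    then have "one_form (\<lambda>v. dird (e v) G w) vs = 0" unfolding one_form_def by (cases vs rule: remdups_adj.cases) auto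
    then show ?thesis using False
      by (simp add: A.conn_other B.conn_other mwedge_form_unit_left mwedge_form_unit_right dloc_form_unit
        bilinear_lzero[OF bilinear_matrix_mult] bilinear_rzero[OF bilinear_matrix_mult])
  qed
qed

text \<open>\<open>G\<close> and its inverse are treated as forms of degree 0, so that the
  transformation law of the connection can be differentiated by the Leibniz rule. By
  \<open>d d G = 0\<close> no second derivatives of \<open>G\<close> remain, and the terms
  containing \<open>d G\<close> cancel.\<close>

lemma curv_gauge:
  assumes w: "w \<in> W" shows "B.curv w = conj_form (G w) (A.curv w)"
proof -
  let ?g = "\<lambda>y. form_unit (G y)" and ?gi = "\<lambda>y. form_unit (Gi y)"
  let ?dg = "dloc e ?g w" and ?a = "A.conn w" and ?da = "dloc e A.conn w"
  note sm = A.smooth_form_unit[OF G] A.smooth_form_unit[OF smooth_Gi] A.smooth_conn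
  note df = A.diff[OF _ w] smooth_on_mwedge smooth_on_dloc A.W sm
  have can: "mwedge (?g w) (mwedge (?gi w) \<Phi>) = \<Phi>" for \<Phi> :: "('c, complex^'r^'r) aform"
    unfolding Gi_def by (rule conj_form_cancel[OF G_inv[OF w]])
  have dgi: "dloc e ?gi w = - mwedge (?gi w) (mwedge ?dg (?gi w))"
  proof (rule ext)
    fix vs
    have "dloc e ?gi w vs = one_form (\<lambda>v. dird (e v) Gi w) vs"
      unfolding dloc_form_unit ..
    then show "dloc e ?gi w vs = (- mwedge (?gi w) (mwedge ?dg (?gi w))) vs"
      by (cases vs rule: remdups_adj.cases)
        (simp_all add: dloc_form_unit one_form_def mwedge_form_unit_left mwedge_form_unit_right dird_Gi[OF w] mult_simps
          bilinear_lzero[OF bilinear_matrix_mult] bilinear_rzero[OF bilinear_matrix_mult])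
  qed
  have gg: "gsg ?dg = - ?dg" unfolding dloc_form_unit by (rule gsg_one_form)
  have "dloc e B.conn w = dloc e (\<lambda>y. mwedge (?gi y) (mwedge (A.conn y) (?g y)) + mwedge (?gi y) (dloc e ?g y)) w"
    by (rule dloc_cong[OF A.W w]) (simp add: conn_gauge)
  also have "\<dots> = dloc e (\<lambda>y. mwedge (?gi y) (mwedge (A.conn y) (?g y))) w + dloc e (\<lambda>y. mwedge (?gi y) (dloc e ?g y)) w"
    by (rule dloc_add) (auto intro!: df)
  also have "dloc e (\<lambda>y. mwedge (?gi y) (mwedge (A.conn y) (?g y))) w =
      mwedge (dloc e ?gi w) (mwedge ?a (?g w)) + mwedge (?gi w) (mwedge ?da (?g w) - mwedge ?a ?dg)"
    by (subst dloc_mwedge, auto intro!: df, subst dloc_mwedge) (auto intro!: df simp: A.gsg_conn mwedge_linear)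
  also have "dloc e (\<lambda>y. mwedge (?gi y) (dloc e ?g y)) w = mwedge (dloc e ?gi w) ?dg"
  proof -
    have "dloc e (\<lambda>y. mwedge (?gi y) (dloc e ?g y)) w = mwedge (dloc e ?gi w) ?dg + mwedge (gsg (?gi w)) (dloc e (dloc e ?g) w)"
      by (rule dloc_mwedge) (auto intro!: df)
    also have "dloc e (dloc e ?g) w = 0" by (rule dloc_dloc[OF A.W w sm(1)])
    finally show ?thesis by (simp only: mwedge_linear add_0_right)
  qed
  finally have d: "dloc e B.conn w = mwedge (dloc e ?gi w) (mwedge ?a (?g w)) + mwedge (?gi w) (mwedge ?da (?g w) - mwedge ?a ?dg)
      + mwedge (dloc e ?gi w) ?dg" .
  show ?thesis
    unfolding B.curv_def d conn_gauge[OF w] dgi A.curv_def conj_form_mwedge_units Gi_def[symmetric]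
    by (simp add: mwedge_linear mwedge_assoc can algebra_simps)
qed

lemma ncv_gauge: "w \<in> W \<Longrightarrow> B.ncv w = conj_form (G w) (A.ncv w)"
  by (rule ext) (simp add: B.ncv_def A.ncv_def curv_gauge conj_form_def cscale_simps)

text \<open>The inhomogeneous term of the connection is \<open>Gi\<close> times \<open>d G\<close>.
  It does not move in the direction \<tau>, so the variation of the connection transforms by
  conjugation alone.\<close>

lemma dconn_gauge:
  assumes w: "w \<in> W" shows "B.dconn w = conj_form (G w) (A.dconn w)"
proof (rule ext)
  fix vs
  show "B.dconn w vs = conj_form (G w) (A.dconn w) vs"
  proof (cases "length vs = 1")
    case False
    then show ?thesis
      by (simp add: A.dconn_other B.dconn_other conj_form_def bilinear_lzero[OF bilinear_matrix_mult] bilinear_rzero[OF bilinear_matrix_mult])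
  next
    case True
    then obtain v where vs: "vs = [v]" by (metis One_nat_def Suc_length_conv length_0_conv)
    have z: "dird \<tau> (dird (e v) G) w = 0"
    proof -
      have "dird (e v) (dird \<tau> G) w = dird (e v) (\<lambda>w. 0) w"
        by (rule dird_cong_open(1)[OF A.W w]) (rule G_const)
      then show ?thesis using dird_commute[OF A.W w G, of \<tau> "e v"] by simp
    qed
    have zi: "dird \<tau> Gi w = 0"
      by (simp add: dird_Gi[OF w] G_const[OF w] bilinear_lzero[OF bilinear_matrix_mult] bilinear_rzero[OF bilinear_matrix_mult])
    note zz = bilinear_lzero[OF bilinear_matrix_mult] bilinear_rzero[OF bilinear_matrix_mult]
    have "B.dconn w [v] = dird \<tau> (\<lambda>w. Gi w ** (A.conn w [v] ** G w) + Gi w ** dird (e v) G w) w"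
      unfolding B.dconn_def by (rule dird_cong_open(1)[OF A.W w]) (rule conn_gauge_one)
    also have "\<dots> = dird \<tau> (\<lambda>w. Gi w ** (A.conn w [v] ** G w)) w + dird \<tau> (\<lambda>w. Gi w ** dird (e v) G w) w"
      by (intro dird_add A.diff[OF _ w] A.smooth_mult smooth_Gi A.smooth_conn G smooth_on_dird)
    also have "\<dots> = Gi w ** (A.dconn w [v] ** G w)"
      by (simp add: A.dird_mult[OF smooth_Gi _ w] A.smooth_mult A.smooth_conn G A.dird_mult[OF A.smooth_conn G w] smooth_on_dird
          z zi zz G_const[OF w] A.dconn_def)
    finally show ?thesis by (simp add: vs conj_form_def Gi_def)
  qed
qed

lemma Ef_gauge: "w \<in> W \<Longrightarrow> B.Ef j w = A.Ef j w"
proof -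
  assume w: "w \<in> W"
  have "form_unit (B.vel w) = conj_form (G w) (form_unit (A.vel w))"
    unfolding conj_form_form_unit by (simp add: vel_gauge[OF w] Gi_def)
  note eq = this
  show ?thesis
    unfolding B.Ef_def A.Ef_def ncv_gauge[OF w] dconn_gauge[OF w] eq ftriple_conj_form[OF G_inv[OF w]] ..
qed

end

text \<open>\<phi> stands for a change of chart coordinates that keeps the parameters, and
  \<open>L\<close> for its derivative on tangent vectors of the chart. \<open>L_i\<close> says that
  the change is holomorphic, \<open>L_sym\<close> that its second derivatives are symmetric, and
  \<open>L_\<tau>\<close> that \<open>L\<close> is constant along \<tau>.\<close>

locale chart_change = A: metric_family W e \<tau> H + C: metric_family W' e \<tau> H'
  for W W' :: "'w::real_normed_vector set" and e :: "complex^'n::finite \<Rightarrow> 'w" and \<tau> :: 'w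
    and H H' :: "'w \<Rightarrow> complex^'r::finite^'r" +
  fixes \<phi> :: "'w \<Rightarrow> 'w" and L :: "'w \<Rightarrow> complex^'n \<Rightarrow> complex^'n"
  assumes \<phi>: "\<And>w. w \<in> W \<Longrightarrow> \<phi> differentiable (at w)" and \<phi>_in: "\<And>w. w \<in> W \<Longrightarrow> \<phi> w \<in> W'"
    and pull: "\<And>w. w \<in> W \<Longrightarrow> H w = H' (\<phi> w)"
    and L: "\<And>w v. w \<in> W \<Longrightarrow> dird (e v) \<phi> w = e (L w v)" and \<phi>_\<tau>: "\<And>w. w \<in> W \<Longrightarrow> dird \<tau> \<phi> w = \<tau>"
    and L_i: "\<And>w v. w \<in> W \<Longrightarrow> L w (\<i> *s v) = \<i> *s L w v"
    and L_smooth: "\<And>v. smooth_on W (\<lambda>y. L y v)"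
    and L_sym: "\<And>w v v'. w \<in> W \<Longrightarrow> dird (e v) (\<lambda>y. L y v') w = dird (e v') (\<lambda>y. L y v) w"
    and L_\<tau>: "\<And>w v. w \<in> W \<Longrightarrow> dird \<tau> (\<lambda>y. L y v) w = 0"
begin

lemma dird_pull: "w \<in> W \<Longrightarrow> f differentiable (at (\<phi> w)) \<Longrightarrow> dird u (\<lambda>y. f (\<phi> y)) w = dird (dird u \<phi> w) f (\<phi> w)"
  by (rule dird_compose[OF \<phi>])

lemma dird_H_pull: "w \<in> W \<Longrightarrow> dird u H w = dird (dird u \<phi> w) H' (\<phi> w)"
  using dird_cong_open(1)[OF A.W, of w H "\<lambda>y. H' (\<phi> y)" u] pull dird_pull[OF _ C.diff[OF C.H \<phi>_in]] by simp

lemma pd_pull: "w \<in> W \<Longrightarrow> A.pd v H w = C.pd (L w v) H' (\<phi> w)"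
  unfolding A.pd_def C.pd_def by (simp add: dird_H_pull L L_i)

lemma Hi_pull: "w \<in> W \<Longrightarrow> A.Hi w = C.Hi (\<phi> w)"
  by (simp add: A.Hi_def C.Hi_def pull)

lemma vel_pull: "w \<in> W \<Longrightarrow> A.vel w = C.vel (\<phi> w)"
  by (simp add: A.vel_def C.vel_def Hi_pull dird_H_pull \<phi>_\<tau>)

lemma conn_pull_one: "w \<in> W \<Longrightarrow> A.conn w [v] = C.conn (\<phi> w) [L w v]"
  by (simp add: A.conn_def C.conn_def one_form_def Hi_pull pd_pull)

text \<open>Both the point \<open>\<phi> y\<close> and the vector \<open>L y v\<close> vary.
  Expanding the vector in a basis lets the product rule separate the two contributions.\<close>

lemma dird_conn_pull:
  assumes w: "w \<in> W"
  shows "dird u (\<lambda>y. C.conn (\<phi> y) [L y v]) w =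
    dird (dird u \<phi> w) (\<lambda>y. C.conn y [L w v]) (\<phi> w) + C.conn (\<phi> w) [dird u (\<lambda>y. L y v) w]"
proof -
  let ?f = "\<lambda>y b. C.conn y [b]"
  have l: "linear (?f y)" if "y \<in> W'" for y by (rule C.linear_conn[OF that])
  have ex: "?f y b = (\<Sum>c\<in>Basis. (b \<bullet> c) *\<^sub>R ?f y c)" if "y \<in> W'" for y b
  proof -
    have "?f y (\<Sum>c\<in>Basis. (b \<bullet> c) *\<^sub>R c) = (\<Sum>c\<in>Basis. (b \<bullet> c) *\<^sub>R ?f y c)"
      unfolding linear_sum[OF l[OF that]] linear_cmul[OF l[OF that]] ..
    then show ?thesis by (simp add: euclidean_representation)
  qed
  have dL: "(\<lambda>y. L y v) differentiable (at w)" by (rule A.diff[OF L_smooth w])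
  have df: "(\<lambda>y. ?f y c) differentiable (at (\<phi> w))" for c by (rule C.diff[OF C.smooth_conn \<phi>_in[OF w]])
  have dfp: "(\<lambda>y. ?f (\<phi> y) c) differentiable (at w)" for c
    using differentiable_chain_at[OF \<phi>[OF w] df] by (simp add: o_def)
  have di: "(\<lambda>y. L y v \<bullet> c) differentiable (at w)" "dird u (\<lambda>y. L y v \<bullet> c) w = dird u (\<lambda>y. L y v) w \<bullet> c" for c
    using dird_linear_compose[OF bounded_linear_inner_left dL] bounded_linear.has_derivative[OF bounded_linear_inner_left has_derivative_dird[OF dL]]
    by (auto simp: differentiable_def)
  have "dird u (\<lambda>y. ?f (\<phi> y) (L y v)) w = dird u (\<lambda>y. \<Sum>c\<in>Basis. (L y v \<bullet> c) *\<^sub>R ?f (\<phi> y) c) w"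
    by (rule dird_cong_open(1)[OF A.W w]) (rule ex[OF \<phi>_in])
  also have "\<dots> = (\<Sum>c\<in>Basis. dird u (\<lambda>y. (L y v \<bullet> c) *\<^sub>R ?f (\<phi> y) c) w)"
    by (rule dird_sum) (rule differentiable_scaleR[OF di(1) dfp])
  also have "\<dots> = (\<Sum>c\<in>Basis. (L w v \<bullet> c) *\<^sub>R dird (dird u \<phi> w) (\<lambda>y. ?f y c) (\<phi> w)) +
      (\<Sum>c\<in>Basis. (dird u (\<lambda>y. L y v) w \<bullet> c) *\<^sub>R ?f (\<phi> w) c)"
    by (simp add: dird_bilinear[OF bounded_bilinear_scaleR di(1) dfp] di(2) dird_pull[OF w df] sum.distrib)
  also have "(\<Sum>c\<in>Basis. (dird u (\<lambda>y. L y v) w \<bullet> c) *\<^sub>R ?f (\<phi> w) c) = ?f (\<phi> w) (dird u (\<lambda>y. L y v) w)"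
    by (rule ex[OF \<phi>_in[OF w], symmetric])
  also have "(\<Sum>c\<in>Basis. (L w v \<bullet> c) *\<^sub>R dird (dird u \<phi> w) (\<lambda>y. ?f y c) (\<phi> w)) = dird (dird u \<phi> w) (\<lambda>y. ?f y (L w v)) (\<phi> w)"
  proof -
    have "dird (dird u \<phi> w) (\<lambda>y. ?f y (L w v)) (\<phi> w) = dird (dird u \<phi> w) (\<lambda>y. \<Sum>c\<in>Basis. (L w v \<bullet> c) *\<^sub>R ?f y c) (\<phi> w)"
      by (rule dird_cong_open(1)[OF C.W \<phi>_in[OF w]]) (rule ex)
    also have "\<dots> = (\<Sum>c\<in>Basis. dird (dird u \<phi> w) (\<lambda>y. (L w v \<bullet> c) *\<^sub>R ?f y c) (\<phi> w))"
      by (rule dird_sum) (rule differentiable_scaleR[OF differentiable_const df])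
    finally show ?thesis by (simp add: dird_linear_compose[OF bounded_linear_scaleR_right df])
  qed
  finally show ?thesis .
qed

lemma dconn_pull:
  assumes w: "w \<in> W" shows "A.dconn w vs = C.dconn (\<phi> w) (map (L w) vs)"
proof (cases "length vs = 1")
  case True
  then obtain v where vs: "vs = [v]" by (metis One_nat_def Suc_length_conv length_0_conv)
  have "A.dconn w [v] = dird \<tau> (\<lambda>y. C.conn (\<phi> y) [L y v]) w"
    unfolding A.dconn_def by (rule dird_cong_open(1)[OF A.W w]) (rule conn_pull_one)
  then show ?thesis
    using linear_0[OF C.linear_conn[OF \<phi>_in[OF w]]]
    by (simp add: vs dird_conn_pull[OF w] \<phi>_\<tau>[OF w] L_\<tau>[OF w] C.dconn_def)
qed (simp add: A.dconn_other C.dconn_other)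

text \<open>The second derivatives of \<phi> enter \<open>d\<close> of the connection through the
  last term of \<open>dird_conn_pull\<close>. They are symmetric and drop out in the
  antisymmetrisation.\<close>

lemma curv_pull:
  assumes w: "w \<in> W" shows "A.curv w vs = C.curv (\<phi> w) (map (L w) vs)"
proof (cases "length vs = 2")
  case True
  then obtain v v' where vs: "vs = [v, v']"
    by (metis (no_types, lifting) One_nat_def Suc_1 Suc_length_conv length_0_conv)
  have d: "dird (e v) (\<lambda>y. A.conn y [v']) w = dird (e (L w v)) (\<lambda>y. C.conn y [L w v']) (\<phi> w)
      + C.conn (\<phi> w) [dird (e v) (\<lambda>y. L y v') w]" for v v'
  proof -
    have "dird (e v) (\<lambda>y. A.conn y [v']) w = dird (e v) (\<lambda>y. C.conn (\<phi> y) [L y v']) w"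
      by (rule dird_cong_open(1)[OF A.W w]) (rule conn_pull_one)
    then show ?thesis by (simp add: dird_conn_pull[OF w] L[OF w])
  qed
  have 1: "dloc e A.conn w [v, v'] = dloc e C.conn (\<phi> w) [L w v, L w v']"
    by (simp add: dloc_def d L_sym[OF w, of v v'])
  have 2: "A.conn w us = C.conn (\<phi> w) (map (L w) us)" for us
    by (cases us rule: remdups_adj.cases) (simp_all add: conn_pull_one[OF w] A.conn_other C.conn_other)
  have "mwedge (A.conn w) (A.conn w) vs = mwedge (C.conn (\<phi> w)) (C.conn (\<phi> w)) (map (L w) vs)"
    unfolding mwedge_map 2[abs_def] ..
  then show ?thesis using 1 by (simp add: A.curv_def C.curv_def vs)
qed (simp add: A.curv_other C.curv_other w \<phi>_in)

lemma Ef_pull: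
  assumes w: "w \<in> W" shows "A.Ef j w vs = C.Ef j (\<phi> w) (map (L w) vs)"
proof -
  have "A.ncv w = (\<lambda>vs. C.ncv (\<phi> w) (map (L w) vs))" "A.dconn w = (\<lambda>vs. C.dconn (\<phi> w) (map (L w) vs))"
    by (auto simp: A.ncv_def C.ncv_def curv_pull[OF w] dconn_pull[OF w])
  moreover have "form_unit (A.vel w) = (\<lambda>vs. form_unit (C.vel (\<phi> w)) (map (L w) vs))"
    by (auto simp: form_unit_def vel_pull[OF w])
  ultimately show ?thesis
    unfolding A.Ef_def C.Ef_def sum_apply ftriple_map by simp
qed

end

section \<open>Stokes' theorem\<close>

lemma swedge_form_unit_left: "swedge (form_unit c) \<alpha> vs = c * \<alpha> vs"
proof (induction vs arbitrary: \<alpha>)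
  case Nil
  then show ?case by (simp add: swedge_Nil form_unit_def)
next
  case (Cons v vs)
  have "swedge (form_unit c) \<alpha> (v # vs) = swedge 0 \<alpha> vs + swedge (form_unit c) (ctr v \<alpha>) vs"
    by (simp only: swedge_Cons ctr_form_unit gsg_form_unit)
  then show ?case using Cons[of "ctr v \<alpha>"] by (simp add: swedge_linear ctr_def)
qed

lemma swedge_sum_left: "swedge (\<Sum>i\<in>A. f i) \<beta> = (\<Sum>i\<in>A. swedge (f i) \<beta>)"
proof (rule ext)
  fix vs
  show "swedge (\<Sum>i\<in>A. f i) \<beta> vs = (\<Sum>i\<in>A. swedge (f i) \<beta>) vs"
    unfolding sum_apply swedge_def wedge_by_def sum_distrib_right scaleR_sum_right by (rule sum.swap)
qed

lemma continuous_on_extend_zero: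
  fixes f :: "'p::topological_space \<times> 'a::t2_space \<Rightarrow> 'b::real_normed_vector"
  assumes "open P" "open S" "compact K" "continuous_on (P \<times> S) f" "\<And>p z. p \<in> P \<Longrightarrow> z \<in> S - K \<Longrightarrow> f (p, z) = 0" "K \<subseteq> S"
  shows "continuous_on (P \<times> UNIV) (\<lambda>(p, z). if z \<in> S then f (p, z) else 0)"
proof -
  have "continuous_on (P \<times> S) (\<lambda>(p, z). if z \<in> S then f (p, z) else 0)"
    by (rule continuous_on_eq[OF assms(4)]) auto
  moreover have "continuous_on (P \<times> (- K)) (\<lambda>(p, z). if z \<in> S then f (p, z) else 0)"
    by (rule continuous_on_eq[OF continuous_on_const[of _ 0]]) (use assms(5) in auto)
  ultimately have "continuous_on (P \<times> S \<union> P \<times> (- K)) (\<lambda>(p, z). if z \<in> S then f (p, z) else 0)"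
    by (intro continuous_on_open_Un open_Times assms(1,2) open_Compl[OF compact_imp_closed[OF assms(3)]])
  moreover have "P \<times> S \<union> P \<times> (- K) = P \<times> UNIV" using assms(6) by auto
  ultimately show ?thesis by simp
qed

lemma continuous_on_extend_zero':
  fixes f :: "'a::t2_space \<Rightarrow> 'b::real_normed_vector"
  assumes "open S" "compact K" "continuous_on S f" "\<And>z. z \<in> S - K \<Longrightarrow> f z = 0" "K \<subseteq> S"
  shows "continuous_on UNIV (\<lambda>z. if z \<in> S then f z else 0)"
proof -
  have "continuous_on S (\<lambda>z. if z \<in> S then f z else 0)"
    by (rule continuous_on_eq[OF assms(3)]) auto
  moreover have "continuous_on (- K) (\<lambda>z. if z \<in> S then f z else 0)"
    by (rule continuous_on_eq[OF continuous_on_const[of _ 0]]) (use assms(4) in auto)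
  ultimately have "continuous_on (S \<union> - K) (\<lambda>z. if z \<in> S then f z else 0)"
    by (intro continuous_on_open_Un assms(1) open_Compl[OF compact_imp_closed[OF assms(2)]])
  moreover have "S \<union> - K = UNIV" using assms(5) by auto
  ultimately show ?thesis by simp
qed

lemma smooth_on_extend_zero:
  fixes f :: "'a::real_normed_vector \<Rightarrow> 'b::real_normed_vector"
  assumes "open S" "compact K" "smooth_on S f" "\<And>z. z \<in> S - K \<Longrightarrow> f z = 0" "K \<subseteq> S"
  shows "smooth_on UNIV (\<lambda>z. if z \<in> S then f z else 0)"
proof (rule smooth_on_local[OF open_UNIV])
  let ?F = "\<lambda>z. if z \<in> S then f z else 0"
  fix x :: 'a
  show "\<exists>T. open T \<and> x \<in> T \<and> smooth_on T ?F"
  proof (cases "x \<in> S")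
    case True
    have "smooth_on S ?F \<longleftrightarrow> smooth_on S f" by (rule smooth_on_cong[OF assms(1)]) simp
    then show ?thesis using True assms by blast
  next
    case False
    have o: "open (- K)" using assms(2) by (simp add: compact_imp_closed open_Compl)
    have "smooth_on (- K) ?F \<longleftrightarrow> smooth_on (- K) (\<lambda>z. 0 :: 'b)" by (rule smooth_on_cong[OF o]) (use assms(4) in auto)
    then show ?thesis using False o smooth_on_const assms(5) by blast
  qed
qed

locale manifold_partition = complex_manifold X
  for X :: "('i, 'x::t2_space, 'n::finite) atlas" +
  fixes \<psi> :: "'i \<Rightarrow> 'x \<Rightarrow> real"
  assumes pu: "partition_of_unity X \<psi>"
begin

definition idx :: "'i set" where "idx = {i. \<exists>x. \<psi> i x \<noteq> 0}"

lemma \<psi>_closure: "closure {x. \<psi> i x \<noteq> 0} \<subseteq> cdom X i"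
  using pu by (simp add: partition_of_unity_def)

lemma \<psi>_nonneg: "0 \<le> \<psi> i x"
  using pu by (simp add: partition_of_unity_def)

lemma \<psi>_smooth: "smooth_on (cimg X j) (\<lambda>z. \<psi> i (cinv X j z))"
proof -
  have "\<forall>i j. smooth_on (cimg X j) (\<lambda>z. \<psi> i (cinv X j z))"
    using pu unfolding partition_of_unity_def by (elim conjE)
  then show ?thesis by simp
qed

lemma \<psi>_sum: "(\<Sum>i\<in>idx. \<psi> i x) = 1"
proof -
  have "\<forall>x. (\<Sum>i\<in>idx. \<psi> i x) = 1"
    using pu unfolding partition_of_unity_def idx_def by (elim conjE)
  then show ?thesis by simp
qed

definition ksupp :: "'i \<Rightarrow> (complex^'n) set" where "ksupp i = crd X i ` closure {x. \<psi> i x \<noteq> 0}"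

lemma compact_ksupp: "compact (ksupp i)" and ksupp_subset: "ksupp i \<subseteq> cimg X i"
proof -
  have "compact (closure {x. \<psi> i x \<noteq> 0})" using compact_Int_closed[OF compact_X closed_closure[of "{x. \<psi> i x \<noteq> 0}"]] unfolding Int_UNIV_left .
  then show "compact (ksupp i)"
    unfolding ksupp_def using continuous_on_subset[OF continuous_on_crd \<psi>_closure] by (rule compact_continuous_image[rotated])
  show "ksupp i \<subseteq> cimg X i" unfolding ksupp_def using \<psi>_closure crd_in by blast
qed

lemma \<psi>_zero: "z \<in> cimg X i \<Longrightarrow> z \<notin> ksupp i \<Longrightarrow> \<psi> i (cinv X i z) = 0"
proof (rule ccontr)
  assume z: "z \<in> cimg X i" "z \<notin> ksupp i" "\<psi> i (cinv X i z) \<noteq> 0"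
  then have "cinv X i z \<in> closure {x. \<psi> i x \<noteq> 0}" using closure_subset[of "{x. \<psi> i x \<noteq> 0}"] by auto
  then have "crd X i (cinv X i z) \<in> ksupp i" unfolding ksupp_def by blast
  then show False using z by simp
qed

lemma \<psi>_zero_outside: "x \<notin> cdom X i \<Longrightarrow> \<psi> i x = 0"
  using \<psi>_closure[of i] closure_subset[of "{x. \<psi> i x \<noteq> 0}"] by auto

text \<open>The integrand of one summand of \<open>form_integral\<close>, extended by 0 to the whole
  coordinate space, where it is supported in the compact set \<open>ksupp i\<close>.\<close>

definition cutoff :: "'i \<Rightarrow> (complex^'n \<Rightarrow> 'b::real_vector) \<Rightarrow> complex^'n \<Rightarrow> 'b" where
  "cutoff i f z = (if z \<in> cimg X i then \<psi> i (cinv X i z) *\<^sub>R f z else 0)"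

lemma continuous_on_\<psi>: "continuous_on (cimg X j) (\<lambda>z. \<psi> i (cinv X j z))"
  by (rule smooth_on_continuous[OF \<psi>_smooth])

lemma cutoff_zero: "z \<notin> ksupp i \<Longrightarrow> cutoff i f z = 0"
  by (simp add: cutoff_def \<psi>_zero)

lemma continuous_on_cutoff:
  fixes f :: "'p::topological_space \<times> (complex^'n) \<Rightarrow> 'b::real_normed_vector"
  assumes "open P" "continuous_on (P \<times> cimg X i) f"
  shows "continuous_on (P \<times> UNIV) (\<lambda>(p, z). cutoff i (\<lambda>z. f (p, z)) z)"
proof -
  have "continuous_on (P \<times> cimg X i) (\<lambda>w. \<psi> i (cinv X i (snd w)) *\<^sub>R f w)"
    by (intro continuous_on_scaleR assms continuous_on_compose2[OF continuous_on_\<psi>] continuous_on_snd continuous_on_id) auto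
  from continuous_on_extend_zero[OF assms(1) open_cimg compact_ksupp this _ ksupp_subset]
  show ?thesis unfolding cutoff_def by (simp add: \<psi>_zero cong: if_cong)
qed

lemma integrable_cutoff:
  fixes f :: "complex^'n \<Rightarrow> 'b::euclidean_space"
  assumes "continuous_on (cimg X i) f"
  shows "integrable lborel (cutoff i f)"
proof -
  have "continuous_on (cimg X i) (\<lambda>z. \<psi> i (cinv X i z) *\<^sub>R f z)"
    by (intro continuous_on_scaleR continuous_on_\<psi> assms)
  from continuous_on_extend_zero'[OF open_cimg compact_ksupp this _ ksupp_subset]
  have "continuous_on UNIV (cutoff i f)" unfolding cutoff_def by (simp add: \<psi>_zero)
  then show ?thesis by (rule integrable_compact_support[OF _ compact_ksupp]) (rule cutoff_zero)
qed

lemma form_integral_cutoff: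
  assumes "\<psi> = (SOME \<psi>. partition_of_unity X \<psi>)"
  shows "form_integral X \<alpha> = (\<Sum>i\<in>idx. integral\<^sup>L lborel (cutoff i (\<lambda>z. \<alpha> i (cinv X i z) oriented_frame)))"
  unfolding form_integral_def Let_def assms[symmetric] idx_def[symmetric] set_lebesgue_integral_def
  by (intro sum.cong refl Bochner_Integration.integral_cong) (simp_all add: cutoff_def)

definition dpsi :: "'i \<Rightarrow> 'i \<Rightarrow> complex^'n \<Rightarrow> (complex^'n, complex) aform" where
  "dpsi i j z = one_form (\<lambda>v. complex_of_real (dird v (\<lambda>z. \<psi> i (cinv X j z)) z))"

lemma \<psi>_diff: "z \<in> cimg X j \<Longrightarrow> (\<lambda>z. \<psi> i (cinv X j z)) differentiable (at z)"
  by (rule smooth_on_differentiable[OF \<psi>_smooth])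

lemma amf_dpsi: "z \<in> cimg X j \<Longrightarrow> amf (dpsi i j z)"
proof -
  assume "z \<in> cimg X j"
  then have "linear (\<lambda>v. dird v (\<lambda>z. \<psi> i (cinv X j z)) z)" by (intro linear_dird \<psi>_diff)
  then show ?thesis
    unfolding dpsi_def using linear_compose[OF _ bounded_linear.linear[OF bounded_linear_of_real]]
    by (intro amf_one_form) (auto simp: o_def)
qed

lemma dpsi_eq_dloc:
  assumes "z \<in> cimg X j"
  shows "dpsi i j z = dloc (\<lambda>v. v) (\<lambda>z. form_unit (complex_of_real (\<psi> i (cinv X j z)))) z"
  unfolding dpsi_def dloc_form_unit dird_linear_compose[OF bounded_linear_of_real \<psi>_diff[OF assms]] ..

lemma dpsi_zero:
  assumes "z \<in> cimg X i" "z \<notin> ksupp i" shows "dpsi i i z = 0"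
proof -
  have o: "open (cimg X i - ksupp i)" using compact_ksupp open_cimg by (intro open_Diff compact_imp_closed)
  have "dird v (\<lambda>z. \<psi> i (cinv X i z)) z = dird v (\<lambda>z. 0) z" for v
    by (rule dird_cong_open(1)[OF o]) (use assms \<psi>_zero in auto)
  then show ?thesis unfolding dpsi_def one_form_def by (auto simp: fun_eq_iff split: list.splits)
qed

lemma dpsi_trans:
  assumes z: "z \<in> ovl j k"
  shows "dpsi i j z vs = dpsi i k (trans j k z) (map (\<lambda>v. dird v (trans j k) z) vs)"
proof -
  have tz: "trans j k z \<in> cimg X k" using trans_in[OF z] ovl_subset by blast
  have "dird v (\<lambda>z. \<psi> i (cinv X j z)) z = dird (dird v (trans j k) z) (\<lambda>z. \<psi> i (cinv X k z)) (trans j k z)" for v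
  proof -
    have "dird v (\<lambda>z. \<psi> i (cinv X j z)) z = dird v (\<lambda>z. \<psi> i (cinv X k (trans j k z))) z"
      by (rule dird_cong_open(1)[OF open_ovl z]) (simp add: cinv_trans)
    then show ?thesis
      by (simp add: dird_compose[OF trans_differentiable[OF z] \<psi>_diff[OF tz]])
  qed
  then show ?thesis unfolding dpsi_def one_form_def by (cases vs rule: remdups_adj.cases) simp_all
qed

lemma continuous_on_dpsi_swedge:
  assumes "\<And>vs. smooth_on (cimg X j) (\<lambda>z. \<eta> z vs)"
  shows "continuous_on (cimg X j) (\<lambda>z. swedge (dpsi i j z) (\<eta> z) vs)"
proof (rule smooth_on_continuous, rule smooth_on_swedge[OF open_cimg _ assms])
  show "smooth_on (cimg X j) (\<lambda>z. dpsi i j z vs)" for vs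
    unfolding dpsi_def one_form_def
    by (cases vs rule: remdups_adj.cases)
      (simp_all add: smooth_on_const smooth_on_linear_compose[OF open_cimg bounded_linear_of_real smooth_on_dird[OF \<psi>_smooth]])
qed

text \<open>Apply \<open>d\<close> to the product of \<open>\<psi> i\<close> with \<eta>: the result
  is a combination of derivatives of compactly supported functions, so its integral is 0, and the
  Leibniz rule splits it into the two sides.\<close>

lemma integral_cutoff_dloc:
  fixes \<eta> :: "complex^'n \<Rightarrow> (complex^'n, complex) aform"
  assumes \<eta>: "\<And>vs. smooth_on (cimg X i) (\<lambda>z. \<eta> z vs)"
  shows "integral\<^sup>L lborel (cutoff i (\<lambda>z. dloc (\<lambda>v. v) \<eta> z vs)) =
    - integral\<^sup>L lborel (\<lambda>z. if z \<in> cimg X i then swedge (dpsi i i z) (\<eta> z) vs else 0)"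
proof -
  define F where "F us z = (if z \<in> cimg X i then \<psi> i (cinv X i z) *\<^sub>R \<eta> z us else 0)" for us z
  have Fs: "smooth_on UNIV (F us)" for us
    unfolding F_def
    by (rule smooth_on_extend_zero[OF open_cimg compact_ksupp _ _ ksupp_subset])
      (auto intro!: smooth_on_scaleR open_cimg \<psi>_smooth \<eta> simp: \<psi>_zero)
  have F0: "F us z = 0" if "z \<notin> ksupp i" for us z using that by (simp add: F_def \<psi>_zero)
  have dF: "integral\<^sup>L lborel (dird v (F us)) = 0" for v us
    by (rule lborel_integral_dird_eq_0[OF Fs compact_ksupp F0])
  have iF: "integrable lborel (dird v (F us))" for v us
  proof (rule integrable_compact_support[OF smooth_on_continuous[OF smooth_on_dird[OF Fs]] compact_ksupp[of i]])
    fix z assume z: "z \<notin> ksupp i"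
    have "dird v (F us) z = dird v (\<lambda>z. 0) z"
      by (rule dird_cong_open(1)[of "- ksupp i"]) (use z F0 compact_ksupp in \<open>auto simp: compact_imp_closed open_Compl\<close>)
    then show "dird v (F us) z = 0" by simp
  qed
  have I0: "integral\<^sup>L lborel (\<lambda>z. dloc (\<lambda>v. v) (\<lambda>z us. F us z) z vs) = 0"
    unfolding dloc_def by (simp add: dF iF)
  have A: "integrable lborel (cutoff i (\<lambda>z. dloc (\<lambda>v. v) \<eta> z vs))"
    by (intro integrable_cutoff smooth_on_continuous smooth_on_dloc open_cimg \<eta>)
  have Bc: "continuous_on UNIV (\<lambda>z. if z \<in> cimg X i then swedge (dpsi i i z) (\<eta> z) vs else 0)"
    by (rule continuous_on_extend_zero'[OF open_cimg compact_ksupp continuous_on_dpsi_swedge[OF \<eta>] _ ksupp_subset])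
      (auto simp: dpsi_zero swedge_linear)
  have B: "integrable lborel (\<lambda>z. if z \<in> cimg X i then swedge (dpsi i i z) (\<eta> z) vs else 0)"
    by (rule integrable_compact_support[OF Bc compact_ksupp[of i]]) (auto simp: dpsi_zero swedge_linear)
  have "dloc (\<lambda>v. v) (\<lambda>z us. F us z) z vs = (if z \<in> cimg X i then swedge (dpsi i i z) (\<eta> z) vs else 0)
      + cutoff i (\<lambda>z. dloc (\<lambda>v. v) \<eta> z vs) z" for z
  proof (cases "z \<in> cimg X i")
    case True
    let ?f = "\<lambda>z. form_unit (complex_of_real (\<psi> i (cinv X i z)))"
    have "dloc (\<lambda>v. v) (\<lambda>z us. F us z) z = dloc (\<lambda>v. v) (\<lambda>z. swedge (?f z) (\<eta> z)) z"
      by (rule dloc_cong[OF open_cimg True]) (simp add: F_def swedge_form_unit_left scaleR_conv_of_real)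
    also have "\<dots> = swedge (dloc (\<lambda>v. v) ?f z) (\<eta> z) + swedge (gsg (?f z)) (dloc (\<lambda>v. v) \<eta> z)"
    proof (rule dloc_swedge)
      show "(\<lambda>y. ?f y vs) differentiable (at z)" for vs
        using bounded_linear.has_derivative[OF bounded_linear_of_real has_derivative_dird[OF \<psi>_diff[OF True]], of i]
        by (cases vs) (auto simp: form_unit_def differentiable_def)
      show "(\<lambda>y. \<eta> y vs) differentiable (at z)" for vs by (rule smooth_on_differentiable[OF \<eta> True])
    qed
    finally show ?thesis using True
      by (simp add: dpsi_eq_dloc cutoff_def swedge_form_unit_left scaleR_conv_of_real)
  next
    case False
    then have "z \<notin> ksupp i" using ksupp_subset by blast
    then have "dird v (F us) z = 0" for v us
      using dird_cong_open(1)[of "- ksupp i" z "F us" "\<lambda>z. 0" v] F0 compact_ksupp[of i] by (simp add: compact_imp_closed open_Compl)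
    then show ?thesis using False by (simp add: dloc_def cutoff_def)
  qed
  then have "integral\<^sup>L lborel (\<lambda>z. dloc (\<lambda>v. v) (\<lambda>z us. F us z) z vs) =
      integral\<^sup>L lborel (\<lambda>z. if z \<in> cimg X i then swedge (dpsi i i z) (\<eta> z) vs else 0)
      + integral\<^sup>L lborel (cutoff i (\<lambda>z. dloc (\<lambda>v. v) \<eta> z vs))"
    using A B by simp
  then show ?thesis using I0 by (simp add: add_eq_0_iff)
qed

text \<open>What remains after \<open>integral_cutoff_dloc\<close> is the sum over \<open>i\<close>
  of the integrals of \<open>dpsi i i\<close> wedge \<open>\<eta> i\<close> in the
  \<open>i\<close>-th chart. Each is split once more by the partition, and its piece with index
  \<open>k\<close> is moved to the \<open>k\<close>-th chart. There the sum over \<open>i\<close>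
  can be taken first, and it vanishes as the differential of the constant 1.\<close>

theorem stokes:
  fixes \<eta> :: "'i \<Rightarrow> complex^'n \<Rightarrow> (complex^'n, complex) aform"
  assumes \<eta>: "\<And>i vs. smooth_on (cimg X i) (\<lambda>z. \<eta> i z vs)" and am: "\<And>i z. z \<in> cimg X i \<Longrightarrow> amf (\<eta> i z)"
    and tr: "\<And>i k z vs. z \<in> ovl i k \<Longrightarrow> \<eta> i z vs = \<eta> k (trans i k z) (map (\<lambda>v. dird v (trans i k) z) vs)"
  shows "(\<Sum>i\<in>idx. integral\<^sup>L lborel (cutoff i (\<lambda>z. dloc (\<lambda>v. v) (\<eta> i) z oriented_frame))) = 0"
proof -
  let ?fr = "oriented_frame :: (complex^'n) list"
  define D where "D i k z = swedge (dpsi i k z) (\<eta> k z)" for i k z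
  define f where "f i k z = (if z \<in> cimg X i then \<psi> k (cinv X i z) *\<^sub>R D i i z ?fr else 0)" for i k z
  have cD: "continuous_on (cimg X k) (\<lambda>z. D i k z vs)" for i k vs
    unfolding D_def by (rule continuous_on_dpsi_swedge[OF \<eta>])
  have D0: "D i i z vs = 0" if "z \<in> cimg X i" "z \<notin> ksupp i" for i z vs
    using that by (simp add: D_def dpsi_zero swedge_linear)
  have fi: "integrable lborel (f i k)" for i k
  proof -
    have "continuous_on (cimg X i) (\<lambda>z. \<psi> k (cinv X i z) *\<^sub>R D i i z ?fr)"
      by (intro continuous_on_scaleR continuous_on_\<psi> cD)
    from continuous_on_extend_zero'[OF open_cimg compact_ksupp this _ ksupp_subset]
    have "continuous_on UNIV (f i k)" unfolding f_def by (simp add: D0)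
    then show ?thesis
      by (rule integrable_compact_support[OF _ compact_ksupp[of i]]) (simp add: f_def D0)
  qed
  have split: "(if z \<in> cimg X i then D i i z ?fr else 0) = (\<Sum>k\<in>idx. f i k z)" for i z
  proof (cases "z \<in> cimg X i")
    case True
    have "(\<Sum>k\<in>idx. f i k z) = (\<Sum>k\<in>idx. \<psi> k (cinv X i z)) *\<^sub>R D i i z ?fr"
      using True by (simp add: f_def scaleR_sum_left)
    then show ?thesis using True by (simp add: \<psi>_sum)
  qed (simp add: f_def)
  \<comment> \<open>Both integrands vanish off the overlap of the two charts: the one on the left
    because of \<open>\<psi> k\<close>, the one on the right because of
    \<open>dpsi i k\<close>.\<close>
  have cov: "integral\<^sup>L lborel (f i k) = integral\<^sup>L lborel (cutoff k (\<lambda>z. D i k z ?fr))" for i k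
  proof (rule lborel_integral_top_form[OF open_ovl[of i k] open_ovl[of k i] inj_on_trans trans_image trans_differentiable
        dird_trans_scalar inj_dird_trans fi, where \<alpha>="\<lambda>z vs. \<psi> k (cinv X i z) *\<^sub>R D i i z vs" and \<beta>="\<lambda>z vs. \<psi> k (cinv X k z) *\<^sub>R D i k z vs"])
    show "f i k z = 0" if "z \<notin> ovl i k" for z
    proof (cases "z \<in> cimg X i")
      case True
      then have "cinv X i z \<notin> cdom X k" using that ovlI[of "cinv X i z" i k] cinv_in[of z i] by auto
      then show ?thesis by (simp add: f_def \<psi>_zero_outside)
    qed (simp add: f_def)
    show "f i k z = \<psi> k (cinv X i z) *\<^sub>R D i i z ?fr" if "z \<in> ovl i k" for z
      using that ovl_subset by (auto simp: f_def)
    show "integrable lborel (cutoff k (\<lambda>z. D i k z ?fr))"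
      by (rule integrable_cutoff[OF cD])
    show "cutoff k (\<lambda>z. D i k z ?fr) z = \<psi> k (cinv X k z) *\<^sub>R D i k z ?fr" if "z \<in> ovl k i" for z
      using that ovl_subset by (auto simp: cutoff_def)
    show "cutoff k (\<lambda>z. D i k z ?fr) z = 0" if "z \<notin> ovl k i" for z
    proof (cases "z \<in> cimg X k")
      case True
      \<comment> \<open>The point lies outside the \<open>i\<close>-th chart, hence off the closed
        support of \<open>\<psi> i\<close>; \<open>N\<close> is a neighbourhood of it on which
        \<open>\<psi> i\<close> is 0, so that \<open>dpsi i k\<close> vanishes there.\<close>
      define N where "N = crd X k ` (cdom X k - closure {x. \<psi> i x \<noteq> 0})"
      have oN: "open N" unfolding N_def by (intro open_crd_image open_Diff open_cdom) auto
      have "cinv X k z \<notin> cdom X i" using that True ovlI[of "cinv X k z" k i] cinv_in by auto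
      then have zN: "z \<in> N"
        unfolding N_def using \<psi>_closure[of i] True cinv_in by (intro image_eqI[of _ _ "cinv X k z"]) auto
      have "dird v (\<lambda>z. \<psi> i (cinv X k z)) z = dird v (\<lambda>z. 0) z" for v
        by (rule dird_cong_open(1)[OF oN zN]) (use closure_subset[of "{x. \<psi> i x \<noteq> 0}"] in \<open>auto simp: N_def\<close>)
      then have "dpsi i k z = 0"
        unfolding dpsi_def one_form_def by (auto simp: fun_eq_iff split: list.splits)
      then show ?thesis by (simp add: cutoff_def D_def swedge_linear)
    qed (simp add: cutoff_def)
    show "amf (\<lambda>vs. \<psi> k (cinv X k z) *\<^sub>R D i k z vs)" if "z \<in> ovl k i" for z
    proof (rule amf_linear_compose[OF bounded_linear.linear[OF bounded_linear_scaleR_right]])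
      show "amf (D i k z)" unfolding D_def using that ovl_subset by (intro amf_swedge amf_dpsi am) auto
    qed
    show "\<psi> k (cinv X i z) *\<^sub>R D i i z ?fr = \<psi> k (cinv X k (trans i k z)) *\<^sub>R D i k (trans i k z) (map (\<lambda>v. dird v (trans i k) z) ?fr)"
      if z: "z \<in> ovl i k" for z
      unfolding cinv_trans[OF z] D_def swedge_map dpsi_trans[OF z, symmetric] tr[OF z, symmetric] ..
  qed
  have sum0: "(\<Sum>i\<in>idx. cutoff k (\<lambda>z. D i k z ?fr) z) = 0" for k z
  proof (cases "z \<in> cimg X k")
    case True
    have "(\<Sum>i\<in>idx. dird v (\<lambda>z. \<psi> i (cinv X k z)) z) = 0" for v
    proof -
      have "(\<Sum>i\<in>idx. dird v (\<lambda>z. \<psi> i (cinv X k z)) z) = dird v (\<lambda>z. \<Sum>i\<in>idx. \<psi> i (cinv X k z)) z"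
        by (rule dird_sum[symmetric]) (rule \<psi>_diff[OF True])
      then show ?thesis by (simp add: \<psi>_sum)
    qed
    then have e: "(\<Sum>i\<in>idx. complex_of_real (dird v (\<lambda>z. \<psi> i (cinv X k z)) z)) = 0" for v
      unfolding of_real_sum[symmetric] by simp
    have "(\<Sum>i\<in>idx. dpsi i k z) = 0"
    proof (rule ext)
      show "(\<Sum>i\<in>idx. dpsi i k z) vs = 0 vs" for vs
        by (cases vs rule: remdups_adj.cases) (simp_all add: sum_apply dpsi_def one_form_def e)
    qed
    moreover have "(\<Sum>i\<in>idx. swedge (dpsi i k z) (\<eta> k z)) = swedge (\<Sum>i\<in>idx. dpsi i k z) (\<eta> k z)"
      by (rule swedge_sum_left[symmetric])
    ultimately have "(\<Sum>i\<in>idx. D i k z) = 0" by (simp only: D_def swedge_linear)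
    then have "(\<Sum>i\<in>idx. D i k z ?fr) = 0" by (metis sum_apply zero_fun_apply)
    then show ?thesis using True by (simp add: cutoff_def flip: scaleR_sum_right)
  qed (simp add: cutoff_def)
  have "(\<Sum>i\<in>idx. integral\<^sup>L lborel (cutoff i (\<lambda>z. dloc (\<lambda>v. v) (\<eta> i) z ?fr))) =
     - (\<Sum>i\<in>idx. integral\<^sup>L lborel (\<lambda>z. if z \<in> cimg X i then D i i z ?fr else 0))"
    unfolding D_def integral_cutoff_dloc[OF \<eta>] sum_negf ..
  also have "(\<Sum>i\<in>idx. integral\<^sup>L lborel (\<lambda>z. if z \<in> cimg X i then D i i z ?fr else 0)) =
     (\<Sum>i\<in>idx. \<Sum>k\<in>idx. integral\<^sup>L lborel (cutoff k (\<lambda>z. D i k z ?fr)))"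
    unfolding split by (simp add: Bochner_Integration.integral_sum[OF fi] cov)
  also have "\<dots> = (\<Sum>k\<in>idx. \<Sum>i\<in>idx. integral\<^sup>L lborel (cutoff k (\<lambda>z. D i k z ?fr)))"
    by (rule sum.swap)
  also have "\<dots> = (\<Sum>k\<in>idx. integral\<^sup>L lborel (\<lambda>z. \<Sum>i\<in>idx. cutoff k (\<lambda>z. D i k z ?fr) z))"
    by (intro sum.cong refl Bochner_Integration.integral_sum[symmetric] integrable_cutoff cD)
  also have "\<dots> = 0" by (simp add: sum0)
  finally show ?thesis by simp
qed

end

section \<open>The central charge along a family of metrics\<close>

lemma linear_embed_snd: "linear (\<lambda>v. (0, v))"
  by (rule linearI) simp_all

lemma dird_slice:
  assumes "F differentiable (at (p, z))"
  shows "dird v (\<lambda>z. F (p, z)) z = dird (0, v) F (p, z)" "(\<lambda>z. F (p, z)) differentiable (at z)"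
proof -
  have g: "((\<lambda>z. (p, z)) has_derivative (\<lambda>v. (0, v))) (at z)"
    by (auto intro!: derivative_eq_intros)
  then have gd: "(\<lambda>z. (p, z)) differentiable (at z)" "dird v (\<lambda>z. (p, z)) z = (0, v)" for v
    by (auto simp: differentiable_def intro: dird_eqI)
  show "dird v (\<lambda>z. F (p, z)) z = dird (0, v) F (p, z)"
    using dird_compose[OF gd(1), of F v] assms gd(2) by simp
  show "(\<lambda>z. F (p, z)) differentiable (at z)"
    using differentiable_chain_at[OF gd(1), of F] assms by (simp add: o_def)
qed

lemma dloc_slice:
  assumes "\<And>vs. (\<lambda>w. \<alpha> w vs) differentiable (at (p, z))"
  shows "dloc (\<lambda>v. v) (\<lambda>z. \<alpha> (p, z)) z = dloc (\<lambda>v. (0, v)) \<alpha> (p, z)"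
  by (rule ext) (simp add: dloc_def dird_slice(1)[OF assms])

lemma smooth_on_snd:
  fixes f :: "'a::euclidean_space \<Rightarrow> 'b::real_normed_vector"
  assumes "open P" "open S" "smooth_on S f"
  shows "smooth_on (P \<times> S) (\<lambda>w. f (snd w))"
  by (rule smooth_on_compose[OF open_Times[OF assms(1,2)] assms(2) _ assms(3)])
    (auto intro!: smooth_on_linear open_Times assms bounded_linear_snd)

lemma dird_snd:
  assumes "f differentiable (at (snd w))"
  shows "dird u (\<lambda>w. f (snd w)) w = dird (snd u) f (snd w)"
  using dird_compose[of snd w f u] assms
  by (simp add: bounded_linear_imp_differentiable bounded_linear_snd dird_eqI[OF bounded_linear_imp_has_derivative[OF bounded_linear_snd]])

lemma swedge_cmult: "swedge (\<lambda>vs. c * \<alpha> vs) \<beta> = (\<lambda>vs. c * swedge \<alpha> \<beta> vs)"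
  "swedge \<alpha> (\<lambda>vs. c * \<beta> vs) = (\<lambda>vs. c * swedge \<alpha> \<beta> vs)"
  by (rule ext, simp add: swedge_def wedge_by_def sum_distrib_left mult.left_commute mult.assoc scaleR_conv_of_real)+

lemma cnj_swedge: "cnj (swedge \<alpha> \<beta> vs) = swedge (\<lambda>vs. cnj (\<alpha> vs)) (\<lambda>vs. cnj (\<beta> vs)) vs"
  by (simp add: swedge_def wedge_by_def scaleR_conv_of_real)

lemma cnj_spow:
  assumes "\<And>vs. cnj (\<alpha> vs) = \<alpha> vs"
  shows "cnj (spow \<alpha> k vs) = spow \<alpha> k vs"
proof (induction k arbitrary: vs)
  case (Suc k)
  then show ?case using assms by (simp add: spow_def cnj_swedge)
qed (simp add: spow_def form_unit_def)

lemma spow_Suc: "spow \<alpha> (Suc k) = swedge \<alpha> (spow \<alpha> k)" and spow_0: "spow \<alpha> 0 = form_unit 1"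
  by (simp_all add: spow_def)

lemma spow_map: "spow \<alpha> k (map f vs) = spow (\<lambda>vs. \<alpha> (map f vs)) k vs"
proof (induction k arbitrary: vs)
  case (Suc k)
  then show ?case by (simp add: spow_Suc swedge_map)
qed (simp add: spow_0 form_unit_def)

lemma gsg_spow: "gsg \<alpha> = \<alpha> \<Longrightarrow> gsg (spow \<alpha> k) = spow \<alpha> k"
  by (induction k) (simp_all add: spow_0 spow_Suc gsg_swedge)

text \<open>\<open>L\<close> will be the trace, possibly after multiplication by a fixed
  endomorphism. Such maps turn the matrix-valued charge forms into scalar ones, built from \<omega>
  and \<open>U\<close> by the ordinary wedge product.\<close>

lemma trace_mwedge_id_left:
  fixes L :: "complex^'r::finite^'r \<Rightarrow> complex"
  assumes "linear L" "\<And>c b. L (mat c ** b) = c * L b"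
  shows "L (mwedge (id_form \<alpha>) \<Phi> vs) = swedge \<alpha> (\<lambda>vs. L (\<Phi> vs)) vs"
  by (simp add: mwedge_def linear_wedge_by[OF assms(1)]) (simp add: wedge_by_def swedge_def id_form_def assms(2))

lemma trace_mwedge_id_right:
  fixes L :: "complex^'r::finite^'r \<Rightarrow> complex"
  assumes "linear L" "\<And>c b. L (mat c ** b) = c * L b"
  shows "L (mwedge \<Phi> (id_form \<alpha>) vs) = swedge (\<lambda>vs. L (\<Phi> vs)) \<alpha> vs"
  by (simp add: mwedge_def linear_wedge_by[OF assms(1)])
    (simp add: wedge_by_def swedge_def id_form_def mat_mult_commute[symmetric] assms(2) mult.commute)

lemma trace_left_mult:
  fixes \<theta> :: "complex^'r::finite^'r"
  shows "linear (\<lambda>b. trace (\<theta> ** b))" "trace (\<theta> ** (mat c ** b)) = c * trace (\<theta> ** b)"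
proof -
  show "linear (\<lambda>b. trace (\<theta> ** b))"
    using linear_compose[OF bilinear_linear_right[OF bilinear_matrix_mult] linear_trace, of \<theta>] by (simp add: o_def)
  show "trace (\<theta> ** (mat c ** b)) = c * trace (\<theta> ** b)"
    unfolding cscale_def[symmetric] cscale_mult_right trace_cscale ..
qed

text \<open>As \<open>d\<close> raises the degree by one, it respects homogeneous parts; closedness
  of \<open>uform\<close> therefore passes to each of its components.\<close>

lemma dloc_deg_part:
  "dloc e (\<lambda>y. deg_part k (\<alpha> y)) w vs = (if length vs = Suc k then dloc e \<alpha> w vs else 0)"
proof -
  have "deg_part k (\<alpha> y) (take i vs @ drop (Suc i) vs) = (if length vs = Suc k then \<alpha> y (take i vs @ drop (Suc i) vs) else 0)"
    if "i < length vs" for i y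
  proof -
    have "length (take i vs @ drop (Suc i) vs) = k \<longleftrightarrow> length vs = Suc k" using that by auto
    then show ?thesis by (simp only: deg_part_def)
  qed
  then have "dloc e (\<lambda>y. deg_part k (\<alpha> y)) w vs = (\<Sum>i<length vs. (-1) ^ i *\<^sub>R
      dird (e (vs ! i)) (\<lambda>y. if length vs = Suc k then \<alpha> y (take i vs @ drop (Suc i) vs) else 0) w)"
    unfolding dloc_def by (intro sum.cong refl) simp
  then show ?thesis by (cases "length vs = Suc k") (simp_all add: dloc_def)
qed

lemma dird_swedge:
  assumes "\<And>vs. (\<lambda>w. \<alpha> w vs) differentiable (at w)" "\<And>vs. (\<lambda>w. \<beta> w vs) differentiable (at w)"
  shows "dird u (\<lambda>w. swedge (\<alpha> w) (\<beta> w) vs) w =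
    swedge (\<lambda>vs. dird u (\<lambda>w. \<alpha> w vs) w) (\<beta> w) vs + swedge (\<alpha> w) (\<lambda>vs. dird u (\<lambda>w. \<beta> w vs) w) vs"
  unfolding swedge_def by (rule dird_wedge_by[OF bounded_bilinear_mult assms])

text \<open>The partition of unity is the very one that \<open>form_integral\<close> selects, so the
  integrals below are literally those of the definitions.\<close>

locale bundle_charge = manifold_partition X "SOME \<psi>. partition_of_unity X \<psi>"
  for X :: "('i, 'x::t2_space, 'n::finite) atlas" +
  fixes g :: "'i \<Rightarrow> 'i \<Rightarrow> 'x \<Rightarrow> complex^'r::finite^'r" and C :: "('i, 'x, 'n) charge"
  assumes hol_bundle: "holomorphic_bundle X g" and charge: "polynomial_central_charge X C"
begin

abbreviation em :: "complex^'n \<Rightarrow> 'p::euclidean_space \<times> (complex^'n)" where "em \<equiv> (\<lambda>v. (0, v))"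

definition kform_loc :: "'i \<Rightarrow> 'p \<times> (complex^'n) \<Rightarrow> (complex^'n, complex) aform" where
  "kform_loc i w = kform C i (cinv X i (snd w))"

definition uform_loc :: "nat \<Rightarrow> 'i \<Rightarrow> 'p \<times> (complex^'n) \<Rightarrow> (complex^'n, complex) aform" where
  "uform_loc l i w = deg_part (2 * l) (uform C i (cinv X i (snd w)))"

text \<open>The scalar counterpart of \<open>charge_term\<close>, to which it reduces under a trace
  (see \<open>trace_charge_term\<close>).\<close>

definition charge_wedge :: "'i \<Rightarrow> 'p \<times> (complex^'n) \<Rightarrow> nat \<Rightarrow> nat \<Rightarrow> (complex^'n, complex) aform \<Rightarrow> (complex^'n, complex) aform" where
  "charge_wedge i w d l f = swedge (spow (kform_loc i w) d) (swedge f (uform_loc l i w))"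

lemma closed_kform: "closed_form X (kform C)" and closed_uform: "closed_form X (uform C)"
  and real_kform: "real_form X (kform C)" and real_uform: "real_form X (uform C)"
  and kform_deg: "x \<in> cdom X i \<Longrightarrow> length vs \<noteq> 2 \<Longrightarrow> kform C i x vs = 0"
  using charge unfolding polynomial_central_charge_def kaehler_form_def by auto

lemma smooth_formD:
  assumes "smooth_form X \<alpha>"
  shows "x \<in> cdom X i \<Longrightarrow> amf (\<alpha> i x)" "smooth_on (cimg X i) (\<lambda>z. \<alpha> i (cinv X i z) vs)"
    "z \<in> ovl i k \<Longrightarrow> \<alpha> i (cinv X i z) vs = \<alpha> k (cinv X k (trans i k z)) (map (\<lambda>v. dird v (trans i k) z) vs)"
proof -
  show "x \<in> cdom X i \<Longrightarrow> amf (\<alpha> i x)" and "smooth_on (cimg X i) (\<lambda>z. \<alpha> i (cinv X i z) vs)"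
    using assms alt_multilinear_imp_amf unfolding smooth_form_def by blast+
  assume z: "z \<in> ovl i k"
  have "chart_deriv X i (crd X k) (cinv X i z) = (\<lambda>v. dird v (trans i k) z)"
    using crd_cinv[OF subsetD[OF ovl_subset z]] by (auto simp: chart_deriv_def[abs_def] dird_def trans_def[abs_def])
  then show "\<alpha> i (cinv X i z) vs = \<alpha> k (cinv X k (trans i k z)) (map (\<lambda>v. dird v (trans i k) z) vs)"
    using assms ovl_cinv[OF z] unfolding smooth_form_def cinv_trans[OF z] by (metis IntD1 IntD2 IntI)
qed

lemma ext_d_eq:
  assumes x: "x \<in> cdom X i" and eq: "\<And>z vs. z \<in> cimg X i \<Longrightarrow> \<alpha> i (cinv X i z) vs = A (p, z) vs"
    and d: "\<And>vs. (\<lambda>w. A w vs) differentiable (at (p, crd X i x))"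
  shows "ext_d X \<alpha> i x vs = dloc em A (p, crd X i x) vs"
proof -
  have "chart_deriv X i (\<lambda>y. \<alpha> i y us) x v = dird (0, v) (\<lambda>w. A w us) (p, crd X i x)" for us v
  proof -
    have "chart_deriv X i (\<lambda>y. \<alpha> i y us) x v = dird v (\<lambda>z. \<alpha> i (cinv X i z) us) (crd X i x)"
      by (simp add: chart_deriv_def dird_def)
    also have "\<dots> = dird v (\<lambda>z. A (p, z) us) (crd X i x)"
      by (rule dird_cong_open(1)[OF open_cimg crd_in[OF x]]) (rule eq)
    also have "\<dots> = dird (0, v) (\<lambda>w. A w us) (p, crd X i x)"
      by (rule dird_slice(1)[OF d])
    finally show ?thesis .
  qed
  then show ?thesis by (simp add: ext_d_def dloc_def)
qed

text \<open>Read on the product of parameters and chart, a form on \<open>X\<close> does not see the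
  parameters. It is thus annihilated by derivatives in the directions \<open>(u, 0)\<close> and,
  being closed, by \<open>d\<close> in the chart directions.\<close>

lemma smooth_closed_field:
  fixes P :: "'p::euclidean_space set"
  assumes \<alpha>: "closed_form X \<alpha>" and P: "open P"
  shows "smooth_on (P \<times> cimg X i) (\<lambda>w. \<alpha> i (cinv X i (snd w)) vs)"
    and "w \<in> P \<times> cimg X i \<Longrightarrow> dloc em (\<lambda>w. \<alpha> i (cinv X i (snd w))) w = 0"
    and "w \<in> P \<times> cimg X i \<Longrightarrow> dird (u, 0) (\<lambda>w. \<alpha> i (cinv X i (snd w)) vs) w = 0"
    and "w \<in> P \<times> cimg X i \<Longrightarrow> amf (\<alpha> i (cinv X i (snd w)))"
proof -
  have sf: "smooth_form X \<alpha>" using \<alpha> by (simp add: closed_form_def)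
  have sm: "smooth_on (P \<times> cimg X i) (\<lambda>w. \<alpha> i (cinv X i (snd w)) vs)" for vs
    using smooth_on_snd[OF P open_cimg smooth_formD(2)[OF sf]] .
  then show "smooth_on (P \<times> cimg X i) (\<lambda>w. \<alpha> i (cinv X i (snd w)) vs)" .
  assume w: "w \<in> P \<times> cimg X i"
  then obtain p z where pz: "w = (p, z)" "z \<in> cimg X i" by auto
  have df: "(\<lambda>w. \<alpha> i (cinv X i (snd w)) vs) differentiable (at w)" for vs
    by (rule smooth_on_differentiable[OF sm w])
  show "dloc em (\<lambda>w. \<alpha> i (cinv X i (snd w))) w = 0"
  proof (rule ext)
    fix vs
    have "ext_d X \<alpha> i (cinv X i z) vs = dloc em (\<lambda>w. \<alpha> i (cinv X i (snd w))) (p, crd X i (cinv X i z)) vs"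
      by (rule ext_d_eq) (use pz df in \<open>simp_all add: cinv_in\<close>)
    moreover have "ext_d X \<alpha> i (cinv X i z) vs = 0"
      using \<alpha> cinv_in[OF pz(2)] unfolding closed_form_def by blast
    ultimately show "dloc em (\<lambda>w. \<alpha> i (cinv X i (snd w))) w vs = 0 vs" using pz by simp
  qed
  have dz: "(\<lambda>z. \<alpha> i (cinv X i z) vs) differentiable (at (snd w))"
    by (rule smooth_on_differentiable[OF smooth_formD(2)[OF sf]]) (use pz in simp)
  show "dird (u, 0) (\<lambda>w. \<alpha> i (cinv X i (snd w)) vs) w = 0"
    using dird_snd[OF dz, of "(u, 0)"] linear_0[OF linear_dird[OF dz]] by simp
  show "amf (\<alpha> i (cinv X i (snd w)))" using smooth_formD(1)[OF sf] cinv_in pz by simp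
qed

lemmas kform_loc_smooth = smooth_closed_field(1)[OF closed_kform, folded kform_loc_def]
  and kform_loc_closed = smooth_closed_field(2)[OF closed_kform, folded kform_loc_def]
  and kform_loc_const = smooth_closed_field(3)[OF closed_kform, folded kform_loc_def]
  and kform_loc_amf = smooth_closed_field(4)[OF closed_kform, folded kform_loc_def]

context
  fixes P :: "'p::euclidean_space set" and i :: 'i
  assumes P: "open P"
begin

lemma gsg_kform_loc: "w \<in> P \<times> cimg X i \<Longrightarrow> gsg (kform_loc i w) = kform_loc i w"
proof (rule ext)
  fix vs assume "w \<in> P \<times> cimg X i"
  then show "gsg (kform_loc i w) vs = kform_loc i w vs"
    using kform_deg[of "cinv X i (snd w)" i vs] cinv_in[of "snd w" i]
    by (cases "length vs = 2") (auto simp: gsg_def kform_loc_def)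
qed

lemma smooth_spow: "smooth_on (P \<times> cimg X i) (\<lambda>w. spow (kform_loc i w) d vs)"
proof (induction d arbitrary: vs)
  case (Suc d)
  then show ?case unfolding spow_Suc by (intro smooth_on_swedge open_Times P open_cimg kform_loc_smooth)
qed (simp add: spow_0 smooth_on_const)

lemma smooth_uform_loc: "smooth_on (P \<times> cimg X i) (\<lambda>w. uform_loc l i w vs)"
  unfolding uform_loc_def deg_part_def
  by (cases "length vs = 2 * l") (simp_all add: smooth_on_const smooth_closed_field(1)[OF closed_uform P])

lemma diffW: "smooth_on (P \<times> cimg X i) f \<Longrightarrow> w \<in> P \<times> cimg X i \<Longrightarrow> f differentiable (at w)"
  by (rule smooth_on_differentiable)

lemma closed_spow: "w \<in> P \<times> cimg X i \<Longrightarrow> dloc em (\<lambda>w. spow (kform_loc i w) d) w = 0"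
proof (induction d)
  case 0
  show ?case by (rule ext) (simp add: dloc_def spow_0)
next
  case (Suc d)
  have "dloc em (\<lambda>w. swedge (kform_loc i w) (spow (kform_loc i w) d)) w =
     swedge (dloc em (kform_loc i) w) (spow (kform_loc i w) d) + swedge (gsg (kform_loc i w)) (dloc em (\<lambda>w. spow (kform_loc i w) d) w)"
    by (rule dloc_swedge) (rule diffW[OF kform_loc_smooth[OF P] Suc.prems] diffW[OF smooth_spow Suc.prems])+
  also have "dloc em (kform_loc i) w = 0" using kform_loc_closed[OF P Suc.prems] by (simp add: kform_loc_def[abs_def])
  finally show ?case unfolding spow_Suc Suc.IH[OF Suc.prems] by (simp only: swedge_linear add_0)
qed

lemma const_spow: "w \<in> P \<times> cimg X i \<Longrightarrow> dird (u, 0) (\<lambda>w. spow (kform_loc i w) d vs) w = 0"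
proof (induction d arbitrary: vs)
  case (Suc d)
  have "dird (u, 0) (\<lambda>w. swedge (kform_loc i w) (spow (kform_loc i w) d) vs) w =
    swedge (\<lambda>vs. dird (u, 0) (\<lambda>w. kform_loc i w vs) w) (spow (kform_loc i w) d) vs +
    swedge (kform_loc i w) (\<lambda>vs. dird (u, 0) (\<lambda>w. spow (kform_loc i w) d vs) w) vs"
    unfolding swedge_def
    by (rule dird_wedge_by[OF bounded_bilinear_mult]) (rule diffW[OF kform_loc_smooth[OF P] Suc.prems] diffW[OF smooth_spow Suc.prems])+
  then show ?case
    using kform_loc_const[OF P Suc.prems] Suc.IH[OF Suc.prems]
    by (simp add: spow_Suc swedge_linear flip: zero_fun_def)
qed (simp add: spow_0)

lemma closed_uform_loc: "w \<in> P \<times> cimg X i \<Longrightarrow> dloc em (uform_loc l i) w = 0"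
  using smooth_closed_field(2)[OF closed_uform P, of w i]
  by (intro ext) (simp add: uform_loc_def[abs_def] dloc_deg_part)

lemma const_uform_loc: "w \<in> P \<times> cimg X i \<Longrightarrow> dird (u, 0) (\<lambda>w. uform_loc l i w vs) w = 0"
  unfolding uform_loc_def deg_part_def
  by (cases "length vs = 2 * l") (simp_all add: smooth_closed_field(3)[OF closed_uform P])

lemma amf_charge_wedge: "w \<in> P \<times> cimg X i \<Longrightarrow> amf f \<Longrightarrow> amf (charge_wedge i w d l f)"
proof -
  assume w: "w \<in> P \<times> cimg X i" and f: "amf f"
  have "amf (spow (kform_loc i w) d)"
    by (induction d) (simp_all add: spow_0 spow_Suc amf_form_unit amf_swedge kform_loc_amf[OF P w])
  moreover have "amf (uform_loc l i w)" unfolding uform_loc_def by (intro amf_deg_part smooth_closed_field(4)[OF closed_uform P w])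
  ultimately show ?thesis unfolding charge_wedge_def by (intro amf_swedge f)
qed

lemma smooth_charge_wedge:
  assumes "\<And>vs. smooth_on (P \<times> cimg X i) (\<lambda>w. f w vs)"
  shows "smooth_on (P \<times> cimg X i) (\<lambda>w. charge_wedge i w d l (f w) vs)"
  unfolding charge_wedge_def by (intro smooth_on_swedge open_Times P open_cimg smooth_spow smooth_uform_loc assms)

text \<open>\<omega> and the components of \<open>U\<close> are closed, and the power of \<omega>
  standing in front is even, so \<open>d\<close> reaches the inner form without a sign.\<close>

lemma dloc_charge_wedge:
  assumes w: "w \<in> P \<times> cimg X i" and f: "\<And>vs. (\<lambda>w. f w vs) differentiable (at w)"
  shows "dloc em (\<lambda>w. charge_wedge i w d l (f w)) w = charge_wedge i w d l (dloc em f w)"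
proof -
  note ds = diffW[OF smooth_spow w] and du = diffW[OF smooth_uform_loc w]
  have 1: "dloc em (\<lambda>w. swedge (f w) (uform_loc l i w)) w = swedge (dloc em f w) (uform_loc l i w)"
    unfolding dloc_swedge[OF f du] closed_uform_loc[OF w] by (simp only: swedge_linear add_0_right)
  have "(\<lambda>w. swedge (f w) (uform_loc l i w) vs) differentiable (at w)" for vs
    unfolding swedge_def by (rule differentiable_wedge_by[OF bounded_bilinear_mult f du])
  then show ?thesis
    unfolding charge_wedge_def by (simp only: dloc_swedge[OF ds] closed_spow[OF w] 1 gsg_spow[OF gsg_kform_loc[OF w]] swedge_linear add_0)
qed

lemma dird_charge_wedge:
  assumes w: "w \<in> P \<times> cimg X i" and f: "\<And>vs. (\<lambda>w. f w vs) differentiable (at w)"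
  shows "dird (u, 0) (\<lambda>w. charge_wedge i w d l (f w) vs) w = charge_wedge i w d l (\<lambda>vs. dird (u, 0) (\<lambda>w. f w vs) w) vs"
proof -
  note ds = diffW[OF smooth_spow w] and du = diffW[OF smooth_uform_loc w]
  have z: "(\<lambda>vs. dird (u, 0) (\<lambda>w. spow (kform_loc i w) d vs) w) = 0" "(\<lambda>vs. dird (u, 0) (\<lambda>w. uform_loc l i w vs) w) = 0"
    by (auto simp: const_spow[OF w] const_uform_loc[OF w] fun_eq_iff)
  have 1: "(\<lambda>vs. dird (u, 0) (\<lambda>w. swedge (f w) (uform_loc l i w) vs) w) = swedge (\<lambda>vs. dird (u, 0) (\<lambda>w. f w vs) w) (uform_loc l i w)"
    by (rule ext, unfold swedge_def, subst dird_wedge_by[OF bounded_bilinear_mult f du])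
      (simp only: z swedge_linear[unfolded swedge_def] zero_fun_apply add_0_right)
  have "(\<lambda>w. swedge (f w) (uform_loc l i w) vs) differentiable (at w)" for vs
    unfolding swedge_def by (rule differentiable_wedge_by[OF bounded_bilinear_mult f du])
  then have "dird (u, 0) (\<lambda>w. swedge (spow (kform_loc i w) d) (swedge (f w) (uform_loc l i w)) vs) w =
      swedge (\<lambda>vs. dird (u, 0) (\<lambda>w. spow (kform_loc i w) d vs) w) (swedge (f w) (uform_loc l i w)) vs +
      swedge (spow (kform_loc i w) d) (\<lambda>vs. dird (u, 0) (\<lambda>w. swedge (f w) (uform_loc l i w) vs) w) vs"
    by (intro dird_swedge[where \<alpha>="\<lambda>w. spow (kform_loc i w) d" and \<beta>="\<lambda>w. swedge (f w) (uform_loc l i w)"] ds)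
  then show ?thesis
    unfolding charge_wedge_def z 1 by (simp only: swedge_linear zero_fun_apply add_0)
qed

lemma cnj_charge_wedge:
  assumes w: "w \<in> P \<times> cimg X i"
  shows "cnj (charge_wedge i w d l f vs) = charge_wedge i w d l (\<lambda>vs. cnj (f vs)) vs"
proof -
  have "cnj (kform_loc i w vs) = kform_loc i w vs" "cnj (uform_loc l i w vs) = uform_loc l i w vs" for vs
    using real_kform real_uform w cinv_in[of "snd w" i] unfolding real_form_def kform_loc_def uform_loc_def deg_part_def
    by (auto simp: Reals_cnj_iff)
  then show ?thesis unfolding charge_wedge_def by (simp add: cnj_swedge cnj_spow)
qed

end

lemma charge_wedge_cmult: "charge_wedge i w d l (\<lambda>vs. c * f vs) = (\<lambda>vs. c * charge_wedge i w d l f vs)"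
  unfolding charge_wedge_def by (simp add: swedge_cmult)

lemma charge_wedge_add: "charge_wedge i w d l (\<alpha> + \<beta>) = charge_wedge i w d l \<alpha> + charge_wedge i w d l \<beta>"
  unfolding charge_wedge_def by (simp add: swedge_linear)

lemma charge_wedge_trans:
  assumes z: "z \<in> ovl i k" and f: "\<And>vs. f vs = f' (map (\<lambda>v. dird v (trans i k) z) vs)"
  shows "charge_wedge i (p, z) d l f vs = charge_wedge k (p, trans i k z) d l f' (map (\<lambda>v. dird v (trans i k) z) vs)"
proof -
  let ?L = "map (\<lambda>v. dird v (trans i k) z)"
  have sf: "smooth_form X (kform C)" "smooth_form X (uform C)"
    using closed_kform closed_uform by (simp_all add: closed_form_def)
  have "kform_loc i (p, z) = (\<lambda>vs. kform_loc k (p, trans i k z) (?L vs))"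
    unfolding kform_loc_def snd_conv by (rule ext) (rule smooth_formD(3)[OF sf(1) z])
  moreover have "uform_loc l i (p, z) = (\<lambda>vs. uform_loc l k (p, trans i k z) (?L vs))"
    unfolding uform_loc_def snd_conv deg_part_def by (rule ext) (simp add: smooth_formD(3)[OF sf(2) z])
  moreover have "f = (\<lambda>vs. f' (?L vs))" using f by auto
  ultimately show ?thesis unfolding charge_wedge_def swedge_map spow_map by simp
qed

lemma trace_charge_term:
  fixes L :: "complex^'r^'r \<Rightarrow> complex"
  assumes x: "x \<in> cdom X i" and L: "linear L" "\<And>c b. L (mat c ** b) = c * L b"
  shows "L (charge_term C i x d l \<Phi> vs) = charge_wedge i (p, crd X i x) d l (\<lambda>vs. L (\<Phi> vs)) vs"
  unfolding charge_term_def trace_mwedge_id_left[OF L] trace_mwedge_id_right[OF L] charge_wedge_def kform_loc_def uform_loc_def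
  using x by simp

end

lemma pos_def_invertible:
  fixes A :: "complex^'r::finite^'r"
  assumes "\<And>s. s \<noteq> 0 \<Longrightarrow> 0 < Re (\<Sum>a\<in>UNIV. \<Sum>b\<in>UNIV. cnj (s $ a) * A $ a $ b * s $ b)"
  shows "invertible A"
proof -
  have "s = 0" if "A *v s = 0" for s
  proof (rule ccontr)
    assume "s \<noteq> 0"
    have "(\<Sum>b\<in>UNIV. A $ a $ b * s $ b) = 0" for a
      using that by (simp add: vec_eq_iff matrix_vector_mult_def)
    then have "(\<Sum>b\<in>UNIV. cnj (s $ a) * A $ a $ b * s $ b) = 0" for a
      by (simp add: mult.assoc flip: sum_distrib_left)
    then show False using assms[OF \<open>s \<noteq> 0\<close>] by simp
  qed
  then show ?thesis by (simp add: invertible_left_inverse matrix_left_invertible_ker)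
qed

lemma smooth_on_Pair:
  assumes S: "open S" and f: "smooth_on S f" and h: "smooth_on S h"
  shows "smooth_on S (\<lambda>w. (f w, h w))"
proof -
  have b: "bounded_linear (\<lambda>x. (x, 0))" "bounded_linear (\<lambda>y. (0, y))"
    by (auto intro: bounded_linear_Pair bounded_linear_ident bounded_linear_zero)
  have "smooth_on S (\<lambda>w. (f w, 0) + (0, h w))"
    by (intro smooth_on_add S smooth_on_linear_compose[OF S b(1) f] smooth_on_linear_compose[OF S b(2) h])
  then show ?thesis by simp
qed

lemma dird_Pair:
  "f differentiable (at w) \<Longrightarrow> h differentiable (at w) \<Longrightarrow> dird u (\<lambda>w. (f w, h w)) w = (dird u f w, dird u h w)"
  by (rule dird_eqI[OF has_derivative_Pair]) (rule has_derivative_dird, assumption)+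

lemma dird_fst: "dird u fst w = fst u"
  by (rule dird_eqI[OF bounded_linear_imp_has_derivative[OF bounded_linear_fst]])

lemma dird_zero: "dird 0 f x = 0" if "f differentiable (at x)"
  using linear_0[OF linear_dird[OF that]] .

text \<open>\<tau> is a direction in the parameter space: for a path, \<open>P\<close> is a set of
  times and \<tau> is 1; for a homotopy of paths, \<open>P\<close> is the plane and \<tau> the time
  direction.\<close>

locale bundle_family = bundle_charge X g C
  for X :: "('i, 'x::t2_space, 'n::finite) atlas"
    and g :: "'i \<Rightarrow> 'i \<Rightarrow> 'x \<Rightarrow> complex^'r::finite^'r" and C :: "('i, 'x, 'n) charge" +
  fixes P :: "'p::euclidean_space set" and metric_of :: "'p \<Rightarrow> 'i \<Rightarrow> 'x \<Rightarrow> complex^'r^'r" and \<tau> :: 'p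
  assumes P: "open P" and metric_of: "\<And>p. p \<in> P \<Longrightarrow> metric_of p \<in> hermitian_metrics X g"
    and metric_of_smooth: "\<And>i. smooth_on (P \<times> cimg X i) (\<lambda>w. metric_of (fst w) i (cinv X i (snd w)))"
begin

definition metric_loc :: "'i \<Rightarrow> 'p \<times> (complex^'n) \<Rightarrow> complex^'r^'r" where
  "metric_loc i w = metric_of (fst w) i (cinv X i (snd w))"

abbreviation "vl i \<equiv> metric_family.vel (\<tau>, 0) (metric_loc i)"
abbreviation "nc i \<equiv> metric_family.ncv em (metric_loc i)"
abbreviation "Efl i \<equiv> metric_family.Ef em (\<tau>, 0) (metric_loc i)"
abbreviation "Tfl i \<equiv> metric_family.Tf em (\<tau>, 0) (metric_loc i)"
abbreviation "dvl i \<equiv> metric_family.dbar_vel em (\<tau>, 0) (metric_loc i)"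

lemma local_metric_family: "metric_family (P \<times> cimg X i) em (metric_loc i)"
proof (rule metric_family.intro)
  show "open (P \<times> cimg X i)" by (intro open_Times P open_cimg)
  show "linear (em :: complex^'n \<Rightarrow> 'p \<times> _)" by (rule linear_embed_snd)
  show "smooth_on (P \<times> cimg X i) (metric_loc i)" using metric_of_smooth by (simp add: metric_loc_def[abs_def])
  fix w assume w: "w \<in> P \<times> cimg X i"
  then have 1: "metric_of (fst w) \<in> hermitian_metrics X g" "cinv X i (snd w) \<in> cdom X i" using metric_of cinv_in by auto
  then show "conj_transpose (metric_loc i w) = metric_loc i w" unfolding hermitian_metrics_def metric_loc_def by blast
  show "invertible (metric_loc i w)"
    by (rule pos_def_invertible) (use 1 in \<open>unfold hermitian_metrics_def metric_loc_def, blast\<close>)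
qed

lemma local_metric_family_subset: "open W \<Longrightarrow> W \<subseteq> P \<times> cimg X i \<Longrightarrow> metric_family W em (metric_loc i)"
  using local_metric_family[of i] smooth_on_subset[of _ _ W] unfolding metric_family_def by blast

lemma in_W: "p \<in> P \<Longrightarrow> x \<in> cdom X i \<Longrightarrow> (p, crd X i x) \<in> P \<times> cimg X i"
  by (simp add: crd_in)

lemma chern_connection_eq:
  assumes p: "p \<in> P" and x: "x \<in> cdom X i"
  shows "chern_connection X (metric_of p) i x vs = metric_family.conn em (metric_loc i) (p, crd X i x) vs"
proof -
  interpret L: metric_family "P \<times> cimg X i" em "(\<tau>, 0)" "metric_loc i" by (rule local_metric_family)
  have "chart_deriv X i (metric_of p i) x v = dird (0, v) (metric_loc i) (p, crd X i x)" for v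
    unfolding dird_slice(1)[OF L.diff[OF L.H in_W[OF p x]], symmetric] by (simp add: chart_deriv_def dird_def metric_loc_def)
  then show ?thesis
    using x by (simp add: chern_connection_def L.conn_def L.pd_def L.Hi_def metric_loc_def cscale_def)
qed

lemma ncurv_eq:
  assumes p: "p \<in> P" and x: "x \<in> cdom X i"
  shows "ncurv X (metric_of p) i x = nc i (p, crd X i x)"
proof
  fix vs
  interpret L: metric_family "P \<times> cimg X i" em "(\<tau>, 0)" "metric_loc i" by (rule local_metric_family)
  have "ext_d X (chern_connection X (metric_of p)) i x vs = dloc em L.conn (p, crd X i x) vs"
    by (rule ext_d_eq[OF x])
      (simp_all add: chern_connection_eq[OF p] cinv_in L.diff[OF L.smooth_conn in_W[OF p x]])
  moreover have "chern_connection X (metric_of p) i x = L.conn (p, crd X i x)"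
    by (rule ext) (rule chern_connection_eq[OF p x])
  ultimately show "ncurv X (metric_of p) i x vs = nc i (p, crd X i x) vs"
    by (simp add: ncurv_def chern_curvature_def L.ncv_def L.curv_def cscale_def)
qed

lemma log_velocity_eq:
  assumes p: "c + t *\<^sub>R \<tau> \<in> P" and x: "x \<in> cdom X i"
  shows "log_velocity (\<lambda>r. metric_of (c + r *\<^sub>R \<tau>)) t i x = vl i (c + t *\<^sub>R \<tau>, crd X i x)"
proof -
  interpret L: metric_family "P \<times> cimg X i" em "(\<tau>, 0)" "metric_loc i" by (rule local_metric_family)
  have "((\<lambda>s. metric_loc i ((c, crd X i x) + s *\<^sub>R (\<tau>, 0))) has_vector_derivative
      dird (\<tau>, 0) (metric_loc i) ((c, crd X i x) + t *\<^sub>R (\<tau>, 0))) (at t)"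
    by (rule dird_has_vector_derivative) (use L.diff[OF L.H in_W[OF p x]] in simp)
  then have "((\<lambda>s. metric_of (c + s *\<^sub>R \<tau>) i x) has_vector_derivative dird (\<tau>, 0) (metric_loc i) (c + t *\<^sub>R \<tau>, crd X i x)) (at t)"
    using x by (simp add: metric_loc_def)
  from vector_derivative_at[OF this] show ?thesis using x
    by (simp add: log_velocity_def L.vel_def L.Hi_def metric_loc_def)
qed

definition charge_coeff :: "nat \<Rightarrow> complex" where "charge_coeff d = cis (- Z_phase X C g) * rho C d"

definition degree_triples :: "(nat \<times> nat \<times> nat) set" where "degree_triples = {(d, j, l). d + j + l = CARD('n)}"

lemma finite_degree_triples: "finite degree_triples"
  by (rule finite_subset[of _ "{..CARD('n)} \<times> {..CARD('n)} \<times> {..CARD('n)}"]) (auto simp: degree_triples_def)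

definition charge_sum :: "(nat \<Rightarrow> complex) \<Rightarrow> 'i \<Rightarrow> 'p \<times> (complex^'n) \<Rightarrow> (nat \<Rightarrow> (complex^'n, complex) aform) \<Rightarrow> (complex^'n, complex) aform" where
  "charge_sum c i w f = (\<Sum>(d, j, l)\<in>degree_triples. (\<lambda>vs. c d / fact j * charge_wedge i w d l (f j) vs))"

lemma charge_sum_apply: "charge_sum c i w f vs = (\<Sum>(d, j, l)\<in>degree_triples. c d / fact j * charge_wedge i w d l (f j) vs)"
  unfolding charge_sum_def sum_apply by (simp add: case_prod_beta)

definition pair :: "'i \<Rightarrow> 'p \<times> (complex^'n) \<Rightarrow> nat \<Rightarrow> (complex^'n, complex) aform" where
  "pair i w j vs = trace (vl i w ** mpow (nc i w) j vs)"

lemma smooth_charge_sum: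
  assumes "\<And>j vs. smooth_on (P \<times> cimg X i) (\<lambda>w. f w j vs)"
  shows "smooth_on (P \<times> cimg X i) (\<lambda>w. charge_sum c i w (f w) vs)"
  unfolding charge_sum_apply case_prod_beta
  by (intro smooth_on_sum smooth_on_mult smooth_on_const smooth_charge_wedge open_Times P open_cimg assms)

lemma smooth_pair: "smooth_on (P \<times> cimg X i) (\<lambda>w. pair i w j vs)"
proof -
  interpret L: metric_family "P \<times> cimg X i" em "(\<tau>, 0)" "metric_loc i" by (rule local_metric_family)
  show ?thesis unfolding pair_def
    by (intro smooth_on_linear_compose[OF L.W _ L.smooth_mult[OF L.smooth_vel L.smooth_mpow]])
      (simp add: linear_trace flip: linear_conv_bounded_linear)
qed

text \<open>The velocity is self-adjoint, so its trace against the adjoint of \<open>T\<close> is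
  the conjugate of its trace against \<open>T\<close>. The imaginary part of an endomorphism thus
  turns into that of a number.\<close>

lemma trace_D_Z:
  assumes p: "p \<in> P" and x: "x \<in> cdom X i"
  shows "trace (vl i (p, crd X i x) ** D_Z X g C (metric_of p) i x vs) =
    of_real (Im (charge_sum charge_coeff i (p, crd X i x) (pair i (p, crd X i x)) vs))"
proof -
  interpret L: metric_family "P \<times> cimg X i" em "(\<tau>, 0)" "metric_loc i" by (rule local_metric_family)
  let ?w = "(p, crd X i x)" let ?H = "metric_loc i ?w" and ?\<theta> = "vl i (p, crd X i x)"
  have w: "?w \<in> P \<times> cimg X i" by (rule in_W[OF p x])
  have H: "metric_of p i x = ?H" using x by (simp add: metric_loc_def)
  define T where "T = mat (cis (- Z_phase X C g)) ** Z_tilde X C (metric_of p) i x vs"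
  have adj: "adjoint_wrt ?H ?\<theta> = ?\<theta>"
    unfolding adjoint_wrt_def L.vel_def conj_transpose_mult L.dird_H_herm[OF w] L.Hi_herm[OF w] L.Hi_def[symmetric]
    by (simp add: L.Hi_cancel[OF w] flip: matrix_mul_assoc)
  have D: "D_Z X g C (metric_of p) i x vs = mat (1 / (2 * \<i>)) ** (T - adjoint_wrt ?H T)"
    by (simp add: D_Z_def form_adj_def H T_def)
  have "trace (?\<theta> ** adjoint_wrt ?H T) = trace (adjoint_wrt ?H (?\<theta> ** T))"
    unfolding adjoint_wrt_mult[OF L.inv[OF w] L.herm[OF w]] adj by (rule trace_mul_sym)
  also have "\<dots> = cnj (trace (?\<theta> ** T))"
    by (rule trace_adjoint_wrt[OF L.inv[OF w] L.herm[OF w]])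
  finally have "trace (?\<theta> ** D_Z X g C (metric_of p) i x vs) = 1 / (2 * \<i>) * (trace (?\<theta> ** T) - cnj (trace (?\<theta> ** T)))"
    unfolding D trace_left_mult(2) mult_simps linear_diff[OF linear_trace] by (simp add: algebra_simps)
  also have "\<dots> = of_real (Im (trace (?\<theta> ** T)))"
    by (simp add: complex_eq_iff)
  also have "trace (?\<theta> ** T) = cis (- Z_phase X C g) * (\<Sum>(d, j, l)\<in>degree_triples. rho C d / fact j *
      charge_wedge i ?w d l (\<lambda>vs. trace (?\<theta> ** mpow (nc i ?w) j vs)) vs)"
    unfolding T_def trace_left_mult(2) Z_tilde_def ncurv_eq[OF p x] degree_triples_def[symmetric]
      linear_sum[OF trace_left_mult(1)] case_prod_beta trace_charge_term[OF x trace_left_mult, where p=p] ..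
  also have "\<dots> = charge_sum charge_coeff i ?w (pair i ?w) vs"
    by (simp add: charge_sum_apply pair_def[abs_def] charge_coeff_def sum_distrib_left case_prod_beta mult.assoc)
  finally show ?thesis .
qed

text \<open>The value on the velocity in the direction \<tau> of the 1-form on the space of metrics
  whose path integrals define \<open>M_Z\<close> (see \<open>form_integral_eq\<close>).\<close>

definition Phi :: "'p \<Rightarrow> real" where
  "Phi p = (\<Sum>i\<in>idx. integral\<^sup>L lborel (cutoff i (\<lambda>z. Im (charge_sum charge_coeff i (p, z) (pair i (p, z)) oriented_frame))))"

lemma form_integral_eq:
  assumes p: "c + t *\<^sub>R \<tau> \<in> P"
  shows "form_integral X (\<lambda>i x vs. trace (log_velocity (\<lambda>r. metric_of (c + r *\<^sub>R \<tau>)) t i x ** D_Z X g C (metric_of (c + t *\<^sub>R \<tau>)) i x vs))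
    = of_real (Phi (c + t *\<^sub>R \<tau>))"
proof -
  let ?p = "c + t *\<^sub>R \<tau>"
  have "cutoff i (\<lambda>z. trace (log_velocity (\<lambda>r. metric_of (c + r *\<^sub>R \<tau>)) t i (cinv X i z) ** D_Z X g C (metric_of ?p) i (cinv X i z) oriented_frame))
    = (\<lambda>z. complex_of_real (cutoff i (\<lambda>z. Im (charge_sum charge_coeff i (?p, z) (pair i (?p, z)) oriented_frame)) z))" for i
  proof (rule ext)
    fix z
    show "cutoff i (\<lambda>z. trace (log_velocity (\<lambda>r. metric_of (c + r *\<^sub>R \<tau>)) t i (cinv X i z) ** D_Z X g C (metric_of ?p) i (cinv X i z) oriented_frame)) z
      = complex_of_real (cutoff i (\<lambda>z. Im (charge_sum charge_coeff i (?p, z) (pair i (?p, z)) oriented_frame)) z)"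
    proof (cases "z \<in> cimg X i")
      case True
      show ?thesis using trace_D_Z[OF p cinv_in[OF True]] True
        by (simp add: cutoff_def log_velocity_eq[OF p cinv_in[OF True]] scaleR_conv_of_real)
    qed (simp add: cutoff_def)
  qed
  then show ?thesis
    unfolding form_integral_cutoff[OF refl] Phi_def by (simp only: integral_complex_of_real of_real_sum)
qed

lemma path_functional_eq:
  assumes "\<And>t. t \<in> {0..1} \<Longrightarrow> c + t *\<^sub>R \<tau> \<in> P"
  shows "path_functional X g C (\<lambda>r. metric_of (c + r *\<^sub>R \<tau>)) = of_real (set_lebesgue_integral lborel {0..1} (\<lambda>t. Phi (c + t *\<^sub>R \<tau>)))"
proof -
  have "indicat_real {0..1} t *\<^sub>R form_integral X (\<lambda>i x vs. trace (log_velocity (\<lambda>r. metric_of (c + r *\<^sub>R \<tau>)) t i x ** D_Z X g C (metric_of (c + t *\<^sub>R \<tau>)) i x vs))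
     = of_real (indicat_real {0..1} t *\<^sub>R Phi (c + t *\<^sub>R \<tau>))" for t
    using form_integral_eq[OF assms] by (cases "t \<in> {0..1}") simp_all
  then show ?thesis
    unfolding path_functional_def set_lebesgue_integral_def by (simp only: integral_complex_of_real)
qed

text \<open>For a one-dimensional \<open>P\<close> this gives integrability along a path, for a
  two-dimensional one the continuity of path integrals in a homotopy.\<close>

lemma continuous_on_Phi: "continuous_on P Phi"
  unfolding Phi_def
proof (rule continuous_on_sum)
  fix i
  have "continuous_on (P \<times> cimg X i) (\<lambda>w. Im (charge_sum charge_coeff i w (pair i w) oriented_frame))"
    by (intro continuous_on_Im smooth_on_continuous[OF smooth_charge_sum[OF smooth_pair]])
  from continuous_on_cutoff[OF P this]
  show "continuous_on P (\<lambda>p. integral\<^sup>L lborel (cutoff i (\<lambda>z. Im (charge_sum charge_coeff i (p, z) (pair i (p, z)) oriented_frame))))"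
    by (rule continuous_on_lborel_integral[OF compact_ksupp]) (rule cutoff_zero)
qed

end

context bundle_family
begin

section \<open>The boundary form as a global form, and the derivative of the charge pairing\<close>

definition pmap :: "'i \<Rightarrow> 'i \<Rightarrow> 'p \<times> (complex^'n) \<Rightarrow> 'p \<times> (complex^'n)" where
  "pmap i k w = (fst w, trans i k (snd w))"

lemma smooth_pmap: "smooth_on (P \<times> ovl i k) (pmap i k)"
  unfolding pmap_def[abs_def]
  by (intro smooth_on_Pair smooth_on_snd open_Times P open_ovl smooth_on_trans smooth_on_linear bounded_linear_fst)

lemma dird_pmap: "w \<in> P \<times> ovl i k \<Longrightarrow> dird u (pmap i k) w = (fst u, dird (snd u) (trans i k) (snd w))"
proof -
  assume "w \<in> P \<times> ovl i k"
  then have d: "trans i k differentiable (at (snd w))" by (intro trans_differentiable) auto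
  have "(\<lambda>w. trans i k (snd w)) differentiable (at w)"
    using differentiable_chain_at[OF bounded_linear_imp_differentiable[OF bounded_linear_snd] d] by (simp add: o_def)
  then show ?thesis
    unfolding pmap_def[abs_def]
    by (simp add: dird_Pair bounded_linear_imp_differentiable[OF bounded_linear_fst] dird_fst dird_snd[OF d])
qed

lemma bundle_cocycle:
  assumes "x \<in> cdom X i" "x \<in> cdom X k"
  shows "invertible (g i k x)" "p \<in> P \<Longrightarrow> metric_of p k x = conj_transpose (g i k x) ** metric_of p i x ** g i k x"
proof -
  have "g i k x ** g k i x = mat 1"
    using hol_bundle assms unfolding holomorphic_bundle_def by (metis IntI)
  then show "invertible (g i k x)" using invertible_right_inverse by blast
  show "p \<in> P \<Longrightarrow> metric_of p k x = conj_transpose (g i k x) ** metric_of p i x ** g i k x"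
    using metric_of assms unfolding hermitian_metrics_def by blast
qed

lemma g_holo: "holo_on (ovl i k) (\<lambda>z. g i k (cinv X i z) $ a $ b)"
  using hol_bundle unfolding holomorphic_bundle_def ovl_def by blast

lemma smooth_g: "smooth_on (ovl i k) (\<lambda>z. g i k (cinv X i z))"
  by (intro smooth_on_vec open_ovl holo_on_imp_smooth_on g_holo)

lemma dird_g_scalar:
  assumes z: "z \<in> ovl i k"
  shows "dird (\<i> *s v) (\<lambda>z. g i k (cinv X i z)) z = cscale \<i> (dird v (\<lambda>z. g i k (cinv X i z)) z)"
proof -
  note d = smooth_on_differentiable[OF smooth_g z]
  have "dird v (\<lambda>z. g i k (cinv X i z) $ a $ b) z = dird v (\<lambda>z. g i k (cinv X i z)) z $ a $ b" for v a b
    using dird_linear_compose[OF bounded_linear_compose[OF bounded_linear_vec_nth[of b] bounded_linear_vec_nth[of a]] d] .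
  moreover have "dird (\<i> *s v) (\<lambda>z. g i k (cinv X i z) $ a $ b) z = \<i> * dird v (\<lambda>z. g i k (cinv X i z) $ a $ b) z" for a b
    by (rule holo_on_dird_scalar[OF g_holo z])
  ultimately show ?thesis by (simp add: vec_eq_iff cscale_nth)
qed

text \<open>The change of trivialisation and the change of coordinates are done one after the other.
  In between stands the matrix of the metric in the \<open>k\<close>-th trivialisation, written in
  the coordinates of the \<open>i\<close>-th chart.\<close>

lemma Ef_trans:
  assumes p: "p \<in> P" and z: "z \<in> ovl i k"
  shows "Efl i j (p, z) vs = Efl k j (p, trans i k z) (map (\<lambda>v. dird v (trans i k) z) vs)"
proof -
  let ?W = "P \<times> ovl i k"
  have W: "open ?W" by (intro open_Times P open_ovl)
  have z': "cinv X i z \<in> cdom X i" "cinv X i z \<in> cdom X k" if "z \<in> ovl i k" for z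
    using ovl_cinv[OF that] by auto
  have pm: "pmap i k w \<in> P \<times> cimg X k" if "w \<in> ?W" for w
    using that subsetD[OF ovl_subset[of k i] trans_in[of _ i k]] by (auto simp: pmap_def)
  have Hk: "metric_loc k (pmap i k w) = conj_transpose (g i k (cinv X i (snd w))) ** metric_loc i w ** g i k (cinv X i (snd w))"
    if "w \<in> ?W" for w
    using that bundle_cocycle(2) z' by (auto simp: metric_loc_def pmap_def cinv_trans)
  have mi: "metric_family ?W em (metric_loc i)"
    by (rule local_metric_family_subset[OF W]) (use ovl_subset in auto)
  interpret K: metric_family "P \<times> cimg X k" em "(\<tau>, 0)" "metric_loc k" by (rule local_metric_family)
  have mk: "metric_family ?W em (\<lambda>w. metric_loc k (pmap i k w))"
    by (rule metric_family.intro[OF W linear_embed_snd smooth_on_compose[OF W K.W pm K.H smooth_pmap]])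
      (use pm K.herm K.inv in auto)
  have "gauge_change ?W em (\<tau>, 0) (metric_loc i) (\<lambda>w. metric_loc k (pmap i k w)) (\<lambda>w. g i k (cinv X i (snd w)))"
  proof (rule gauge_change.intro[OF mi mk], rule gauge_change_axioms.intro)
    show "smooth_on ?W (\<lambda>w. g i k (cinv X i (snd w)))" by (rule smooth_on_snd[OF P open_ovl smooth_g])
    fix w assume w: "w \<in> ?W"
    then have sw: "snd w \<in> ovl i k" by auto
    note d = smooth_on_differentiable[OF smooth_g sw]
    show "invertible (g i k (cinv X i (snd w)))" using bundle_cocycle(1) z' sw by blast
    show "metric_loc k (pmap i k w) = conj_transpose (g i k (cinv X i (snd w))) ** metric_loc i w ** g i k (cinv X i (snd w))"
      by (rule Hk[OF w])
    show "dird (\<tau>, 0) (\<lambda>w. g i k (cinv X i (snd w))) w = 0"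
      by (simp add: dird_snd[OF d] dird_zero[OF d])
    show "dird (0, \<i> *s v) (\<lambda>w. g i k (cinv X i (snd w))) w = cscale \<i> (dird (0, v) (\<lambda>w. g i k (cinv X i (snd w))) w)" for v
      by (simp add: dird_snd[OF d] dird_g_scalar[OF sw])
  qed
  then have 1: "metric_family.Ef em (\<tau>, 0) (\<lambda>w. metric_loc k (pmap i k w)) j (p, z) = Efl i j (p, z)"
    by (rule gauge_change.Ef_gauge) (use p z in simp)
  have "chart_change ?W (P \<times> cimg X k) em (\<tau>, 0) (\<lambda>w. metric_loc k (pmap i k w)) (metric_loc k) (pmap i k) (\<lambda>w v. dird v (trans i k) (snd w))"
  proof (rule chart_change.intro[OF mk local_metric_family], rule chart_change_axioms.intro)
    note sd = smooth_on_dird[OF smooth_on_trans[of i k]]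
    show "smooth_on ?W (\<lambda>w. dird v (trans i k) (snd w))" for v
      by (rule smooth_on_snd[OF P open_ovl sd])
    fix w assume w: "w \<in> ?W"
    then have sw: "snd w \<in> ovl i k" by auto
    show "pmap i k differentiable (at w)" by (rule smooth_on_differentiable[OF smooth_pmap w])
    show "pmap i k w \<in> P \<times> cimg X k" by (rule pm[OF w])
    show "dird (0, v) (pmap i k) w = (0, dird v (trans i k) (snd w))" for v
      by (simp add: dird_pmap[OF w])
    show "dird (\<tau>, 0) (pmap i k) w = (\<tau>, 0)"
      by (simp add: dird_pmap[OF w] dird_zero[OF trans_differentiable[OF sw]])
    show "dird (\<i> *s v) (trans i k) (snd w) = \<i> *s dird v (trans i k) (snd w)" for v
      by (rule dird_trans_scalar[OF sw])
    note d = smooth_on_differentiable[OF sd sw]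
    show "dird (0, v) (\<lambda>y. dird v' (trans i k) (snd y)) w = dird (0, v') (\<lambda>y. dird v (trans i k) (snd y)) w" for v v'
      by (simp add: dird_snd[OF d] dird_commute[OF open_ovl sw smooth_on_trans, of v])
    show "dird (\<tau>, 0) (\<lambda>y. dird v (trans i k) (snd y)) w = 0" for v
      by (simp add: dird_snd[OF d] dird_zero[OF d])
  qed simp
  then have "metric_family.Ef em (\<tau>, 0) (\<lambda>w. metric_loc k (pmap i k w)) j (p, z) vs
      = Efl k j (pmap i k (p, z)) (map ((\<lambda>w v. dird v (trans i k) (snd w)) (p, z)) vs)"
    by (rule chart_change.Ef_pull) (use p z in simp)
  then show ?thesis unfolding 1 by (simp add: pmap_def)
qed

definition eta :: "'i \<Rightarrow> 'p \<times> (complex^'n) \<Rightarrow> (complex^'n, complex) aform" where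
  "eta i w = charge_sum charge_coeff i w (\<lambda>j. Efl i j w)"

lemma smooth_eta: "smooth_on (P \<times> cimg X i) (\<lambda>w. eta i w vs)"
  unfolding eta_def by (intro smooth_charge_sum metric_family.smooth_Ef[OF local_metric_family])

lemma stokes_eta:
  assumes p: "p \<in> P"
  shows "(\<Sum>i\<in>idx. integral\<^sup>L lborel (cutoff i (\<lambda>z. dloc em (eta i) (p, z) oriented_frame))) = 0"
proof -
  have df: "(\<lambda>w. eta i w vs) differentiable (at (p, z))" if "z \<in> cimg X i" for i z vs
    by (rule smooth_on_differentiable[OF smooth_eta]) (use p that in simp)
  have "(\<Sum>i\<in>idx. integral\<^sup>L lborel (cutoff i (\<lambda>z. dloc (\<lambda>v. v) (\<lambda>z. eta i (p, z)) z oriented_frame))) = 0"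
  proof (rule stokes)
    show "smooth_on (cimg X i) (\<lambda>z. eta i (p, z) vs)" for i vs
      by (rule smooth_on_compose[OF open_cimg open_Times[OF P open_cimg[of i]] _ smooth_eta])
        (use p in \<open>auto intro!: smooth_on_Pair open_cimg smooth_on_const smooth_on_id\<close>)
    show "amf (eta i (p, z))" if "z \<in> cimg X i" for i z
    proof -
      have w: "(p, z) \<in> P \<times> cimg X i" using p that by simp
      have am: "amf (\<lambda>vs. c * f vs)" if "amf f" for c and f :: "(complex^'n, complex) aform"
        by (rule amf_linear_compose[OF bounded_linear.linear[OF bounded_linear_mult_right] that])
      then show ?thesis unfolding eta_def charge_sum_def case_prod_beta
        by (intro metric_family.amf_sum[OF local_metric_family] am amf_charge_wedge[OF P w] metric_family.amf_Ef[OF local_metric_family w])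
    qed
    show "eta i (p, z) vs = eta k (p, trans i k z) (map (\<lambda>v. dird v (trans i k) z) vs)" if "z \<in> ovl i k" for i k z vs
    proof -
      have "charge_wedge i (p, z) d l (Efl i j (p, z)) vs = charge_wedge k (p, trans i k z) d l (Efl k j (p, trans i k z)) (map (\<lambda>v. dird v (trans i k) z) vs)" for d j l
        by (rule charge_wedge_trans[OF that]) (rule Ef_trans[OF p that])
      then show ?thesis unfolding eta_def charge_sum_apply by simp
    qed
  qed
  moreover have "cutoff i (\<lambda>z. dloc (\<lambda>v. v) (\<lambda>z. eta i (p, z)) z oriented_frame) = cutoff i (\<lambda>z. dloc em (eta i) (p, z) oriented_frame)" for i
    by (rule ext) (simp add: cutoff_def dloc_slice[OF df])
  ultimately show ?thesis by simp
qed

lemma dloc_charge_sum: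
  assumes w: "w \<in> P \<times> cimg X i" and f: "\<And>j vs. smooth_on (P \<times> cimg X i) (\<lambda>w. f w j vs)"
  shows "dloc em (\<lambda>w. charge_sum c i w (f w)) w = charge_sum c i w (\<lambda>j. dloc em (\<lambda>w. f w j) w)"
proof -
  note d = smooth_on_differentiable[OF f w]
  have dK: "(\<lambda>w. charge_wedge i w d l (f w j) vs) differentiable (at w)" for d j l vs
    by (rule smooth_on_differentiable[OF smooth_charge_wedge[OF P f] w])
  have "dloc em (\<lambda>w vs. c d / fact j * charge_wedge i w d l (f w j) vs) w = (\<lambda>vs. c d / fact j * charge_wedge i w d l (dloc em (\<lambda>w. f w j) w) vs)" for d j l
    unfolding dloc_charge_wedge[OF P w d, symmetric] by (rule ext) (rule dloc_linear[OF bounded_linear_mult_right dK])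
  then show ?thesis
    unfolding charge_sum_def case_prod_beta
    by (subst dloc_sum) (intro differentiable_mult differentiable_const dK, simp)
qed

lemma dird_charge_sum:
  assumes w: "w \<in> P \<times> cimg X i" and f: "\<And>j vs. smooth_on (P \<times> cimg X i) (\<lambda>w. f w j vs)"
  shows "dird (u, 0) (\<lambda>w. charge_sum c i w (f w) vs) w = charge_sum c i w (\<lambda>j vs. dird (u, 0) (\<lambda>w. f w j vs) w) vs"
proof -
  note d = smooth_on_differentiable[OF f w]
  have dK: "(\<lambda>w. charge_wedge i w d l (f w j) vs) differentiable (at w)" for d j l vs
    by (rule smooth_on_differentiable[OF smooth_charge_wedge[OF P f] w])
  have "dird (u, 0) (\<lambda>w. c d / fact j * charge_wedge i w d l (f w j) vs) w = c d / fact j * charge_wedge i w d l (\<lambda>vs. dird (u, 0) (\<lambda>w. f w j vs) w) vs" for d j l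
    unfolding dird_charge_wedge[OF P w d, symmetric] by (rule dird_linear_compose[OF bounded_linear_mult_right dK])
  then show ?thesis
    unfolding charge_sum_apply case_prod_beta
    by (subst dird_sum) (intro differentiable_mult differentiable_const dK, simp)
qed

lemma charge_sum_add: "charge_sum c i w (\<lambda>j. f j + h j) = charge_sum c i w f + charge_sum c i w h"
  by (rule ext, subst plus_fun_apply, unfold charge_sum_apply charge_wedge_add, unfold plus_fun_apply sum.distrib[symmetric])
    (auto intro!: sum.cong simp: distrib_left add_divide_distrib)

lemma charge_sum_cmult: "charge_sum c i w (\<lambda>j vs. a * f j vs) vs = a * charge_sum c i w f vs"
  by (simp add: charge_sum_apply charge_wedge_cmult sum_distrib_left case_prod_beta mult.left_commute)

text \<open>Constancy of the velocity, the geodesic equation, leaves only the variation of the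
  curvature.\<close>

lemma dird_pair:
  assumes w: "w \<in> P \<times> cimg X i" and v: "dird (\<tau>, 0) (vl i) w = 0"
  shows "dird (\<tau>, 0) (\<lambda>w. pair i w j vs) w = \<i> / (2 * of_real pi) * (dloc em (Efl i j) w vs + Tfl i j w vs)"
proof -
  interpret L: metric_family "P \<times> cimg X i" em "(\<tau>, 0)" "metric_loc i" by (rule local_metric_family)
  have "dird (\<tau>, 0) (\<lambda>w. pair i w j vs) w = trace (dird (\<tau>, 0) (\<lambda>w. L.vel w ** mpow (L.ncv w) j vs) w)"
    unfolding pair_def
    by (rule dird_linear_compose[OF _ L.diff[OF L.smooth_mult[OF L.smooth_vel L.smooth_mpow] w]])
      (simp add: linear_trace flip: linear_conv_bounded_linear)
  also have "dird (\<tau>, 0) (\<lambda>w. L.vel w ** mpow (L.ncv w) j vs) w = L.vel w ** dird (\<tau>, 0) (\<lambda>w. mpow (L.ncv w) j vs) w"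
    unfolding L.dird_mult[OF L.smooth_vel L.smooth_mpow w] v by (simp add: bilinear_lzero[OF bilinear_matrix_mult])
  also have "trace \<dots> = \<i> / (2 * of_real pi) * (dloc em (Efl i j) w vs + Tfl i j w vs)"
    by (rule L.ftr_vel_dird_mpow[OF w])
  finally show ?thesis .
qed

lemma dird_charge_sum_pair:
  assumes w: "w \<in> P \<times> cimg X i" and v: "dird (\<tau>, 0) (vl i) w = 0"
  shows "dird (\<tau>, 0) (\<lambda>w. charge_sum charge_coeff i w (pair i w) vs) w =
    \<i> / (2 * of_real pi) * (dloc em (eta i) w vs + charge_sum charge_coeff i w (\<lambda>j. Tfl i j w) vs)"
proof -
  have "dird (\<tau>, 0) (\<lambda>w. charge_sum charge_coeff i w (pair i w) vs) w =
    charge_sum charge_coeff i w (\<lambda>j vs. \<i> / (2 * of_real pi) * (dloc em (Efl i j) w + Tfl i j w) vs) vs"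
    unfolding dird_charge_sum[OF w smooth_pair] dird_pair[OF w v] plus_fun_apply ..
  also have "\<dots> = \<i> / (2 * of_real pi) * (charge_sum charge_coeff i w (\<lambda>j. dloc em (Efl i j) w) vs + charge_sum charge_coeff i w (\<lambda>j. Tfl i j w) vs)"
    unfolding charge_sum_cmult charge_sum_add unfolding plus_fun_apply ..
  also have "charge_sum charge_coeff i w (\<lambda>j. dloc em (Efl i j) w) = dloc em (eta i) w"
    unfolding eta_def[abs_def] dloc_charge_sum[OF w metric_family.smooth_Ef[OF local_metric_family]] ..
  finally show ?thesis .
qed

end

section \<open>The subsolution form evaluated at the variation\<close>

context bundle_family
begin

text \<open>The factor \<open>1 / j\<close> from the symmetrisation completes
  \<open>1 / (j - 1)!\<close> to the \<open>1 / j!\<close> of the charge. The terms with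
  \<open>j = 0\<close>, absent from the bracket, are empty sums on the right.\<close>

lemma trace_sym_bracket:
  fixes B u u' :: "(complex^'n, complex^'r^'r) aform"
  assumes x: "x \<in> cdom X i" and gs: "gsg B = B" "gsg u' = - u'" "gsg u = - u"
  shows "trace (sym_bracket C i x c B u' u vs) =
    charge_sum c i (p, crd X i x) (\<lambda>j vs. \<Sum>k<j. ftriple k (j - 1 - k) B u' u vs) vs"
proof -
  have tc: "trace (charge_term C i x d l \<Phi> vs) = charge_wedge i (p, crd X i x) d l (ftr \<Phi>) vs" for d l and \<Phi> :: "(complex^'n, complex^'r^'r) aform"
    using trace_charge_term[OF x linear_trace trace_mat_mult, where p=p] by (simp add: ftr_def[abs_def])
  have fin: "finite {(d, j, l). d + j + l = CARD('n) \<and> 1 \<le> j}"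
    by (rule finite_subset[OF _ finite_degree_triples]) (auto simp: degree_triples_def)
  have K0: "charge_wedge i (p, crd X i x) d l (\<lambda>vs. 0) vs = 0" for d l
    using charge_wedge_cmult[of i "(p, crd X i x)" d l 0 "\<lambda>vs. 0"] by simp
  have "trace (sym_bracket C i x c B u' u vs) = (\<Sum>(d, j, l) | d + j + l = CARD('n) \<and> 1 \<le> j.
     c d / fact (j - 1) * charge_wedge i (p, crd X i x) d l (ftr (sym_wedge (replicate (j - 1) (2, B) @ [(1, u'), (1, u)]))) vs)"
    unfolding sym_bracket_def linear_sum[OF linear_trace] case_prod_beta trace_mat_mult tc ..
  also have "\<dots> = (\<Sum>(d, j, l) | d + j + l = CARD('n) \<and> 1 \<le> j.
     c d / fact j * charge_wedge i (p, crd X i x) d l (\<lambda>vs. \<Sum>k<j. ftriple k (j - 1 - k) B u' u vs) vs)"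
  proof (intro sum.cong refl, clarify)
    fix d j l :: nat assume j: "1 \<le> j"
    have "ftr (sym_wedge (replicate (j - 1) (2, B) @ [(1, u'), (1, u)])) =
        (\<lambda>vs. 1 / of_nat j * (\<Sum>k<j. ftriple k (j - 1 - k) B u' u vs))"
      by (rule ext) (simp only: ftr_sym_wedge[OF gs j] ftriple_def, simp)
    moreover have "(fact j :: complex) = of_nat j * fact (j - 1)" using j fact_reduce[of j, where 'a=complex] by simp
    ultimately show "c d / fact (j - 1) * charge_wedge i (p, crd X i x) d l (ftr (sym_wedge (replicate (j - 1) (2, B) @ [(1, u'), (1, u)]))) vs
      = c d / fact j * charge_wedge i (p, crd X i x) d l (\<lambda>vs. \<Sum>k<j. ftriple k (j - 1 - k) B u' u vs) vs"
      by (simp only: charge_wedge_cmult) simp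
  qed
  also have "\<dots> = charge_sum c i (p, crd X i x) (\<lambda>j vs. \<Sum>k<j. ftriple k (j - 1 - k) B u' u vs) vs"
    unfolding charge_sum_apply
  proof (rule sum.mono_neutral_left[OF finite_degree_triples])
    show "\<forall>a\<in>degree_triples - {(d, j, l). d + j + l = CARD('n) \<and> 1 \<le> j}.
        (case a of (d, j, l) \<Rightarrow> c d / fact j * charge_wedge i (p, crd X i x) d l (\<lambda>vs. \<Sum>k<j. ftriple k (j - 1 - k) B u' u vs) vs) = 0"
    proof (rule ballI)
      fix a assume a: "a \<in> degree_triples - {(d, j, l). d + j + l = CARD('n) \<and> 1 \<le> j}"
      moreover obtain d j l where "a = (d, j, l)" by (metis prod.collapse)
      ultimately have "a = (d, 0, l)" by (auto simp: degree_triples_def)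
      then show "(case a of (d, j, l) \<Rightarrow> c d / fact j * charge_wedge i (p, crd X i x) d l (\<lambda>vs. \<Sum>k<j. ftriple k (j - 1 - k) B u' u vs) vs) = 0"
        by (simp add: K0)
    qed
  qed (auto simp: degree_triples_def)
  finally show ?thesis .
qed

lemma cnj_charge_sum:
  assumes w: "w \<in> P \<times> cimg X i"
  shows "cnj (charge_sum c i w f vs) = charge_sum (\<lambda>d. cnj (c d)) i w (\<lambda>j vs. cnj (f j vs)) vs"
  by (simp add: charge_sum_apply cnj_charge_wedge[OF P w] case_prod_beta)

text \<open>The normalised curvature is self-adjoint, so both brackets contain the same words and
  differ only by conjugation of the coefficients. As \<open>Tf\<close> is imaginary, the second is
  minus the conjugate of the first, and the prefactor \<open>\<i> / (2 \<i>)\<close> leaves the real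
  part.\<close>

lemma subsolution_form_dbar_vel:
  assumes p: "p \<in> P" and z: "z \<in> cimg X i"
  shows "Re (subsolution_form X g C (metric_of p) i (cinv X i z) (dvl i (p, z)) vs) = Re (charge_sum charge_coeff i (p, z) (\<lambda>j. Tfl i j (p, z)) vs)"
proof -
  interpret L: metric_family "P \<times> cimg X i" em "(\<tau>, 0)" "metric_loc i" by (rule local_metric_family)
  let ?x = "cinv X i z" and ?w = "(p, z)"
  have w: "?w \<in> P \<times> cimg X i" using p z by simp
  have x: "?x \<in> cdom X i" by (rule cinv_in[OF z])
  have H: "metric_of p i ?x = metric_loc i ?w" by (simp add: metric_loc_def)
  have B: "ncurv X (metric_of p) i ?x = L.ncv ?w" using ncurv_eq[OF p x] z by simp
  have u': "form_adj (metric_of p i ?x) (one_form (L.dbar_vel ?w)) = L.dconn ?w"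
    unfolding H by (rule L.form_adj_dbar_vel[OF w])
  have B': "form_adj (metric_of p i ?x) (L.ncv ?w) = L.ncv ?w"
    unfolding H by (rule L.form_adj_ncv[OF w])
  have S: "trace (sym_bracket C i ?x c (L.ncv ?w) (L.dconn ?w) (one_form (L.dbar_vel ?w)) vs) = charge_sum c i ?w (\<lambda>j. L.Tf j ?w) vs" for c
  proof -
    have "(\<lambda>j vs. \<Sum>k<j. ftriple k (j - 1 - k) (L.ncv ?w) (L.dconn ?w) (one_form (L.dbar_vel ?w)) vs) = (\<lambda>j. L.Tf j ?w)"
      by (intro ext) (simp add: L.Tf_def sum_apply)
    then show ?thesis
      unfolding trace_sym_bracket[OF x L.gsg_ncv[OF w] L.gsg_dconn gsg_one_form, where p=p] crd_cinv[OF z] by (rule arg_cong)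
  qed
  have alg: "\<i> * (1 / (2 * \<i>) * a) = a / 2" for a by simp
  have "subsolution_form X g C (metric_of p) i ?x (L.dbar_vel ?w) vs =
     (charge_sum charge_coeff i ?w (\<lambda>j. L.Tf j ?w) vs - charge_sum (\<lambda>d. cnj (charge_coeff d)) i ?w (\<lambda>j. L.Tf j ?w) vs) / 2"
    unfolding subsolution_form_def Let_def B u' B' charge_coeff_def[symmetric] trace_mat_mult linear_diff[OF linear_trace] S alg ..
  moreover have "cnj (charge_sum charge_coeff i ?w (\<lambda>j. L.Tf j ?w) vs) = - charge_sum (\<lambda>d. cnj (charge_coeff d)) i ?w (\<lambda>j. L.Tf j ?w) vs"
    unfolding cnj_charge_sum[OF w] L.cnj_Tf[OF w] using charge_sum_cmult[of "\<lambda>d. cnj (charge_coeff d)" i ?w "-1"] by simp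
  ultimately have "subsolution_form X g C (metric_of p) i ?x (L.dbar_vel ?w) vs =
     (charge_sum charge_coeff i ?w (\<lambda>j. L.Tf j ?w) vs + cnj (charge_sum charge_coeff i ?w (\<lambda>j. L.Tf j ?w) vs)) / 2"
    by simp
  then show ?thesis by (simp only: complex_add_cnj) simp
qed

text \<open>The strict inequality is available for \<open>u \<noteq> 0\<close> only; where
  \<open>dbar_vel\<close> vanishes, every word contains a zero factor.\<close>

lemma subsolution_nonneg:
  assumes p: "p \<in> P" and s: "metric_of p \<in> subsolutions X g C" and z: "z \<in> cimg X i"
  shows "0 \<le> Re (charge_sum charge_coeff i (p, z) (\<lambda>j. Tfl i j (p, z)) oriented_frame)"
proof -
  interpret L: metric_family "P \<times> cimg X i" em "(\<tau>, 0)" "metric_loc i" by (rule local_metric_family)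
  have w: "(p, z) \<in> P \<times> cimg X i" using p z by simp
  show ?thesis
  proof (cases "\<exists>v. L.dbar_vel (p, z) v \<noteq> 0")
    case True
    then have "0 < Re (subsolution_form X g C (metric_of p) i (cinv X i z) (L.dbar_vel (p, z)) oriented_frame)"
      using s cinv_in[OF z] L.linear_dbar_vel[OF w] L.dbar_vel_scalar[OF w] unfolding subsolutions_def by blast
    then show ?thesis using subsolution_form_dbar_vel[OF p z] by simp
  next
    case False
    then have "one_form (L.dbar_vel (p, z)) = 0"
      by (auto simp: one_form_def fun_eq_iff split: list.splits)
    then have "L.Tf j (p, z) = 0" for j
      by (simp only: L.Tf_def ftriple_def mwedge_linear sum.neutral_const) (simp add: ftr_def fun_eq_iff sum_apply linear_0[OF linear_trace])
    then have "charge_sum charge_coeff i (p, z) (\<lambda>j. L.Tf j (p, z)) oriented_frame = 0"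
      using charge_sum_cmult[of charge_coeff i "(p, z)" 0 "\<lambda>j. L.Tf j (p, z)" oriented_frame] by (simp add: zero_fun_def)
    then show ?thesis by simp
  qed
qed

end

section \<open>Sign of the derivative along a geodesic\<close>

locale real_bundle_family = bundle_family X g C P metric_of "1 :: real"
  for X :: "('i, 'x::t2_space, 'n::finite) atlas"
    and g :: "'i \<Rightarrow> 'i \<Rightarrow> 'x \<Rightarrow> complex^'r::finite^'r" and C :: "('i, 'x, 'n) charge"
    and P :: "real set" and metric_of :: "real \<Rightarrow> 'i \<Rightarrow> 'x \<Rightarrow> complex^'r^'r"
begin

definition Phi' :: "real \<Rightarrow> real" where
  "Phi' t = (\<Sum>i\<in>idx. integral\<^sup>L lborel (cutoff i (\<lambda>z. Im (dird (1, 0) (\<lambda>w. charge_sum charge_coeff i w (pair i w) oriented_frame) (t, z)))))"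

lemma Phi_has_derivative:
  assumes t: "t \<in> P"
  shows "(Phi has_vector_derivative Phi' t) (at t)"
  unfolding Phi_def[abs_def] Phi'_def
proof (rule has_vector_derivative_sum)
  fix i
  let ?q = "\<lambda>w. charge_sum charge_coeff i w (pair i w) oriented_frame"
  have q: "smooth_on (P \<times> cimg X i) ?q" by (rule smooth_charge_sum[OF smooth_pair])
  have c: "continuous_on (P \<times> UNIV) (\<lambda>(p, z). cutoff i (\<lambda>z. Im (f (p, z))) z)" if "smooth_on (P \<times> cimg X i) f"
    for f :: "real \<times> (complex^'n) \<Rightarrow> complex"
    by (rule continuous_on_cutoff[OF P, of i "\<lambda>w. Im (f w)"]) (intro continuous_on_Im smooth_on_continuous that)
  show "((\<lambda>t. integral\<^sup>L lborel (cutoff i (\<lambda>z. Im (?q (t, z))))) has_vector_derivative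
      integral\<^sup>L lborel (cutoff i (\<lambda>z. Im (dird (1, 0) ?q (t, z))))) (at t)"
  proof (rule lborel_integral_has_vector_derivative[OF compact_ksupp P t c[OF q] c[OF smooth_on_dird[OF q]]])
    fix s z assume s: "s \<in> P"
    show "((\<lambda>t. cutoff i (\<lambda>z. Im (?q (t, z))) z) has_vector_derivative cutoff i (\<lambda>z. Im (dird (1, 0) ?q (s, z))) z) (at s)"
    proof (cases "z \<in> cimg X i")
      case True
      have "((\<lambda>t. ?q ((0, z) + t *\<^sub>R (1, 0))) has_vector_derivative dird (1, 0) ?q ((0, z) + s *\<^sub>R (1, 0))) (at s)"
        by (rule dird_has_vector_derivative, rule smooth_on_differentiable[OF q]) (use s True in simp)
      then have "((\<lambda>t. ?q (t, z)) has_vector_derivative dird (1, 0) ?q (s, z)) (at s)" by simp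
      from bounded_linear.has_vector_derivative[OF bounded_linear_scaleR_right
          bounded_linear.has_vector_derivative[OF bounded_linear_Im this]]
      show ?thesis using True by (simp add: cutoff_def)
    qed (simp add: cutoff_def)
  qed (rule cutoff_zero, assumption)+
qed

text \<open>The imaginary part of \<open>\<i> / 2 \<pi>\<close> times a number is its real part over
  \<open>2 \<pi>\<close>. By the subsolution condition the integrand of \<open>Phi'\<close> is then
  bounded below by the contribution of the exact form \<open>d eta\<close>, which integrates to
  0.\<close>

lemma Phi'_nonneg:
  assumes t: "t \<in> P" and s: "metric_of t \<in> subsolutions X g C"
    and v: "\<And>i z. z \<in> cimg X i \<Longrightarrow> dird (1, 0) (vl i) (t, z) = 0"
  shows "0 \<le> Phi' t"
proof -
  let ?fr = "oriented_frame :: (complex^'n) list"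
  let ?S = "\<lambda>i z. charge_sum charge_coeff i (t, z) (\<lambda>j. Tfl i j (t, z)) ?fr"
  have ct: "continuous_on (cimg X i) (\<lambda>z. f (t, z))" if "smooth_on (P \<times> cimg X i) f" for i and f :: "real \<times> (complex^'n) \<Rightarrow> complex"
    by (rule continuous_on_compose2[OF smooth_on_continuous[OF that]]) (use t in \<open>auto intro!: continuous_intros\<close>)
  have sd: "smooth_on (P \<times> cimg X i) (\<lambda>w. dloc em (eta i) w ?fr)" for i
    by (intro smooth_on_dloc open_Times P open_cimg smooth_eta)
  have iD: "integrable lborel (cutoff i (\<lambda>z. dloc em (eta i) (t, z) ?fr))" for i
    by (rule integrable_cutoff[OF ct[OF sd]])
  have iq: "integrable lborel (cutoff i (\<lambda>z. Im (dird (1, 0) (\<lambda>w. charge_sum charge_coeff i w (pair i w) ?fr) (t, z))))" for i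
    by (rule integrable_cutoff) (intro continuous_on_Im ct smooth_on_dird smooth_charge_sum smooth_pair)
  have "1 / (2 * pi) * Re (cutoff i (\<lambda>z. dloc em (eta i) (t, z) ?fr) z) \<le>
      cutoff i (\<lambda>z. Im (dird (1, 0) (\<lambda>w. charge_sum charge_coeff i w (pair i w) ?fr) (t, z))) z" for i z
  proof (cases "z \<in> cimg X i")
    case True
    have w: "(t, z) \<in> P \<times> cimg X i" using t True by simp
    have "Im (dird (1, 0) (\<lambda>w. charge_sum charge_coeff i w (pair i w) ?fr) (t, z)) = 1 / (2 * pi) * (Re (dloc em (eta i) (t, z) ?fr) + Re (?S i z))"
      unfolding dird_charge_sum_pair[OF w v[OF True]] by (simp add: Im_divide field_simps power2_eq_square)
    moreover have "0 \<le> 1 / (2 * pi) * Re (?S i z)"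
      using subsolution_nonneg[OF t s True] by simp
    ultimately have "1 / (2 * pi) * Re (dloc em (eta i) (t, z) ?fr) \<le> Im (dird (1, 0) (\<lambda>w. charge_sum charge_coeff i w (pair i w) ?fr) (t, z))"
      by (simp add: distrib_left)
    then show ?thesis
      using mult_left_mono[OF _ \<psi>_nonneg[of i "cinv X i z"]] True
      by (force simp: cutoff_def algebra_simps)
  qed (simp add: cutoff_def)
  then have "(\<Sum>i\<in>idx. integral\<^sup>L lborel (\<lambda>z. 1 / (2 * pi) * Re (cutoff i (\<lambda>z. dloc em (eta i) (t, z) ?fr) z))) \<le> Phi' t"
    unfolding Phi'_def by (intro sum_mono integral_mono integrable_mult_right integrable_Re iD iq)
  also have "(\<Sum>i\<in>idx. integral\<^sup>L lborel (\<lambda>z. 1 / (2 * pi) * Re (cutoff i (\<lambda>z. dloc em (eta i) (t, z) ?fr) z)))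
      = 1 / (2 * pi) * Re (\<Sum>i\<in>idx. integral\<^sup>L lborel (cutoff i (\<lambda>z. dloc em (eta i) (t, z) ?fr)))"
    by (simp add: iD sum_distrib_left Re_sum)
  also have "\<dots> = 0" by (simp add: stokes_eta[OF t])
  finally show ?thesis .
qed

end

section \<open>Paths of metrics\<close>

lemma smooth_on_fst:
  fixes f :: "'a::euclidean_space \<Rightarrow> 'b::real_normed_vector"
  assumes "open P" "open S" "smooth_on P f"
  shows "smooth_on (P \<times> S) (\<lambda>w. f (fst w))"
  by (rule smooth_on_compose[OF open_Times[OF assms(1,2)] assms(1) _ assms(3)])
    (auto intro!: smooth_on_linear open_Times assms bounded_linear_fst)

context complex_manifold
begin

lemma chart_deriv_cong:
  assumes "\<And>y. y \<in> cdom X i \<Longrightarrow> f y = f' y" "x \<in> cdom X i"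
  shows "chart_deriv X i f x v = chart_deriv X i f' x v"
  using dird_cong_open(1)[OF open_cimg crd_in[OF assms(2)], of "\<lambda>z. f (cinv X i z)" "\<lambda>z. f' (cinv X i z)" v] assms(1) cinv_in
  by (simp add: chart_deriv_def dird_def)

lemma ncurv_cong:
  assumes eq: "\<And>y. y \<in> cdom X i \<Longrightarrow> h i y = h' i y" and x: "x \<in> cdom X i"
  shows "ncurv X h i x = ncurv X h' i x"
proof
  fix vs
  have c: "chern_connection X h i y = chern_connection X h' i y" if "y \<in> cdom X i" for y
    using chart_deriv_cong[of i "h i" "h' i" y, OF eq that] eq[OF that] by (simp add: chern_connection_def)
  have "chart_deriv X i (\<lambda>y. chern_connection X h i y us) x v = chart_deriv X i (\<lambda>y. chern_connection X h' i y us) x v" for us v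
    by (rule chart_deriv_cong[OF _ x]) (simp add: c)
  then show "ncurv X h i x vs = ncurv X h' i x vs"
    by (simp add: ncurv_def chern_curvature_def ext_d_def c[OF x])
qed

lemma hermitian_metricsI:
  fixes h :: "'i \<Rightarrow> 'x \<Rightarrow> complex^'r::finite^'r"
  assumes "\<And>i. smooth_on (cimg X i) (\<lambda>z. h i (cinv X i z))" "\<And>i x. x \<in> cdom X i \<Longrightarrow> conj_transpose (h i x) = h i x"
    "\<And>i x s. x \<in> cdom X i \<Longrightarrow> s \<noteq> 0 \<Longrightarrow> 0 < Re (\<Sum>a\<in>UNIV. \<Sum>b\<in>UNIV. cnj ((s :: complex^'r) $ a) * h i x $ a $ b * s $ b)"
    "\<And>i j x. x \<in> cdom X i \<Longrightarrow> x \<in> cdom X j \<Longrightarrow> h j x = conj_transpose (g i j x) ** h i x ** g i j x"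
  shows "h \<in> hermitian_metrics X g"
  unfolding hermitian_metrics_def using assms by blast

lemma hermitian_metricsD:
  fixes h :: "'i \<Rightarrow> 'x \<Rightarrow> complex^'r::finite^'r" and s :: "complex^'r"
  assumes "h \<in> hermitian_metrics X g"
  shows "smooth_on (cimg X i) (\<lambda>z. h i (cinv X i z))" "x \<in> cdom X i \<Longrightarrow> conj_transpose (h i x) = h i x"
    "x \<in> cdom X i \<Longrightarrow> s \<noteq> 0 \<Longrightarrow> 0 < Re (\<Sum>a\<in>UNIV. \<Sum>b\<in>UNIV. cnj (s $ a) * h i x $ a $ b * s $ b)"
    "x \<in> cdom X i \<Longrightarrow> x \<in> cdom X j \<Longrightarrow> h j x = conj_transpose (g i j x) ** h i x ** g i j x"
  using assms unfolding hermitian_metrics_def by blast+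

lemma hermitian_metrics_cong:
  fixes h h' :: "'i \<Rightarrow> 'x \<Rightarrow> complex^'r::finite^'r"
  assumes h: "h \<in> hermitian_metrics X g" and eq: "\<And>i x. x \<in> cdom X i \<Longrightarrow> h' i x = h i x"
  shows "h' \<in> hermitian_metrics X g"
proof -
  have "smooth_on (cimg X i) (\<lambda>z. h' i (cinv X i z))" for i
    using smooth_on_cong[OF open_cimg, of i "\<lambda>z. h' i (cinv X i z)" "\<lambda>z. h i (cinv X i z)"] hermitian_metricsD(1)[OF h] eq cinv_in by simp
  then show ?thesis
  proof (rule hermitian_metricsI)
    show "h' j x = conj_transpose (g i j x) ** h' i x ** g i j x" if "x \<in> cdom X i" "x \<in> cdom X j" for i j x
      unfolding eq[OF that(1)] eq[OF that(2)] by (rule hermitian_metricsD(4)[OF h that])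
    show "0 < Re (\<Sum>a\<in>UNIV. \<Sum>b\<in>UNIV. cnj (s $ a) * h' i x $ a $ b * s $ b)" if "x \<in> cdom X i" "s \<noteq> 0" for i x s
      unfolding eq[OF that(1)] by (rule hermitian_metricsD(3)[OF h that])
  qed (simp_all add: eq hermitian_metricsD(2)[OF h])
qed

text \<open>Convexity of the set of metrics is the source of the connecting paths and of the
  homotopies constructed below.\<close>

lemma hermitian_metrics_convex:
  fixes a b :: "'i \<Rightarrow> 'x \<Rightarrow> complex^'r::finite^'r"
  assumes a: "a \<in> hermitian_metrics X g" and b: "b \<in> hermitian_metrics X g" and c: "0 \<le> c" "c \<le> 1"
  shows "(\<lambda>i x. (1 - c) *\<^sub>R a i x + c *\<^sub>R b i x) \<in> hermitian_metrics X g"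
proof -
  define q where "q A s = (\<Sum>a\<in>UNIV. \<Sum>b\<in>UNIV. cnj (s $ a) * A $ a $ b * s $ b)" for A :: "complex^'r^'r" and s
  have "q ((1 - c) *\<^sub>R A + c *\<^sub>R B) s = of_real (1 - c) * q A s + of_real c * q B s" for A B :: "complex^'r^'r" and s
    unfolding q_def sum_distrib_left sum.distrib[symmetric]
    by (intro sum.cong refl) (simp only: vector_add_component vector_scaleR_component, simp add: scaleR_conv_of_real distrib_left distrib_right mult_ac del: of_real_diff)
  then have f: "Re (q ((1 - c) *\<^sub>R A + c *\<^sub>R B) s) = (1 - c) * Re (q A s) + c * Re (q B s)" for A B :: "complex^'r^'r" and s
    by (simp del: of_real_diff)
  have pos: "0 < (1 - c) * x + c * y" if "0 < x" "0 < y" for x y :: real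
    using c that by (cases "c = 0") (auto intro!: add_nonneg_pos)
  have ct: "conj_transpose ((1 - c) *\<^sub>R A + c *\<^sub>R B) = (1 - c) *\<^sub>R conj_transpose A + c *\<^sub>R conj_transpose B" for A B :: "complex^'r^'r"
    by (simp add: conj_transpose_add linear_cmul[OF linear_conj_transpose])
  have m: "G' ** ((1 - c) *\<^sub>R A + c *\<^sub>R B) ** G = (1 - c) *\<^sub>R (G' ** A ** G) + c *\<^sub>R (G' ** B ** G)" for A B G G' :: "complex^'r^'r"
    by (simp add: bilinear_ladd[OF bilinear_matrix_mult] bilinear_radd[OF bilinear_matrix_mult]
      bilinear_lmul[OF bilinear_matrix_mult] bilinear_rmul[OF bilinear_matrix_mult])
  note A = hermitian_metricsD[OF a] and B = hermitian_metricsD[OF b]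
  show ?thesis
  proof (rule hermitian_metricsI)
    show "smooth_on (cimg X i) (\<lambda>z. (1 - c) *\<^sub>R a i (cinv X i z) + c *\<^sub>R b i (cinv X i z))" for i
      by (intro smooth_on_add smooth_on_scaleR smooth_on_const open_cimg A(1) B(1))
    fix i x assume x: "x \<in> cdom X i"
    show "conj_transpose ((1 - c) *\<^sub>R a i x + c *\<^sub>R b i x) = (1 - c) *\<^sub>R a i x + c *\<^sub>R b i x"
      unfolding ct A(2)[OF x] B(2)[OF x] ..
    show "0 < Re (\<Sum>k\<in>UNIV. \<Sum>l\<in>UNIV. cnj (s $ k) * ((1 - c) *\<^sub>R a i x + c *\<^sub>R b i x) $ k $ l * s $ l)" if "s \<noteq> 0" for s
      unfolding q_def[symmetric] f by (intro pos) (use A(3)[OF x that] B(3)[OF x that] in \<open>simp_all only: q_def\<close>)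
    show "(1 - c) *\<^sub>R a j x + c *\<^sub>R b j x = conj_transpose (g i j x) ** ((1 - c) *\<^sub>R a i x + c *\<^sub>R b i x) ** g i j x"
      if "x \<in> cdom X j" for j
      unfolding m A(4)[OF x that, symmetric] B(4)[OF x that, symmetric] ..
  qed
qed

end

section \<open>Values of the path integral\<close>

context bundle_charge
begin

abbreviation PhiR :: "(real \<Rightarrow> 'i \<Rightarrow> 'x \<Rightarrow> complex^'r^'r) \<Rightarrow> real \<Rightarrow> real" where
  "PhiR \<gamma> \<equiv> bundle_family.Phi X g C \<gamma> 1"

lemma familyI:
  assumes "open P" "\<And>p. p \<in> P \<Longrightarrow> metric_of p \<in> hermitian_metrics X g"
    "\<And>i. smooth_on (P \<times> cimg X i) (\<lambda>w. metric_of (fst w) i (cinv X i (snd w)))"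
  shows "bundle_family X g C P metric_of"
  using assms by (intro bundle_family.intro bundle_charge_axioms bundle_family_axioms.intro)

lemma smooth_metric_path_iff: "smooth_metric_path X g J \<gamma> \<longleftrightarrow> (\<exists>T. J \<subseteq> T \<and> bundle_family X g C T \<gamma>)"
  unfolding smooth_metric_path_def case_prod_beta'
proof
  assume "\<exists>T. open T \<and> J \<subseteq> T \<and> (\<forall>t\<in>T. \<gamma> t \<in> hermitian_metrics X g) \<and>
    (\<forall>i. smooth_on (T \<times> cimg X i) (\<lambda>w. \<gamma> (fst w) i (cinv X i (snd w))))"
  then obtain T where "open T" "J \<subseteq> T" "\<forall>t\<in>T. \<gamma> t \<in> hermitian_metrics X g"
    "\<forall>i. smooth_on (T \<times> cimg X i) (\<lambda>w. \<gamma> (fst w) i (cinv X i (snd w)))" by blast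
  then show "\<exists>T. J \<subseteq> T \<and> bundle_family X g C T \<gamma>" by (intro exI[of _ T] conjI familyI) auto
next
  assume "\<exists>T. J \<subseteq> T \<and> bundle_family X g C T \<gamma>"
  then obtain T where T: "J \<subseteq> T" "bundle_family X g C T \<gamma>" by blast
  show "\<exists>T. open T \<and> J \<subseteq> T \<and> (\<forall>t\<in>T. \<gamma> t \<in> hermitian_metrics X g) \<and>
    (\<forall>i. smooth_on (T \<times> cimg X i) (\<lambda>w. \<gamma> (fst w) i (cinv X i (snd w))))"
    by (intro exI[of _ T] conjI ballI allI T(1) bundle_family.P[OF T(2)] bundle_family.metric_of[OF T(2)] bundle_family.metric_of_smooth[OF T(2)])
qed

lemma family_compose:
  fixes \<sigma> :: "'q::euclidean_space \<Rightarrow> 'p::euclidean_space"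
  assumes f: "bundle_family X g C T \<gamma>" and S: "open S" and \<sigma>: "smooth_on S \<sigma>" "\<And>s. s \<in> S \<Longrightarrow> \<sigma> s \<in> T"
  shows "bundle_family X g C S (\<lambda>s. \<gamma> (\<sigma> s))"
proof (rule familyI[OF S])
  interpret F: bundle_family X g C T \<gamma> undefined by (rule f)
  show "\<gamma> (\<sigma> s) \<in> hermitian_metrics X g" if "s \<in> S" for s using F.metric_of \<sigma>(2) that by blast
  fix i
  have "smooth_on (S \<times> cimg X i) (\<lambda>w. (\<sigma> (fst w), snd w))"
    by (intro smooth_on_Pair smooth_on_fst smooth_on_snd smooth_on_id open_Times S open_cimg \<sigma>)
  from smooth_on_compose[OF open_Times[OF S open_cimg] open_Times[OF F.P open_cimg] _ F.metric_of_smooth this]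
  show "smooth_on (S \<times> cimg X i) (\<lambda>w. \<gamma> (\<sigma> (fst w)) i (cinv X i (snd w)))"
    using \<sigma>(2) by auto
qed

lemma family_const: "h \<in> hermitian_metrics X g \<Longrightarrow> bundle_family X g C UNIV (\<lambda>p::'p::euclidean_space. h)"
  by (rule familyI[OF open_UNIV _ smooth_on_snd[OF open_UNIV open_cimg hermitian_metricsD(1)]])

lemma family_homotopy:
  fixes p q :: "'p::euclidean_space \<Rightarrow> 'i \<Rightarrow> 'x \<Rightarrow> complex^'r^'r"
  assumes p: "bundle_family X g C UNIV p" and q: "bundle_family X g C UNIV q"
    and c: "smooth_on UNIV c" "\<And>s. 0 \<le> c s" "\<And>s. c s \<le> 1"
  shows "bundle_family X g C UNIV (\<lambda>s i x. (1 - c s) *\<^sub>R p s i x + c s *\<^sub>R q s i x)"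
proof (rule familyI[OF open_UNIV])
  interpret A: bundle_family X g C UNIV p undefined by (rule p)
  interpret B: bundle_family X g C UNIV q undefined by (rule q)
  show "(\<lambda>i x. (1 - c s) *\<^sub>R p s i x + c s *\<^sub>R q s i x) \<in> hermitian_metrics X g" for s
    by (intro hermitian_metrics_convex A.metric_of B.metric_of UNIV_I c)
  show "smooth_on (UNIV \<times> cimg X i) (\<lambda>w. (1 - c (fst w)) *\<^sub>R p (fst w) i (cinv X i (snd w)) + c (fst w) *\<^sub>R q (fst w) i (cinv X i (snd w)))" for i
    by (intro smooth_on_add smooth_on_scaleR smooth_on_diff smooth_on_const smooth_on_fst[OF open_UNIV open_cimg c(1)]
        open_Times open_UNIV open_cimg A.metric_of_smooth B.metric_of_smooth)
qed

text \<open>Reparametrisation multiplies the velocity by \<open>d\<close>, while the curvature at a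
  single time is not affected. Agreement is asked on chart domains only, since the values of a
  metric elsewhere carry no meaning.\<close>

lemma Phi_local:
  assumes A: "bundle_family X g C T \<gamma>" and B: "bundle_family X g C T' \<beta>"
    and U: "open U" "s \<in> U" "U \<subseteq> T'" "\<And>s. s \<in> U \<Longrightarrow> \<sigma> s \<in> T"
    and eq: "\<And>s i x. s \<in> U \<Longrightarrow> x \<in> cdom X i \<Longrightarrow> \<beta> s i x = \<gamma> (\<sigma> s) i x"
    and \<sigma>: "(\<sigma> has_real_derivative d) (at s)"
  shows "PhiR \<beta> s = d * PhiR \<gamma> (\<sigma> s)"
proof -
  interpret A: bundle_family X g C T \<gamma> 1 by (rule A)
  interpret B: bundle_family X g C T' \<beta> 1 by (rule B)
  have sT: "s \<in> T'" "\<sigma> s \<in> T" using U by auto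
  have charge_sum: "B.charge_sum B.charge_coeff i (s, z) (B.pair i (s, z)) vs = of_real d * A.charge_sum A.charge_coeff i (\<sigma> s, z) (A.pair i (\<sigma> s, z)) vs"
    if z: "z \<in> cimg X i" for i z vs
  proof -
    interpret LA: metric_family "T \<times> cimg X i" em "(1, 0)" "A.metric_loc i" by (rule A.local_metric_family)
    interpret LB: metric_family "T' \<times> cimg X i" em "(1, 0)" "B.metric_loc i" by (rule B.local_metric_family)
    have w: "(s, z) \<in> U \<times> cimg X i" "(\<sigma> s, z) \<in> T \<times> cimg X i" using U z sT by auto
    have ev: "B.metric_loc i w = A.metric_loc i (\<sigma> (fst w), snd w)" if "w \<in> U \<times> cimg X i" for w
      using that eq cinv_in by (auto simp: A.metric_loc_def B.metric_loc_def)
    have "(\<sigma> has_derivative (\<lambda>h. h * d)) (at (fst (s, z)))"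
      using \<sigma> by (simp add: has_field_derivative_def mult.commute[of _ d])
    then have hd: "((\<lambda>w. (\<sigma> (fst w), snd w)) has_derivative (\<lambda>v. (fst v * d, snd v))) (at (s, z))"
      by (intro has_derivative_Pair has_derivative_compose[OF has_derivative_fst[OF has_derivative_ident]] has_derivative_snd has_derivative_ident)
    have "dird (1, 0) (B.metric_loc i) (s, z) = dird (1, 0) (\<lambda>w. A.metric_loc i (\<sigma> (fst w), snd w)) (s, z)"
      by (rule dird_cong_open(1)[OF open_Times[OF U(1) open_cimg] w(1) ev])
    also have "\<dots> = dird (dird (1, 0) (\<lambda>w. (\<sigma> (fst w), snd w)) (s, z)) (A.metric_loc i) (\<sigma> (fst (s, z)), snd (s, z))"
      by (rule dird_compose) (use hd LA.diff[OF LA.H w(2)] in \<open>auto simp: differentiable_def\<close>)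
    also have "\<dots> = d *\<^sub>R dird (1, 0) (A.metric_loc i) (\<sigma> s, z)"
      unfolding dird_eqI[OF hd] using linear_cmul[OF linear_dird[OF LA.diff[OF LA.H w(2)]], of d "(1, 0)"] by simp
    finally have vel: "LB.vel (s, z) = d *\<^sub>R LA.vel (\<sigma> s, z)"
      unfolding LA.vel_def LB.vel_def LA.Hi_def LB.Hi_def ev[OF w(1)] by (simp add: bilinear_rmul[OF bilinear_matrix_mult])
    have "LB.ncv (s, z) = LA.ncv (\<sigma> s, z)"
      using B.ncurv_eq[OF sT(1) cinv_in[OF z]] A.ncurv_eq[OF sT(2) cinv_in[OF z]]
        ncurv_cong[of i "\<beta> s" "\<gamma> (\<sigma> s)" "cinv X i z"] eq[OF U(2)] cinv_in[OF z] z by simp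
    then have "B.pair i (s, z) = (\<lambda>j vs. of_real d * A.pair i (\<sigma> s, z) j vs)"
      unfolding A.pair_def B.pair_def vel
      by (intro ext) (simp only: bilinear_lmul[OF bilinear_matrix_mult] linear_cmul[OF linear_trace], simp add: scaleR_conv_of_real)
    moreover have "charge_wedge i (s, z) = charge_wedge i (\<sigma> s, z)" by (intro ext) (simp add: charge_wedge_def kform_loc_def uform_loc_def)
    ultimately show ?thesis by (simp add: B.charge_sum_apply A.charge_sum_apply charge_wedge_cmult sum_distrib_left case_prod_beta mult.left_commute)
  qed
  have "cutoff i (\<lambda>z. Im (B.charge_sum B.charge_coeff i (s, z) (B.pair i (s, z)) oriented_frame)) =
     (\<lambda>z. d * cutoff i (\<lambda>z. Im (A.charge_sum A.charge_coeff i (\<sigma> s, z) (A.pair i (\<sigma> s, z)) oriented_frame)) z)" for i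
    by (rule ext) (simp add: cutoff_def charge_sum)
  then show ?thesis unfolding A.Phi_def B.Phi_def by (simp add: sum_distrib_left)
qed

lemma path_functional_integral:
  assumes "bundle_family X g C T \<gamma>" "{0..1} \<subseteq> T"
  shows "path_functional X g C \<gamma> = of_real (integral {0..1} (PhiR \<gamma>))"
proof -
  interpret F: bundle_family X g C T \<gamma> 1 by (rule assms)
  have "set_lebesgue_integral lborel {0..1} F.Phi = integral {0..1} F.Phi"
    by (rule set_borel_integral_eq_integral(2)[OF borel_integrable_atLeastAtMost'])
      (rule continuous_on_subset[OF F.continuous_on_Phi assms(2)])
  then show ?thesis using F.path_functional_eq[of 0] subsetD[OF assms(2)] by simp
qed

text \<open>The paths are smooth for all real times, so that reparametrising and gluing them
  involves no domains; \<open>path_functional_values\<close> shows that these are the values in the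
  definition of \<open>M_Z\<close>.\<close>

definition path_value :: "('i \<Rightarrow> 'x \<Rightarrow> complex^'r^'r) \<Rightarrow> ('i \<Rightarrow> 'x \<Rightarrow> complex^'r^'r) \<Rightarrow> real \<Rightarrow> bool" where
  "path_value a b m \<longleftrightarrow> (\<exists>\<gamma>. bundle_family X g C UNIV \<gamma> \<and>
     (\<forall>i. \<forall>x\<in>cdom X i. \<gamma> 0 i x = a i x \<and> \<gamma> 1 i x = b i x) \<and> integral {0..1} (PhiR \<gamma>) = m)"

text \<open>The difference of the two integrals is the oriented integral from
  \<open>\<sigma> u\<close> to \<open>\<sigma> v\<close>: at least one of them runs over an empty
  set or a point.\<close>

lemma has_integral_reparam:
  assumes \<gamma>: "bundle_family X g C T \<gamma>" and \<beta>: "bundle_family X g C T' \<beta>"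
    and \<sigma>: "smooth_on UNIV \<sigma>" "\<sigma> ` {u..v} \<subseteq> {c..d}" "{c..d} \<subseteq> T" and uv: "u \<le> v" "{u..v} \<subseteq> U" "open U" "U \<subseteq> T'" "\<And>s. s \<in> U \<Longrightarrow> \<sigma> s \<in> T"
    and eq: "\<And>s i x. s \<in> U \<Longrightarrow> x \<in> cdom X i \<Longrightarrow> \<beta> s i x = \<gamma> (\<sigma> s) i x"
  shows "(PhiR \<beta> has_integral (integral {\<sigma> u..\<sigma> v} (PhiR \<gamma>) - integral {\<sigma> v..\<sigma> u} (PhiR \<gamma>))) {u..v}"
proof -
  have d: "(\<sigma> has_real_derivative dird 1 \<sigma> s) (at s)" for s
    using dird_has_vector_derivative[of \<sigma> 0 s 1] smooth_on_differentiable[OF \<sigma>(1)]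
    by (simp add: has_real_derivative_iff_has_vector_derivative)
  have "((\<lambda>s. dird 1 \<sigma> s *\<^sub>R PhiR \<gamma> (\<sigma> s)) has_integral (integral {\<sigma> u..\<sigma> v} (PhiR \<gamma>) - integral {\<sigma> v..\<sigma> u} (PhiR \<gamma>))) {u..v}"
    by (rule has_integral_substitution_general[OF finite.emptyI uv(1) \<sigma>(2)
          continuous_on_subset[OF bundle_family.continuous_on_Phi[OF \<gamma>] \<sigma>(3)]
          continuous_on_subset[OF smooth_on_continuous[OF \<sigma>(1)] subset_UNIV] has_field_derivative_at_within[OF d]])
  then show ?thesis
    by (rule has_integral_eq[rotated])
      (use Phi_local[OF \<gamma> \<beta> uv(3) _ uv(4,5) eq d] uv(2) in auto)
qed

lemma path_value_reparam:
  fixes \<sigma> :: "real \<Rightarrow> real"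
  assumes \<gamma>: "bundle_family X g C T \<gamma>"
    and \<sigma>: "smooth_on UNIV \<sigma>" "\<And>s. \<sigma> s \<in> T" "\<sigma> ` {0..1} \<subseteq> {c..d}" "{c..d} \<subseteq> T"
  shows "path_value (\<gamma> (\<sigma> 0)) (\<gamma> (\<sigma> 1)) (integral {\<sigma> 0..\<sigma> 1} (PhiR \<gamma>) - integral {\<sigma> 1..\<sigma> 0} (PhiR \<gamma>))"
proof -
  have \<beta>: "bundle_family X g C UNIV (\<lambda>s. \<gamma> (\<sigma> s))" by (rule family_compose[OF \<gamma> open_UNIV \<sigma>(1,2)])
  show ?thesis
    unfolding path_value_def
    by (rule exI[of _ "\<lambda>s. \<gamma> (\<sigma> s)"]) (use \<beta> has_integral_reparam[OF \<gamma> \<beta> \<sigma>(1,3,4), of UNIV] \<sigma>(2) in \<open>auto intro!: integral_unique\<close>)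
qed

lemma path_value_cong:
  assumes "path_value a b m" "\<And>i x. x \<in> cdom X i \<Longrightarrow> a' i x = a i x" "\<And>i x. x \<in> cdom X i \<Longrightarrow> b' i x = b i x"
  shows "path_value a' b' m"
  using assms unfolding path_value_def by simp

text \<open>The family may be defined near \<open>{a..b}\<close> only. Running through it with
  \<open>smooth_step\<close> never leaves this interval, which gives a path for all times with the
  same integral.\<close>

lemma path_value_segment:
  assumes \<gamma>: "bundle_family X g C T \<gamma>" and ab: "a \<le> b" "{a..b} \<subseteq> T"
  shows "path_value (\<gamma> a) (\<gamma> b) (integral {a..b} (PhiR \<gamma>))"
proof -
  define \<sigma> where "\<sigma> s = a + (b - a) * smooth_step s" for s
  have \<sigma>: "smooth_on UNIV \<sigma>"
    unfolding \<sigma>_def[abs_def] by (intro smooth_on_add smooth_on_mult smooth_on_const smooth_on_smooth_step open_UNIV)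
  have r: "\<sigma> s \<in> {a..b}" for s
    using ab(1) mult_left_mono[OF smooth_step_bounds(2), of "b - a" s] smooth_step_bounds(1)[of s] by (simp add: \<sigma>_def)
  have e: "\<sigma> 0 = a" "\<sigma> 1 = b" by (simp_all add: \<sigma>_def smooth_step_0 smooth_step_1)
  have z: "integral {b..a} (PhiR \<gamma>) = 0" using ab(1) by (cases "a = b") auto
  have "path_value (\<gamma> (\<sigma> 0)) (\<gamma> (\<sigma> 1)) (integral {\<sigma> 0..\<sigma> 1} (PhiR \<gamma>) - integral {\<sigma> 1..\<sigma> 0} (PhiR \<gamma>))"
    by (rule path_value_reparam[OF \<gamma> \<sigma> _ _ ab(2)]) (use r ab(2) in auto)
  then show ?thesis unfolding e z by simp
qed

lemma path_value_exists:
  assumes "a \<in> hermitian_metrics X g" "b \<in> hermitian_metrics X g"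
  shows "\<exists>m. path_value a b m"
proof -
  have "bundle_family X g C UNIV (\<lambda>s i x. (1 - smooth_step s) *\<^sub>R a i x + smooth_step s *\<^sub>R b i x)"
    by (rule family_homotopy[OF family_const[OF assms(1)] family_const[OF assms(2)] smooth_on_smooth_step])
      (rule smooth_step_bounds)+
  then show ?thesis unfolding path_value_def
    by (intro exI conjI) (auto simp: smooth_step_0 smooth_step_1)
qed

lemma path_value_reverse:
  assumes "path_value a b m" shows "path_value b a (- m)"
proof -
  obtain \<gamma> where \<gamma>: "bundle_family X g C UNIV \<gamma>" and e: "\<And>i x. x \<in> cdom X i \<Longrightarrow> \<gamma> 0 i x = a i x \<and> \<gamma> 1 i x = b i x"
    and m: "integral {0..1} (PhiR \<gamma>) = m" using assms unfolding path_value_def by blast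
  have \<sigma>: "smooth_on UNIV (\<lambda>s::real. 1 - s)" by (intro smooth_on_diff smooth_on_const smooth_on_id open_UNIV)
  have "path_value (\<gamma> (1 - 0)) (\<gamma> (1 - 1)) (integral {1 - 0..1 - 1} (PhiR \<gamma>) - integral {1 - 1..1 - 0} (PhiR \<gamma>))"
    by (rule path_value_reparam[OF \<gamma> \<sigma>, of 0 1]) auto
  then have "path_value (\<gamma> 1) (\<gamma> 0) (- m)" using m by simp
  then show ?thesis by (rule path_value_cong) (use e in auto)
qed

text \<open>The glued path is \<open>p (\<sigma> s) + (q (\<rho> s) - q 0)\<close>, a single
  expression and therefore smooth. Before time 2/3 the bracket is 0; after time 1/3 the first term
  has arrived at \<open>b\<close>, which cancels \<open>q 0\<close>. The two descriptions overlap,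
  so each half of the time interval lies in an open set on which one of them holds.\<close>

lemma path_value_trans:
  assumes "path_value a b m" "path_value b c m'" shows "path_value a c (m + m')"
proof -
  obtain p where p: "bundle_family X g C UNIV p" and pe: "\<And>i x. x \<in> cdom X i \<Longrightarrow> p 0 i x = a i x \<and> p 1 i x = b i x"
    and m: "integral {0..1} (PhiR p) = m" using assms unfolding path_value_def by blast
  obtain q where q: "bundle_family X g C UNIV q" and qe: "\<And>i x. x \<in> cdom X i \<Longrightarrow> q 0 i x = b i x \<and> q 1 i x = c i x"
    and m': "integral {0..1} (PhiR q) = m'" using assms unfolding path_value_def by blast
  define \<sigma> \<rho> where "\<sigma> s = smooth_step (2 * s)" and "\<rho> s = smooth_step (2 * s - 1)" for s
  have s: "smooth_on UNIV \<sigma>" "smooth_on UNIV \<rho>"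
  proof -
    have l: "smooth_on UNIV (\<lambda>s::real. 2 * s)" "smooth_on UNIV (\<lambda>s::real. 2 * s - 1)"
      by (intro smooth_on_diff smooth_on_mult smooth_on_const smooth_on_id open_UNIV)+
    show "smooth_on UNIV \<sigma>" "smooth_on UNIV \<rho>"
      unfolding \<sigma>_def[abs_def] \<rho>_def[abs_def]
      by (rule smooth_on_compose[OF open_UNIV open_UNIV _ smooth_on_smooth_step l(1)], simp,
          rule smooth_on_compose[OF open_UNIV open_UNIV _ smooth_on_smooth_step l(2)], simp)
  qed
  define \<beta> where "\<beta> s i x = p (\<sigma> s) i x + (q (\<rho> s) i x - q 0 i x)" for s i x
  have \<beta>p: "\<beta> s = p (\<sigma> s)" if "s < 2/3" for s
    using that by (intro ext) (simp add: \<beta>_def \<rho>_def smooth_step_0)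
  have \<beta>q: "\<beta> s i x = q (\<rho> s) i x" if "s > 1/3" "x \<in> cdom X i" for s i x
    using that pe qe by (simp add: \<beta>_def \<sigma>_def smooth_step_1)
  have \<beta>: "bundle_family X g C UNIV \<beta>"
  proof (rule familyI[OF open_UNIV])
    show "\<beta> s \<in> hermitian_metrics X g" for s
    proof (cases "s < 2/3")
      case True
      then show ?thesis using \<beta>p bundle_family.metric_of[OF p] by simp
    next
      case False
      have "q (\<rho> s) \<in> hermitian_metrics X g" using bundle_family.metric_of[OF q] by simp
      then show ?thesis by (rule hermitian_metrics_cong) (use \<beta>q False in simp)
    qed
    show "smooth_on (UNIV \<times> cimg X i) (\<lambda>w. \<beta> (fst w) i (cinv X i (snd w)))" for i
      unfolding \<beta>_def
      by (intro smooth_on_add smooth_on_diff open_Times open_UNIV open_cimg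
          bundle_family.metric_of_smooth[OF family_compose[OF p open_UNIV s(1)]]
          bundle_family.metric_of_smooth[OF family_compose[OF q open_UNIV s(2)]]
          bundle_family.metric_of_smooth[OF family_const] bundle_family.metric_of[OF q] UNIV_I)
  qed
  have b: "\<sigma> ` A \<subseteq> {0..1}" "\<rho> ` A \<subseteq> {0..1}" for A by (auto simp: \<sigma>_def \<rho>_def smooth_step_bounds)
  have e: "\<sigma> 0 = 0" "\<sigma> (1/2) = 1" "\<rho> (1/2) = 0" "\<rho> 1 = 1" by (simp_all add: \<sigma>_def \<rho>_def smooth_step_0 smooth_step_1)
  have "(PhiR \<beta> has_integral m) {0..1/2}"
    using has_integral_reparam[OF p \<beta> s(1) b(1) subset_UNIV, of 0 "1/2" "{..<2/3}"] \<beta>p unfolding e by (simp add: m subset_iff)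
  moreover have "(PhiR \<beta> has_integral m') {1/2..1}"
    using has_integral_reparam[OF q \<beta> s(2) b(2) subset_UNIV, of "1/2" 1 "{1/3<..}"] \<beta>q unfolding e by (simp add: m' subset_iff)
  ultimately have "(PhiR \<beta> has_integral m + m') {0..1}"
    by (rule has_integral_combine[rotated 2]) auto
  moreover have "\<beta> 0 i x = a i x \<and> \<beta> 1 i x = c i x" if "x \<in> cdom X i" for i x
    using \<beta>p[of 0] \<beta>q[OF _ that, of 1] pe[OF that] qe[OF that] e by simp
  ultimately show ?thesis unfolding path_value_def using \<beta> by (blast intro: integral_unique)
qed

text \<open>The convex homotopy between two paths with the same end points keeps these fixed. The
  path integral is continuous in the homotopy parameter, and the intermediate value theorem
  applies.\<close>

lemma path_value_between:
  assumes "path_value a b m1" "path_value a b m2" "m1 \<le> m" "m \<le> m2"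
  shows "path_value a b m"
proof -
  obtain p where p: "bundle_family X g C UNIV p" and pe: "\<And>i x. x \<in> cdom X i \<Longrightarrow> p 0 i x = a i x \<and> p 1 i x = b i x"
    and m1: "integral {0..1} (PhiR p) = m1" using assms unfolding path_value_def by blast
  obtain q where q: "bundle_family X g C UNIV q" and qe: "\<And>i x. x \<in> cdom X i \<Longrightarrow> q 0 i x = a i x \<and> q 1 i x = b i x"
    and m2: "integral {0..1} (PhiR q) = m2" using assms unfolding path_value_def by blast
  \<comment> \<open>\<open>smooth_step\<close> keeps the coefficient in the unit interval for every
    real value of the homotopy parameter, so the family is defined on the whole plane.\<close>
  define metric_of where "metric_of w i x = (1 - smooth_step (fst w)) *\<^sub>R p (snd w) i x + smooth_step (fst w) *\<^sub>R q (snd w) i x" for w :: "real \<times> real" and i x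
  have sn: "smooth_on UNIV (snd :: real \<times> real \<Rightarrow> real)" by (rule smooth_on_linear[OF open_UNIV bounded_linear_snd])
  have sf: "smooth_on UNIV (\<lambda>w :: real \<times> real. smooth_step (fst w))"
    using smooth_on_fst[OF open_UNIV open_UNIV smooth_on_smooth_step] by simp
  have H: "bundle_family X g C UNIV metric_of"
    unfolding metric_of_def[abs_def]
    by (rule family_homotopy[OF family_compose[OF p open_UNIV sn] family_compose[OF q open_UNIV sn] sf]) (auto simp: smooth_step_bounds)
  interpret H: bundle_family X g C UNIV metric_of "(0, 1)" by (rule H)
  define V where "V u = integral {0..1} (\<lambda>t. H.Phi (u, t))" for u
  have sub: "bundle_family X g C UNIV (\<lambda>r. metric_of (u, r))" for u
    by (rule family_compose[OF H open_UNIV]) (auto intro: smooth_on_Pair smooth_on_const smooth_on_id)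
  have cP: "continuous_on UNIV H.Phi" by (rule H.continuous_on_Phi)
  have V: "integral {0..1} (PhiR (\<lambda>r. metric_of (u, r))) = V u" for u
  proof -
    have "complex_of_real (integral {0..1} (PhiR (\<lambda>r. metric_of (u, r)))) = of_real (set_lebesgue_integral lborel {0..1} (\<lambda>t. H.Phi (u, t)))"
      using path_functional_integral[OF sub, of u] H.path_functional_eq[of "(u, 0)"] by simp
    moreover have "set_lebesgue_integral lborel {0..1} (\<lambda>t. H.Phi (u, t)) = V u"
      unfolding V_def
      by (rule set_borel_integral_eq_integral(2)[OF borel_integrable_atLeastAtMost'])
        (intro continuous_on_compose2[OF cP] continuous_intros, simp)
    ultimately show ?thesis by simp
  qed
  have pv: "path_value a b (V u)" for u
    unfolding path_value_def
    by (rule exI[of _ "\<lambda>r. metric_of (u, r)"]) (use sub V pe qe in \<open>auto simp: metric_of_def scaleR_left_distrib[symmetric]\<close>)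
  have "V 0 = m1" "V 1 = m2"
    using V[of 0] V[of 1] m1 m2 by (simp_all add: metric_of_def[abs_def] smooth_step_0 smooth_step_1)
  moreover have "continuous_on {0..1} V"
    unfolding V_def using integral_continuous_on_param[of "{0..1::real}" 0 "1::real" "\<lambda>u t. H.Phi (u, t)"]
      continuous_on_subset[OF cP subset_UNIV] by (simp add: case_prod_eta[unfolded case_prod_beta] case_prod_beta)
  ultimately obtain u where "V u = m" using IVT'[of V 0 m 1] assms by auto
  then show ?thesis using pv by blast
qed

end

section \<open>Dichotomy of the path values and convexity\<close>

context bundle_charge
begin

text \<open>A path in the definition is smooth near the unit interval only;
  \<open>path_value_segment\<close> replaces it by one for all times without changing end points or
  value.\<close>

lemma path_functional_values:
  "(\<exists>\<gamma>. smooth_metric_path X g {0..1} \<gamma> \<and> (\<forall>i. \<forall>x\<in>cdom X i. \<gamma> 0 i x = h' i x \<and> \<gamma> 1 i x = h i x) \<and> m = path_functional X g C \<gamma>)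
    \<longleftrightarrow> (\<exists>r. m = of_real r \<and> path_value h' h r)"
proof
  assume "\<exists>\<gamma>. smooth_metric_path X g {0..1} \<gamma> \<and> (\<forall>i. \<forall>x\<in>cdom X i. \<gamma> 0 i x = h' i x \<and> \<gamma> 1 i x = h i x) \<and> m = path_functional X g C \<gamma>"
  then obtain \<gamma> T where T: "{0..1} \<subseteq> T" "bundle_family X g C T \<gamma>"
    and e: "\<And>i x. x \<in> cdom X i \<Longrightarrow> \<gamma> 0 i x = h' i x \<and> \<gamma> 1 i x = h i x" and m: "m = path_functional X g C \<gamma>"
    unfolding smooth_metric_path_iff by blast
  have "path_value (\<gamma> 0) (\<gamma> 1) (integral {0..1} (PhiR \<gamma>))" by (rule path_value_segment[OF T(2) _ T(1)]) simp
  then have "path_value h' h (integral {0..1} (PhiR \<gamma>))" by (rule path_value_cong) (use e in auto)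
  then show "\<exists>r. m = of_real r \<and> path_value h' h r" using path_functional_integral[OF T(2,1)] m by blast
next
  assume "\<exists>r. m = of_real r \<and> path_value h' h r"
  then obtain r \<gamma> where "m = of_real r" and \<gamma>: "bundle_family X g C UNIV \<gamma>"
    and "\<forall>i. \<forall>x\<in>cdom X i. \<gamma> 0 i x = h' i x \<and> \<gamma> 1 i x = h i x" "integral {0..1} (PhiR \<gamma>) = r"
    unfolding path_value_def by blast
  then show "\<exists>\<gamma>. smooth_metric_path X g {0..1} \<gamma> \<and> (\<forall>i. \<forall>x\<in>cdom X i. \<gamma> 0 i x = h' i x \<and> \<gamma> 1 i x = h i x) \<and> m = path_functional X g C \<gamma>"
    using path_functional_integral[OF \<gamma>] smooth_metric_path_iff by (intro exI[of _ \<gamma>]) auto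
qed

lemma M_Z_eq: "M_Z X g C h h' = Re (SOME m. \<exists>r. m = of_real r \<and> path_value h' h r)"
  unfolding M_Z_def path_functional_values ..

lemma path_value_M_Z:
  assumes "path_value h' h r" shows "path_value h' h (M_Z X g C h h')"
proof -
  have "\<exists>m r. m = complex_of_real r \<and> path_value h' h r" using assms by blast
  from someI_ex[OF this] show ?thesis unfolding M_Z_eq by force
qed

text \<open>Two values between the same end points yield a loop at \<open>a\<close> with value
  \<open>\<delta> > 0\<close>. Running through it repeatedly gives arbitrarily large multiples,
  reversal their negatives, and \<open>path_value_between\<close> everything in between. Paths from
  \<open>c\<close> to \<open>a\<close> and from \<open>a\<close> to \<open>d\<close> transport this
  to the other end points.\<close>

lemma path_value_dichotomy:
  assumes ab: "path_value a b m" "path_value a b m'" "m \<noteq> m'"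
    and h: "a \<in> hermitian_metrics X g" "c \<in> hermitian_metrics X g" "d \<in> hermitian_metrics X g"
  shows "path_value c d r"
proof -
  define \<delta> where "\<delta> = \<bar>m - m'\<bar>"
  have "path_value a a (m + - m')" "path_value a a (m' + - m)"
    by (rule path_value_trans[OF _ path_value_reverse]; rule ab)+
  then have \<delta>: "path_value a a \<delta>" using ab(3) unfolding \<delta>_def by (cases "m < m'") (simp_all add: abs_if)
  have "path_value a a (of_nat (Suc k) * \<delta>)" for k
  proof (induction k)
    case (Suc k)
    then show ?case using path_value_trans[OF \<delta> Suc] by (simp add: algebra_simps)
  qed (use \<delta> in simp)
  moreover obtain r1 r2 where r: "path_value c a r1" "path_value a d r2" using path_value_exists h by blast
  obtain k where "\<bar>r - r1 - r2\<bar> < of_nat k * \<delta>"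
    using ex_less_of_nat_mult[of \<delta> "\<bar>r - r1 - r2\<bar>"] ab(3) by (auto simp: \<delta>_def)
  moreover from this have "0 < k" by (cases k) auto
  ultimately have k: "path_value a a (of_nat k * \<delta>)" "\<bar>r - r1 - r2\<bar> < of_nat k * \<delta>" by (metis Suc_pred)+
  have "path_value a a (r - r1 - r2)"
    by (rule path_value_between[OF path_value_reverse[OF k(1)] k(1)]) (use k(2) in linarith)+
  from path_value_trans[OF path_value_trans[OF r(1) this] r(2)] show ?thesis by simp
qed

lemma M_Z_convex_on:
  assumes J: "is_interval J" and geo: "metric_geodesic X g J \<gamma>" and sub: "\<forall>t\<in>J. \<gamma> t \<in> subsolutions X g C"
    and h: "h \<in> hermitian_metrics X g"
  shows "convex_on J (\<lambda>t. M_Z X g C (\<gamma> t) h)"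
proof -
  let ?M = "\<lambda>t. M_Z X g C (\<gamma> t) h"
  have cJ: "convex J" using J by (simp add: is_interval_convex_1)
  have met: "\<gamma> t \<in> hermitian_metrics X g" if "t \<in> J" for t using sub that by (auto simp: subsolutions_def)
  have inJ: "{x..y} \<subseteq> J" if "x \<in> J" "y \<in> J" for x y
    using J that unfolding is_interval_1 by (meson atLeastAtMost_iff subsetI)
  show ?thesis
  proof (cases "\<exists>a b m m'. a \<in> hermitian_metrics X g \<and> path_value a b m \<and> path_value a b m' \<and> m \<noteq> m'")
    case True
    then have "path_value h (\<gamma> t) r" if "t \<in> J" for t r
      using path_value_dichotomy h met[OF that] by blast
    then have const: "?M t = Re (SOME m. \<exists>r. m = complex_of_real r)" if "t \<in> J" for t
      unfolding M_Z_eq using that by simp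
    show ?thesis
    proof (rule convex_on_linorderI[OF _ cJ])
      fix t x y :: real assume t: "0 < t" "t < 1" "x \<in> J" "y \<in> J"
      then have "(1 - t) *\<^sub>R x + t *\<^sub>R y \<in> J" using cJ convex_alt by (metis less_eq_real_def)
      then show "?M ((1 - t) *\<^sub>R x + t *\<^sub>R y) \<le> (1 - t) * ?M x + t * ?M y"
        using const t by (simp add: algebra_simps)
    qed
  next
    case False
    obtain T where T: "J \<subseteq> T" "bundle_family X g C T \<gamma>"
      using geo unfolding metric_geodesic_def smooth_metric_path_iff by blast
    interpret F: real_bundle_family X g C T \<gamma> by (intro real_bundle_family.intro T)
    \<comment> \<open>The geodesic equation is stated for \<open>log_velocity\<close>, which agrees
      with \<open>vel\<close> on an open set of times; uniqueness of the derivative transfers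
      it.\<close>
    have "dird (1, 0) (F.vl i) (t, z) = 0" if "t \<in> J" "z \<in> cimg X i" for t i z
    proof -
      interpret L: metric_family "T \<times> cimg X i" em "(1, 0)" "F.metric_loc i" by (rule F.local_metric_family)
      have w: "(t, z) \<in> T \<times> cimg X i" using that T by auto
      have "((\<lambda>s. L.vel ((0, z) + s *\<^sub>R (1, 0))) has_vector_derivative dird (1, 0) L.vel ((0, z) + t *\<^sub>R (1, 0))) (at t)"
        by (rule dird_has_vector_derivative) (use L.diff[OF L.smooth_vel w] in simp)
      then have 1: "((\<lambda>s. L.vel (s, z)) has_vector_derivative dird (1, 0) L.vel (t, z)) (at t)" by simp
      have "((\<lambda>s. log_velocity \<gamma> s i (cinv X i z)) has_vector_derivative 0) (at t)"
        using geo that cinv_in unfolding metric_geodesic_def by blast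
      then have "((\<lambda>s. L.vel (s, z)) has_vector_derivative 0) (at t)"
        by (rule has_vector_derivative_transform_within_open[OF _ F.P])
          (use w that F.log_velocity_eq[of 0 _ "cinv X i z" i] cinv_in in auto)
      with 1 show ?thesis by (rule vector_derivative_unique_at)
    qed
    then have d: "DERIV F.Phi t :> F.Phi' t" "0 \<le> F.Phi' t" if "t \<in> J" for t
      using that T sub F.Phi_has_derivative F.Phi'_nonneg by (auto simp: has_real_derivative_iff_has_vector_derivative)
    have mono: "F.Phi x \<le> F.Phi y" if "x \<in> J" "y \<in> J" "x \<le> y" for x y
    proof (rule DERIV_nonneg_imp_nondecreasing[OF that(3)])
      fix s assume "x \<le> s" "s \<le> y"
      then have "s \<in> J" using inJ[OF that(1,2)] by auto
      then show "\<exists>D. DERIV F.Phi s :> D \<and> 0 \<le> D" using d by blast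
    qed
    have int: "F.Phi integrable_on {x..y}" if "x \<in> J" "y \<in> J" for x y
      by (rule integrable_continuous_real[OF continuous_on_subset[OF F.continuous_on_Phi]]) (use inJ[OF that] T in auto)
    \<comment> \<open>A path from \<open>h\<close> to \<open>\<gamma> x\<close> followed by the
      segment of the geodesic is a path to \<open>\<gamma> y\<close>; as path values are unique in
      this case, its value is \<open>M_Z\<close> at \<open>\<gamma> y\<close>.\<close>
    have diff: "?M y = ?M x + integral {x..y} F.Phi" if "x \<in> J" "y \<in> J" "x \<le> y" for x y
    proof -
      have "path_value h (\<gamma> t) (?M t)" if "t \<in> J" for t
        using path_value_exists[OF h met[OF that]] path_value_M_Z by blast
      then have "path_value h (\<gamma> y) (?M y)" "path_value h (\<gamma> y) (?M x + integral {x..y} F.Phi)"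
        using that path_value_trans path_value_segment[OF T(2) that(3)] inJ[OF that(1,2)] T(1) by blast+
      then show ?thesis using False h by blast
    qed
    show ?thesis
    proof (rule convex_on_linorderI[OF _ cJ])
      fix t x y :: real assume t: "0 < t" "t < 1" "x \<in> J" "y \<in> J" "x < y"
      define z where "z = (1 - t) *\<^sub>R x + t *\<^sub>R y"
      have zx: "z - x = t * (y - x)" "y - z = (1 - t) * (y - x)" by (simp_all add: z_def algebra_simps)
      then have "0 \<le> z - x" "0 \<le> y - z" using t by simp_all
      then have xz: "x \<le> z" "z \<le> y" by linarith+
      then have z: "z \<in> J" using inJ[OF t(3,4)] by auto
      \<comment> \<open>Monotonicity compares \<Phi> with its value at \<open>z\<close> on both
        sides of \<open>z\<close>. Since \<open>(1 - t) (z - x) = t (y - z)\<close>, the two bounds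
        meet after weighting by \<open>1 - t\<close> and \<open>t\<close>.\<close>
      have "integral {x..z} F.Phi \<le> integral {x..z} (\<lambda>_. F.Phi z)"
        by (rule integral_le[OF int[OF t(3) z]]) (use mono[OF _ z] inJ[OF t(3) z] in auto)
      then have u: "?M z - ?M x \<le> t * (y - x) * F.Phi z"
        unfolding diff[OF t(3) z xz(1)] zx(1)[symmetric] using xz by simp
      have "integral {z..y} (\<lambda>_. F.Phi z) \<le> integral {z..y} F.Phi"
        by (rule integral_le[OF _ int[OF z t(4)]]) (use mono[OF z] inJ[OF z t(4)] in auto)
      then have v: "(1 - t) * (y - x) * F.Phi z \<le> ?M y - ?M z"
        unfolding diff[OF z t(4) xz(2)] zx(2)[symmetric] using xz by simp
      have "(1 - t) * (?M z - ?M x) \<le> (1 - t) * (t * (y - x) * F.Phi z)"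
        by (rule mult_left_mono[OF u]) (use t in simp)
      also have "\<dots> = t * ((1 - t) * (y - x) * F.Phi z)" by simp
      also have "\<dots> \<le> t * (?M y - ?M z)"
        by (rule mult_left_mono[OF v]) (use t in simp)
      finally have "(1 - t) * (?M z - ?M x) \<le> t * (?M y - ?M z)" .
      moreover have "D \<le> (1 - t) * A + t * B" if "(1 - t) * (D - A) \<le> t * (B - D)" for A B D :: real
      proof -
        have "(1 - t) * A + t * B - D = t * (B - D) - (1 - t) * (D - A)" by (simp only: algebra_simps)
        with that show ?thesis by linarith
      qed
      ultimately show "?M ((1 - t) *\<^sub>R x + t *\<^sub>R y) \<le> (1 - t) * ?M x + t * ?M y"
        unfolding z_def by blast
    qed
  qed
qed

end

theorem theorem4p5p9:
  fixes X :: "('i, 'x::t2_space, 'n::finite) atlas"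
    and g :: "'i \<Rightarrow> 'i \<Rightarrow> 'x \<Rightarrow> complex^'r::finite^'r"
    and C :: "('i, 'x, 'n) charge"
    and h_ref :: "'i \<Rightarrow> 'x \<Rightarrow> complex^'r^'r"
    and \<gamma> :: "real \<Rightarrow> 'i \<Rightarrow> 'x \<Rightarrow> complex^'r^'r"
    and J :: "real set"
  assumes "compact_complex_manifold X"
    and "holomorphic_bundle X g"
    and "polynomial_central_charge X C"
    and "Z_of X C g \<noteq> 0"
    and "h_ref \<in> hermitian_metrics X g"
    and "is_interval J"
    and "metric_geodesic X g J \<gamma>"
    and "\<forall>t\<in>J. \<gamma> t \<in> subsolutions X g C"
  shows "convex_on J (\<lambda>t. M_Z X g C (\<gamma> t) h_ref)"
proof -
  have m: "complex_manifold X" using assms(1) by (rule complex_manifold.intro)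
  then have "manifold_partition X (SOME \<psi>. partition_of_unity X \<psi>)"
    by (intro manifold_partition.intro manifold_partition_axioms.intro someI_ex[OF complex_manifold.exists_partition_of_unity])
  then interpret bundle_charge X g C
    by (rule bundle_charge.intro) (rule bundle_charge_axioms.intro[OF assms(2,3)])
  show ?thesis by (rule M_Z_convex_on[OF assms(6,7,8,5)])
qed

end
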